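(* Let $T>0$, $\nu>0$, let $\alpha>0$ be fixed and let $\tfrac16\le\theta<1$. Let $\boldsymbol f\in L^2(0,T;\boldsymbol H^{-1})$ be divergence free and let $\boldsymbol v_0\in\boldsymbol L^2_\sigma$. For each integer $N>0$ let $(\boldsymbol w_N,q_N)$ be the (regular weak) solution of the Rotational Approximate Deconvolution Model of order $N$ on $(0,T)\times\mathbb T_3$ with periodic boundary conditions, $$\nabla\cdot\boldsymbol w_N=0,\qquad \partial_t\boldsymbol w_N-\overline{D_{N,\theta}\boldsymbol w_N\times(\nabla\times D_{N,\theta}\boldsymbol w_N)}-\nu\Delta\boldsymbol w_N+\nabla q_N=\overline{\boldsymbol f},$$ $$\int_{\mathbb T_3}\boldsymbol w_N=0,\qquad\int_{\mathbb T_3}q_N=0,\qquad\boldsymbol w_N(\boldsymbol x,0)=\overline{\boldsymbol v_0}(\boldsymbol x).$$ Then there are a subsequence $N_j\to\infty$ as $j\to\infty$ and a couple $$(\boldsymbol w,q)\in \Big(L^\infty([0,T];\boldsymbol H^\theta)\cap L^2([0,T];\boldsymbol H^{1+\theta})\Big)\times L^2([0,T];H^{-\frac12+2\theta}(\mathbb T_3))$$ such that $(\boldsymbol w_{N_j},q_{N_j})\to(\boldsymbol w,q)$ as $j\to\infty$ in the following sense: $\boldsymbol w_{N_j}\to\boldsymbol w$ strongly in $L^2([0,T];\boldsymbol H^s)$ for all $s<1+\theta$, and $q_{N_j}\rightharpoonup q$ weakly in $L^2([0,T];H^{-\frac12+2\theta}(\mathbb T_3))$; and $(\boldsymbol w,q)$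 is a distributional solution of the following system with periodic boundary conditions: $$\nabla\cdot\boldsymbol w=0,\qquad \boldsymbol w_{,t}-\overline{\mathbb A_\theta\boldsymbol w\times(\nabla\times\mathbb A_\theta\boldsymbol w)}-\nu\Delta\boldsymbol w+\nabla q=\overline{\boldsymbol f},$$ $$\int_{\mathbb T_3}\boldsymbol w=0,\qquad\int_{\mathbb T_3}q=0,\qquad\boldsymbol w(\boldsymbol x,0)=\boldsymbol w_0(\boldsymbol x)=\overline{\boldsymbol v_0}(\boldsymbol x).$$
   Context: Function spaces. $\mathbb T_3$ is the three-dimensional torus (period $2\pi$ in each direction). For real $s$, $\boldsymbol H^s$ is the space of mean-free real vector fields (distributions) $\boldsymbol v=\sum_{\boldsymbol k\in\mathbb Z^3\setminus\{0\}}\boldsymbol c_{\boldsymbol k}e^{i\boldsymbol k\cdot\boldsymbol x}$ on $\mathbb T_3$, with $\boldsymbol c_{\boldsymbol k}\in\mathbb C^3$, $\boldsymbol c_{\boldsymbol k}^*=\boldsymbol c_{-\boldsymbol k}$ (complex conjugate) and $\|\boldsymbol v\|_{s,2}^2=\sum_{\boldsymbol k}|\boldsymbol k|^{2s}|\boldsymbol c_{\boldsymbol k}|^2<\infty$; $\boldsymbol H^{-s}$ is identified with the dual of $\boldsymbol H^s$. $\boldsymbol H^s_\sigma=\{\boldsymbol v\in\boldsymbol H^s:\nabla\cdot\boldsymbol v=0\}$, $\boldsymbol L^2=\boldsymbol H^0$, $\boldsymbol L^2_\sigma=\boldsymbol H^0_\sigma$. $H^s(\mathbb T_3)$ is the scalar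 Sobolev space. Filter. $\mathbb A_\theta=I+\alpha^{2\theta}(-\Delta)^\theta$ is the Fourier multiplier with symbol $1+\alpha^{2\theta}|\boldsymbol k|^{2\theta}$, and the overline denotes filtering: $\overline{\boldsymbol v}=\mathbb A_\theta^{-1}\boldsymbol v$. Deconvolution operator. $D_{N,\theta}=\sum_{i=0}^N(I-\mathbb A_\theta^{-1})^i$. Regular weak solution. A couple $(\boldsymbol w_N,q_N)$ is a regular weak solution of the model of order $N$ if (i) $\boldsymbol w_N\in C(0,T;\boldsymbol H^\theta_\sigma)\cap L^2(0,T;\boldsymbol H^{1+\theta}_\sigma)$ (continuity on $[0,T]$), $\partial_t\boldsymbol w_N\in L^2(0,T;\boldsymbol H^{4\theta-\frac32})$, $q_N\in L^2(0,T;H^{4\theta-\frac12}(\mathbb T_3))$, with $\int_{\mathbb T_3}q_N=0$; (ii) for all $\boldsymbol\varphi\in L^2(0,T;\boldsymbol H^1)$, $$\int_0^T\Big(\langle\partial_t\boldsymbol w_N,\boldsymbol\varphi\rangle-\langle\overline{D_{N,\theta}\boldsymbol w_N\times(\nabla\times D_{N,\theta}\boldsymbol w_N)},\boldsymbol\varphi\rangle+\nu\langle\nabla\boldsymbol w_N,\nabla\boldsymbol\varphi\rangle+\langle\nabla q_N,\boldsymbol\varphi\rangle\Big)dt=\int_0^T\langle\overline{\boldsymbol f},\boldsymbol\varphi\rangle\,dt,$$ where the first, second and fourth brackets are duality pairings on $\boldsymbol H^{4\theta-\frac32}\times\boldsymbol H^{\frac32-4\theta}$, the third is a duality pairing on $\boldsymbol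 H^{\theta}\times\boldsymbol H^{-\theta}$, and the last is a duality pairing on $\boldsymbol H^{1-2\theta}\times\boldsymbol H^{2\theta-1}$ (all extending the $L^2$ inner product); (iii) $\boldsymbol w_N(0)=\overline{\boldsymbol v_0}$. For each $N$ the regular weak solution is unique. Distributional solution of the limit system. This means that the product $\mathbb A_\theta\boldsymbol w\times(\nabla\times\mathbb A_\theta\boldsymbol w)$ is a well-defined element of $L^1(0,T;L^1(\mathbb T_3)^3)$, that $\nabla\cdot\boldsymbol w=0$ and the two mean-value conditions hold, and that the momentum equation with its initial condition holds when tested against every $\boldsymbol\varphi\in C^\infty([0,T]\times\mathbb T_3)^3$ vanishing near $t=T$, all spatial derivatives and filters being moved to the test function by duality and the time term becoming $-\int_0^T\langle\boldsymbol w,\partial_t\boldsymbol\varphi\rangle\,dt-\langle\overline{\boldsymbol v_0},\boldsymbol\varphi(0)\rangle$. *)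

theory Defs
  imports "HOL-Analysis.Analysis"
begin

section \<open>Bochner spaces over the time interval\<close>

text \<open>The spaces \<open>H\<^sup>s\<close> depend on a real parameter, so a normed space is passed as a carrier set
  \<open>X\<close> with a norm \<open>nrm\<close>. Elements of the Bochner spaces are functions of time, not classes modulo
  null sets; values outside \<open>[0,T]\<close> play no role.\<close>

text \<open>Strong measurability: almost everywhere limit of simple functions.\<close>

definition bochner_measurable ::
  "real \<Rightarrow> 'e::minus set \<Rightarrow> ('e \<Rightarrow> real) \<Rightarrow> (real \<Rightarrow> 'e) \<Rightarrow> bool" where
  "bochner_measurable T X nrm u \<longleftrightarrow>
     (\<exists>g :: nat \<Rightarrow> real \<Rightarrow> 'e.
        (\<forall>n. finite (g n ` {0..T}) \<and> g n ` {0..T} \<subseteq> X \<and>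
             (\<forall>y. {t \<in> {0..T}. g n t = y} \<in> sets lebesgue)) \<and>
        (AE t in lebesgue_on {0..T}. u t \<in> X \<and> (\<lambda>n. nrm (g n t - u t)) \<longlonglongrightarrow> 0))"

definition bochner_Lp ::
  "nat \<Rightarrow> real \<Rightarrow> 'e::minus set \<Rightarrow> ('e \<Rightarrow> real) \<Rightarrow> (real \<Rightarrow> 'e) set" where
  "bochner_Lp p T X nrm =
     {u. bochner_measurable T X nrm u \<and> integrable (lebesgue_on {0..T}) (\<lambda>t. nrm (u t) ^ p)}"

definition bochner_Linf ::
  "real \<Rightarrow> 'e::minus set \<Rightarrow> ('e \<Rightarrow> real) \<Rightarrow> (real \<Rightarrow> 'e) set" where
  "bochner_Linf T X nrm =
     {u. bochner_measurable T X nrm u \<and> (\<exists>C. AE t in lebesgue_on {0..T}. nrm (u t) \<le> C)}"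

definition time_continuous ::
  "real \<Rightarrow> 'e::minus set \<Rightarrow> ('e \<Rightarrow> real) \<Rightarrow> (real \<Rightarrow> 'e) set" where
  "time_continuous T X nrm =
     {u. \<forall>t\<in>{0..T}. u t \<in> X \<and> ((\<lambda>s. nrm (u s - u t)) \<longlongrightarrow> 0) (at t within {0..T})}"

definition L2_strong_conv ::
  "real \<Rightarrow> 'e::minus set \<Rightarrow> ('e \<Rightarrow> real) \<Rightarrow> (nat \<Rightarrow> real \<Rightarrow> 'e) \<Rightarrow> (real \<Rightarrow> 'e) \<Rightarrow> bool" where
  "L2_strong_conv T X nrm u v \<longleftrightarrow>
     (\<forall>j. u j \<in> bochner_Lp 2 T X nrm) \<and> v \<in> bochner_Lp 2 T X nrm \<and>
     (\<lambda>j. sqrt (LINT t|lebesgue_on {0..T}. (nrm (u j t - v t))\<^sup>2)) \<longlonglongrightarrow> 0"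


section \<open>Periodic distributions and Sobolev spaces\<close>

text \<open>A distribution on the torus is represented by its family of Fourier coefficients:
  \<open>c\<close> stands for the series with terms \<open>c k\<close> times \<open>exp (i k \<cdot> x)\<close>.\<close>

type_synonym sfield = "int ^ 3 \<Rightarrow> complex"
type_synonym vfield = "int ^ 3 \<Rightarrow> complex ^ 3"

definition wave :: "int ^ 3 \<Rightarrow> real ^ 3" where
  "wave k = (\<chi> j. real_of_int (k $ j))"

definition cnj_vec :: "complex ^ 3 \<Rightarrow> complex ^ 3" where
  "cnj_vec z = (\<chi> j. cnj (z $ j))"

definition mean_free :: "(int ^ 3 \<Rightarrow> 'v::zero) \<Rightarrow> bool" where
  "mean_free c \<longleftrightarrow> c 0 = 0"

definition Hv :: "real \<Rightarrow> vfield set" where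
  "Hv s = {c. mean_free c \<and> (\<forall>k. c (- k) = cnj_vec (c k)) \<and>
              (\<lambda>k. norm (wave k) powr (2 * s) * (norm (c k))\<^sup>2) summable_on (UNIV - {0})}"

definition Hv_norm :: "real \<Rightarrow> vfield \<Rightarrow> real" where
  "Hv_norm s c = sqrt (\<Sum>\<^sub>\<infinity>k\<in>UNIV - {0}. norm (wave k) powr (2 * s) * (norm (c k))\<^sup>2)"

text \<open>The scalar space is not restricted to mean-free elements, hence the inhomogeneous weight.\<close>

definition Hs :: "real \<Rightarrow> sfield set" where
  "Hs s = {c. (\<forall>k. c (- k) = cnj (c k)) \<and>
              (\<lambda>k. (1 + (norm (wave k))\<^sup>2) powr s * (norm (c k))\<^sup>2) summable_on UNIV}"

definition Hs_norm :: "real \<Rightarrow> sfield \<Rightarrow> real" where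
  "Hs_norm s c = sqrt (\<Sum>\<^sub>\<infinity>k. (1 + (norm (wave k))\<^sup>2) powr s * (norm (c k))\<^sup>2)"

text \<open>By Parseval this is the real \<open>L\<^sup>2\<close> inner product of two square integrable real fields; for
  fields in \<open>H\<^sup>s\<close> and \<open>H\<^sup>-\<^sup>s\<close> the series still converges absolutely and is the duality pairing.
  The inner product of \<open>complex\<close> and \<open>complex ^ 3\<close> is the real part of the Hermitian one, and
  these real parts lose nothing for real fields.\<close>

definition pairing :: "(int ^ 3 \<Rightarrow> 'v::real_inner) \<Rightarrow> (int ^ 3 \<Rightarrow> 'v) \<Rightarrow> real" where
  "pairing u v = (2 * pi) ^ 3 * (\<Sum>\<^sub>\<infinity>k. u k \<bullet> v k)"

text \<open>The dual of \<open>L\<^sup>2(0,T;H\<^sup>s)\<close> is \<open>L\<^sup>2(0,T;H\<^sup>-\<^sup>s)\<close> through the pairing.\<close>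

definition L2_weak_conv :: "real \<Rightarrow> real \<Rightarrow> (nat \<Rightarrow> real \<Rightarrow> sfield) \<Rightarrow> (real \<Rightarrow> sfield) \<Rightarrow> bool" where
  "L2_weak_conv T s q p \<longleftrightarrow>
     (\<forall>j. q j \<in> bochner_Lp 2 T (Hs s) (Hs_norm s)) \<and> p \<in> bochner_Lp 2 T (Hs s) (Hs_norm s) \<and>
     (\<forall>\<psi>\<in>bochner_Lp 2 T (Hs (- s)) (Hs_norm (- s)).
        (\<lambda>j. LINT t|lebesgue_on {0..T}. pairing (q j t) (\<psi> t))
          \<longlonglongrightarrow> (LINT t|lebesgue_on {0..T}. pairing (p t) (\<psi> t)))"


section \<open>Differential operators, filter and deconvolution\<close>

definition grad :: "sfield \<Rightarrow> vfield" where
  "grad q k = (\<chi> j. \<i> * of_int (k $ j) * q k)"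

definition partial :: "3 \<Rightarrow> vfield \<Rightarrow> vfield" where
  "partial j v k = (\<chi> l. \<i> * of_int (k $ j) * v k $ l)"

definition divergence :: "vfield \<Rightarrow> sfield" where
  "divergence v k = (\<Sum>j\<in>UNIV. partial j v k $ j)"

definition curl :: "vfield \<Rightarrow> vfield" where
  "curl v k = vector [partial 2 v k $ 3 - partial 3 v k $ 2,
                      partial 3 v k $ 1 - partial 1 v k $ 3,
                      partial 1 v k $ 2 - partial 2 v k $ 1]"

definition laplacian :: "vfield \<Rightarrow> vfield" where
  "laplacian v k = (\<Sum>j\<in>UNIV. partial j (partial j v) k)"

definition grad_pairing :: "vfield \<Rightarrow> vfield \<Rightarrow> real" where
  "grad_pairing u v = (\<Sum>j\<in>UNIV. pairing (partial j u) (partial j v))"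

definition Hv_sigma :: "real \<Rightarrow> vfield set" where
  "Hv_sigma s = {v \<in> Hv s. \<forall>k. divergence v k = 0}"

definition A_op :: "real \<Rightarrow> real \<Rightarrow> vfield \<Rightarrow> vfield" where
  "A_op \<alpha> \<theta> v k = (1 + \<alpha> powr (2 * \<theta>) * norm (wave k) powr (2 * \<theta>)) *\<^sub>R v k"

definition filtered :: "real \<Rightarrow> real \<Rightarrow> vfield \<Rightarrow> vfield" where
  "filtered \<alpha> \<theta> v k = inverse (1 + \<alpha> powr (2 * \<theta>) * norm (wave k) powr (2 * \<theta>)) *\<^sub>R v k"

definition D_op :: "real \<Rightarrow> real \<Rightarrow> nat \<Rightarrow> vfield \<Rightarrow> vfield" where
  "D_op \<alpha> \<theta> N v k = (\<Sum>i=0..N. ((\<lambda>u. u - filtered \<alpha> \<theta> u) ^^ i) v k)"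


section \<open>Functions on the torus and products\<close>

definition cell :: "(real ^ 3) set" where
  "cell = cbox 0 (\<chi> j. 2 * pi)"

definition L1_torus :: "(real ^ 3 \<Rightarrow> real ^ 3) set" where
  "L1_torus = {F. integrable (lebesgue_on cell) F}"

definition L1_norm :: "(real ^ 3 \<Rightarrow> real ^ 3) \<Rightarrow> real" where
  "L1_norm F = (LINT x|lebesgue_on cell. norm (F x))"

definition fourier :: "(real ^ 3 \<Rightarrow> real ^ 3) \<Rightarrow> vfield" where
  "fourier F k =
     (\<chi> j. (LINT x|lebesgue_on cell. (F x $ j) *\<^sub>R cis (- (wave k \<bullet> x))) / of_real ((2 * pi) ^ 3))"

definition is_L1_field :: "vfield \<Rightarrow> bool" where
  "is_L1_field v \<longleftrightarrow> (\<exists>F\<in>L1_torus. fourier F = v)"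

text \<open>The function behind a field; meaningful only under \<open>is_L1_field\<close>, and then unique up to a
  null set of the cell.\<close>

definition fun_of :: "vfield \<Rightarrow> real ^ 3 \<Rightarrow> real ^ 3" where
  "fun_of v = (SOME F. F \<in> L1_torus \<and> fourier F = v)"

definition cross_fun :: "vfield \<Rightarrow> vfield \<Rightarrow> real ^ 3 \<Rightarrow> real ^ 3" where
  "cross_fun u v x = cross3 (fun_of u x) (fun_of v x)"

text \<open>For fields in \<open>L\<^sup>2\<close>, such as almost every \<open>D_op \<alpha> \<theta> N (w t)\<close> and its curl when
  \<open>w \<in> L\<^sup>2(0,T;H\<^sup>1)\<close>, the pointwise product is integrable and the following is its
  distribution.\<close>

definition cross_field :: "vfield \<Rightarrow> vfield \<Rightarrow> vfield" where
  "cross_field u v = fourier (cross_fun u v)"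


section \<open>Smooth test functions\<close>

text \<open>Derivatives are taken within \<open>S\<close>; they are unique for the sets used below.\<close>

primrec C_k_on :: "nat \<Rightarrow> 'a::real_normed_vector set \<Rightarrow> ('a \<Rightarrow> 'b::real_normed_vector) \<Rightarrow> bool" where
  "C_k_on 0 S f \<longleftrightarrow> continuous_on S f"
| "C_k_on (Suc n) S f \<longleftrightarrow>
     (\<exists>f'. (\<forall>p\<in>S. (f has_derivative f' p) (at p within S)) \<and> (\<forall>h. C_k_on n S (\<lambda>p. f' p h)))"

definition smooth_on :: "'a::real_normed_vector set \<Rightarrow> ('a \<Rightarrow> 'b::real_normed_vector) \<Rightarrow> bool" where
  "smooth_on S f \<longleftrightarrow> (\<forall>n. C_k_on n S f)"

definition test_fields :: "real \<Rightarrow> (real \<times> (real ^ 3) \<Rightarrow> real ^ 3) set" where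
  "test_fields T =
     {\<phi>. smooth_on ({0..T} \<times> UNIV) \<phi> \<and>
         (\<forall>t\<in>{0..T}. \<forall>x j. \<phi> (t, x + (2 * pi) *\<^sub>R axis j 1) = \<phi> (t, x)) \<and>
         (\<exists>\<delta>>0. \<forall>t\<in>{0..T}. T - \<delta> < t \<longrightarrow> (\<forall>x. \<phi> (t, x) = 0))}"

text \<open>The distributional time derivative on \<open>(0,T)\<close>, read off mode by mode.\<close>

definition has_weak_time_deriv ::
  "real \<Rightarrow> (real \<Rightarrow> vfield) \<Rightarrow> (real \<Rightarrow> vfield) \<Rightarrow> bool" where
  "has_weak_time_deriv T w w' \<longleftrightarrow>
     (\<forall>\<eta> :: real \<Rightarrow> real. smooth_on UNIV \<eta> \<and> closure {t. \<eta> t \<noteq> 0} \<subseteq> {0<..<T} \<longrightarrow>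
        (\<forall>k. (LINT t|lebesgue_on {0..T}. deriv \<eta> t *\<^sub>R w t k)
              = - (LINT t|lebesgue_on {0..T}. \<eta> t *\<^sub>R w' t k)))"


section \<open>The model and its limit\<close>

definition regular_weak_solution ::
  "real \<Rightarrow> real \<Rightarrow> real \<Rightarrow> real \<Rightarrow> (real \<Rightarrow> vfield) \<Rightarrow> vfield \<Rightarrow> nat
     \<Rightarrow> (real \<Rightarrow> vfield) \<Rightarrow> (real \<Rightarrow> sfield) \<Rightarrow> bool" where
  "regular_weak_solution T \<nu> \<alpha> \<theta> f v0 N w q \<longleftrightarrow>
     w \<in> time_continuous T (Hv_sigma \<theta>) (Hv_norm \<theta>) \<and>
     w \<in> bochner_Lp 2 T (Hv_sigma (1 + \<theta>)) (Hv_norm (1 + \<theta>)) \<and>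
     q \<in> bochner_Lp 2 T (Hs (4 * \<theta> - 1/2)) (Hs_norm (4 * \<theta> - 1/2)) \<and>
     (AE t in lebesgue_on {0..T}. mean_free (q t)) \<and>
     (\<exists>w'. w' \<in> bochner_Lp 2 T (Hv (4 * \<theta> - 3/2)) (Hv_norm (4 * \<theta> - 3/2)) \<and>
        has_weak_time_deriv T w w' \<and>
        (\<forall>\<phi>\<in>bochner_Lp 2 T (Hv 1) (Hv_norm 1).
           (LINT t|lebesgue_on {0..T}.
                pairing (w' t) (\<phi> t)
              - pairing (filtered \<alpha> \<theta>
                   (cross_field (D_op \<alpha> \<theta> N (w t)) (curl (D_op \<alpha> \<theta> N (w t))))) (\<phi> t)
              + \<nu> * grad_pairing (w t) (\<phi> t)
              + pairing (grad (q t)) (\<phi> t))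
           = (LINT t|lebesgue_on {0..T}. pairing (filtered \<alpha> \<theta> (f t)) (\<phi> t)))) \<and>
     w 0 = filtered \<alpha> \<theta> v0"

definition distributional_solution ::
  "real \<Rightarrow> real \<Rightarrow> real \<Rightarrow> real \<Rightarrow> (real \<Rightarrow> vfield) \<Rightarrow> vfield
     \<Rightarrow> (real \<Rightarrow> vfield) \<Rightarrow> (real \<Rightarrow> sfield) \<Rightarrow> bool" where
  "distributional_solution T \<nu> \<alpha> \<theta> f v0 w q \<longleftrightarrow>
     (AE t in lebesgue_on {0..T}.
        is_L1_field (A_op \<alpha> \<theta> (w t)) \<and> is_L1_field (curl (A_op \<alpha> \<theta> (w t)))) \<and>
     (\<lambda>t. cross_fun (A_op \<alpha> \<theta> (w t)) (curl (A_op \<alpha> \<theta> (w t)))) \<in> bochner_Lp 1 T L1_torus L1_norm \<and>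
     (AE t in lebesgue_on {0..T}. \<forall>k. divergence (w t) k = 0) \<and>
     (AE t in lebesgue_on {0..T}. mean_free (w t) \<and> mean_free (q t)) \<and>
     (\<forall>\<phi>\<in>test_fields T.
        (let \<phi>F = (\<lambda>t. fourier (\<lambda>x. \<phi> (t, x)));
             \<phi>F' = (\<lambda>t. fourier (\<lambda>x. vector_derivative (\<lambda>s. \<phi> (s, x)) (at t within {0..T})))
         in - (LINT t|lebesgue_on {0..T}. pairing (w t) (\<phi>F' t))
            - pairing (filtered \<alpha> \<theta> v0) (\<phi>F 0)
            - (LINT t|lebesgue_on {0..T}.
                 pairing (cross_field (A_op \<alpha> \<theta> (w t)) (curl (A_op \<alpha> \<theta> (w t))))
                         (filtered \<alpha> \<theta> (\<phi>F t)))
            - \<nu> * (LINT t|lebesgue_on {0..T}. pairing (w t) (laplacian (\<phi>F t)))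
            - (LINT t|lebesgue_on {0..T}. pairing (q t) (divergence (\<phi>F t)))
            = (LINT t|lebesgue_on {0..T}. pairing (f t) (filtered \<alpha> \<theta> (\<phi>F t)))))"

end

theory Submission
  imports Defs "HOL-Complex_Analysis.Great_Picard"
begin

text \<open>Everything is done on Fourier coefficients. Testing the equation of \<open>w\<^sub>N\<close> with a single mode shows
  that every coefficient solves an integral equation in time, in which the pressure is the one that
  keeps the velocity divergence free. Testing with \<open>A D\<^sub>N w\<^sub>N\<close> makes the nonlinear term drop out; in
  truncated form this is justified by \<open>\<theta> \<ge> 1/6\<close>. It bounds \<open>u\<^sub>N = D\<^sub>N w\<^sub>N\<close> in \<open>L\<^sup>\<infinity>(L\<^sup>2)\<close> and in
  \<open>L\<^sup>2(H\<^sup>1)\<close> uniformly in \<open>N\<close>, and through the integral equation the coefficients are equicontinuous,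
  so that a diagonal subsequence converges mode by mode at every time. The uniform bounds in the next
  stronger space turn this into strong convergence of \<open>w\<^sub>N\<close>, and of \<open>u\<^sub>N\<close> to \<open>A w\<close> in \<open>L\<^sup>2(L\<^sup>2)\<close>, which
  suffices for the quadratic term; the pressures stay bounded in the borderline space, where
  convergence of the modes is weak convergence.\<close>

text \<open>The difficulty is the gap between estimates for one N and estimates uniform in N. The
  field A D_N w_N is only known to lie in L^2(H^(1-\<theta>)), so it cannot be inserted into the
  weak formulation, whose test fields are in L^2(H^1); this is why the energy identity is summed
  over a finite box of modes. The work of the nonlinearity on a box does not vanish, it only tends
  to zero as the box grows. For this limit constants may depend on N: the symbol d of D_N is at most
  N + 1, so u_N inherits the regularity of w_N, bounded in H^\<theta> and square integrable in
  H^(1+\<theta>), and \<theta> + (1 + \<theta>) + (1 + \<theta>) - 1 >= 3/2. Uniformity comes from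
  d^2 <= a d, with a the symbol of A: the sum of a d |w|^2 dominates that of |u|^2 and starts below
  the energy of v0. In the limit u is controlled only in L^2 and H^1; the product estimate with
  exponents 0, 1, 1/2 then places the nonlinearity, a derivative of a quadratic term, in H^(-3/2),
  and filter and inverse gradient lift this to -1/2 + 2\<theta>, the exponent of the
  pressure.\<close>

abbreviation (input) leb :: "real => real measure" where
  "leb T \<equiv> lebesgue_on {0..T}"

abbreviation (input) freq :: "int ^ 3 => real" where
  "freq k \<equiv> norm (wave k)"

abbreviation (input) sq_summable :: "('i => 'v::real_normed_vector) => bool" where
  "sq_summable c \<equiv> (\<lambda>k. (norm (c k))\<^sup>2) summable_on UNIV"

abbreviation (input) wsum :: "(int ^ 3 => real) => (int ^ 3 => 'v::real_normed_vector) => real" where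
  "wsum W c \<equiv> \<Sum>\<^sub>\<infinity>k. W k * (norm (c k))\<^sup>2"

abbreviation (input) wsummable :: "(int ^ 3 => real) => (int ^ 3 => 'v::real_normed_vector) => bool" where
  "wsummable W c \<equiv> (\<lambda>k. W k * (norm (c k))\<^sup>2) summable_on UNIV"

abbreviation (input) seq_limit :: "(nat => 'a::topological_space) => 'a => bool" (infix "---->" 60) where
  "X ----> L \<equiv> X \<longlonglongrightarrow> L"

subsection \<open>Lattice sums\<close>

text \<open>Cubes in the maximum norm have an exactly known cardinality, are symmetric under k -> -k
  as the reality condition requires, and exhaust the lattice along a sequence.\<close>

definition box3 :: "nat => (int ^ 3) set" where
	"box3 n = {k. \<forall>j. \<bar>k $ j\<bar> <= int n}"

lemma bij_box3: "bij_betw vec_nth (box3 n) (PiE UNIV (%_. {- int n..int n}))"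
	by (rule bij_betwI[where g = "%f. \<chi> i. f i"])
		 (auto simp: box3_def PiE_def Pi_def abs_le_iff vec_eq_iff minus_le_iff)

lemma finite_box3: "finite (box3 n)"
	using bij_betw_finite[OF bij_box3] by (simp add: finite_PiE)

lemma card_box3: "card (box3 n) = (2 * n + 1) ^ 3"
proof -
	have "card {- int n..int n} = 2 * n + 1" by simp
	then show ?thesis
		using bij_betw_same_card[OF bij_box3[of n]] by (simp add: card_PiE)
qed

lemma box3_mono: "m <= n ==> box3 m \<subseteq> box3 n"
	unfolding box3_def by (auto intro: order_trans[of _ "int m"])

lemma box3_uminus: "- k \<in> box3 n \<longleftrightarrow> k \<in> box3 n"
	by (simp add: box3_def)

lemma box3_0: "box3 0 = {0}"
	by (auto simp: box3_def vec_eq_iff)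

lemma wave_eq_0_iff [simp]: "wave k = 0 \<longleftrightarrow> k = 0"
	by (simp add: wave_def vec_eq_iff)

lemma wave_0 [simp]: "wave 0 = 0"
	by simp

lemma wave_uminus: "wave (- k) = - wave k"
	by (simp add: wave_def vec_eq_iff)

lemma wave_add: "wave (k + l) = wave k + wave l"
	by (simp add: wave_def vec_eq_iff)

lemma wave_diff: "wave (k - l) = wave k - wave l"
	by (simp add: wave_def vec_eq_iff)

lemma component_le_wave: "\<bar>of_int (k $ j)\<bar> <= freq k"
	using component_le_norm_cart[of "wave k" j] by (simp add: wave_def)

lemma norm_wave_ge: "k \<notin> box3 n ==> real (Suc n) <= freq k"
proof -
	assume "k \<notin> box3 n"
	then obtain j where "\<not> \<bar>k $ j\<bar> <= int n" by (auto simp: box3_def)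
	then have "real (Suc n) <= \<bar>of_int (k $ j)\<bar>" by linarith
	then show ?thesis using component_le_wave[of k j] by linarith
qed

lemma norm_wave_ge_1: "k ~= 0 ==> 1 <= freq k"
	using norm_wave_ge[of k 0] by (simp add: box3_0)

lemma norm_wave_powr_mono:
	"s <= t ==> freq k powr s <= freq k powr t"
	using norm_wave_ge_1[of k] by (cases "k = 0") (auto intro: powr_mono)

lemma in_box3: "freq k <= real n ==> k \<in> box3 n"
	using norm_wave_ge[of k n] by linarith

lemma ex_box3: "\<exists>n. k \<in> box3 n"
	using in_box3 real_arch_simple by blast

lemma finite_subset_box3: "finite F ==> \<exists>n. F \<subseteq> box3 n"
proof (induction F rule: finite_induct)
	case (insert k F)
	then obtain m n where "F \<subseteq> box3 m" "k \<in> box3 n" using ex_box3 by metis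
	then have "insert k F \<subseteq> box3 (max m n)"
		using box3_mono[of m "max m n"] box3_mono[of n "max m n"] by auto
	then show ?case ..
qed simp

text \<open>Cofinality of the cubes among the finite sets. It brings unconditional sums within reach
  of the convergence theorems for integrals, which speak of sequences.\<close>

lemma filterlim_box3: "filterlim box3 (finite_subsets_at_top UNIV) sequentially"
	unfolding filterlim_finite_subsets_at_top
proof (intro allI impI)
	fix X :: "(int ^ 3) set" assume "finite X \<and> X \<subseteq> UNIV"
	then obtain n where n: "X \<subseteq> box3 n" using finite_subset_box3 by blast
	show "\<forall>\<^sub>F m in sequentially. finite (box3 m) \<and> X \<subseteq> box3 m \<and> box3 m \<subseteq> UNIV"
		using eventually_ge_at_top[of n]
		by eventually_elim (use n box3_mono finite_box3 in fastforce)
qed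

lemma sum_box3_tendsto:
	"f summable_on UNIV ==> (%n. sum f (box3 n)) ----> infsum f UNIV"
	using filterlim_compose[OF _ filterlim_box3] infsum_tendsto by blast

text \<open>Mean value theorem for x^q on [n, n+1]. The constant 4 covers q > 1, where n + 1 <= 2z
  costs 2^(q-1) <= 4; for q <= 1 the power q - 1 is decreasing and nothing is lost.\<close>

lemma powr_step:
	assumes "0 < q" and "q <= 3" and "1 <= n"
	shows "real (Suc n) powr (q - 1) <= (4 / q) * (real (Suc n) powr q - real n powr q)"
proof -
	have "\<exists>z. real n < z \<and> z < real (Suc n) \<and>
			real (Suc n) powr q - real n powr q = (real (Suc n) - real n) * (q * z powr (q - 1))"
		by (rule MVT2) (use assms in \<open>auto intro!: derivative_eq_intros simp: powr_diff field_simps\<close>)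
	then obtain z where z: "real n < z" "z < real (Suc n)"
		and eq: "real (Suc n) powr q - real n powr q = q * z powr (q - 1)" by auto
	have "real (Suc n) powr (q - 1) <= 4 * z powr (q - 1)"
	proof (cases "q <= 1")
		case True
		have "real (Suc n) powr (q - 1) <= z powr (q - 1)"
			using True z assms by (intro powr_mono2') auto
		then show ?thesis using powr_ge_zero[of z "q - 1"] by linarith
	next
		case False
		have "real (Suc n) powr (q - 1) <= (2 * z) powr (q - 1)"
			using False z assms by (intro powr_mono2) auto
		also have "... = 2 powr (q - 1) * z powr (q - 1)"
			using z by (simp add: powr_mult)
		also have "... <= 2 powr 2 * z powr (q - 1)"
			using assms by (intro mult_right_mono powr_mono) auto
		finally show ?thesis by (simp add: powr_numeral)
	qed
	then show ?thesis unfolding eq using assms by simp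
qed

text \<open>The first 26 pays for the innermost shell, 26 * (4/q) for the telescoped remainder. The
  blow-up as q -> 0 reflects the logarithmic divergence of the sum of |l|^(-3); it is why the
  exponents of the trilinear estimate stay strictly below 3/2.\<close>

definition lattice_const :: "real => real" where
	"lattice_const q = 26 + 26 * (4 / q)"

text \<open>The shell has (2n+3)^3 - (2n+1)^3 = 24 (n+1)^2 + 2 points, all of length at least n +
  1.\<close>

lemma lattice_shell:
	assumes "p <= 0"
	shows "(\<Sum>l\<in>box3 (Suc n) - box3 n. freq l powr p) <= 26 * real (Suc n) powr (p + 2)"
proof -
	have "card (box3 (Suc n) - box3 n) = (2 * Suc n + 1) ^ 3 - (2 * n + 1) ^ 3"
		using card_Diff_subset[OF finite_box3 box3_mono[of n "Suc n"]] by (simp add: card_box3)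
	then have "real (card (box3 (Suc n) - box3 n)) = real ((2 * Suc n + 1) ^ 3) - real ((2 * n + 1) ^ 3)"
		by (simp add: of_nat_diff power_mono)
	also have "... <= 26 * (real (Suc n))^2"
		by (simp add: power2_eq_square power3_eq_cube algebra_simps)
	finally have card: "real (card (box3 (Suc n) - box3 n)) <= 26 * (real (Suc n))^2" .
	have "(\<Sum>l\<in>box3 (Suc n) - box3 n. freq l powr p)
			<= (\<Sum>l\<in>box3 (Suc n) - box3 n. real (Suc n) powr p)"
		by (rule sum_mono) (use assms norm_wave_ge in \<open>auto intro!: powr_mono2' simp del: of_nat_Suc\<close>)
	also have "... <= 26 * (real (Suc n))^2 * real (Suc n) powr p"
		using mult_right_mono[OF card, of "real (Suc n) powr p"] by simp
	also have "(real (Suc n))^2 * real (Suc n) powr p = real (Suc n) powr (p + 2)"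
		using powr_add[of "real (Suc n)" 2 p] by (simp add: powr_numeral add.commute del: of_nat_Suc)
	then have "26 * (real (Suc n))^2 * real (Suc n) powr p = 26 * real (Suc n) powr (p + 2)"
		by (simp only: mult.assoc)
	finally show ?thesis .
qed

text \<open>A discrete version of integrating r^(q-1): each shell contributes at most 26
  (n+1)^(q-1), which \<open>powr_step\<close> bounds by an increment of the power q, and the
  increments telescope.\<close>

lemma lattice_sum_box3:
	assumes q: "0 < q" "q <= 3"
	shows "(\<Sum>l\<in>box3 (Suc n) - {0}. freq l powr (q - 3)) <= lattice_const q * real (Suc n) powr q"
proof (induction n)
	have shell: "(\<Sum>l\<in>box3 (Suc n) - box3 n. freq l powr (q - 3)) <= 26 * real (Suc n) powr (q - 1)" for n
		using lattice_shell[of "q - 3" n] q by simp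
	{
		case 0
		have "26 <= lattice_const q" using q by (simp add: lattice_const_def)
		then show ?case using shell[of 0] by (simp add: box3_0)
	next
		case (Suc n)
		have split: "box3 (Suc (Suc n)) - {0} = (box3 (Suc n) - {0}) \<union> (box3 (Suc (Suc n)) - box3 (Suc n))"
			using box3_mono[of "Suc n" "Suc (Suc n)"] by (auto simp: box3_def)
		have "(\<Sum>l\<in>box3 (Suc (Suc n)) - {0}. freq l powr (q - 3))
			= (\<Sum>l\<in>box3 (Suc n) - {0}. freq l powr (q - 3))
			 + (\<Sum>l\<in>box3 (Suc (Suc n)) - box3 (Suc n). freq l powr (q - 3))"
			unfolding split by (rule sum.union_disjoint) (auto simp: finite_box3)
		also have "... <= lattice_const q * real (Suc n) powr q + 26 * real (Suc (Suc n)) powr (q - 1)"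
			using Suc shell by (intro add_mono)
		also have "26 * real (Suc (Suc n)) powr (q - 1)
				<= (26 * (4 / q)) * (real (Suc (Suc n)) powr q - real (Suc n) powr q)"
			using mult_left_mono[OF powr_step[OF q, of "Suc n"], of 26] by (simp only: mult.assoc)
		also have "... <= lattice_const q * (real (Suc (Suc n)) powr q - real (Suc n) powr q)"
			using q by (intro mult_right_mono) (auto simp: lattice_const_def intro!: powr_mono2)
		finally show ?case by (simp add: algebra_simps)
	}
qed

lemma lattice_sum:
	assumes q: "0 < q" "q <= 3" and F: "finite F" "!!l. l \<in> F ==> l ~= 0 \<and> freq l <= R" and R: "1 <= R"
	shows "(\<Sum>l\<in>F. freq l powr (q - 3)) <= lattice_const q * 8 * R powr q"
proof -
	\<comment> \<open>Rounding up at most doubles R because 1 <= R; this is the origin of the factor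
	  2^q <= 8.\<close>
	define n where "n = nat \<lceil>R\<rceil>"
	have n: "R <= real n" "real n <= 2 * R" using R unfolding n_def by linarith+
	then have "n ~= 0" using R by auto
	then obtain m where m: "n = Suc m" using not0_implies_Suc by blast
	have "(\<Sum>l\<in>F. freq l powr (q - 3)) <= (\<Sum>l\<in>box3 n - {0}. freq l powr (q - 3))"
	proof (rule sum_mono2)
		show "F \<subseteq> box3 n - {0}" using F(2) n(1) in_box3 by (auto intro: order_trans)
	qed (auto simp: finite_box3)
	also have "... <= lattice_const q * real n powr q"
		unfolding m by (rule lattice_sum_box3[OF q])
	also have "... <= lattice_const q * (2 * R) powr q"
		using q n by (intro mult_left_mono powr_mono2) (auto simp: lattice_const_def)
	also have "(2 * R) powr q = 2 powr q * R powr q" using R by (simp add: powr_mult)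
	also have "lattice_const q * (2 powr q * R powr q) <= lattice_const q * (2 powr 3 * R powr q)"
		using q by (intro mult_left_mono mult_right_mono powr_mono) (auto simp: lattice_const_def)
	finally show ?thesis by (simp add: powr_numeral)
qed

lemma powr_squared: "(x powr a)^2 = x powr (2 * a)" for x :: real
	by (cases "x = 0") (auto simp: power2_eq_square powr_add[symmetric])

subsection \<open>A trilinear lattice estimate\<close>

text \<open>The sum over the smallest of the three frequencies, with the middle one fixed, converges by
	scaling; Cauchy--Schwarz then leaves a product of two independent sums.\<close>

lemma trilinear_smallest:
	fixes X Y Z :: "int ^ 3 => real"
	assumes exps: "0 <= a" "a < 3/2" "0 <= c" "a + b + c = 3/2"
		and F: "finite F"
		and reg: "!!l m. (l, m) \<in> F ==> l ~= 0 \<and> m ~= 0 \<and> freq l <= freq m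
								\<and> freq l <= norm (wave (l + m))"
		and X: "!!K. finite K ==> (\<Sum>k\<in>K. (X k)^2) <= A^2"
		and Y: "!!K. finite K ==> (\<Sum>k\<in>K. (Y k)^2) <= B^2"
		and Z: "!!K. finite K ==> (\<Sum>k\<in>K. (Z k)^2) <= D^2"
		and nonneg: "0 <= A" "0 <= B" "0 <= D"
	shows "(\<Sum>(l, m)\<in>F. X l * Y m * Z (l + m) * (freq l powr - a * freq m powr - b
						* norm (wave (l + m)) powr - c))
			<= sqrt (4 powr c * (lattice_const (3 - 2 * a) * 8)) * A * B * D"
proof -
	define \<mu> where "\<mu> l m = freq l powr - a * freq m powr - b * norm (wave (l + m)) powr - c"
		for l m :: "int ^ 3"
	define C where "C = 4 powr c * (lattice_const (3 - 2 * a) * 8)"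
	have C: "0 <= C" using exps by (auto simp: C_def lattice_const_def)
	\<comment> \<open>\<open>X\<close> is grouped with \<open>Z\<close> since (l, m) -> (l, l + m) is
	  injective, so their double sum is at most A^2 D^2. What remains is, at fixed m, the sum of the
	  squared weight over the smallest frequency l, which must be bounded independently of m.\<close>
	have "(\<Sum>p\<in>F. (X (fst p) * Z (fst p + snd p)) * (Y (snd p) * \<mu> (fst p) (snd p)))^2
		<= (\<Sum>p\<in>F. (X (fst p) * Z (fst p + snd p))^2) * (\<Sum>p\<in>F. (Y (snd p) * \<mu> (fst p) (snd p))^2)"
		by (rule Cauchy_Schwarz_ineq_sum)
	also have "... <= (A^2 * D^2) * (C * B^2)"
	proof (rule mult_mono)
		let ?g = "%p :: (int^3) \<times> (int^3). (fst p, fst p + snd p)"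
		have inj: "inj_on ?g F" by (auto simp: inj_on_def prod_eq_iff)
		have "(\<Sum>p\<in>F. (X (fst p) * Z (fst p + snd p))^2) = (\<Sum>(l, k)\<in>?g ` F. (X l)^2 * (Z k)^2)"
			by (subst sum.reindex[OF inj]) (simp add: power_mult_distrib)
		also have "... <= (\<Sum>(l, k)\<in>(fst ` F) \<times> ((%p. fst p + snd p) ` F). (X l)^2 * (Z k)^2)"
			using F by (intro sum_mono2) auto
		also have "... = (\<Sum>l\<in>fst ` F. (X l)^2) * (\<Sum>k\<in>(%p. fst p + snd p) ` F. (Z k)^2)"
			by (simp add: sum_product sum.cartesian_product)
		also have "... <= A^2 * D^2"
			using F X Z by (intro mult_mono) (auto intro: sum_nonneg)
		finally show "(\<Sum>p\<in>F. (X (fst p) * Z (fst p + snd p))^2) <= A^2 * D^2" .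
		have mu: "(\<Sum>l | (l, m) \<in> F. (\<mu> l m)^2) <= C" if "m \<in> snd ` F" for m
		proof -
			have m: "m ~= 0" using that reg by force
			then have m1: "1 <= freq m" by (rule norm_wave_ge_1)
			have fin: "finite {l. (l, m) \<in> F}"
				using finite_imageI[OF F, of fst] by (rule finite_subset[rotated]) force
			have "(\<Sum>l | (l, m) \<in> F. (\<mu> l m)^2)
				<= (\<Sum>l | (l, m) \<in> F. freq l powr ((3 - 2 * a) - 3) * (4 powr c * freq m powr (- 2 * b - 2 * c)))"
			proof (rule sum_mono)
				fix l assume "l \<in> {l. (l, m) \<in> F}"
				then have l: "freq l <= freq m" "freq l <= norm (wave (l + m))"
					using reg by auto
				\<comment> \<open>Since l is the smallest frequency, l + m is at least half as long as m, so its
				  weight can be traded for one at m at the price 4^c.\<close>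
				have "freq m <= norm (wave (l + m)) + freq l"
					using norm_triangle_ineq4[of "wave (l + m)" "wave l"] by (simp add: wave_add)
				then have "freq m / 2 <= norm (wave (l + m))" using l by linarith
				then have "norm (wave (l + m)) powr (- 2 * c) <= (freq m / 2) powr (- 2 * c)"
					using m1 exps by (intro powr_mono2') auto
				also have "... = freq m powr (- 2 * c) * 2 powr (2 * c)"
					using m1 by (simp add: powr_divide powr_minus field_simps)
				also have "(2 :: real) powr (2 * c) = 4 powr c"
					using powr_powr[of 2 2 c] by (simp add: powr_numeral)
				finally have "norm (wave (l + m)) powr (- 2 * c) <= 4 powr c * freq m powr (- 2 * c)"
					by (simp add: mult.commute)
				then have "freq l powr (- 2 * a) * freq m powr (- 2 * b) * norm (wave (l + m)) powr (- 2 * c)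
					<= freq l powr (- 2 * a) * freq m powr (- 2 * b) * (4 powr c * freq m powr (- 2 * c))"
					by (intro mult_left_mono) auto
				also have "... = freq l powr (- 2 * a) * (4 powr c * freq m powr (- 2 * b - 2 * c))"
					by (simp add: powr_diff powr_minus powr_add[symmetric] field_simps)
				finally show "(\<mu> l m)^2 <= freq l powr ((3 - 2 * a) - 3) * (4 powr c * freq m powr (- 2 * b - 2 * c))"
					by (simp add: \<mu>_def power_mult_distrib powr_squared)
			qed
			also have "... = (\<Sum>l | (l, m) \<in> F. freq l powr ((3 - 2 * a) - 3)) * (4 powr c * freq m powr (- 2 * b - 2 * c))"
				by (simp add: sum_distrib_right)
			also have "... <= (lattice_const (3 - 2 * a) * 8 * freq m powr (3 - 2 * a)) * (4 powr c * freq m powr (- 2 * b - 2 * c))"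
				using exps fin reg m1 by (intro mult_right_mono lattice_sum) auto
			also have "... = C * (freq m powr (3 - 2 * a) * freq m powr (- 2 * b - 2 * c))"
				by (simp add: C_def)
			\<comment> \<open>Scale invariance: the exponent 3 - 2a - 2b - 2c is zero because a + b + c =
			  3/2.\<close>
			also have "freq m powr (3 - 2 * a) * freq m powr (- 2 * b - 2 * c) = freq m powr 0"
				unfolding powr_add[symmetric] using exps by (intro arg_cong2[where f = "(powr)"]) auto
			finally show ?thesis using m by simp
		qed
		have "(\<Sum>p\<in>F. (Y (snd p) * \<mu> (fst p) (snd p))^2)
			 = (\<Sum>m\<in>snd ` F. \<Sum>p | p \<in> F \<and> snd p = m. (Y (snd p) * \<mu> (fst p) (snd p))^2)"
			by (rule sum.image_gen[OF F])
		also have "... = (\<Sum>m\<in>snd ` F. (Y m)^2 * (\<Sum>l | (l, m) \<in> F. (\<mu> l m)^2))"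
		proof (rule sum.cong[OF refl])
			fix m
			have "{p. p \<in> F \<and> snd p = m} = (%l. (l, m)) ` {l. (l, m) \<in> F}" by force
			moreover have "inj_on (%l. (l, m)) {l. (l, m) \<in> F}" by (auto simp: inj_on_def)
			ultimately show "(\<Sum>p | p \<in> F \<and> snd p = m. (Y (snd p) * \<mu> (fst p) (snd p))^2)
					= (Y m)^2 * (\<Sum>l | (l, m) \<in> F. (\<mu> l m)^2)"
				by (simp add: sum.reindex power_mult_distrib sum_distrib_left)
		qed
		also have "... <= (\<Sum>m\<in>snd ` F. (Y m)^2 * C)"
			by (intro sum_mono mult_left_mono mu) auto
		also have "... <= B^2 * C"
			using F Y C by (simp add: sum_distrib_right[symmetric] mult_right_mono)
		finally show "(\<Sum>p\<in>F. (Y (snd p) * \<mu> (fst p) (snd p))^2) <= C * B^2" by (simp add: mult.commute)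
	qed (auto intro: sum_nonneg)
	also have "... = (sqrt C * A * B * D)^2" using C by (simp add: power_mult_distrib)
	finally have "(\<Sum>p\<in>F. (X (fst p) * Z (fst p + snd p)) * (Y (snd p) * \<mu> (fst p) (snd p)))
			<= sqrt C * A * B * D"
		by (rule power2_le_imp_le) (use C nonneg in auto)
	then show ?thesis by (simp add: C_def \<mu>_def case_prod_unfold algebra_simps)
qed

text \<open>One summand for each choice of the smallest among l, m and l + m. The exponent inside
  \<open>lattice_const\<close> belongs to the frequency that is summed, the power of 4 to the one
  that is compared with the fixed frequency.\<close>

definition tri_const :: "real => real => real => real" where
	"tri_const a b c = sqrt (4 powr c * (lattice_const (3 - 2 * a) * 8))
		 + sqrt (4 powr c * (lattice_const (3 - 2 * b) * 8))
		 + sqrt (4 powr a * (lattice_const (3 - 2 * c) * 8))"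

lemma tri_const_nonneg: "a < 3/2 ==> b < 3/2 ==> c < 3/2 ==> 0 <= tri_const a b c"
	by (auto simp: tri_const_def lattice_const_def)

text \<open>The three regions, according to which frequency is smallest, cover F; their overlaps do
  no harm since all terms are nonnegative. By the symmetry of the triad each region reduces to the
  case where the first frequency is the smallest.\<close>

lemma trilinear_finite:
	fixes X Y Z :: "int ^ 3 => real"
	assumes exps: "0 <= a" "a < 3/2" "0 <= b" "b < 3/2" "0 <= c" "c < 3/2" "a + b + c = 3/2"
		and F: "finite F"
		and reg: "!!l m. (l, m) \<in> F ==> l ~= 0 \<and> m ~= 0 \<and> l + m ~= 0"
		and X: "!!K. finite K ==> (\<Sum>k\<in>K. (X k)^2) <= A^2"
		and Y: "!!K. finite K ==> (\<Sum>k\<in>K. (Y k)^2) <= B^2"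
		and Z: "!!K. finite K ==> (\<Sum>k\<in>K. (Z k)^2) <= D^2"
		and nonneg: "0 <= A" "0 <= B" "0 <= D" "!!k. 0 <= X k" "!!k. 0 <= Y k" "!!k. 0 <= Z k"
	shows "(\<Sum>(l, m)\<in>F. X l * Y m * Z (l + m) * (freq l powr - a * freq m powr - b
						* norm (wave (l + m)) powr - c)) <= tri_const a b c * A * B * D"
proof -
	let ?t = "%(l, m). X l * Y m * Z (l + m) * (freq l powr - a * freq m powr - b
						* norm (wave (l + m)) powr - c)"
	let ?n = "%k. freq k"
	define F1 where "F1 = {p \<in> F. ?n (fst p) <= ?n (snd p) \<and> ?n (fst p) <= ?n (fst p + snd p)}"
	define F2 where "F2 = {p \<in> F. ?n (snd p) <= ?n (fst p) \<and> ?n (snd p) <= ?n (fst p + snd p)}"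
	define F3 where "F3 = {p \<in> F. ?n (fst p + snd p) <= ?n (fst p) \<and> ?n (fst p + snd p) <= ?n (snd p)}"
	have fin: "finite F1" "finite F2" "finite F3" using F by (auto simp: F1_def F2_def F3_def)
	have nn: "0 <= ?t p" for p using nonneg by (auto simp: case_prod_unfold)
	have un: "sum ?t (P \<union> Q) <= sum ?t P + sum ?t Q" if "finite P" "finite Q" for P Q
		using sum.union_inter[OF that, of ?t] sum_nonneg[of "P \<inter> Q" ?t] nn by simp
	have "F = F1 \<union> F2 \<union> F3" unfolding F1_def F2_def F3_def by auto
	then have "sum ?t F <= sum ?t F1 + sum ?t F2 + sum ?t F3"
		using un[OF fin(1,2)] un[OF _ fin(3), of "F1 \<union> F2"] fin by (simp add: case_prod_unfold)
	also have "sum ?t F1 <= sqrt (4 powr c * (lattice_const (3 - 2 * a) * 8)) * A * B * D"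
		by (rule trilinear_smallest[OF _ _ _ _ fin(1) _ X Y Z])
			 (use exps reg nonneg in \<open>auto simp: F1_def\<close>)
	also have "sum ?t F2 <= sqrt (4 powr c * (lattice_const (3 - 2 * b) * 8)) * B * A * D"
	proof -
		have "sum ?t F2 = (\<Sum>(m, l)\<in>prod.swap ` F2. Y m * X l * Z (m + l) * (?n m powr - b * ?n l powr - a * ?n (m + l) powr - c))"
			by (subst sum.reindex) (auto intro!: sum.cong simp: case_prod_unfold add.commute algebra_simps)
		also have "... <= sqrt (4 powr c * (lattice_const (3 - 2 * b) * 8)) * B * A * D"
			by (rule trilinear_smallest[OF _ _ _ _ _ _ Y X Z])
				 (use exps reg nonneg fin in \<open>auto simp: F2_def add.commute\<close>)
		finally show ?thesis .
	qed
	also have "sum ?t F3 <= sqrt (4 powr a * (lattice_const (3 - 2 * c) * 8)) * D * B * A"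
	proof -
		\<comment> \<open>When the output frequency is smallest the triad is relabelled: -(l + m) plays
		  the first role, m keeps its own, and their sum is -l. The weights are even, and the bounds on X
		  and Z hold for all finite sets, hence for reflected ones.\<close>
		let ?g = "%p :: (int^3) \<times> (int^3). (- (fst p + snd p), snd p)"
		have inj: "inj_on ?g F3" by (auto simp: inj_on_def prod_eq_iff)
		have neg: "(\<Sum>k\<in>K. (h (- k))^2) <= E^2" if "!!K. finite K ==> (\<Sum>k\<in>K. (h k)^2) <= E^2" "finite K"
			for h :: "int ^ 3 => real" and K E
			using that(1)[of "uminus ` K"] that(2) by (simp add: sum.reindex)
		have "sum ?t F3 = (\<Sum>(l, m)\<in>?g ` F3. Z (- l) * Y m * X (- (l + m)) * (?n l powr - c * ?n m powr - b * ?n (l + m) powr - a))"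
			by (subst sum.reindex[OF inj])
				 (auto intro!: sum.cong simp: case_prod_unfold algebra_simps wave_add wave_uminus norm_minus_commute wave_diff)
		also have "... <= sqrt (4 powr a * (lattice_const (3 - 2 * c) * 8)) * D * B * A"
		proof (rule trilinear_smallest[OF _ _ _ _ _ _ neg[OF Z] Y neg[OF X]])
			show "l ~= 0 \<and> m ~= 0 \<and> ?n l <= ?n m \<and> ?n l <= ?n (l + m)" if lm: "(l, m) \<in> ?g ` F3" for l m
			proof -
				from lm obtain p q where pq: "(p, q) \<in> F3" "l = - (p + q)" "m = q" by auto
				then have "l + m = - p" by simp
				then show ?thesis using pq reg[of p q] by (auto simp: F3_def wave_uminus simp del: minus_add_distrib)
			qed
		qed (use exps nonneg fin in auto)
		finally show ?thesis .
	qed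
	finally show ?thesis by (simp add: tri_const_def algebra_simps)
qed

subsection \<open>Infinite sums\<close>

lemma nonneg_summable_bounded:
	fixes f :: "'a => real"
	assumes "!!k. 0 <= f k" and "!!F. finite F ==> sum f F <= B"
	shows "f summable_on UNIV" and "infsum f UNIV <= B"
proof -
	show s: "f summable_on UNIV"
		using assms by (intro nonneg_bdd_above_summable_on) (auto intro!: bdd_aboveI2)
	show "infsum f UNIV <= B" using assms by (intro infsum_le_finite_sums[OF s])
qed

lemma finite_sum_le_box3:
	fixes f :: "int ^ 3 => real"
	assumes "!!k. 0 <= f k" and "!!n. sum f (box3 n) <= B" and "finite F"
	shows "sum f F <= B"
proof -
	obtain n where "F \<subseteq> box3 n" using finite_subset_box3[OF assms(3)] ..
	then have "sum f F <= sum f (box3 n)" using assms finite_box3 by (intro sum_mono2) auto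
	then show ?thesis using assms(2) order_trans by blast
qed

lemma sum_le_infsum:
	fixes f :: "'a => real"
	assumes "f summable_on UNIV" "!!k. 0 <= f k" "finite F"
	shows "sum f F <= infsum f UNIV"
	by (rule finite_sum_le_infsum[OF assms(1,3)]) (simp_all add: assms(2))

lemma le_infsum:
	fixes f :: "'a => real"
	assumes "f summable_on UNIV" "!!k. 0 <= f k"
	shows "f k <= infsum f UNIV"
	using sum_le_infsum[OF assms, of "{k}"] by simp

lemma summable_on_abs_real:
	fixes f :: "'a => real"
	shows "(%k. \<bar>f k\<bar>) summable_on UNIV ==> f summable_on UNIV"
	using summable_on_iff_abs_summable_on_real[of f UNIV] by simp

lemma summable_on_comparison_real:
	fixes f g :: "'a => real"
	assumes "g summable_on UNIV" and "!!k. \<bar>f k\<bar> <= g k"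
	shows "f summable_on UNIV"
proof -
	have "(%k. \<bar>f k\<bar>) summable_on UNIV"
		using assms by (intro summable_on_comparison_test[OF assms(1)]) auto
	then show ?thesis by (rule summable_on_abs_real)
qed

text \<open>Dominated convergence for the counting measure; absolutely convergent unconditional sums
  are integrals against it.\<close>

lemma infsum_dominated_convergence:
	fixes f :: "nat => 'a => real"
	assumes h: "h summable_on UNIV" and le: "!!i k. \<bar>f i k\<bar> <= h k"
		and lim: "!!k. (%i. f i k) ----> g k"
	shows "(%i. infsum (f i) UNIV) ----> infsum g UNIV"
proof -
	have gh: "\<bar>g k\<bar> <= h k" for k
		by (rule tendsto_upperbound[OF tendsto_rabs[OF lim]]) (simp_all add: le)
	have eq: "infsum \<phi> UNIV = integral\<^sup>L (count_space UNIV) \<phi>" if "!!k. \<bar>\<phi> k\<bar> <= h k" for \<phi>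
	proof -
		have "\<phi> summable_on UNIV" by (rule summable_on_comparison_real[OF h that])
		then have "Infinite_Set_Sum.abs_summable_on \<phi> UNIV"
			by (simp only: abs_summable_equivalent[symmetric] summable_on_iff_abs_summable_on_real[THEN iffD1])
		from infsetsum_infsum[OF this] show ?thesis unfolding infsetsum_def by simp
	qed
	have "integrable (count_space UNIV) h"
		using summable_on_iff_abs_summable_on_real[THEN iffD1, OF h]
		by (simp only: abs_summable_equivalent Infinite_Set_Sum.abs_summable_on_def)
	then have "(%i. integral\<^sup>L (count_space UNIV) (f i)) ----> integral\<^sup>L (count_space UNIV) g"
		by (rule integral_dominated_convergence[where w = h, rotated 2]) (use le lim in auto)
	then show ?thesis unfolding eq[OF le] eq[OF gh] .
qed

lemma infsum_Cauchy_Schwarz: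
	fixes x y :: "'a => real"
	assumes x: "(%k. (x k)^2) summable_on UNIV" and y: "(%k. (y k)^2) summable_on UNIV"
	shows "(%k. \<bar>x k * y k\<bar>) summable_on UNIV" and "(%k. x k * y k) summable_on UNIV"
		and "(INFSUM k. \<bar>x k * y k\<bar>) <= sqrt (INFSUM k. (x k)^2) * sqrt (INFSUM k. (y k)^2)"
		and "\<bar>INFSUM k. x k * y k\<bar> <= sqrt (INFSUM k. (x k)^2) * sqrt (INFSUM k. (y k)^2)"
proof -
	let ?B = "sqrt (INFSUM k. (x k)^2) * sqrt (INFSUM k. (y k)^2)"
	have fin: "(\<Sum>k\<in>F. \<bar>x k * y k\<bar>) <= ?B" if F: "finite F" for F
	proof -
		have "(\<Sum>k\<in>F. \<bar>x k\<bar> * \<bar>y k\<bar>) <= sqrt (\<Sum>k\<in>F. \<bar>x k\<bar>^2) * sqrt (\<Sum>k\<in>F. \<bar>y k\<bar>^2)"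
			unfolding real_sqrt_mult[symmetric]
			by (rule real_le_rsqrt) (rule Cauchy_Schwarz_ineq_sum)
		also have "... <= ?B"
			using sum_le_infsum[OF x _ F] sum_le_infsum[OF y _ F]
			by (intro mult_mono real_sqrt_le_mono) (auto intro!: infsum_nonneg sum_nonneg)
		finally show ?thesis by (simp add: abs_mult)
	qed
	show 1: "(%k. \<bar>x k * y k\<bar>) summable_on UNIV" and 2: "(INFSUM k. \<bar>x k * y k\<bar>) <= ?B"
		by (rule nonneg_summable_bounded[OF _ fin]; simp)+
	from 1 show "(%k. x k * y k) summable_on UNIV" by (rule summable_on_abs_real)
	have "\<bar>INFSUM k. x k * y k\<bar> <= (INFSUM k. \<bar>x k * y k\<bar>)"
		using norm_infsum_bound[of "%k. x k * y k" UNIV] 1 by simp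
	then show "\<bar>INFSUM k. x k * y k\<bar> <= ?B" using 2 by linarith
qed

subsection \<open>Measurability and almost everywhere limits\<close>

text \<open>Rests on the completeness of Lebesgue measure. The fields are often known only at almost
  every time, so measurability has to survive changes on null sets.\<close>

lemma borel_measurable_lebesgue_on_AE:
	fixes f g :: "'a::euclidean_space => 'b::euclidean_space"
	assumes f: "f \<in> borel_measurable (lebesgue_on S)" and S: "S \<in> sets lebesgue"
		and ae: "AE x in lebesgue_on S. f x = g x"
	shows "g \<in> borel_measurable (lebesgue_on S)"
proof -
	have "(%x. if x \<in> S then f x else 0) \<in> borel_measurable lebesgue"
		using f S by (simp add: borel_measurable_if)
	moreover have "AE x in lebesgue. (if x \<in> S then f x else 0) = (if x \<in> S then g x else 0)"
		using ae S by (simp add: AE_restrict_space_iff)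
	ultimately have "(%x. if x \<in> S then g x else 0) \<in> borel_measurable lebesgue"
		by (rule borel_measurable_AE)
	then show ?thesis using S by (simp add: borel_measurable_if)
qed

lemma borel_measurable_lebesgue_on_AE_LIMSEQ:
	fixes f :: "nat => 'a::euclidean_space => 'b::euclidean_space"
	assumes f: "!!n. f n \<in> borel_measurable (lebesgue_on S)" and S: "S \<in> sets lebesgue"
		and ae: "AE x in lebesgue_on S. (%n. f n x) ----> g x"
	shows "g \<in> borel_measurable (lebesgue_on S)"
proof (rule borel_measurable_lebesgue_on_AE[OF _ S])
	show "(%x. lim (%n. f n x)) \<in> borel_measurable (lebesgue_on S)"
		using f by (intro borel_measurable_lim_metric)
	show "AE x in lebesgue_on S. lim (%n. f n x) = g x"
		using ae by eventually_elim (rule limI)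
qed

lemma borel_measurable_infsum_AE:
	fixes g :: "int ^ 3 => 'a::euclidean_space => 'b::euclidean_space"
	assumes "!!k. g k \<in> borel_measurable (lebesgue_on S)" and "S \<in> sets lebesgue"
		and ae: "AE x in lebesgue_on S. (%k. g k x) summable_on UNIV"
	shows "(%x. INFSUM k. g k x) \<in> borel_measurable (lebesgue_on S)"
proof (rule borel_measurable_lebesgue_on_AE_LIMSEQ[OF _ assms(2)])
	show "(%x. \<Sum>k\<in>box3 n. g k x) \<in> borel_measurable (lebesgue_on S)" for n
		using assms(1) by measurable
	show "AE x in lebesgue_on S. (%n. \<Sum>k\<in>box3 n. g k x) ----> (INFSUM k. g k x)"
		using ae by eventually_elim (rule sum_box3_tendsto)
qed

text \<open>Monotone convergence along the cubes. Only integrals over cubes are assumed bounded, and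
  almost everywhere summability comes out as a conclusion; in this form finite energy estimates
  deliver membership in a Bochner space.\<close>

lemma integrable_infsum_nonneg:
	fixes g :: "int ^ 3 => 'a::euclidean_space => real"
	assumes int: "!!k. integrable (lebesgue_on S) (g k)" and S: "S \<in> sets lebesgue"
		and nonneg: "!!k x. 0 <= g k x"
		and bound: "!!n. (LINT x|lebesgue_on S. (\<Sum>k\<in>box3 n. g k x)) <= C"
	shows "AE x in lebesgue_on S. (%k. g k x) summable_on UNIV"
		and "integrable (lebesgue_on S) (%x. INFSUM k. g k x)"
		and "(LINT x|lebesgue_on S. (INFSUM k. g k x)) <= C"
proof -
	let ?M = "lebesgue_on S"
	define f where "f n x = (\<Sum>k\<in>box3 n. g k x)" for n x
	have f_int: "integrable ?M (f n)" for n unfolding f_def using int by auto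
	have f_mono: "f m x <= f n x" if "m <= n" for m n x
		unfolding f_def using that nonneg box3_mono finite_box3 by (intro sum_mono2) auto
	have f_nn: "0 <= f n x" for n x unfolding f_def using nonneg by (intro sum_nonneg) auto
	have [measurable]: "f n \<in> borel_measurable ?M" for n using f_int by blast
	have bound': "integral\<^sup>L ?M (f n) <= C" for n using bound unfolding f_def by simp
	have "(\<integral>\<^sup>+x. (SUP n. ennreal (f n x)) \<partial>?M) = (SUP n. \<integral>\<^sup>+x. ennreal (f n x) \<partial>?M)"
		by (rule nn_integral_monotone_convergence_SUP) (auto simp: incseq_def le_fun_def intro!: ennreal_leI f_mono)
	also have "... <= ennreal C"
		using f_int f_nn bound' by (intro SUP_least) (auto simp: nn_integral_eq_integral intro!: ennreal_leI)
	finally have "(\<integral>\<^sup>+x. (SUP n. ennreal (f n x)) \<partial>?M) ~= \<infinity>"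
		by (auto simp: top_unique)
	then have "AE x in ?M. (SUP n. ennreal (f n x)) ~= \<infinity>"
		by (intro nn_integral_noteq_infinite) auto
	then show ae: "AE x in ?M. (%k. g k x) summable_on UNIV"
	proof eventually_elim
		case (elim x)
		then obtain B where B: "(SUP n. ennreal (f n x)) = ennreal B" "0 <= B"
			by (cases "SUP n. ennreal (f n x)") auto
		have "f n x <= B" for n
			using SUP_upper[of n UNIV "%n. ennreal (f n x)"] B by (simp add: ennreal_le_iff)
		then show ?case
			using nonneg by (intro nonneg_summable_bounded(1)[where B = B]) (auto simp: f_def intro: finite_sum_le_box3)
	qed
	have lim: "AE x in ?M. (%n. f n x) ----> (INFSUM k. g k x)"
		using ae unfolding f_def by eventually_elim (rule sum_box3_tendsto)
	have inc: "incseq (%n. integral\<^sup>L ?M (f n))"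
		using f_int by (auto simp: incseq_def intro!: integral_mono f_mono)
	then obtain L where L: "(%n. integral\<^sup>L ?M (f n)) ----> L"
		using incseq_convergent[OF inc] bound' by blast
	have meas: "(%x. INFSUM k. g k x) \<in> borel_measurable ?M"
		using int ae S by (intro borel_measurable_infsum_AE) auto
	have ms: "AE x in ?M. mono (%n. f n x)" using f_mono by (auto simp: mono_def)
	show "integrable ?M (%x. INFSUM k. g k x)"
		by (rule integrable_monotone_convergence[OF f_int ms lim L meas])
	have "(LINT x|?M. (INFSUM k. g k x)) = L"
		by (rule integral_monotone_convergence[OF f_int ms lim L meas])
	then show "(LINT x|?M. (INFSUM k. g k x)) <= C"
		using L bound' by (auto intro: LIMSEQ_le_const2)
qed

lemma lattice_summable:
	assumes p: "p < - 3"
	shows "(%k. freq k powr p) summable_on UNIV"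
proof (rule nonneg_summable_bounded(1))
	have s: "summable (%n. 26 * real (Suc n) powr (p + 2))"
		using p summable_Suc_iff[of "%n. real n powr (p + 2)"]
		by (intro summable_mult) (simp add: summable_real_powr_iff del: of_nat_Suc)
	fix F :: "(int ^ 3) set" assume F: "finite F"
	show "(\<Sum>k\<in>F. freq k powr p) <= (\<Sum>n. 26 * real (Suc n) powr (p + 2))"
	proof (rule finite_sum_le_box3[OF _ _ F])
		fix n
		have "(\<Sum>k\<in>box3 n. freq k powr p) <= (\<Sum>i<n. 26 * real (Suc i) powr (p + 2))"
		proof (induction n)
			case (Suc n)
			have "(\<Sum>k\<in>box3 (Suc n). freq k powr p) = (\<Sum>l\<in>box3 (Suc n) - box3 n. freq l powr p) + (\<Sum>k\<in>box3 n. freq k powr p)"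
				by (rule sum.subset_diff) (use box3_mono[of n "Suc n"] finite_box3 in auto)
			then show ?case using Suc lattice_shell[of p n] p by simp
		qed (simp add: box3_0)
		also have "... <= (\<Sum>n. 26 * real (Suc n) powr (p + 2))" by (rule sum_le_suminf[OF s]) auto
		finally show "(\<Sum>k\<in>box3 n. freq k powr p) <= (\<Sum>n. 26 * real (Suc n) powr (p + 2))" .
	qed simp
qed simp

subsection \<open>Bochner spaces over weighted sequence spaces\<close>

text \<open>One format for both Sobolev scales: a weight that vanishes exactly at k = 0 gives the
  mean-free vector space, a positive weight the scalar space. J is the conjugation in the reality
  condition.\<close>

definition wspace :: "(int ^ 3 => real) => ('v => 'v) => (int ^ 3 => 'v::real_normed_vector) set" where
	"wspace W J = {c. (\<forall>k. W k = 0 \<longrightarrow> c k = 0) \<and> (\<forall>k. c (- k) = J (c k)) \<and>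
										wsummable W c}"

definition wnorm :: "(int ^ 3 => real) => (int ^ 3 => 'v::real_normed_vector) => real" where
	"wnorm W c = sqrt (wsum W c)"

lemma wnorm_sq: "(!!k. 0 <= W k) ==> (wnorm W c)^2 = (wsum W c)"
	by (simp add: wnorm_def infsum_nonneg)

lemma wnorm_nonneg: "(!!k. 0 <= W k) ==> 0 <= wnorm W c"
	by (simp add: wnorm_def infsum_nonneg)

lemma norm_diff_sq_le:
	fixes a b :: "'v::real_normed_vector"
	shows "(norm (a - b))^2 <= 2 * (norm a)^2 + 2 * (norm b)^2"
proof -
	have "(norm (a - b))^2 <= (norm a + norm b)^2"
		by (intro power_mono norm_triangle_ineq4) auto
	also have "... <= 2 * (norm a)^2 + 2 * (norm b)^2"
		using sum_squares_bound[of "norm a" "norm b"] by (simp add: power2_sum)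
	finally show ?thesis .
qed

lemma wsum_diff:
	fixes a b :: "int ^ 3 => 'v::real_normed_vector"
	assumes W: "!!k. 0 <= W k"
		and "wsummable W a" "wsummable W b"
	shows "(%k. W k * (norm (a k - b k))^2) summable_on UNIV"
		and "(INFSUM k. W k * (norm (a k - b k))^2)
			<= 2 * (wsum W a) + 2 * (wsum W b)"
proof -
	have s: "(%k. 2 * (W k * (norm (a k))^2) + 2 * (W k * (norm (b k))^2)) summable_on UNIV"
		using assms by (intro summable_on_add summable_on_cmult_right)
	have le: "W k * (norm (a k - b k))^2 <= 2 * (W k * (norm (a k))^2) + 2 * (W k * (norm (b k))^2)" for k
		using mult_left_mono[OF norm_diff_sq_le[of "a k" "b k"] W[of k]] by (simp add: algebra_simps)
	show 1: "(%k. W k * (norm (a k - b k))^2) summable_on UNIV"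
		by (rule summable_on_comparison_real[OF s]) (use le W in auto)
	have "(INFSUM k. W k * (norm (a k - b k))^2)
			<= (INFSUM k. 2 * (W k * (norm (a k))^2) + 2 * (W k * (norm (b k))^2))"
		by (rule infsum_mono[OF 1 s le])
	also have "... = 2 * (wsum W a) + 2 * (wsum W b)"
		using assms by (subst infsum_add) (auto intro!: summable_on_cmult_right simp: infsum_cmult_right')
	finally show "(INFSUM k. W k * (norm (a k - b k))^2)
			<= 2 * (wsum W a) + 2 * (wsum W b)" .
qed

text \<open>Convergence in the weighted norm forces convergence of each mode of positive weight; at
  modes of weight zero the field and its approximations vanish by the definition of
  \<open>wspace\<close>.\<close>

lemma bochner_measurable_component:
	fixes u :: "real => int ^ 3 => 'v::euclidean_space"
	assumes W: "!!k. 0 <= W k" and X: "X \<subseteq> wspace W J"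
		and u: "bochner_measurable T X (wnorm W) u"
	shows "(%t. u t k) \<in> borel_measurable (leb T)"
proof -
	let ?M = "leb T"
	obtain g where fin: "!!n. finite (g n ` {0..T})" and gX: "!!n. g n ` {0..T} \<subseteq> X"
		and meas: "!!n y. {t \<in> {0..T}. g n t = y} \<in> sets lebesgue"
		and ae: "AE t in ?M. u t \<in> X \<and> (%n. wnorm W (g n t - u t)) ----> 0"
		using u unfolding bochner_measurable_def by blast
	show ?thesis
	proof (rule borel_measurable_lebesgue_on_AE_LIMSEQ)
		show "(%t. g n t k) \<in> borel_measurable ?M" for n
		proof (rule borel_measurable_simple_function, unfold simple_function_def, intro conjI ballI)
			show "finite ((%t. g n t k) ` space ?M)"
				using finite_imageI[OF fin[of n], of "%c. c k"] by (simp add: image_image)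
			fix x
			have "(%t. g n t k) -` {x} \<inter> space ?M = (\<Union>y\<in>{y \<in> g n ` {0..T}. y k = x}. {t \<in> {0..T}. g n t = y})"
				by auto
			also have "... \<in> sets lebesgue" using fin meas by (intro sets.finite_UN) auto
			finally show "(%t. g n t k) -` {x} \<inter> space ?M \<in> sets ?M"
				by (auto simp: sets_restrict_space_iff)
		qed
		show "AE t in ?M. (%n. g n t k) ----> u t k"
			using ae AE_space
		proof eventually_elim
			case (elim t)
			then have ut: "u t \<in> wspace W J" using X by blast
			have gt: "g n t \<in> wspace W J" for n using X gX[of n] elim by fastforce
			show ?case
			proof (cases "W k = 0")
				case True
				then have "u t k = 0" "g n t k = 0" for n using ut gt by (auto simp: wspace_def)
				then show ?thesis by simp
			next
				case False
				then have Wk: "0 < W k" using W[of k] by linarith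
				have "norm (g n t k - u t k) <= wnorm W (g n t - u t) / sqrt (W k)" for n
				proof -
					have "W k * (norm (g n t k - u t k))^2 <= (INFSUM k. W k * (norm (g n t k - u t k))^2)"
						using ut gt[of n] W by (intro le_infsum[of "%k. W k * (norm (g n t k - u t k))^2"] wsum_diff) (auto simp: wspace_def)
					then have "sqrt (W k * (norm (g n t k - u t k))^2) <= wnorm W (g n t - u t)"
						unfolding wnorm_def by simp
					then show ?thesis using Wk by (simp add: real_sqrt_mult field_simps)
				qed
				moreover have "(%n. wnorm W (g n t - u t) / sqrt (W k)) ----> 0"
					using tendsto_divide_zero elim by blast
				ultimately have "(%n. g n t k - u t k) ----> 0"
					by (auto intro: Lim_null_comparison[of _ "%n. wnorm W (g n t - u t) / sqrt (W k)"])
				then show ?thesis using LIM_zero_iff by blast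
			qed
		qed
	qed simp
qed

text \<open>A converse of \<open>bochner_measurable_component\<close>: in these sequence spaces
  strong measurability reduces to that of the modes. Membership in a Bochner space is therefore
  checked below by measurable modes, an almost everywhere condition and an integral.\<close>

lemma bochner_measurable_wspace:
	fixes u :: "real => int ^ 3 => 'v::euclidean_space"
	assumes W: "!!k. 0 <= W k" "!!k. W (- k) = W k"
		and J: "linear J" "!!x. norm (J x) = norm x" "!!x. J (J x) = x"
		and meas: "!!k. (%t. u t k) \<in> borel_measurable (leb T)"
		and ae: "AE t in leb T. u t \<in> wspace W J"
	shows "bochner_measurable T (wspace W J) (wnorm W) u"
proof -
	let ?M = "leb T"
	have "\<exists>F. (\<forall>i. simple_function ?M (F i)) \<and> (\<forall>t\<in>space ?M. (%i. F i t) ----> u t k) \<and>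
		(\<forall>i. \<forall>t\<in>space ?M. dist (F i t) 0 <= 2 * dist (u t k) 0)" for k
		by (rule borel_measurable_implies_sequence_metric[OF meas])
	then obtain S where S: "!!k i. simple_function ?M (S k i)"
		and Slim: "!!k t. t \<in> {0..T} ==> (%i. S k i t) ----> u t k"
		and Sle: "!!k i t. t \<in> {0..T} ==> norm (S k i t) <= 2 * norm (u t k)"
		unfolding dist_norm diff_zero space_lebesgue_on by meson
	\<comment> \<open>Averaging with the reflected conjugate restores the reality condition, which
	  approximating the modes independently destroys; truncation to a cube keeps the range finite. The
	  bound by twice |u| survives, so the squared error is at most 9 |u|^2, an admissible
	  majorant.\<close>
	define g where "g i t k = (if k \<in> box3 i \<and> W k ~= 0 then (1/2) *\<^sub>R (S k i t + J (S (- k) i t)) else 0)"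
		for i t k
	have gk: "simple_function ?M (%t. g i t k)" for i k
	proof -
		have "simple_function ?M (%t. (%(a, b). (1/2) *\<^sub>R (a + J b)) (S k i t, S (- k) i t))"
			using simple_function_compose[OF simple_function_Pair[OF S S], of "%(a, b). (1/2) *\<^sub>R (a + J b)"]
			by (simp add: comp_def)
		then show ?thesis by (cases "k \<in> box3 i \<and> W k ~= 0") (auto simp: g_def)
	qed
	have J0: "J 0 = 0" using J(1) by (rule linear_0)
	have gX: "g i t \<in> wspace W J" for i t
	proof -
		have fin: "finite {k. g i t k ~= 0}"
			by (rule finite_subset[OF _ finite_box3[of i]]) (auto simp: g_def)
		have "wsummable W (g i t)"
			by (rule finite_nonzero_values_imp_summable_on, rule finite_subset[OF _ fin]) auto
		moreover have "g i t (- k) = J (g i t k)" for k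
			using J J0 W(2)[of k] box3_uminus[of k i]
			by (auto simp: g_def linear_add linear_scale add.commute)
		ultimately show ?thesis by (auto simp: wspace_def g_def)
	qed
	have gle: "norm (g i t k) <= 2 * norm (u t k)" if t: "t \<in> {0..T}" and ut: "u t \<in> wspace W J" for i t k
	proof (cases "k \<in> box3 i \<and> W k ~= 0")
		case True
		have "norm (S k i t + J (S (- k) i t)) <= norm (S k i t) + norm (S (- k) i t)"
			using norm_triangle_ineq[of "S k i t" "J (S (- k) i t)"] J(2) by simp
		also have "... <= 2 * norm (u t k) + 2 * norm (u t (- k))"
			using Sle[OF t] by (intro add_mono) auto
		also have "norm (u t (- k)) = norm (u t k)" using ut J(2) by (simp add: wspace_def)
		finally show ?thesis using True by (simp add: g_def)
	qed (auto simp: g_def)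
	show ?thesis
		unfolding bochner_measurable_def
	proof (intro exI[of _ g] conjI allI)
		fix i
		have fk: "finite ((%t. g i t k) ` {0..T})" for k
			using simple_functionD(1)[OF gk[of i k]] by simp
		have "finite {c. (\<forall>k. (k \<in> box3 i \<longrightarrow> c k \<in> (\<Union>k\<in>box3 i. (%t. g i t k) ` {0..T})) \<and> (k \<notin> box3 i \<longrightarrow> c k = 0))}"
			by (rule finite_set_of_finite_funs) (use fk finite_box3 in auto)
		then show "finite (g i ` {0..T})"
			by (rule finite_subset[rotated]) (auto simp: g_def)
		show "g i ` {0..T} \<subseteq> wspace W J" using gX by auto
		fix y
		have "{t \<in> {0..T}. g i t = y} = (\<Inter>k. {t \<in> {0..T}. g i t k = y k})"
			by (auto simp: fun_eq_iff)
		also have "... \<in> sets lebesgue"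
		proof (rule sets.countable_INT'')
			fix k
			have "(%t. g i t k) -` {y k} \<inter> space ?M \<in> sets ?M"
				by (rule simple_functionD(2)[OF gk])
			moreover have "(%t. g i t k) -` {y k} \<inter> space ?M = {t \<in> {0..T}. g i t k = y k}" by auto
			ultimately show "{t \<in> {0..T}. g i t k = y k} \<in> sets lebesgue"
				by (auto simp: sets_restrict_space_iff)
		qed auto
		finally show "{t \<in> {0..T}. g i t = y} \<in> sets lebesgue" .
	next
		show "AE t in ?M. u t \<in> wspace W J \<and> (%n. wnorm W (g n t - u t)) ----> 0"
			using ae AE_space
		proof eventually_elim
			case (elim t)
			then have t: "t \<in> {0..T}" and ut: "u t \<in> wspace W J" by auto
			have "(%i. INFSUM k. W k * (norm (g i t k - u t k))^2) ----> (\<Sum>\<^sub>\<infinity>k::int^3. 0)"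
			proof (rule infsum_dominated_convergence)
				show "(%k. 9 * (W k * (norm (u t k))^2)) summable_on UNIV"
					using ut by (intro summable_on_cmult_right) (auto simp: wspace_def)
				fix i k
				have "norm (g i t k - u t k) <= 3 * norm (u t k)"
					using gle[OF t ut, of i k] norm_triangle_ineq4[of "g i t k" "u t k"] by linarith
				then have "(norm (g i t k - u t k))^2 <= (3 * norm (u t k))^2" by (intro power_mono) auto
				then show "\<bar>W k * (norm (g i t k - u t k))^2\<bar> <= 9 * (W k * (norm (u t k))^2)"
					using mult_left_mono[OF _ W(1)[of k]] W(1)[of k] by (simp add: power_mult_distrib) (fastforce simp: algebra_simps)
			next
				fix k
				have "(%i. g i t k) ----> u t k"
				proof (cases "W k = 0")
					case True
					then show ?thesis using ut by (simp add: g_def wspace_def)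
				next
					case False
					obtain n where n: "k \<in> box3 n" using ex_box3 by blast
					have "\<forall>\<^sub>F i in sequentially. (1/2) *\<^sub>R (S k i t + J (S (- k) i t)) = g i t k"
						using eventually_ge_at_top[of n] by eventually_elim (use False n box3_mono in \<open>auto simp: g_def\<close>)
					moreover have "(%i. (1/2) *\<^sub>R (S k i t + J (S (- k) i t))) ----> (1/2) *\<^sub>R (u t k + J (u t (- k)))"
						using J(1) Slim[OF t]
						by (intro tendsto_scaleR tendsto_const tendsto_add bounded_linear.tendsto[of J])
							 (auto simp: linear_conv_bounded_linear)
					moreover have "(1/2) *\<^sub>R (u t k + J (u t (- k))) = u t k"
						using ut J(3) by (simp add: wspace_def scaleR_half_double)
					ultimately show ?thesis
						using Lim_transform_eventually by fastforce
				qed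
				then have "(%i. W k * (norm (g i t k - u t k))^2) ----> W k * (norm (u t k - u t k))^2"
					by (rule tendsto_mult[OF tendsto_const tendsto_power[OF tendsto_norm[OF tendsto_diff[OF _ tendsto_const]]]])
				then show "(%i. W k * (norm (g i t k - u t k))^2) ----> 0" by simp
			qed
			then have "(%n. sqrt (INFSUM k. W k * (norm (g n t k - u t k))^2)) ----> sqrt 0"
				by (intro tendsto_real_sqrt) simp
			then show ?case using ut by (simp add: wnorm_def)
		qed
	qed
qed

subsection \<open>Functions with vanishing integrals over boxes\<close>

text \<open>Boxes form an intersection-stable generator of the Borel sets, so a Dynkin argument
  extends the vanishing to all Borel sets, in particular to the sets where f is positive or
  negative.\<close>

lemma AE_zero_if_box_integrals_zero:
	fixes f :: "'a::euclidean_space => real"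
	assumes f: "integrable (lebesgue_on S) f" and S: "S \<in> sets lebesgue"
		and box: "!!a b. (LINT x|lebesgue_on S. indicator (box a b) x * f x) = 0"
	shows "AE x in lebesgue_on S. f x = 0"
proof -
	define g where "g x = indicator S x * f x" for x
	have g: "integrable lebesgue g"
		using f S integrable_restrict_space[of S lebesgue f] by (simp add: g_def[abs_def])
	\<comment> \<open>A Borel representative, since the generator argument sees Borel sets only while f
	  is Lebesgue measurable.\<close>
	obtain g' where g': "g' \<in> borel_measurable lborel" and ae: "AE x in lborel. g x = g' x"
		using completion_ex_borel_measurable_real[of g lborel] g by blast
	have aeL: "AE x in lebesgue. g x = g' x" using ae by (rule AE_completion)
	have g'L: "integrable lebesgue g'"
		using g g' aeL by (intro integrable_cong_AE_imp[OF g]) (auto intro: measurable_completion)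
	have g'i: "integrable lborel g'" using g'L g' by (simp add: integrable_completion)
	have gen: "(LINT x|lborel. indicator (box a b) x * g' x) = 0" for a b
	proof -
		have "(LINT x|lborel. indicator (box a b) x * g' x) = (LINT x|lebesgue. indicator (box a b) x * g' x)"
			using g' by (intro integral_completion[symmetric]) auto
		also have "... = (LINT x|lebesgue. indicator (box a b) x * g x)"
			using g'L g aeL by (intro integral_cong_AE) (auto intro!: borel_measurable_times borel_measurable_indicator)
		also have "... = (LINT x|lebesgue_on S. indicator (box a b) x * f x)"
			using S by (subst integral_restrict_space) (auto simp: g_def mult.left_commute)
		finally show ?thesis using box by simp
	qed
	have bint: "integrable lborel (%x. indicator A x * g' x)" if "A \<in> sets borel" for A
		using integrable_mult_indicator[OF _ g'i, of A] that by simp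
	\<comment> \<open>The integral over the whole space is reached by growing boxes; it handles
	  complements in the Dynkin argument.\<close>
	have total: "(LINT x|lborel. g' x) = 0"
	proof -
		have "(%n::nat. LINT x|lborel. indicator (box (- (real n *\<^sub>R One)) (real n *\<^sub>R One)) x * g' x)
				----> (LINT x|lborel. g' x)"
		proof (rule integral_dominated_convergence[where w = "%x. norm (g' x)"])
			show "AE x in lborel. (%n::nat. indicator (box (- (real n *\<^sub>R One)) (real n *\<^sub>R One)) x * g' x) ----> g' x"
			proof (rule AE_I2, rule tendsto_eventually)
				fix x :: 'a
				obtain n :: nat where n: "norm x < real n" using reals_Archimedean2 by blast
				show "\<forall>\<^sub>F n::nat in sequentially. indicator (box (- (real n *\<^sub>R One)) (real n *\<^sub>R One)) x * g' x = g' x"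
					using eventually_ge_at_top[of n]
				proof eventually_elim
					case (elim m)
					have "x \<in> box (- (real m *\<^sub>R One)) (real m *\<^sub>R One)"
						unfolding mem_box
					proof
						fix i :: 'a assume i: "i \<in> Basis"
						have "\<bar>x \<bullet> i\<bar> < real m" using Basis_le_norm[OF i, of x] n elim by linarith
						then show "- (real m *\<^sub>R One) \<bullet> i < x \<bullet> i \<and> x \<bullet> i < real m *\<^sub>R One \<bullet> i"
							using i by (auto simp: inner_sum_left_Basis abs_less_iff)
					qed
					then show ?case by simp
				qed
			qed
		qed (use g'i g' in \<open>auto simp: indicator_def\<close>)
		then show ?thesis unfolding gen by (simp add: LIMSEQ_const_iff)
	qed
	have all: "(LINT x|lborel. indicator A x * g' x) = 0" if "A \<in> sets borel" for A
	proof -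
		have As: "A \<in> sigma_sets UNIV (range (%(a, b). box a b :: 'a set))"
			using that unfolding borel_eq_box by simp
		have Is: "Int_stable (range (%(a, b). box a b :: 'a set))"
			unfolding Int_stable_def
		proof (intro ballI)
			fix A B :: "'a set"
			assume "A \<in> range (%(a, b). box a b)" "B \<in> range (%(a, b). box a b)"
			then obtain a b c d where "A = box a b" "B = box c d" by auto
			then show "A \<inter> B \<in> range (%(a, b). box a b)"
				unfolding \<open>A = box a b\<close> \<open>B = box c d\<close> box_Int_box by (intro image_eqI[OF _ UNIV_I, of _ _ "(_, _)"]) simp
		qed
		show ?thesis
		proof (rule sigma_sets_induct_disjoint[OF Is _ As, where P = "%A. (LINT x|lborel. indicator A x * g' x) = 0"])
			fix A assume "A \<in> range (%(a, b). box a b :: 'a set)"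
			then show "(LINT x|lborel. indicator A x * g' x) = 0" using gen by auto
		next
			fix A assume compl: "A \<in> sigma_sets UNIV (range (%(a, b). box a b :: 'a set))"
				"(LINT x|lborel. indicator A x * g' x) = 0"
			then have A: "A \<in> sets borel" unfolding borel_eq_box by simp
			have "(LINT x|lborel. indicator (UNIV - A) x * g' x) = (LINT x|lborel. g' x - indicator A x * g' x)"
				by (intro Bochner_Integration.integral_cong) (auto split: split_indicator)
			also have "... = 0" using g'i bint[OF A] total compl by simp
			finally show "(LINT x|lborel. indicator (UNIV - A) x * g' x) = 0" .
		next
			fix A :: "nat => 'a set"
			assume union: "disjoint_family A" "range A \<subseteq> sigma_sets UNIV (range (%(a, b). box a b :: 'a set))"
				"!!i. (LINT x|lborel. indicator (A i) x * g' x) = 0"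
			then have A: "A i \<in> sets borel" for i unfolding borel_eq_box by auto
			have "(LINT x:(\<Union>i. A i)|lborel. g' x) = (\<Sum>i. (LINT x:(A i)|lborel. g' x))"
				using A union(1) bint[of "\<Union>i. A i"]
				by (intro lebesgue_integral_countable_add) (auto simp: set_integrable_def disjoint_family_on_def)
			then show "(LINT x|lborel. indicator (\<Union> (range A)) x * g' x) = 0"
				using union(3) by (simp add: set_lebesgue_integral_def)
		qed auto
	qed
	have pos: "AE x in lborel. h x <= 0"
		if h: "integrable lborel h" "!!A. A \<in> sets borel ==> (LINT x|lborel. indicator A x * h x) = 0"
		for h :: "'a => real"
	proof -
		have [measurable]: "h \<in> borel_measurable borel" using h(1) by auto
		let ?A = "{x. 0 < h x}"
		have "?A \<in> sets borel" by measurable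
		then have "(LINT x|lborel. indicator ?A x * h x) = 0" and "integrable lborel (%x. indicator ?A x * h x)"
			using h integrable_mult_indicator[OF _ h(1), of ?A] by auto
		then have "AE x in lborel. indicator ?A x * h x = 0"
			by (subst (asm) integral_nonneg_eq_0_iff_AE) (auto simp: indicator_def)
		then show ?thesis by eventually_elim (auto simp: indicator_def split: if_splits)
	qed
	have "AE x in lborel. g' x <= 0" using pos[OF g'i all] .
	moreover have "AE x in lborel. - g' x <= 0"
		using g'i all by (intro pos) auto
	ultimately have "AE x in lborel. g' x = 0" by eventually_elim auto
	then have "AE x in lebesgue. g' x = 0" by (rule AE_completion)
	then have "AE x in lebesgue. g x = 0" using aeL by eventually_elim auto
	then show ?thesis using S by (auto simp: AE_restrict_space_iff g_def indicator_def elim: eventually_mono)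
qed

subsection \<open>Primitives of integrable functions of time\<close>

text \<open>An indicator under an integral over the fixed interval instead of an integral over a
  moving one: all primitives then live on one measure space, and linearity, domination and limits
  are inherited from the Lebesgue integral.\<close>

definition prim :: "real => (real => 'a::euclidean_space) => real => 'a" where
	"prim T f \<tau> = (LINT s|leb T. indicator {..\<tau>} s *\<^sub>R f s)"

lemma id_measurable_lebesgue_on [measurable]: "(%x. x) \<in> borel_measurable (lebesgue_on S)"
	by (rule measurable_restrict_space1) (auto intro: measurable_completion)

lemma indicator_measurable_lebesgue_on [measurable]:
	"A \<in> sets borel ==> (indicator A :: _ => real) \<in> borel_measurable (lebesgue_on S)"
	using measurable_compose[OF id_measurable_lebesgue_on borel_measurable_indicator, of A S] by simp

lemma integrable_indicator_lebesgue_on: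
	fixes f :: "'a::euclidean_space => 'b::euclidean_space"
	assumes f: "integrable (lebesgue_on S) f" and A: "A \<in> sets borel"
	shows "integrable (lebesgue_on S) (%x. indicator A x *\<^sub>R f x)"
	by (rule Bochner_Integration.integrable_bound[OF integrable_norm[OF f]])
		 (use f A in \<open>auto intro!: borel_measurable_scaleR indicator_measurable_lebesgue_on split: split_indicator\<close>)

lemma lebesgue_on_interval_sigma_finite: "finite_measure (lebesgue_on {a..b::real})"
	by (intro finite_measure_lebesgue_on) simp

lemma AE_lebesgue_on_neq: "AE x in lebesgue_on S. x ~= (c::real)" if "S \<in> sets lebesgue"
proof -
	have "AE x in lborel. x ~= c" by (rule AE_lborel_singleton)
	then have "AE x in lebesgue. x ~= c" by (rule AE_completion)
	then show ?thesis using that by (auto simp: AE_restrict_space_iff elim: eventually_mono)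
qed

lemma prim_T: "prim T f T = (LINT s|leb T. f s)"
	unfolding prim_def by (rule Bochner_Integration.integral_cong) auto

lemma prim_le_0: "\<tau> <= 0 ==> prim T f \<tau> = 0"
proof -
	assume "\<tau> <= 0"
	have "AE s in leb T. indicator {..\<tau>} s *\<^sub>R f s = 0"
		using AE_lebesgue_on_neq[of "{0..T}" 0, simplified] AE_space
		by eventually_elim (use \<open>\<tau> <= 0\<close> in \<open>auto simp: indicator_def\<close>)
	then show ?thesis unfolding prim_def by (rule integral_eq_zero_AE)
qed

lemma prim_inner:
	assumes "integrable (leb T) f"
	shows "prim T (%t. f t \<bullet> b) \<tau> = prim T f \<tau> \<bullet> b"
	unfolding prim_def
	by (subst integral_inner_left[symmetric])
		 (use integrable_indicator_lebesgue_on[OF assms, of "{..\<tau>}"] in auto)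

lemma prim_diff_norm_le:
	fixes f :: "real => 'a::euclidean_space"
	assumes f: "integrable (leb T) f" and "\<sigma> <= \<tau>"
	shows "norm (prim T f \<tau> - prim T f \<sigma>) <= (LINT s|leb T. indicator {\<sigma><..\<tau>} s * norm (f s))"
proof -
	have "prim T f \<tau> - prim T f \<sigma> = (LINT s|leb T. indicator {..\<tau>} s *\<^sub>R f s - indicator {..\<sigma>} s *\<^sub>R f s)"
		unfolding prim_def
		by (rule Bochner_Integration.integral_diff[symmetric]) (use f in \<open>auto intro!: integrable_indicator_lebesgue_on\<close>)
	also have "... = (LINT s|leb T. indicator {\<sigma><..\<tau>} s *\<^sub>R f s)"
		by (rule Bochner_Integration.integral_cong) (use \<open>\<sigma> <= \<tau>\<close> in \<open>auto split: split_indicator\<close>)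
	also have "norm ... <= (LINT s|leb T. norm (indicator {\<sigma><..\<tau>} s *\<^sub>R f s))"
		by (rule integral_norm_bound)
	finally show ?thesis by simp
qed

lemma continuous_prim:
	fixes f :: "real => 'a::euclidean_space"
	assumes f: "integrable (leb T) f"
	shows "continuous_on UNIV (prim T f)"
	unfolding continuous_on_sequentially
proof (intro ballI allI impI)
	fix x :: "nat => real" and a
	assume x: "(\<forall>n. x n \<in> UNIV) \<and> x ----> a"
	show "(prim T f \<circ> x) ----> prim T f a"
		unfolding comp_def prim_def
	proof (rule integral_dominated_convergence[where w = "%s. norm (f s)"])
		show "AE s in leb T. (%i. indicator {..x i} s *\<^sub>R f s) ----> indicator {..a} s *\<^sub>R f s"
			using AE_lebesgue_on_neq[of "{0..T}" a, simplified]
		proof eventually_elim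
			case (elim s)
			show ?case
			proof (rule tendsto_eventually)
				show "\<forall>\<^sub>F n in sequentially. indicator {..x n} s *\<^sub>R f s = indicator {..a} s *\<^sub>R f s"
				proof (cases "s < a")
					case True
					then have "\<forall>\<^sub>F n in sequentially. s < x n" using order_tendstoD(1)[of x a sequentially s] x by simp
					then show ?thesis by eventually_elim (use True in \<open>simp add: indicator_def\<close>)
				next
					case False
					then have "a < s" using elim by auto
					then have "\<forall>\<^sub>F n in sequentially. x n < s" using order_tendstoD(2)[of x a sequentially s] x by simp
					then show ?thesis by eventually_elim (use \<open>a < s\<close> in \<open>simp add: indicator_def\<close>)
				qed
			qed
		qed
	qed (use f in \<open>auto intro!: borel_measurable_scaleR indicator_measurable_lebesgue_on split: split_indicator\<close>)
qed

text \<open>Differences of the primitive are integrals over intervals, so this is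
  \<open>AE_zero_if_box_integrals_zero\<close> applied to the components.\<close>

lemma AE_zero_if_prim_zero:
	fixes f :: "real => 'a::euclidean_space"
	assumes f: "integrable (leb T) f" and z: "!!\<tau>. 0 <= \<tau> ==> \<tau> <= T ==> prim T f \<tau> = 0"
	shows "AE t in leb T. f t = 0"
proof (cases "0 <= T")
	case T: True
	have zero: "prim T f \<tau> = 0" for \<tau>
	proof (cases "\<tau> <= T")
		case True
		then show ?thesis using z prim_le_0[of \<tau> T f] by (cases "0 <= \<tau>") auto
	next
		case False
		then have "prim T f \<tau> = prim T f T" unfolding prim_def
			by (intro Bochner_Integration.integral_cong) (auto simp: indicator_def)
		then show ?thesis using z T by simp
	qed
	have "AE t in leb T. f t \<bullet> b = 0" for b
	proof (rule AE_zero_if_box_integrals_zero)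
		show fb: "integrable (leb T) (%t. f t \<bullet> b)" using f by simp
		fix c d :: real
		show "(LINT x|leb T. indicator (box c d) x * (f x \<bullet> b)) = 0"
		proof (cases "c < d")
			case True
			have "(LINT x|leb T. indicator (box c d) x * (f x \<bullet> b))
				 = (LINT x|leb T. indicator {..d} x *\<^sub>R (f x \<bullet> b) - indicator {..c} x *\<^sub>R (f x \<bullet> b))"
			proof (rule integral_cong_AE)
				show "AE x in leb T. indicator (box c d) x * (f x \<bullet> b)
						= indicator {..d} x *\<^sub>R (f x \<bullet> b) - indicator {..c} x *\<^sub>R (f x \<bullet> b)"
					using AE_lebesgue_on_neq[of "{0..T}" d, simplified]
					by eventually_elim (use True in \<open>auto simp: indicator_def box_real\<close>)
			qed (use fb in \<open>auto intro!: borel_measurable_times borel_measurable_diff indicator_measurable_lebesgue_on\<close>)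
			also have "... = prim T (%t. f t \<bullet> b) d - prim T (%t. f t \<bullet> b) c"
				unfolding prim_def
				by (rule Bochner_Integration.integral_diff; rule integrable_indicator_lebesgue_on[OF fb]; simp)
			also have "... = 0" using zero by (simp add: prim_inner[OF f])
			finally show ?thesis .
		next
			case False
			then have "box c d = {}" by (simp add: box_real)
			then show ?thesis by simp
		qed
	qed simp
	then have "AE t in leb T. \<forall>b\<in>Basis. f t \<bullet> b = 0"
		by (subst AE_ball_countable) (auto intro: countable_finite)
	then show ?thesis by eventually_elim (auto intro: euclidean_eqI)
next
	case False
	then have "space (leb T) = {}" by simp
	then show ?thesis by (intro AE_I2) simp
qed

text \<open>Integration by parts for absolutely continuous functions, without derivatives: the
  square of side \<tau> is cut along its diagonal and Fubini's theorem evaluates the two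
  triangles.\<close>

lemma prim_mult:
	fixes f g :: "real => real"
	assumes f: "integrable (leb T) f" and g: "integrable (leb T) g"
	shows "integrable (leb T) (%t. f t * prim T g t)"
		and "integrable (leb T) (%t. prim T f t * g t)"
		and "prim T f \<tau> * prim T g \<tau> = prim T (%t. f t * prim T g t) \<tau> + prim T (%t. prim T f t * g t) \<tau>"
proof -
	let ?M = "leb T"
	interpret M: finite_measure ?M by (rule lebesgue_on_interval_sigma_finite)
	interpret P: pair_sigma_finite ?M ?M ..
	have [measurable]: "f \<in> borel_measurable ?M" "g \<in> borel_measurable ?M" using f g by auto
	have id1: "fst \<in> borel_measurable (?M \<Otimes>\<^sub>M ?M)" "snd \<in> borel_measurable (?M \<Otimes>\<^sub>M ?M)"
		using measurable_compose[OF measurable_fst id_measurable_lebesgue_on[of "{0..T}"], of "leb T"]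
			measurable_compose[OF measurable_snd id_measurable_lebesgue_on[of "{0..T}"], of "leb T"]
		by auto
	have bd: "\<bar>prim T h t\<bar> <= (LINT s|?M. \<bar>h s\<bar>)" if "integrable ?M h" for h :: "real => real" and t
	proof -
		have "norm (prim T h t) <= (LINT s|?M. norm (indicator {..t} s *\<^sub>R h s))"
			unfolding prim_def by (rule integral_norm_bound)
		also have "... <= (LINT s|?M. \<bar>h s\<bar>)"
			using that integrable_norm[OF integrable_indicator_lebesgue_on[OF that, of "{..t}"]]
			by (intro integral_mono) (auto split: split_indicator)
		finally show ?thesis by simp
	qed
	have pm [measurable]: "prim T h \<in> borel_measurable ?M" if "integrable ?M h" for h :: "real => real"
		using measurable_compose[OF id_measurable_lebesgue_on borel_measurable_continuous_onI[OF continuous_prim[OF that]]]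
		by simp
	have prod: "integrable ?M (%t. h t * prim T h' t)" if "integrable ?M h" "integrable ?M h'" for h h' :: "real => real"
	proof (rule Bochner_Integration.integrable_bound[where f = "%t. (LINT s|?M. \<bar>h' s\<bar>) * \<bar>h t\<bar>"])
		show "integrable ?M (%t. (LINT s|?M. \<bar>h' s\<bar>) * \<bar>h t\<bar>)" using that by auto
		have "h \<in> borel_measurable ?M" using that by auto
		then show "(%t. h t * prim T h' t) \<in> borel_measurable ?M" using pm[OF that(2)] by measurable
		show "AE t in ?M. norm (h t * prim T h' t) <= norm ((LINT s|?M. \<bar>h' s\<bar>) * \<bar>h t\<bar>)"
			using mult_left_mono[OF order_trans[OF bd[OF that(2)] abs_ge_self]] by (intro AE_I2) (simp add: abs_mult mult.commute)
	qed
	show 1: "integrable ?M (%t. f t * prim T g t)" using prod f g by blast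
	show 2: "integrable ?M (%t. prim T f t * g t)" using prod[OF g f] by (simp add: mult.commute)
	define u where "u s = indicator {..\<tau>} s * f s" for s
	define v where "v s = indicator {..\<tau>} s * g s" for s
	have u: "integrable ?M u" and v: "integrable ?M v"
		using integrable_indicator_lebesgue_on[OF f, of "{..\<tau>}"] integrable_indicator_lebesgue_on[OF g, of "{..\<tau>}"]
		by (auto simp: u_def[abs_def] v_def[abs_def])
	have [measurable]: "u \<in> borel_measurable ?M" "v \<in> borel_measurable ?M" using u v by auto
	have uv: "integrable (?M \<Otimes>\<^sub>M ?M) (%p. u (fst p) * v (snd p))"
	proof (rule P.Fubini_integrable)
		show "integrable ?M (%x. LINT y|?M. norm (u (fst (x, y)) * v (snd (x, y))))"
			using u v by (auto simp: abs_mult)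
	qed (use u v in auto)
	have ind: "integrable (?M \<Otimes>\<^sub>M ?M) (%p. indicator {p. fst p <= snd p} p * (u (fst p) * v (snd p)))"
		(is "integrable _ (%p. ?i p * _)")
	proof (rule Bochner_Integration.integrable_bound[OF uv])
		have "{p \<in> space (?M \<Otimes>\<^sub>M ?M). fst p <= snd p} \<in> sets (?M \<Otimes>\<^sub>M ?M)"
			using id1 by (rule borel_measurable_le)
		then have "?i \<in> borel_measurable (?M \<Otimes>\<^sub>M ?M)"
			by (subst borel_measurable_indicator_iff) (auto simp: Int_def conj_commute)
		then show "(%p. ?i p * (u (fst p) * v (snd p))) \<in> borel_measurable (?M \<Otimes>\<^sub>M ?M)"
			by measurable
	qed (auto split: split_indicator)
	have "prim T f \<tau> * prim T g \<tau> = (LINT s|?M. u s) * (LINT t|?M. v t)"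
		by (simp add: prim_def u_def v_def)
	also have "... = (LINT s|?M. (LINT t|?M. u s * v t))" using u by simp
	also have "... = (LINT p|(?M \<Otimes>\<^sub>M ?M). u (fst p) * v (snd p))"
		using P.integral_fst'[OF uv] by simp
	also have "... = (LINT p|(?M \<Otimes>\<^sub>M ?M). ?i p * (u (fst p) * v (snd p)))
			+ (LINT p|(?M \<Otimes>\<^sub>M ?M). u (fst p) * v (snd p) - ?i p * (u (fst p) * v (snd p)))"
		using uv ind by simp
	also have "(LINT p|(?M \<Otimes>\<^sub>M ?M). ?i p * (u (fst p) * v (snd p))) = prim T (%t. prim T f t * g t) \<tau>"
	proof -
		have "(LINT p|(?M \<Otimes>\<^sub>M ?M). ?i p * (u (fst p) * v (snd p))) = (LINT t|?M. (LINT s|?M. indicator {p. fst p <= snd p} (s, t) * (u s * v t)))"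
			using P.integral_snd[of "%s t. indicator {p. fst p <= snd p} (s, t) * (u s * v t)"] ind
			by (simp add: case_prod_unfold)
		also have "... = (LINT t|?M. indicator {..\<tau>} t *\<^sub>R (prim T f t * g t))"
		proof (rule Bochner_Integration.integral_cong[OF refl])
			fix t
			have "(LINT s|?M. indicator {p. fst p <= snd p} (s, t) * (u s * v t)) = (LINT s|?M. (indicator {..t} s *\<^sub>R f s) * v t)"
				by (rule Bochner_Integration.integral_cong[OF refl]) (auto simp: u_def v_def indicator_def)
			also have "... = prim T f t * v t" unfolding prim_def by simp
			finally show "(LINT s|?M. indicator {p. fst p <= snd p} (s, t) * (u s * v t)) = indicator {..\<tau>} t *\<^sub>R (prim T f t * g t)"
				by (simp add: v_def)
		qed
		finally show ?thesis by (simp add: prim_def)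
	qed
	\<comment> \<open>The complement of the closed triangle is t < s; it differs from t <= s only on
	  the diagonal, which is null for each fixed s.\<close>
	also have "(LINT p|(?M \<Otimes>\<^sub>M ?M). u (fst p) * v (snd p) - ?i p * (u (fst p) * v (snd p))) = prim T (%t. f t * prim T g t) \<tau>"
	proof -
		have "(LINT p|(?M \<Otimes>\<^sub>M ?M). u (fst p) * v (snd p) - ?i p * (u (fst p) * v (snd p)))
			 = (LINT s|?M. (LINT t|?M. u s * v t - indicator {p. fst p <= snd p} (s, t) * (u s * v t)))"
			using P.integral_fst'[of "%p. u (fst p) * v (snd p) - ?i p * (u (fst p) * v (snd p))"] ind uv by simp
		also have "... = (LINT s|?M. indicator {..\<tau>} s *\<^sub>R (f s * prim T g s))"
		proof (rule Bochner_Integration.integral_cong[OF refl])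
			fix s
			have "(LINT t|?M. u s * v t - indicator {p. fst p <= snd p} (s, t) * (u s * v t)) = (LINT t|?M. u s * (indicator {..s} t *\<^sub>R g t))"
			proof (rule integral_cong_AE)
				show "AE t in ?M. u s * v t - indicator {p. fst p <= snd p} (s, t) * (u s * v t) = u s * (indicator {..s} t *\<^sub>R g t)"
					using AE_lebesgue_on_neq[of "{0..T}" s, simplified]
					by eventually_elim (auto simp: u_def v_def indicator_def)
				have "(%t. indicator {p. fst p <= snd p} (s, t) :: real) = indicator {s..}" by (auto simp: indicator_def)
				then show "(%t. u s * v t - indicator {p. fst p <= snd p} (s, t) * (u s * v t)) \<in> borel_measurable ?M"
					by simp
			qed measurable
			also have "... = u s * prim T g s" unfolding prim_def by simp
			finally show "(LINT t|?M. u s * v t - indicator {p. fst p <= snd p} (s, t) * (u s * v t)) = indicator {..\<tau>} s *\<^sub>R (f s * prim T g s)"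
				by (simp add: u_def)
		qed
		finally show ?thesis by (simp add: prim_def)
	qed
	finally show "prim T f \<tau> * prim T g \<tau> = prim T (%t. f t * prim T g t) \<tau> + prim T (%t. prim T f t * g t) \<tau>"
		by simp
qed

lemma prim_add:
	assumes "integrable (leb T) f" and "integrable (leb T) g"
	shows "prim T (%t. f t + g t) \<tau> = prim T f \<tau> + prim T g \<tau>"
	unfolding prim_def scaleR_add_right
	by (rule Bochner_Integration.integral_add) (use assms in \<open>auto intro!: integrable_indicator_lebesgue_on\<close>)

lemma prim_cmult:
	fixes f :: "real => real"
	shows "prim T (%t. c * f t) \<tau> = c * prim T f \<tau>"
	unfolding prim_def by (simp add: mult.left_commute)

lemma prim_by_parts:
	fixes f g F G :: "real => real"
	assumes f: "integrable (leb T) f" and g: "integrable (leb T) g"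
		and F: "!!t. 0 <= t ==> t <= T ==> F t = F 0 + prim T f t"
		and G: "!!t. 0 <= t ==> t <= T ==> G t = G 0 + prim T g t"
		and \<tau>: "0 <= \<tau>" "\<tau> <= T"
	shows "integrable (leb T) (%t. f t * G t)" and "integrable (leb T) (%t. F t * g t)"
		and "F \<tau> * G \<tau> = F 0 * G 0 + prim T (%t. f t * G t) \<tau> + prim T (%t. F t * g t) \<tau>"
proof -
	let ?M = "leb T"
	note pm = prim_mult[OF f g]
	have i: "integrable ?M (%t. G 0 * f t + f t * prim T g t)" "integrable ?M (%t. F 0 * g t + prim T f t * g t)"
		using f g pm by auto
	have e1: "f t * G t = G 0 * f t + f t * prim T g t" if "t \<in> space ?M" for t
		using G[of t] that by (simp add: algebra_simps)
	have e2: "F t * g t = F 0 * g t + prim T f t * g t" if "t \<in> space ?M" for t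
		using F[of t] that by (simp add: algebra_simps)
	show "integrable ?M (%t. f t * G t)"
		by (subst Bochner_Integration.integrable_cong[OF refl e1]) (auto intro: i)
	show "integrable ?M (%t. F t * g t)"
		by (subst Bochner_Integration.integrable_cong[OF refl e2]) (auto intro: i)
	have p1: "prim T (%t. f t * G t) \<tau> = G 0 * prim T f \<tau> + prim T (%t. f t * prim T g t) \<tau>"
		using f pm(1) by (subst prim_cmult[symmetric], subst prim_add[symmetric])
			(auto simp: prim_def intro!: Bochner_Integration.integral_cong simp: e1)
	have p2: "prim T (%t. F t * g t) \<tau> = F 0 * prim T g \<tau> + prim T (%t. prim T f t * g t) \<tau>"
		using g pm(2) by (subst prim_cmult[symmetric], subst prim_add[symmetric])
			(auto simp: prim_def intro!: Bochner_Integration.integral_cong simp: e2)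
	show "F \<tau> * G \<tau> = F 0 * G 0 + prim T (%t. f t * G t) \<tau> + prim T (%t. F t * g t) \<tau>"
		unfolding F[OF \<tau>] G[OF \<tau>] p1 p2 using pm(3)[of \<tau>] by (simp add: algebra_simps)
qed

subsection \<open>Smooth functions and the du Bois-Reymond lemma\<close>

lemma C_k_on_bounded_linear:
	assumes L: "bounded_linear L"
	shows "C_k_on n S f ==> C_k_on n S (%x. L (f x))"
proof (induction n arbitrary: f)
	case 0
	then show ?case by (auto intro: bounded_linear.continuous_on[OF L])
next
	case (Suc n)
	then obtain f' where f': "\<forall>p\<in>S. (f has_derivative f' p) (at p within S)" "\<forall>h. C_k_on n S (%p. f' p h)"
		by auto
	have "\<forall>p\<in>S. ((%x. L (f x)) has_derivative (%h. L (f' p h))) (at p within S)"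
		using f'(1) bounded_linear.has_derivative[OF L] by blast
	moreover have "\<forall>h. C_k_on n S (%p. L (f' p h))" using f'(2) Suc.IH by blast
	ultimately show ?case unfolding C_k_on.simps by (intro exI[of _ "%p h. L (f' p h)"] conjI)
qed

lemma C_k_on_add: "C_k_on n S f ==> C_k_on n S g ==> C_k_on n S (%x. f x + g x)"
proof (induction n arbitrary: f g)
	case 0
	then show ?case by (auto intro: continuous_on_add)
next
	case (Suc n)
	then obtain f' g' where f': "\<forall>p\<in>S. (f has_derivative f' p) (at p within S)" "\<forall>h. C_k_on n S (%p. f' p h)"
		and g': "\<forall>p\<in>S. (g has_derivative g' p) (at p within S)" "\<forall>h. C_k_on n S (%p. g' p h)"
		by auto
	have "\<forall>p\<in>S. ((%x. f x + g x) has_derivative (%h. f' p h + g' p h)) (at p within S)"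
		using f'(1) g'(1) by (auto intro: has_derivative_add)
	moreover have "\<forall>h. C_k_on n S (%p. f' p h + g' p h)" using f'(2) g'(2) Suc.IH by blast
	ultimately show ?case unfolding C_k_on.simps by (intro exI[of _ "%p h. f' p h + g' p h"] conjI)
qed

lemma C_k_on_continuous: "C_k_on n S f ==> continuous_on S f"
	by (cases n) (auto intro: has_derivative_continuous_on)

lemma C_k_on_Suc_real:
	fixes f f' :: "real => real"
	assumes "!!x. (f has_real_derivative f' x) (at x)" and "C_k_on n UNIV f'"
	shows "C_k_on (Suc n) UNIV f"
proof -
	have "\<forall>p\<in>UNIV. (f has_derivative (%h. f' p * h)) (at p within UNIV)"
		using assms(1) by (simp add: has_field_derivative_def)
	moreover have "\<forall>h. C_k_on n UNIV (%p. f' p * h)"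
		using C_k_on_bounded_linear[OF bounded_linear_mult_left assms(2)] by blast
	ultimately show ?thesis unfolding C_k_on.simps by (intro exI[of _ "%p h. f' p * h"] conjI)
qed

text \<open>The class of functions p(1/x) exp(-1/x) is closed under differentiation, which makes
  smoothness of the standard cutoff an induction over all p at once.\<close>

definition flat_poly :: "real poly => real => real" where
	"flat_poly p x = (if 0 < x then poly p (inverse x) * exp (- inverse x) else 0)"

lemma flat_poly_tendsto_0: "(flat_poly p \<longlongrightarrow> 0) (at 0)"
proof -
	have "((%y. poly p y * exp (- y)) \<longlongrightarrow> 0) at_top"
	proof -
		have "((%y. \<Sum>i\<le>degree p. coeff p i * (y ^ i / exp y)) \<longlongrightarrow> (\<Sum>i\<le>degree p. coeff p i * 0)) at_top"
			by (intro tendsto_sum tendsto_mult tendsto_const tendsto_power_div_exp_0)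
		then show ?thesis by (simp add: poly_altdef sum_distrib_right sum_divide_distrib exp_minus field_simps)
	qed
	then have "((%x. poly p (inverse x) * exp (- inverse x)) \<longlongrightarrow> 0) (at_right 0)"
		by (rule filterlim_compose[OF _ filterlim_inverse_at_top_right])
	then have "(flat_poly p \<longlongrightarrow> 0) (at_right 0)"
		by (rule Lim_transform_eventually)
			 (auto simp: flat_poly_def eventually_at_filter)
	moreover have "(flat_poly p \<longlongrightarrow> 0) (at_left 0)"
		by (rule tendsto_eventually) (auto simp: flat_poly_def eventually_at_filter)
	ultimately show ?thesis by (simp add: filterlim_split_at)
qed

text \<open>With y = 1/x the chain rule gives y^2 (p(y) - p'(y)) exp(-y). At the origin the
  difference quotient is again a function of the class, for the polynomial y p(y), and tends to
  0.\<close>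

lemma flat_poly_deriv:
	"(flat_poly p has_real_derivative flat_poly ([:0, 0, 1:] * (p - pderiv p)) x) (at x)"
proof (cases "x = 0")
	case True
	have "((%y. (flat_poly p y - flat_poly p 0) / (y - 0)) \<longlongrightarrow> 0) (at 0)"
	proof (rule Lim_transform_eventually[OF flat_poly_tendsto_0[of "[:0, 1:] * p"]])
		show "\<forall>\<^sub>F y in at 0. flat_poly ([:0, 1:] * p) y = (flat_poly p y - flat_poly p 0) / (y - 0)"
			by (auto simp: flat_poly_def eventually_at_filter field_simps)
	qed
	then show ?thesis using True by (simp add: has_field_derivative_iff flat_poly_def)
next
	case False
	show ?thesis
	proof (cases "0 < x")
		case True
		have "((%x. poly p (inverse x) * exp (- inverse x)) has_real_derivative
				flat_poly ([:0, 0, 1:] * (p - pderiv p)) x) (at x)"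
			using True by (auto intro!: derivative_eq_intros simp: flat_poly_def field_simps power2_eq_square)
		then show ?thesis
			by (rule has_field_derivative_transform_within_open[where S = "{0<..}"]) (use True in \<open>auto simp: flat_poly_def\<close>)
	next
		case neg: False
		have "((%x. 0) has_real_derivative flat_poly ([:0, 0, 1:] * (p - pderiv p)) x) (at x)"
			using neg by (simp add: flat_poly_def)
		then show ?thesis
			by (rule has_field_derivative_transform_within_open[where S = "{..<0}"]) (use neg False in \<open>auto simp: flat_poly_def\<close>)
	qed
qed

text \<open>One polynomial for each end of the support: the product rule then produces sums of
  functions of the same shape, so the induction over the order of differentiability closes.\<close>

definition bump2 :: "real poly => real poly => real => real => real => real" where
	"bump2 p q a b x = flat_poly p (x - a) * flat_poly q (b - x)"

lemma bump2_deriv: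
	"(bump2 p q a b has_real_derivative
		 bump2 ([:0, 0, 1:] * (p - pderiv p)) q a b x + - bump2 p ([:0, 0, 1:] * (q - pderiv q)) a b x) (at x)"
proof -
	have "((%x. flat_poly p (x - a)) has_real_derivative flat_poly ([:0, 0, 1:] * (p - pderiv p)) (x - a) * 1) (at x)"
		by (rule DERIV_chain2[OF flat_poly_deriv]) (auto intro!: derivative_eq_intros)
	moreover have "((%x. flat_poly q (b - x)) has_real_derivative flat_poly ([:0, 0, 1:] * (q - pderiv q)) (b - x) * - 1) (at x)"
		by (rule DERIV_chain2[OF flat_poly_deriv]) (auto intro!: derivative_eq_intros)
	ultimately show ?thesis
		unfolding bump2_def[abs_def] by (auto dest: DERIV_mult simp: algebra_simps)
qed

lemma C_k_on_uminus_real: "C_k_on n S f ==> C_k_on n S (%x. - f x :: real)"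
	using C_k_on_bounded_linear[OF bounded_linear_minus[OF bounded_linear_ident]] by blast

lemma C_k_on_bump2: "C_k_on n UNIV (bump2 p q a b)"
proof (induction n arbitrary: p q)
	case 0
	show ?case using bump2_deriv[THEN DERIV_isCont] by (auto intro: continuous_at_imp_continuous_on)
next
	case (Suc n)
	show ?case by (rule C_k_on_Suc_real[OF bump2_deriv]) (intro C_k_on_add C_k_on_uminus_real Suc)
qed

definition bump :: "real => real => real => real" where
	"bump a b = bump2 1 1 a b"

lemma bump_nonneg: "0 <= bump a b x"
	by (simp add: bump_def bump2_def flat_poly_def)

lemma bump_pos: "a < x ==> x < b ==> 0 < bump a b x"
	by (simp add: bump_def bump2_def flat_poly_def)

lemma bump_zero: "x <= a \<or> b <= x ==> bump a b x = 0"
	by (auto simp: bump_def bump2_def flat_poly_def)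

lemma C_k_on_bump: "C_k_on n UNIV (bump a b)"
	unfolding bump_def by (rule C_k_on_bump2)

lemma continuous_bump: "continuous_on A (bump a b)"
	using C_k_on_bump[of 0 a b] by (auto intro: continuous_on_subset)

definition test_time :: "real => (real => real) => bool" where
	"test_time T \<eta> \<longleftrightarrow> smooth_on UNIV \<eta> \<and> closure {t. \<eta> t ~= 0} \<subseteq> {0<..<T}"

text \<open>Vanishing mean makes the primitive vanish again beyond the support of \<rho>. The
  argument for constancy has to prescribe the derivative of a test function rather than the function
  itself.\<close>

lemma antiderivative_test_time:
	fixes \<rho> :: "real => real"
	assumes \<rho>: "!!n. C_k_on n UNIV \<rho>" and lr: "0 < l" "l < r" "r < T"
		and zero: "!!t. t <= l \<or> r <= t ==> \<rho> t = 0" and int: "integral {0..r} \<rho> = 0"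
	shows "\<exists>\<eta>. test_time T \<eta> \<and> (\<forall>t. (\<eta> has_real_derivative \<rho> t) (at t))"
proof -
	define \<eta> where "\<eta> t = integral {0..t} \<rho>" for t
	have cont: "continuous_on A \<rho>" for A using \<rho>[of 0] by (auto intro: continuous_on_subset)
	have low: "\<eta> t = 0" if "t <= l" for t
	proof -
		have "integral {0..t} \<rho> = integral {0..t} (%_. 0)"
			by (rule integral_cong) (use that zero in auto)
		then show ?thesis by (simp add: \<eta>_def)
	qed
	have high: "\<eta> t = 0" if "r <= t" for t
	proof -
		have "integral {0..r} \<rho> + integral {r..t} \<rho> = integral {0..t} \<rho>"
			using lr that by (intro Henstock_Kurzweil_Integration.integral_combine integrable_continuous_interval cont) auto
		moreover have "integral {r..t} \<rho> = integral {r..t} (%_. 0)"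
			by (rule integral_cong) (use that zero in auto)
		ultimately show ?thesis using int by (simp add: \<eta>_def)
	qed
	have deriv: "(\<eta> has_real_derivative \<rho> t) (at t)" for t
	proof (cases "t < l")
		case True
		have "((%_. 0) has_real_derivative \<rho> t) (at t)" using True zero by simp
		then show ?thesis
			by (rule has_field_derivative_transform_within_open[where S = "{..<l}"]) (use True low in auto)
	next
		case False
		have "((%x. integral {0..x} \<rho>) has_real_derivative \<rho> t) (at t within {0..t+1})"
			by (rule integral_has_real_derivative[OF cont]) (use False lr in auto)
		moreover have "at t within {0..t+1} = at t"
			using False lr by (intro at_within_Icc_at) auto
		ultimately show ?thesis by (simp add: \<eta>_def[abs_def])
	qed
	have "smooth_on UNIV \<eta>" unfolding smooth_on_def
	proof
		fix n show "C_k_on n UNIV \<eta>"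
		proof (cases n)
			case 0
			then show ?thesis using deriv[THEN DERIV_isCont] by (auto intro: continuous_at_imp_continuous_on)
		next
			case (Suc m)
			then show ?thesis using C_k_on_Suc_real[OF deriv \<rho>] by simp
		qed
	qed
	moreover have "closure {t. \<eta> t ~= 0} \<subseteq> {l..r}"
	proof (rule closure_minimal)
		show "{t. \<eta> t ~= 0} \<subseteq> {l..r}"
		proof
			fix t assume "t \<in> {t. \<eta> t ~= 0}"
			then show "t \<in> {l..r}" using low[of t] high[of t] by (cases "t <= l"; cases "r <= t") auto
		qed
	qed simp
	ultimately show ?thesis using lr deriv unfolding test_time_def by (intro exI[of _ \<eta>]) auto
qed

lemma lebesgue_on_integral_continuous:
	fixes g :: "real => real"
	assumes "continuous_on {a..b} g"
	shows "integrable (lebesgue_on {a..b}) g" and "(LINT t|lebesgue_on {a..b}. g t) = integral {a..b} g"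
proof -
	show i: "integrable (lebesgue_on {a..b}) g"
		by (rule continuous_imp_integrable_real[OF assms])
	show "(LINT t|lebesgue_on {a..b}. g t) = integral {a..b} g"
		using i by (intro lebesgue_integral_eq_integral) auto
qed

lemma integral_bump_pos:
	assumes "0 <= a" "a < b" "b <= T"
	shows "0 < integral {0..T} (bump a b)"
proof -
	have "integral {0..T} (bump a b) ~= 0"
	proof
		assume "integral {0..T} (bump a b) = 0"
		then have "(bump a b has_integral 0) (cbox 0 T)"
			using integrable_integral[OF integrable_continuous_interval[OF continuous_bump[of "{0..T}" a b]]] by simp
		then have "bump a b ((a + b) / 2) = 0"
			by (rule has_integral_0_cbox_imp_0[OF continuous_bump bump_nonneg])
				 (use assms in \<open>auto simp: field_simps\<close>)
		then show False using bump_pos[of a "(a + b) / 2" b] assms by simp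
	qed
	moreover have "0 <= integral {0..T} (bump a b)"
		by (rule integral_nonneg) (auto intro: integrable_continuous_interval continuous_bump bump_nonneg)
	ultimately show ?thesis by simp
qed

text \<open>The test is the difference of two normalized bumps around c and d, which has mean zero
  and is therefore the derivative of an admissible function. One inequality suffices, since c and d
  can be exchanged.\<close>

lemma du_Bois_Reymond_constant:
	fixes G :: "real => real"
	assumes G: "continuous_on {0..T} G"
		and test: "!!\<eta> \<rho>. test_time T \<eta> ==> (!!t. (\<eta> has_real_derivative \<rho> t) (at t)) ==> continuous_on UNIV \<rho> ==>
			 integral {0..T} (%t. \<rho> t * G t) = 0"
		and cd: "0 < c" "c < T" "0 < d" "d < T"
	shows "G c <= G d"
proof (rule field_le_epsilon)
	fix e :: real assume e: "0 < e"
	have "\<exists>\<delta>>0. \<forall>s\<in>{0..T}. dist s x < \<delta> \<longrightarrow> dist (G s) (G x) < e / 2" if "0 < x" "x < T" for x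
		using G[unfolded continuous_on_iff, rule_format, of x "e / 2"] that e by auto
	from this[OF cd(1,2)] this[OF cd(3,4)] obtain \<delta>1 \<delta>2 where \<delta>1: "\<delta>1 > 0" "!!s. s \<in> {0..T} ==> dist s c < \<delta>1 ==> dist (G s) (G c) < e / 2"
		and \<delta>2: "\<delta>2 > 0" "!!s. s \<in> {0..T} ==> dist s d < \<delta>2 ==> dist (G s) (G d) < e / 2"
		by blast
	\<comment> \<open>Small enough for the continuity of G with tolerance e/2, and such that both
	  supports stay away from 0 and T.\<close>
	define \<delta> where "\<delta> = min (min \<delta>1 \<delta>2) (min (min (c / 2) (d / 2)) (min ((T - c) / 2) ((T - d) / 2)))"
	have \<delta>: "0 < \<delta>" "\<delta> <= \<delta>1" "\<delta> <= \<delta>2" "\<delta> <= c / 2" "\<delta> <= d / 2" "\<delta> <= (T - c) / 2" "\<delta> <= (T - d) / 2"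
		using \<delta>1(1) \<delta>2(1) cd unfolding \<delta>_def by (simp_all only: min_le_iff_disj min_less_iff_conj) simp_all
	define l where "l = min c d - \<delta>"
	define r where "r = max c d + \<delta>"
	have lr: "0 < l" "l < r" "r < T" using \<delta> cd unfolding l_def r_def by (cases "c <= d"; simp add: min_def max_def; linarith)+
	define B where "B x = bump (x - \<delta>) (x + \<delta>)" for x
	define m where "m x = integral {0..T} (B x)" for x
	have m: "0 < m c" "0 < m d" using \<delta> cd unfolding m_def B_def by (auto intro!: integral_bump_pos)
	have Bc: "continuous_on A (B x)" for A x unfolding B_def by (rule continuous_bump)
	define \<rho> where "\<rho> t = inverse (m c) * B c t + - (inverse (m d) * B d t)" for t
	have \<rho>C: "C_k_on n UNIV \<rho>" for n
		unfolding \<rho>_def[abs_def] B_def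
		by (intro C_k_on_add C_k_on_uminus_real C_k_on_bounded_linear[OF bounded_linear_mult_right] C_k_on_bump)
	have \<rho>c: "continuous_on A \<rho>" for A using \<rho>C[of 0] by (auto intro: continuous_on_subset)
	have zero: "\<rho> t = 0" if "t <= l \<or> r <= t" for t
	proof -
		have "B c t = 0" "B d t = 0" using that unfolding B_def l_def r_def by (auto intro!: bump_zero)
		then show ?thesis by (simp add: \<rho>_def)
	qed
	have "integral {0..T} \<rho> = inverse (m c) * m c - inverse (m d) * m d"
		unfolding \<rho>_def[abs_def] m_def
		by (subst Henstock_Kurzweil_Integration.integral_add)
			 (auto intro!: integrable_continuous_interval continuous_intros Bc)
	then have "integral {0..T} \<rho> = 0" using m by simp
	moreover have "integral {0..r} \<rho> + integral {r..T} \<rho> = integral {0..T} \<rho>"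
		using lr by (intro Henstock_Kurzweil_Integration.integral_combine integrable_continuous_interval \<rho>c) auto
	moreover have "integral {r..T} \<rho> = integral {r..T} (%_. 0)"
		by (rule integral_cong) (use zero in auto)
	ultimately have int0: "integral {0..r} \<rho> = 0" by simp
	obtain \<eta> where \<eta>: "test_time T \<eta>" "!!t. (\<eta> has_real_derivative \<rho> t) (at t)"
		using antiderivative_test_time[OF \<rho>C lr zero int0] by blast
	have "integral {0..T} (%t. \<rho> t * G t) = 0" by (rule test[OF \<eta> \<rho>c])
	moreover have "integral {0..T} (%t. \<rho> t * G t)
			= inverse (m c) * integral {0..T} (%t. B c t * G t) - inverse (m d) * integral {0..T} (%t. B d t * G t)"
	proof -
		have "integral {0..T} (%t. \<rho> t * G t)
			= integral {0..T} (%t. inverse (m c) * (B c t * G t) - inverse (m d) * (B d t * G t))"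
			by (simp add: \<rho>_def algebra_simps)
		then show ?thesis
			by (subst (asm) Henstock_Kurzweil_Integration.integral_diff)
				 (auto intro!: integrable_continuous_interval continuous_intros Bc G)
	qed
	ultimately have eq: "inverse (m c) * integral {0..T} (%t. B c t * G t) = inverse (m d) * integral {0..T} (%t. B d t * G t)"
		by simp
	have lower: "integral {0..T} (%t. B c t * (G c - e / 2)) <= integral {0..T} (%t. B c t * G t)"
	proof (rule integral_le)
		fix t assume t: "t \<in> {0..T}"
		show "B c t * (G c - e / 2) <= B c t * G t"
		proof (cases "dist t c < \<delta>")
			case True
			then have "G c - e / 2 <= G t" using \<delta>1(2)[OF t] \<delta> by (auto simp: dist_real_def abs_if split: if_splits)
			then show ?thesis unfolding B_def by (intro mult_left_mono bump_nonneg)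
		next
			case False
			then have "B c t = 0" unfolding B_def by (intro bump_zero) (auto simp: dist_real_def abs_if split: if_splits)
			then show ?thesis by simp
		qed
	qed (auto intro!: integrable_continuous_interval continuous_intros Bc G)
	have upper: "integral {0..T} (%t. B d t * G t) <= integral {0..T} (%t. B d t * (G d + e / 2))"
	proof (rule integral_le)
		fix t assume t: "t \<in> {0..T}"
		show "B d t * G t <= B d t * (G d + e / 2)"
		proof (cases "dist t d < \<delta>")
			case True
			then have "G t <= G d + e / 2" using \<delta>2(2)[OF t] \<delta> by (auto simp: dist_real_def abs_if split: if_splits)
			then show ?thesis unfolding B_def by (intro mult_left_mono bump_nonneg)
		next
			case False
			then have "B d t = 0" unfolding B_def by (intro bump_zero) (auto simp: dist_real_def abs_if split: if_splits)
			then show ?thesis by simp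
		qed
	qed (auto intro!: integrable_continuous_interval continuous_intros Bc G)
	have "inverse (m c) * (m c * (G c - e / 2)) <= inverse (m c) * integral {0..T} (%t. B c t * G t)"
		using lower m by (intro mult_left_mono) (auto simp: m_def)
	moreover have "inverse (m d) * integral {0..T} (%t. B d t * G t) <= inverse (m d) * (m d * (G d + e / 2))"
		using upper m by (intro mult_left_mono) (auto simp: m_def)
	moreover have "inverse (m c) * (m c * (G c - e / 2)) = G c - e / 2"
		"inverse (m d) * (m d * (G d + e / 2)) = G d + e / 2"
		using m by simp_all
	ultimately have "G c - e / 2 <= G d + e / 2" using eq by linarith
	then show "G c <= G d + e" by simp
qed

text \<open>The difference of g and the primitive of h has zero weak derivative, hence is constant
  inside and, by continuity, up to both ends. In this way the initial value enters although the test
  functions vanish near time 0.\<close>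

lemma weak_deriv_prim_real:
	fixes g h :: "real => real"
	assumes T: "0 < T" and g: "continuous_on {0..T} g" and h: "integrable (leb T) h"
		and weak: "!!\<eta>. test_time T \<eta> ==>
			(LINT t|leb T. deriv \<eta> t * g t) = - (LINT t|leb T. \<eta> t * h t)"
		and \<tau>: "0 <= \<tau>" "\<tau> <= T"
	shows "g \<tau> = g 0 + prim T h \<tau>"
proof -
	define G where "G t = g t - prim T h t" for t
	have Gc: "continuous_on {0..T} G"
		unfolding G_def by (intro continuous_on_diff g continuous_on_subset[OF continuous_prim[OF h]]) auto
	have test: "integral {0..T} (%t. \<rho> t * G t) = 0"
		if \<eta>: "test_time T \<eta>" and d: "!!t. (\<eta> has_real_derivative \<rho> t) (at t)" and c: "continuous_on UNIV \<rho>"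
		for \<eta> \<rho> :: "real => real"
	proof -
		have c': "continuous_on {0..t} \<rho>" for t using c by (rule continuous_on_subset) auto
		have \<rho>i: "integrable (leb T) \<rho>" by (rule lebesgue_on_integral_continuous[OF c'])
		have "closure {t. \<eta> t ~= 0} \<subseteq> {0<..<T}" using \<eta> by (simp add: test_time_def)
		\<comment> \<open>No boundary terms remain in the integration by parts, because the support lies
		  in the open interval.\<close>
		then have e0: "\<eta> 0 = 0" "\<eta> T = 0" using closure_subset[of "{t. \<eta> t ~= 0}"] by auto
		have \<eta>p: "\<eta> t = \<eta> 0 + prim T \<rho> t" if t: "0 <= t" "t <= T" for t
		proof -
			have "prim T \<rho> t = (LINT s|lebesgue_on {0..t}. \<rho> s)"
				unfolding prim_def using t
				by (subst (1 2) integral_restrict_space)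
					 (auto intro!: Bochner_Integration.integral_cong simp: indicator_def)
			also have "... = integral {0..t} \<rho>" by (rule lebesgue_on_integral_continuous(2)[OF c'])
			also have "... = \<eta> t - \<eta> 0"
				using t d by (intro integral_unique fundamental_theorem_of_calculus)
					(auto simp: has_real_derivative_iff_has_vector_derivative[symmetric] intro: has_field_derivative_at_within)
			finally show ?thesis by simp
		qed
		note bp = prim_by_parts[OF \<rho>i h \<eta>p, of "prim T h" T]
		have P0: "prim T h 0 = 0" by (simp add: prim_le_0)
		have bp3: "0 = prim T (%t. \<rho> t * prim T h t) T + prim T (%t. \<eta> t * h t) T"
			using bp(3) T e0 P0 by simp
		have "deriv \<eta> = \<rho>" using d by (auto intro!: DERIV_imp_deriv)
		then have "(LINT t|leb T. \<rho> t * g t) = - (LINT t|leb T. \<eta> t * h t)"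
			using weak[OF \<eta>] by simp
		also have "... = (LINT t|leb T. \<rho> t * prim T h t)"
			using bp3 unfolding prim_T by simp
		finally have "(LINT t|leb T. \<rho> t * g t) = (LINT t|leb T. \<rho> t * prim T h t)" .
		moreover have "integral {0..T} (%t. \<rho> t * G t) = (LINT t|leb T. \<rho> t * G t)"
			by (intro lebesgue_on_integral_continuous(2)[symmetric] continuous_intros Gc c')
		moreover have "... = (LINT t|leb T. \<rho> t * g t - \<rho> t * prim T h t)"
			by (simp add: G_def algebra_simps)
		moreover have "... = (LINT t|leb T. \<rho> t * g t) - (LINT t|leb T. \<rho> t * prim T h t)"
			by (intro Bochner_Integration.integral_diff lebesgue_on_integral_continuous(1) continuous_intros g c'
					continuous_on_subset[OF continuous_prim[OF h]]) auto
		ultimately show ?thesis by simp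
	qed
	have const: "G c = G d" if "0 < c" "c < T" "0 < d" "d < T" for c d
		using du_Bois_Reymond_constant[OF Gc test] that by (intro antisym) auto
	have "\<forall>x\<in>{0..T}. G x = G (T / 2)"
	proof (rule ccontr)
		let ?C = "{x \<in> {0..T}. G x = G (T / 2)}"
		assume "\<not> (\<forall>x\<in>{0..T}. G x = G (T / 2))"
		have "closed ?C"
			using continuous_closed_preimage_constant[OF Gc, of "G (T / 2)"] by simp
		moreover have "{0<..<T} \<subseteq> ?C"
		proof
			fix x assume "x \<in> {0<..<T}"
			moreover from this have "G x = G (T / 2)" using T by (intro const) auto
			ultimately show "x \<in> ?C" by simp
		qed
		ultimately have "closure {0<..<T} \<subseteq> ?C" by (rule closure_minimal[rotated])
		then have "{0..T} \<subseteq> ?C" using T by simp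
		then show False using \<open>\<not> _\<close> by auto
	qed
	from bspec[OF this, of \<tau>] bspec[OF this, of 0] have "G \<tau> = G 0" using \<tau> by simp
	then show ?thesis by (simp add: G_def prim_le_0)
qed

lemma integrable_scaleR_bounded:
	fixes h :: "real => 'a::euclidean_space"
	assumes "\<eta> \<in> borel_measurable (leb T)" "integrable (leb T) h"
		and B: "!!t. t \<in> {0..T} ==> norm (\<eta> t) <= B"
	shows "integrable (leb T) (%t. \<eta> t *\<^sub>R h t)"
proof (rule Bochner_Integration.integrable_bound[where f = "%t. B *\<^sub>R h t"])
	show "AE t in leb T. norm (\<eta> t *\<^sub>R h t) <= norm (B *\<^sub>R h t)"
	proof (rule AE_I2)
		fix t assume "t \<in> space (leb T)"
		then have "\<bar>\<eta> t\<bar> <= \<bar>B\<bar>" using B[of t] by auto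
		then show "norm (\<eta> t *\<^sub>R h t) <= norm (B *\<^sub>R h t)" by (simp add: mult_right_mono)
	qed
qed (use assms in auto)

lemma weak_deriv_prim:
	fixes g h :: "real => 'a::euclidean_space"
	assumes T: "0 < T" and g: "continuous_on {0..T} g" and h: "integrable (leb T) h"
		and weak: "!!\<eta>. test_time T \<eta> ==>
			(LINT t|leb T. deriv \<eta> t *\<^sub>R g t) = - (LINT t|leb T. \<eta> t *\<^sub>R h t)"
		and \<tau>: "0 <= \<tau>" "\<tau> <= T"
	shows "g \<tau> = g 0 + prim T h \<tau>"
proof (rule euclidean_eqI)
	fix b :: 'a assume b: "b \<in> Basis"
	have "(%t. g t \<bullet> b) \<tau> = (%t. g t \<bullet> b) 0 + prim T (%t. h t \<bullet> b) \<tau>"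
	proof (rule weak_deriv_prim_real[OF T _ _ _ \<tau>])
		show "continuous_on {0..T} (%t. g t \<bullet> b)" by (intro continuous_intros g)
		show "integrable (leb T) (%t. h t \<bullet> b)" using h by simp
		fix \<eta> assume \<eta>: "test_time T \<eta>"
		then have C: "C_k_on (Suc 1) UNIV \<eta>" unfolding test_time_def smooth_on_def by blast
		then obtain f' where f': "!!p. (\<eta> has_derivative f' p) (at p)" and Cf: "!!h. C_k_on 1 UNIV (%p. f' p h)"
			by auto
		have d: "(\<eta> has_real_derivative f' t 1) (at t)" for t
		proof -
			have "f' t h = f' t 1 * h" for h
				using linear_cmul[OF has_derivative_linear[OF f'[of t]], of h 1] by (simp add: mult.commute)
			then have "f' t = (*) (f' t 1)" by (rule ext)
			then show ?thesis using f'[of t] unfolding has_field_derivative_def by simp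
		qed
		then have de: "deriv \<eta> = (%t. f' t 1)" by (auto intro!: DERIV_imp_deriv)
		have "C_k_on 0 UNIV (%p. f' p 1)"
			using C_k_on_continuous[OF Cf[of 1]] by simp
		then have dc: "continuous_on {0..T} (deriv \<eta>)" unfolding de by (auto intro: continuous_on_subset)
		have ec: "continuous_on {0..T} \<eta>" using d[THEN DERIV_isCont] by (auto intro: continuous_at_imp_continuous_on)
		have i1: "integrable (leb T) (%t. deriv \<eta> t *\<^sub>R g t)"
			by (intro continuous_imp_integrable_real continuous_intros dc g)
		have i2: "integrable (leb T) (%t. \<eta> t *\<^sub>R h t)"
		proof -
			obtain B where B: "!!t. t \<in> {0..T} ==> norm (\<eta> t) <= B"
				using compact_imp_bounded[OF compact_continuous_image[OF ec]] unfolding bounded_iff by fastforce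
			have "\<eta> \<in> borel_measurable (leb T)"
				using ec by (intro continuous_imp_measurable_on_sets_lebesgue) auto
			then show ?thesis
				using B h
				by (intro integrable_scaleR_bounded) auto
		qed
		have "(LINT t|leb T. deriv \<eta> t *\<^sub>R g t) \<bullet> b = - (LINT t|leb T. \<eta> t *\<^sub>R h t) \<bullet> b"
			using weak[OF \<eta>] by simp
		then show "(LINT t|leb T. deriv \<eta> t * (g t \<bullet> b)) = - (LINT t|leb T. \<eta> t * (h t \<bullet> b))"
			using integral_inner_left[of b, OF i1] integral_inner_left[of b, OF i2] by simp
	qed
	then show "g \<tau> \<bullet> b = (g 0 + prim T h \<tau>) \<bullet> b" by (simp add: prim_inner[OF h] inner_add_left)
qed

subsection \<open>Integrals over the periodicity cell\<close>

lemma integral_Cauchy_Schwarz: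
	fixes f g :: "'a => real"
	assumes f: "f \<in> borel_measurable M" "integrable M (%x. (f x)^2)"
		and g: "g \<in> borel_measurable M" "integrable M (%x. (g x)^2)"
	shows "integrable M (%x. f x * g x)"
		and "(LINT x|M. \<bar>f x * g x\<bar>) <= sqrt (LINT x|M. (f x)^2) * sqrt (LINT x|M. (g x)^2)"
proof -
	have [measurable]: "f \<in> borel_measurable M" "g \<in> borel_measurable M" by (fact f g)+
	have bound: "\<bar>f x * g x\<bar> <= (f x)^2 + (g x)^2" for x
	proof -
		have "0 <= \<bar>f x\<bar> * \<bar>g x\<bar>" by simp
		then show ?thesis using sum_squares_bound[of "\<bar>f x\<bar>" "\<bar>g x\<bar>"]
			by (simp only: abs_mult power2_abs mult.assoc)
	qed
	show i: "integrable M (%x. f x * g x)"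
		by (rule Bochner_Integration.integrable_bound[OF Bochner_Integration.integrable_add[OF f(2) g(2)]])
			 (use bound in auto)
	then have i': "integrable M (%x. \<bar>f x * g x\<bar>)" by simp
	let ?A = "LINT x|M. (f x)^2" and ?B = "LINT x|M. (g x)^2" and ?P = "LINT x|M. \<bar>f x * g x\<bar>"
	have nn: "0 <= ?A" "0 <= ?B" "0 <= ?P" by (auto intro!: Bochner_Integration.integral_nonneg)
	\<comment> \<open>A nonnegative quadratic polynomial in t; its value at the minimizer is the
	  squared inequality. If the leading coefficient is zero and P is not, the choice t = (B + 1) / (2
	  P) would give the value -1.\<close>
	have quad: "0 <= t^2 * ?A - 2 * t * ?P + ?B" for t
	proof -
		have "0 <= (LINT x|M. (t * \<bar>f x\<bar> - \<bar>g x\<bar>)^2)" by (rule Bochner_Integration.integral_nonneg) simp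
		also have "... = (LINT x|M. t^2 * (f x)^2 - 2 * t * \<bar>f x * g x\<bar> + (g x)^2)"
			by (rule Bochner_Integration.integral_cong) (auto simp: power2_diff power_mult_distrib abs_mult)
		also have "... = t^2 * ?A - 2 * t * ?P + ?B" using f(2) g(2) i' by simp
		finally show ?thesis .
	qed
	have "?P^2 <= ?A * ?B"
	proof (cases "?A = 0")
		case True
		have "?P = 0"
		proof (rule ccontr)
			assume "?P ~= 0"
			then show False using quad[of "(?B + 1) / (2 * ?P)"] True by simp
		qed
		then show ?thesis using True by simp
	next
		case False
		then have "0 < ?A" using nn(1) by linarith
		have "0 <= (?P / ?A)^2 * ?A - 2 * (?P / ?A) * ?P + ?B" by (rule quad)
		also have "... = ?B - ?P^2 / ?A" using False by (simp add: power2_eq_square)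
		finally show ?thesis using \<open>0 < ?A\<close> by (simp add: field_simps)
	qed
	then have "?P <= sqrt (?A * ?B)" by (rule real_le_rsqrt)
	then show "?P <= sqrt ?A * sqrt ?B" by (simp only: real_sqrt_mult)
qed

lemma indicator_measurable_lebesgue_on':
	"A \<in> sets borel ==> (indicator A :: 'a::euclidean_space => real) \<in> borel_measurable (lebesgue_on S)"
	by (rule measurable_restrict_space1, rule borel_measurable_indicator) simp

section \<open>Translations and partial derivatives of periodic functions on the cell\<close>

abbreviation cellm :: "(real ^ 3) measure" where "cellm \<equiv> lebesgue_on cell"

text \<open>Slabs cut the cell across direction j. A translation by h moves a slab of width h from
  one face to the opposite one, where periodicity identifies it.\<close>

definition slab :: "3 => real => real => (real ^ 3) set" where
	"slab j p q = cbox (\<chi> i. if i = j then p else 0) (\<chi> i. if i = j then q else 2 * pi)"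

lemma mem_slab: "x \<in> slab j p q \<longleftrightarrow> p <= x $ j \<and> x $ j <= q \<and> (\<forall>i. i ~= j \<longrightarrow> 0 <= x $ i \<and> x $ i <= 2 * pi)"
	unfolding slab_def mem_box_cart by auto

lemma mem_cell: "x \<in> cell \<longleftrightarrow> (\<forall>i. 0 <= x $ i \<and> x $ i <= 2 * pi)"
	unfolding cell_def mem_box_cart by simp

lemma cell_eq_slab: "cell = slab j 0 (2 * pi)"
	by (auto simp: set_eq_iff mem_cell mem_slab)

lemma cell_lmeasurable [simp]: "cell \<in> lmeasurable"
	by (simp add: cell_def)

lemma cell_sets [simp]: "cell \<in> sets lebesgue"
	by (simp add: cell_def)

lemma measure_cell: "measure lebesgue cell = (2 * pi) ^ 3"
proof -
	have "0 \<in> cell" by (simp add: mem_cell)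
	then have "cell ~= {}" by blast
	then have "measure lebesgue cell = (\<Prod>i\<in>(UNIV :: 3 set). (\<chi> j. 2 * pi) $ i - (0 :: real ^ 3) $ i)"
		using content_cbox_cart[of 0 "\<chi> j. 2 * pi :: real ^ 3"] by (simp add: cell_def)
	then show ?thesis by simp
qed

interpretation cell: finite_measure cellm
	by (rule finite_measure_lebesgue_on) simp

lemma cell_const_integral: "(LINT x|cellm. c) = (2 * pi) ^ 3 *\<^sub>R c" for c :: "'a::euclidean_space"
	by (simp add: measure_cell measure_restrict_space)

lemma cell_continuous_integral:
	fixes g :: "real ^ 3 => 'a::euclidean_space"
	assumes "continuous_on cell g"
	shows "integrable cellm g" and "(LINT x|cellm. g x) = integral cell g"
proof -
	show i: "integrable cellm g"
		using assms unfolding cell_def by (rule continuous_imp_integrable)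
	show "(LINT x|cellm. g x) = integral cell g"
		using i by (intro lebesgue_integral_eq_integral) auto
qed

lemma integral_slab_split:
	fixes g :: "real ^ 3 => 'a::euclidean_space"
	assumes g: "continuous_on UNIV g" and "p <= r" "r <= q"
	shows "integral (slab j p q) g = integral (slab j p r) g + integral (slab j r q) g"
proof -
	let ?a = "(\<chi> i. if i = j then p else 0) :: real ^ 3"
	let ?b = "(\<chi> i. if i = j then q else 2 * pi) :: real ^ 3"
	have "integral (cbox ?a ?b) g = integral (cbox ?a ?b \<inter> {x. x \<bullet> axis j 1 <= r}) g
			+ integral (cbox ?a ?b \<inter> {x. x \<bullet> axis j 1 \<ge> r}) g"
		by (rule integral_split)
			 (auto intro!: integrable_continuous continuous_on_subset[OF g] simp: axis_in_Basis_iff)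
	moreover have "cbox ?a ?b \<inter> {x. x \<bullet> axis j 1 <= r} = slab j p r"
		using assms by (auto simp: set_eq_iff mem_slab slab_def[symmetric] inner_axis)
	moreover have "cbox ?a ?b \<inter> {x. x \<bullet> axis j 1 \<ge> r} = slab j r q"
		using assms by (auto simp: set_eq_iff mem_slab slab_def[symmetric] inner_axis)
	ultimately show ?thesis by (simp add: slab_def)
qed

lemma integral_slab_shift:
	fixes g :: "real ^ 3 => 'a::euclidean_space"
	shows "integral (slab j p q) (%x. g (x + c *\<^sub>R axis j 1)) = integral (slab j (p + c) (q + c)) g"
proof -
	have "(\<chi> i. if i = j then p + c else 0) - c *\<^sub>R axis j 1 = ((\<chi> i. if i = j then p else 0) :: real ^ 3)"
		and "(\<chi> i. if i = j then q + c else 2 * pi) - c *\<^sub>R axis j 1 = ((\<chi> i. if i = j then q else 2 * pi) :: real ^ 3)"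
		by (auto simp: vec_eq_iff axis_def)
	then show ?thesis
		using integral_shift_cbox[of "\<chi> i. if i = j then p + c else 0" "c *\<^sub>R axis j 1" "\<chi> i. if i = j then q + c else 2 * pi" g]
		by (simp add: slab_def)
qed

lemma integral_cell_shift:
	fixes g :: "real ^ 3 => 'a::euclidean_space"
	assumes g: "continuous_on UNIV g" and per: "!!x. g (x + (2 * pi) *\<^sub>R axis j 1) = g x"
		and h: "0 <= h" "h <= 2 * pi"
	shows "integral cell (%x. g (x + h *\<^sub>R axis j 1)) = integral cell g"
proof -
	have "integral cell (%x. g (x + h *\<^sub>R axis j 1)) = integral (slab j h (2 * pi + h)) g"
		by (simp add: cell_eq_slab[of j] integral_slab_shift)
	also have "... = integral (slab j h (2 * pi)) g + integral (slab j (2 * pi) (2 * pi + h)) g"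
		using h by (intro integral_slab_split[OF g]) auto
	also have "integral (slab j (2 * pi) (2 * pi + h)) g = integral (slab j 0 h) g"
		using integral_slab_shift[of j 0 h g "2 * pi"] by (simp add: per add.commute)
	also have "integral (slab j h (2 * pi)) g + integral (slab j 0 h) g = integral cell g"
		using integral_slab_split[OF g, of 0 h "2 * pi" j] h by (simp add: cell_eq_slab[of j])
	finally show ?thesis .
qed

text \<open>Integration by parts on the torus: the integral over the cell is invariant under
  translations of the integrand, and differentiating this constant in the translation parameter
  gives the integral of g'.\<close>

lemma integral_cell_partial_deriv:
	fixes g g' :: "real ^ 3 => 'a::euclidean_space"
	assumes g: "continuous_on UNIV g" and g': "continuous_on UNIV g'"
		and per: "!!x. g (x + (2 * pi) *\<^sub>R axis j 1) = g x"
		and d: "!!x h. ((%h. g (x + h *\<^sub>R axis j 1)) has_vector_derivative g' (x + h *\<^sub>R axis j 1)) (at h)"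
	shows "integral cell g' = 0"
proof -
	have "((%h. integral cell (%x. g (x + h *\<^sub>R axis j 1))) has_vector_derivative
			integral cell (%x. g' (x + 0 *\<^sub>R axis j 1))) (at 0 within {0..2 * pi})"
		unfolding cell_def
	proof (rule leibniz_rule_vector_derivative)
		show "((%h. g (x + h *\<^sub>R axis j 1)) has_vector_derivative g' (x + h *\<^sub>R axis j 1)) (at h within {0..2 * pi})" for x h
			using d by (rule has_vector_derivative_at_within)
		show "(%x. g (x + h *\<^sub>R axis j 1)) integrable_on cbox 0 (\<chi> j. 2 * pi)" for h
			by (intro integrable_continuous continuous_on_compose2[OF g] continuous_intros) auto
		show "continuous_on ({0..2 * pi} \<times> cbox 0 (\<chi> j. 2 * pi)) (%(h, x). g' (x + h *\<^sub>R axis j 1))"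
			unfolding case_prod_unfold
			by (intro continuous_on_compose2[OF g'] continuous_intros) auto
	qed auto
	moreover have "((%h. integral cell (%x. g (x + h *\<^sub>R axis j 1))) has_vector_derivative 0) (at 0 within {0..2 * pi})"
		by (rule has_vector_derivative_transform[where f = "%_. integral cell g"])
			 (auto simp: integral_cell_shift[OF g per])
	ultimately have "integral cell (%x. g' (x + 0 *\<^sub>R axis j 1)) = 0"
		by (rule vector_derivative_unique_within[rotated]) (simp add: trivial_limit_within islimpt_Icc)
	then show ?thesis by simp
qed

subsection \<open>Fourier coefficients of scalar functions\<close>

definition chr :: "int ^ 3 => real ^ 3 => complex" where
	"chr k x = cis (wave k \<bullet> x)"

definition fc :: "(real ^ 3 => complex) => int ^ 3 => complex" where
	"fc F k = (LINT x|cellm. F x * chr (- k) x) / of_real ((2 * pi) ^ 3)"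

lemma chr_add: "chr (k + l) x = chr k x * chr l x"
	by (simp add: chr_def wave_add inner_add_left cis_mult)

lemma chr_0 [simp]: "chr 0 x = 1"
	by (simp add: chr_def)

lemma norm_chr [simp]: "norm (chr k x) = 1"
	by (simp add: chr_def)

lemma cnj_chr: "cnj (chr k x) = chr (- k) x"
	by (simp add: chr_def wave_uminus cis_cnj)

lemma continuous_chr [continuous_intros]: "continuous_on S (chr k)"
	unfolding chr_def[abs_def] cis_conv_exp by (intro continuous_intros)

lemma chr_measurable [measurable]: "chr k \<in> borel_measurable cellm"
	by (rule continuous_imp_measurable_on_sets_lebesgue[OF continuous_chr]) simp

lemma integrable_mult_chr:
	assumes F: "integrable cellm F"
	shows "integrable cellm (%x. F x * chr k x)"
proof (rule Bochner_Integration.integrable_bound[OF F])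
	have [measurable]: "F \<in> borel_measurable cellm" using F by auto
	show "(%x. F x * chr k x) \<in> borel_measurable cellm" by measurable
qed (simp add: norm_mult)

lemma wave_inner_axis: "wave k \<bullet> axis j 1 = of_int (k $ j)"
	by (simp add: inner_axis wave_def)

lemma chr_periodic: "chr k (x + (2 * pi) *\<^sub>R axis j 1) = chr k x"
	by (simp add: chr_def inner_add_right wave_inner_axis cis_mult[symmetric] cis_multiple_2pi)

lemma integral_chr: "(LINT x|cellm. chr k x) = (if k = 0 then of_real ((2 * pi) ^ 3) else 0)"
proof (cases "k = 0")
	case True
	then show ?thesis using cell_const_integral[of "1 :: complex"] by (simp add: scaleR_conv_of_real)
next
	case False
	then obtain j where j: "k $ j ~= 0" by (auto simp: vec_eq_iff)
	\<comment> \<open>Half a period in a direction with k_j nonzero: the translation flips the sign of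
	  the character but leaves its integral unchanged.\<close>
	define h where "h = pi / \<bar>of_int (k $ j)\<bar>"
	have "1 <= \<bar>real_of_int (k $ j)\<bar>" using j by linarith
	then have h: "0 <= h" "h <= 2 * pi" using pi_gt_zero
		by (auto simp: h_def divide_le_eq intro: order_trans[of pi "2 * pi"] mult_left_le_one_le)
	have c: "cis (of_int (k $ j) * h) = -1"
	proof (cases "k $ j > 0")
		case True
		then have "of_int (k $ j) * h = pi" by (simp add: h_def)
		then show ?thesis by simp
	next
		case False
		then have "of_int (k $ j) * h = - pi" using j by (simp add: h_def)
		then show ?thesis by (simp add: complex_eq_iff)
	qed
	have "integral cell (%x. chr k (x + h *\<^sub>R axis j 1)) = integral cell (chr k)"
		by (rule integral_cell_shift[OF continuous_chr chr_periodic h])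
	moreover have "chr k (x + h *\<^sub>R axis j 1) = - chr k x" for x
		using c by (simp add: chr_def inner_add_right wave_inner_axis cis_mult[symmetric] mult.commute)
	ultimately have "integral cell (chr k) = 0" by (simp add: equation_minus_iff)
	then show ?thesis using False cell_continuous_integral(2)[OF continuous_chr, of k] by simp
qed

lemma fc_chr: "fc (chr l) k = (if k = l then 1 else 0)"
	unfolding fc_def chr_add[symmetric] integral_chr by auto

lemma fc_diff:
	assumes "integrable cellm F" "integrable cellm G"
	shows "fc (%x. F x - G x) k = fc F k - fc G k"
	using integrable_mult_chr[OF assms(1)] integrable_mult_chr[OF assms(2)]
	by (simp add: fc_def left_diff_distrib diff_divide_distrib)

lemma fc_sum:
	assumes "!!i. i \<in> I ==> integrable cellm (F i)"
	shows "fc (%x. \<Sum>i\<in>I. F i x) k = (\<Sum>i\<in>I. fc (F i) k)"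
	using integrable_mult_chr[OF assms]
	by (simp add: fc_def sum_distrib_right sum_divide_distrib)

lemma fc_cmult: "fc (%x. c * F x) k = c * fc F k"
	by (simp add: fc_def mult.assoc)

lemma fc_shift: "fc (%x. chr l x * F x) k = fc F (k - l)"
	by (simp add: fc_def mult.assoc[symmetric] mult.commute[of "chr l _"] chr_add[symmetric] mult.assoc)

lemma fc_cnj:
	assumes "integrable cellm F"
	shows "fc (%x. cnj (F x)) k = cnj (fc F (- k))"
proof -
	have "(%x. cnj (F x) * chr (- k) x) = (%x. cnj (F x * chr k x))" by (simp add: cnj_chr)
	moreover have "(LINT x|cellm. cnj (F x * chr k x)) = cnj (LINT x|cellm. F x * chr k x)"
		by (rule integral_bounded_linear[OF bounded_linear_cnj integrable_mult_chr[OF assms]])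
	ultimately show ?thesis unfolding fc_def
		by (simp only: minus_minus complex_cnj_divide complex_cnj_complex_of_real)
qed

lemma norm_fc_le:
	assumes "integrable cellm F"
	shows "norm (fc F k) <= (LINT x|cellm. norm (F x)) / (2 * pi) ^ 3"
proof -
	have "norm (LINT x|cellm. F x * chr (- k) x) <= (LINT x|cellm. norm (F x * chr (- k) x))"
		by (rule integral_norm_bound)
	then show ?thesis by (simp add: fc_def norm_divide norm_mult norm_power divide_right_mono)
qed

subsection \<open>Uniqueness of Fourier coefficients\<close>

text \<open>Trigonometric polynomials, generated so that closure under products is an induction.
  They have to contain all real polynomials in the cosines and sines of the coordinates, which
  Stone-Weierstrass supplies.\<close>

inductive trig :: "(real ^ 3 => complex) => bool" where
	trig_chr: "trig (%x. c * chr k x)"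
| trig_add: "trig p ==> trig q ==> trig (%x. p x + q x)"

lemma trig_mult_chr: "trig p ==> trig (%x. (c * chr k x) * p x)"
proof (induction rule: trig.induct)
	case (trig_chr d l)
	have "(%x. (c * chr k x) * (d * chr l x)) = (%x. (c * d) * chr (k + l) x)"
		by (simp add: chr_add algebra_simps)
	then show ?case using trig.trig_chr by simp
next
	case (trig_add p q)
	then show ?case using trig.trig_add[of "%x. (c * chr k x) * p x" "%x. (c * chr k x) * q x"]
		by (simp add: distrib_left)
qed

lemma trig_mult: "trig p ==> trig q ==> trig (%x. p x * q x)"
proof (induction rule: trig.induct)
	case (trig_chr c k)
	then show ?case by (rule trig_mult_chr)
next
	case (trig_add p p')
	then show ?case using trig.trig_add[of "%x. p x * q x" "%x. p' x * q x"]
		by (simp add: distrib_right)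
qed

lemma trig_const: "trig (%x. c)"
	using trig_chr[of c 0] by simp

lemma trig_cmult: "trig p ==> trig (%x. c * p x)"
	using trig_mult[OF trig_const] .

lemma trig_sum: "finite I ==> (!!i. i \<in> I ==> trig (p i)) ==> trig (%x. \<Sum>i\<in>I. p i x)"
	by (induction I rule: finite_induct) (auto intro: trig_const trig_add)

lemma trig_integral:
	assumes F: "integrable cellm F" "!!k. fc F k = 0"
	shows "trig p ==> integrable cellm (%x. F x * p x) \<and> (LINT x|cellm. F x * p x) = 0"
proof (induction rule: trig.induct)
	case (trig_chr c k)
	have "(LINT x|cellm. F x * chr k x) = 0" using F(2)[of "- k"] by (simp add: fc_def)
	then show ?case using integrable_mult_chr[OF F(1), of k] by (simp add: mult.left_commute)
next
	case (trig_add p q)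
	then show ?case by (simp add: distrib_left)
qed

text \<open>Maps the cell onto a compact subset of C^3, so that Stone-Weierstrass applies:
  continuous functions there pull back to periodic functions, and polynomials to trigonometric
  polynomials.\<close>

definition to_circle :: "real ^ 3 => complex ^ 3" where
	"to_circle x = (\<chi> j. cis (x $ j))"

lemma continuous_to_circle: "continuous_on S to_circle"
	unfolding to_circle_def[abs_def] cis_conv_exp by (intro continuous_intros)

lemma trig_cos_sin: "trig (%x. of_real (cos (x $ j)))" "trig (%x. of_real (sin (x $ j)))"
proof -
	let ?e = "axis j 1 :: int ^ 3"
	have w: "wave ?e \<bullet> x = x $ j" for x
	proof -
		have "wave ?e = axis j 1" by (auto simp: wave_def axis_def vec_eq_iff)
		then show ?thesis by (simp add: inner_axis' )
	qed
	have p: "chr ?e x = cis (x $ j)" and m: "chr (- ?e) x = cis (- (x $ j))" for x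
		by (simp_all add: chr_def w wave_uminus)
	have "(%x. complex_of_real (cos (x $ j))) = (%x. (1/2) * chr ?e x + (1/2) * chr (- ?e) x)"
		by (simp add: p m complex_eq_iff fun_eq_iff)
	then show "trig (%x. of_real (cos (x $ j)))"
		using trig_add[OF trig_chr[of "1/2" ?e] trig_chr[of "1/2" "- ?e"]] by (simp only:)
	have "(%x. complex_of_real (sin (x $ j))) = (%x. (-\<i>/2) * chr ?e x + (\<i>/2) * chr (- ?e) x)"
		by (simp add: p m complex_eq_iff fun_eq_iff)
	then show "trig (%x. of_real (sin (x $ j)))"
		using trig_add[OF trig_chr[of "-\<i>/2" ?e] trig_chr[of "\<i>/2" "- ?e"]] by (simp only:)
qed

lemma trig_real_polynomial:
	"real_polynomial_function p ==> trig (%x. complex_of_real (p (to_circle x)))"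
proof (induction rule: real_polynomial_function.induct)
	case (linear f)
	interpret f: bounded_linear f by (rule linear)
	have "f (to_circle x) = (\<Sum>j\<in>UNIV. cos (x $ j) * f (axis j 1) + sin (x $ j) * f (axis j \<i>))" for x
	proof -
		have "to_circle x = (\<Sum>j\<in>UNIV. cos (x $ j) *\<^sub>R axis j 1 + sin (x $ j) *\<^sub>R axis j \<i>)"
			by (simp add: vec_eq_iff to_circle_def axis_def if_distrib[of "%c. _ *\<^sub>R c"] sum.distrib complex_eq_iff
					cong: if_cong)
		then show ?thesis by (simp add: f.sum f.add f.scaleR)
	qed
	then have "(%x. complex_of_real (f (to_circle x)))
		 = (%x. \<Sum>j\<in>UNIV. of_real (f (axis j 1)) * of_real (cos (x $ j)) + of_real (f (axis j \<i>)) * of_real (sin (x $ j)))"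
		by (simp add: mult.commute)
	then show ?case by (auto intro!: trig_sum trig_add trig_cmult trig_cos_sin)
next
	case (const c)
	show ?case by (rule trig_const)
next
	case (add f g)
	then show ?case using trig_add by fastforce
next
	case (mult f g)
	then show ?case using trig_mult by fastforce
qed

lemma integral_continuous_on_circle_zero:
	assumes F: "integrable cellm F" "!!k. fc F k = 0" and h: "continuous_on UNIV h"
	shows "(LINT x|cellm. F x * complex_of_real (h (to_circle x))) = 0"
proof -
	have [measurable]: "F \<in> borel_measurable cellm" using F by auto
	have hm [measurable]: "(%x. complex_of_real (g (to_circle x))) \<in> borel_measurable cellm"
		if "continuous_on UNIV g" for g :: "complex ^ 3 => real"
		by (rule continuous_imp_measurable_on_sets_lebesgue)
			 (auto intro!: continuous_intros continuous_on_compose2[OF that] continuous_to_circle)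
	have comp: "compact (to_circle ` cell)"
		by (rule compact_continuous_image[OF continuous_to_circle]) (simp add: cell_def)
	have Fh: "integrable cellm (%x. F x * complex_of_real (h (to_circle x)))"
	proof -
		have "bounded (h ` to_circle ` cell)"
			by (intro compact_imp_bounded compact_continuous_image[OF continuous_on_subset[OF h] comp]) auto
		then obtain B where B: "!!x. x \<in> cell ==> \<bar>h (to_circle x)\<bar> <= B" by (auto simp: bounded_iff)
		have "integrable cellm (%x. complex_of_real B * F x)" using F by simp
		then show ?thesis
		proof (rule Bochner_Integration.integrable_bound)
			show "AE x in cellm. norm (F x * complex_of_real (h (to_circle x))) <= norm (complex_of_real B * F x)"
			proof (rule AE_I2)
				fix x assume "x \<in> space cellm"
				then have "\<bar>h (to_circle x)\<bar> <= \<bar>B\<bar>" using B[of x] by auto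
				then show "norm (F x * complex_of_real (h (to_circle x))) <= norm (complex_of_real B * F x)"
					by (simp add: norm_mult mult.commute[of "norm (F x)"] mult_right_mono)
			qed
		qed (use hm[OF h] in measurable)
	qed
	let ?I = "LINT x|cellm. norm (F x)"
	have le: "norm (LINT x|cellm. F x * complex_of_real (h (to_circle x))) <= e * ?I" if e: "0 < e" for e
	proof -
		obtain g where g: "real_polynomial_function g" "!!z. z \<in> to_circle ` cell ==> \<bar>h z - g z\<bar> < e"
			using Stone_Weierstrass_real_polynomial_function[OF comp continuous_on_subset[OF h] e] by auto
		note ti = trig_integral[OF F trig_real_polynomial[OF g(1)]]
		have "(LINT x|cellm. F x * complex_of_real (h (to_circle x)))
			 = (LINT x|cellm. F x * complex_of_real (h (to_circle x)) - F x * complex_of_real (g (to_circle x)))"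
			using Fh ti by simp
		also have "norm ... <= (LINT x|cellm. norm (F x * complex_of_real (h (to_circle x)) - F x * complex_of_real (g (to_circle x))))"
			by (rule integral_norm_bound)
		also have "... <= (LINT x|cellm. e * norm (F x))"
		proof (rule integral_mono)
			show "integrable cellm (%x. norm (F x * complex_of_real (h (to_circle x)) - F x * complex_of_real (g (to_circle x))))"
				using Fh ti by auto
			fix x assume "x \<in> space cellm"
			then have "\<bar>h (to_circle x) - g (to_circle x)\<bar> <= e" using g(2)[of "to_circle x"] by force
			moreover have "norm (F x * complex_of_real (h (to_circle x)) - F x * complex_of_real (g (to_circle x)))
					= norm (F x) * \<bar>h (to_circle x) - g (to_circle x)\<bar>"
				by (simp only: right_diff_distrib[symmetric] of_real_diff[symmetric] norm_mult norm_of_real)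
			ultimately show "norm (F x * complex_of_real (h (to_circle x)) - F x * complex_of_real (g (to_circle x))) <= e * norm (F x)"
				by (simp add: mult.commute[of "norm (F x)"] mult_right_mono)
		qed (use F in auto)
		finally show ?thesis by simp
	qed
	have "norm (LINT x|cellm. F x * complex_of_real (h (to_circle x))) <= 0 + e" if "0 < e" for e
	proof -
		have nn: "0 <= ?I" by (rule Bochner_Integration.integral_nonneg) simp
		then have I1: "0 < ?I + 1" by linarith
		have "norm (LINT x|cellm. F x * complex_of_real (h (to_circle x))) <= e / (?I + 1) * ?I"
			by (rule le) (use I1 that in simp)
		also have "... <= e" using I1 that by (simp add: field_simps)
		finally show ?thesis by simp
	qed
	then have "norm (LINT x|cellm. F x * complex_of_real (h (to_circle x))) <= 0"
		by (rule field_le_epsilon)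
	then show ?thesis by simp
qed

text \<open>One point in the open cell, the other in the closed cell: opposite faces are identified,
  so injectivity can be claimed only at interior points, but there against all points of the
  cell.\<close>

lemma to_circle_inj:
	assumes "x \<in> box 0 (\<chi> j. 2 * pi)" "y \<in> cell" "to_circle x = to_circle y"
	shows "x = y"
	unfolding vec_eq_iff
proof
	fix j
	have x: "0 < x $ j" "x $ j < 2 * pi" and y: "0 <= y $ j" "y $ j <= 2 * pi"
		using assms(1,2) by (auto simp: mem_cell mem_box_cart)
	have "cis (x $ j) = cis (y $ j)" using assms(3) by (simp add: to_circle_def vec_eq_iff)
	then have "sin (x $ j) = sin (y $ j) \<and> cos (x $ j) = cos (y $ j)" by (simp add: complex_eq_iff)
	then obtain n :: int where n: "x $ j = y $ j + 2 * of_int n * pi" using sin_cos_eq_iff by auto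
	have "(2 * of_int n) * pi < 2 * pi" "(- 2) * pi < (2 * of_int n) * pi"
		using n x y by linarith+
	then have "2 * real_of_int n < 2" "- 2 < 2 * real_of_int n"
		unfolding mult_less_cancel_right_pos[OF pi_gt_zero] .
	then have "n = 0" by linarith
	then show "x $ j = y $ j" using n by simp
qed

text \<open>Indicators of open subsets of the open cell are bounded limits of continuous functions
  on the torus, against which F integrates to zero by Stone-Weierstrass. Boxes can be cut down to
  the open cell because its boundary is null.\<close>

lemma fc_zero_imp_AE_zero:
	assumes F: "integrable cellm F" "!!k. fc F k = 0"
	shows "AE x in cellm. F x = 0"
proof -
	let ?Q = "box 0 (\<chi> j. 2 * pi) :: (real ^ 3) set"
	have open_zero: "(LINT x|cellm. indicator V x *\<^sub>R F x) = 0" if V: "open V" "V \<subseteq> ?Q" for V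
	proof -
		define C where "C = to_circle ` (cell - V)"
		have "0 \<in> cell - V" using V(2) by (auto simp: mem_cell mem_box_cart)
		then have C: "C ~= {}" "compact C"
			unfolding C_def
			by (auto intro!: compact_continuous_image continuous_to_circle compact_diff V simp: cell_def)
		\<comment> \<open>The truncated multiple of the distance to the image of the complement vanishes
		  off V and tends to 1 on V: by injectivity at interior points, the image of a point of V has
		  positive distance to \<open>C\<close>.\<close>
		define h where "h n z = min 1 (real n * infdist z C)" for n z
		have hc: "continuous_on UNIV (h n)" for n unfolding h_def[abs_def] by (intro continuous_intros)
		have zero: "(LINT x|cellm. F x * complex_of_real (h n (to_circle x))) = 0" for n
			by (rule integral_continuous_on_circle_zero[OF F hc])
		have "(%n. LINT x|cellm. F x * complex_of_real (h n (to_circle x))) ----> (LINT x|cellm. indicator V x *\<^sub>R F x)"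
		proof (rule integral_dominated_convergence[where w = "%x. norm (F x)"])
			show "(%x. F x * complex_of_real (h n (to_circle x))) \<in> borel_measurable cellm" for n
			proof (rule borel_measurable_times)
				show "(%x. complex_of_real (h n (to_circle x))) \<in> borel_measurable cellm"
					by (rule continuous_imp_measurable_on_sets_lebesgue)
						 (auto intro!: continuous_intros continuous_on_compose2[OF hc] continuous_to_circle)
			qed (use F in auto)
			show "AE x in cellm. norm (F x * complex_of_real (h n (to_circle x))) <= norm (F x)" for n
				by (auto simp: norm_mult h_def infdist_nonneg intro!: mult_left_le)
			show "AE x in cellm. (%n. F x * complex_of_real (h n (to_circle x))) ----> indicator V x *\<^sub>R F x"
			proof (rule AE_I2)
				fix x assume "x \<in> space cellm"
				then have xc: "x \<in> cell" by simp
				show "(%n. F x * complex_of_real (h n (to_circle x))) ----> indicator V x *\<^sub>R F x"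
				proof (cases "x \<in> V")
					case False
					then have "to_circle x \<in> C" using xc by (auto simp: C_def)
					then have "h n (to_circle x) = 0" for n by (simp add: h_def)
					then show ?thesis using False by simp
				next
					case True
					have "to_circle x \<notin> C"
						unfolding C_def using to_circle_inj[of x] True V(2) by blast
					then have "infdist (to_circle x) C ~= 0"
						using in_closed_iff_infdist_zero[OF compact_imp_closed[OF C(2)] C(1)] by simp
					then have pos: "0 < infdist (to_circle x) C" using infdist_nonneg[of "to_circle x" C] by linarith
					obtain m :: nat where m: "1 <= real m * infdist (to_circle x) C"
						using reals_Archimedean3[OF pos, rule_format, of 1] by (meson less_imp_le)
					have "\<forall>\<^sub>F n in sequentially. F x * complex_of_real (h n (to_circle x)) = indicator V x *\<^sub>R F x"
						using eventually_ge_at_top[of m]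
					proof eventually_elim
						case (elim n)
						then have "real m * infdist (to_circle x) C <= real n * infdist (to_circle x) C"
							using pos by (intro mult_right_mono) auto
						then show ?case using m True by (simp add: h_def)
					qed
					then show ?thesis by (rule tendsto_eventually)
				qed
			qed
			show "(%x. indicator V x *\<^sub>R F x) \<in> borel_measurable cellm"
				using F V by (intro borel_measurable_scaleR indicator_measurable_lebesgue_on') auto
		qed (use F in auto)
		then show ?thesis unfolding zero by (simp add: LIMSEQ_const_iff)
	qed
	have box_zero: "(LINT x|cellm. indicator (box a b) x *\<^sub>R F x) = 0" for a b
	proof -
		have "negligible (cell - ?Q)" unfolding cell_def by (rule negligible_frontier_interval)
		then have "AE x in lebesgue. x \<notin> cell - ?Q"
			unfolding negligible_iff_null_sets by (rule AE_not_in)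
		then have "AE x in lebesgue. x \<in> cell \<longrightarrow> x \<in> ?Q" by eventually_elim auto
		then have ae: "AE x in cellm. x \<in> ?Q" by (simp add: AE_restrict_space_iff)
		have "(LINT x|cellm. indicator (box a b) x *\<^sub>R F x) = (LINT x|cellm. indicator (box a b \<inter> ?Q) x *\<^sub>R F x)"
		proof (rule integral_cong_AE)
			show "AE x in cellm. indicator (box a b) x *\<^sub>R F x = indicator (box a b \<inter> ?Q) x *\<^sub>R F x"
				using ae by eventually_elim (simp add: indicator_def)
		qed (use F in \<open>auto intro!: borel_measurable_scaleR indicator_measurable_lebesgue_on'\<close>)
		also have "... = 0" by (rule open_zero) (auto intro: open_Int)
		finally show ?thesis .
	qed
	have ind: "integrable cellm (%x. indicator (box a b) x *\<^sub>R F x)" for a b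
		by (rule integrable_indicator_lebesgue_on[OF F(1)]) simp
	have "AE x in cellm. Re (F x) = 0"
	proof (rule AE_zero_if_box_integrals_zero)
		fix a b
		show "(LINT x|cellm. indicator (box a b) x * Re (F x)) = 0"
			using box_zero[of a b] integral_Re[OF ind[of a b]] by simp
	qed (use F in auto)
	moreover have "AE x in cellm. Im (F x) = 0"
	proof (rule AE_zero_if_box_integrals_zero)
		fix a b
		show "(LINT x|cellm. indicator (box a b) x * Im (F x)) = 0"
			using box_zero[of a b] integral_Im[OF ind[of a b]] by simp
	qed (use F in auto)
	ultimately show ?thesis by eventually_elim (simp add: complex_eq_iff)
qed

lemma fc_eq_imp_AE_eq:
	assumes "integrable cellm F" "integrable cellm G" "!!k. fc F k = fc G k"
	shows "AE x in cellm. F x = G x"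
proof -
	have "AE x in cellm. F x - G x = 0"
		using assms by (intro fc_zero_imp_AE_zero) (auto simp: fc_diff)
	then show ?thesis by eventually_elim simp
qed

subsection \<open>Square integrable fields on the torus\<close>

lemma Fatou_real:
	fixes f :: "nat => 'a => real"
	assumes f: "!!n. integrable M (f n)" "!!n x. 0 <= f n x"
		and g: "g \<in> borel_measurable M" "!!x. 0 <= g x"
		and lim: "AE x in M. (%n. f n x) ----> g x"
		and B: "\<forall>\<^sub>F n in sequentially. (LINT x|M. f n x) <= B"
	shows "integrable M g" and "(LINT x|M. g x) <= B"
proof -
	have [measurable]: "f n \<in> borel_measurable M" for n using f(1) by blast
	have "(\<integral>\<^sup>+x. ennreal (g x) \<partial>M) = (\<integral>\<^sup>+x. liminf (%n. ennreal (f n x)) \<partial>M)"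
	proof (rule nn_integral_cong_AE)
		show "AE x in M. ennreal (g x) = liminf (%n. ennreal (f n x))"
			using lim
		proof eventually_elim
			case (elim x)
			then have "(%n. ennreal (f n x)) ----> ennreal (g x)" by (rule tendsto_ennrealI)
			then show ?case by (rule lim_imp_Liminf[OF sequentially_bot, symmetric])
		qed
	qed
	also have "... <= liminf (%n. \<integral>\<^sup>+x. ennreal (f n x) \<partial>M)"
		by (rule nn_integral_liminf) simp
	also have "... <= ennreal B"
	proof (rule Liminf_le)
		show "\<forall>\<^sub>F n in sequentially. (\<integral>\<^sup>+x. ennreal (f n x) \<partial>M) <= ennreal B"
			using B by eventually_elim (use f in \<open>simp add: nn_integral_eq_integral ennreal_leI\<close>)
	qed simp
	finally have le: "(\<integral>\<^sup>+x. ennreal (g x) \<partial>M) <= ennreal B" .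
	show i: "integrable M g"
		using le g by (intro integrableI_bounded) (auto simp: le_less_trans)
	obtain n where "(LINT x|M. f n x) <= B" using B by (auto simp: eventually_sequentially)
	moreover have "0 <= (LINT x|M. f n x)" using f by (intro Bochner_Integration.integral_nonneg)
	ultimately have "0 <= B" by linarith
	then show "(LINT x|M. g x) <= B"
		using le i g by (simp add: nn_integral_eq_integral ennreal_le_iff)
qed

definition tpoly :: "(int ^ 3 => complex) => (int ^ 3) set => real ^ 3 => complex" where
	"tpoly c K x = (\<Sum>k\<in>K. c k * chr k x)"

lemma tpoly_measurable [measurable]: "tpoly c K \<in> borel_measurable cellm"
	unfolding tpoly_def[abs_def] by measurable

lemma integrable_chr: "integrable cellm (chr k)"
	by (rule cell_continuous_integral(1)[OF continuous_chr])

lemma tpoly_integrable: "integrable cellm (tpoly c K)"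
	unfolding tpoly_def[abs_def] using integrable_chr by auto

lemma fc_tpoly: "finite K ==> fc (tpoly c K) k = (if k \<in> K then c k else 0)"
	unfolding tpoly_def[abs_def]
	by (subst fc_sum) (auto simp: integrable_chr fc_cmult fc_chr if_distrib[of "%x. c _ * x"] sum.delta cong: if_cong)

lemma tpoly_sq_integral:
	assumes K: "finite K"
	shows "integrable cellm (%x. (norm (tpoly c K x))^2)"
		and "(LINT x|cellm. (norm (tpoly c K x))^2) = (2 * pi) ^ 3 * (\<Sum>k\<in>K. (norm (c k))^2)"
proof -
	show i: "integrable cellm (%x. (norm (tpoly c K x))^2)"
		unfolding tpoly_def
		by (rule cell_continuous_integral(1)) (intro continuous_intros)
	have sq: "complex_of_real ((norm (tpoly c K x))^2) = (\<Sum>k\<in>K. \<Sum>l\<in>K. (c k * cnj (c l)) * chr (k - l) x)" for x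
	proof -
		have "complex_of_real ((norm (tpoly c K x))^2) = tpoly c K x * cnj (tpoly c K x)"
			by (rule complex_norm_square)
		also have "... = (\<Sum>k\<in>K. \<Sum>l\<in>K. (c k * chr k x) * (cnj (c l) * chr (- l) x))"
			by (simp add: tpoly_def sum_product cnj_chr)
		also have "... = (\<Sum>k\<in>K. \<Sum>l\<in>K. (c k * cnj (c l)) * chr (k - l) x)"
			by (simp only: diff_conv_add_uminus chr_add) (simp add: algebra_simps)
		finally show ?thesis .
	qed
	have "complex_of_real (LINT x|cellm. (norm (tpoly c K x))^2)
			= (LINT x|cellm. complex_of_real ((norm (tpoly c K x))^2))"
		by (rule integral_complex_of_real[symmetric])
	also have "... = (\<Sum>k\<in>K. \<Sum>l\<in>K. (c k * cnj (c l)) * (LINT x|cellm. chr (k - l) x))"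
		unfolding sq using integrable_chr by (subst Bochner_Integration.integral_sum | simp)+
	also have "... = (\<Sum>k\<in>K. (c k * cnj (c k)) * of_real ((2 * pi) ^ 3))"
		using K by (intro sum.cong refl)
			(simp add: integral_chr if_distrib[of "%x. _ * x"] sum.delta' cong: if_cong)
	also have "... = complex_of_real ((2 * pi) ^ 3 * (\<Sum>k\<in>K. (norm (c k))^2))"
		by (simp only: complex_norm_square[symmetric]) (simp add: sum_distrib_right[symmetric] mult.commute)
	finally show "(LINT x|cellm. (norm (tpoly c K x))^2) = (2 * pi) ^ 3 * (\<Sum>k\<in>K. (norm (c k))^2)"
		by (simp only: of_real_eq_iff)
qed

lemma tpoly_diff:
	assumes "finite K" "L \<subseteq> K"
	shows "tpoly c K x - tpoly c L x = tpoly c (K - L) x"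
	unfolding tpoly_def using sum_diff[OF assms, of "%k. c k * chr k x"] by simp

text \<open>One half of Parseval's identity, for the error of every partial sum. As an inequality it
  passes to limits by Fatou's lemma, and it already fixes the coefficients and gives convergence of
  the partial sums in L^2.\<close>

definition L2rep :: "(real ^ 3 => complex) => (int ^ 3 => complex) => bool" where
	"L2rep F c \<longleftrightarrow> F \<in> borel_measurable cellm \<and> sq_summable c \<and>
		 (\<forall>K. finite K \<longrightarrow> integrable cellm (%x. (norm (F x - tpoly c K x))^2) \<and>
				(LINT x|cellm. (norm (F x - tpoly c K x))^2)
					<= (2 * pi) ^ 3 * ((INFSUM k. (norm (c k))^2) - (\<Sum>k\<in>K. (norm (c k))^2)))"

lemma norm_integral_le_sqrt:
	assumes F: "F \<in> borel_measurable cellm" "integrable cellm (%x. (norm (F x :: complex))^2)"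
	shows "integrable cellm F"
		and "(LINT x|cellm. norm (F x)) <= sqrt ((2 * pi) ^ 3) * sqrt (LINT x|cellm. (norm (F x))^2)"
proof -
	have m: "(%x. norm (F x)) \<in> borel_measurable cellm" using F(1) by simp
	note cs = integral_Cauchy_Schwarz[of "%x. 1" cellm "%x. norm (F x)", OF _ _ m F(2)]
	have "integrable cellm (%x. norm (F x))" using cs(1) by simp
	then show "integrable cellm F" using F(1) by (simp add: integrable_norm_iff)
	show "(LINT x|cellm. norm (F x)) <= sqrt ((2 * pi) ^ 3) * sqrt (LINT x|cellm. (norm (F x))^2)"
		using cs(2) cell_const_integral[of "1::real"] by simp
qed

text \<open>Along a subsequence of cubes whose tails are below 4^(-i) the increments have L^1 norm
  of order 2^(-i), so the partial sums converge almost everywhere; Fatou's lemma hands the tail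
  bounds to the limit.\<close>

lemma Riesz_Fischer:
	assumes c: "(%k. (norm (c k :: complex))^2) summable_on UNIV"
	shows "\<exists>F. L2rep F c"
proof -
	let ?V = "(2 * pi) ^ 3"
	define S where "S = (INFSUM k. (norm (c k))^2)"
	have fin: "(\<Sum>k\<in>K. (norm (c k))^2) <= S" if "finite K" for K
		unfolding S_def by (rule sum_le_infsum[OF c _ that]) simp
	have "(%n. \<Sum>k\<in>box3 n. (norm (c k))^2) ----> S" unfolding S_def by (rule sum_box3_tendsto[OF c])
	then have "\<exists>N. \<forall>n\<ge>N. S - (\<Sum>k\<in>box3 n. (norm (c k))^2) <= (1/4) ^ i" for i
	proof -
		have "\<forall>\<^sub>F n in sequentially. S - (1/4) ^ i < (\<Sum>k\<in>box3 n. (norm (c k))^2)"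
			by (rule order_tendstoD(1)[OF \<open>_ ----> S\<close>]) simp
		then show ?thesis unfolding eventually_sequentially by (auto intro: less_imp_le simp: algebra_simps)
	qed
	then obtain N where N: "!!i n. N i <= n ==> S - (\<Sum>k\<in>box3 n. (norm (c k))^2) <= (1/4) ^ i" by metis
	\<comment> \<open>Adding all \<open>N j\<close> up to i makes the index monotone and at least
	  \<open>N i\<close>; the summand i makes it unbounded.\<close>
	define r where "r i = i + (\<Sum>j\<le>i. N j)" for i :: nat
	have rmono: "r i <= r j" if "i <= j" for i j
		unfolding r_def using that by (intro add_mono sum_mono2) auto
	have rN: "N i <= r i" for i
		unfolding r_def using member_le_sum[of i "{..i}" N] by simp
	have ri: "i <= r i" for i unfolding r_def by simp
	define s where "s i = tpoly c (box3 (r i))" for i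
	define g where "g i x = s (Suc i) x - s i x" for i x
	have g_eq: "g i = tpoly c (box3 (r (Suc i)) - box3 (r i))" for i
		unfolding g_def[abs_def] s_def using box3_mono[OF rmono, of i "Suc i"] by (simp add: tpoly_diff finite_box3)
	have gi: "integrable cellm (g i)" for i unfolding g_eq by (rule tpoly_integrable)
	have g1: "(LINT x|cellm. norm (g i x)) <= ?V * (1/2) ^ i" for i
	proof -
		let ?K = "box3 (r (Suc i)) - box3 (r i)"
		have "(\<Sum>k\<in>?K. (norm (c k))^2) = (\<Sum>k\<in>box3 (r (Suc i)). (norm (c k))^2) - (\<Sum>k\<in>box3 (r i). (norm (c k))^2)"
			by (rule sum_diff) (auto simp: finite_box3 box3_mono rmono)
		also have "... <= S - (\<Sum>k\<in>box3 (r i). (norm (c k))^2)" using fin[OF finite_box3] by simp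
		also have "... <= (1/4) ^ i" by (rule N[OF rN])
		finally have K: "(\<Sum>k\<in>?K. (norm (c k))^2) <= (1/4) ^ i" .
		have "(LINT x|cellm. norm (g i x)) <= sqrt ?V * sqrt (LINT x|cellm. (norm (g i x))^2)"
			unfolding g_eq by (intro norm_integral_le_sqrt(2) tpoly_sq_integral(1) tpoly_measurable) (simp add: finite_box3)
		also have "... <= sqrt ?V * sqrt (?V * (1/4) ^ i)"
			unfolding g_eq using K by (subst tpoly_sq_integral(2)) (auto simp: finite_box3 intro!: mult_left_mono)
		also have "... = (sqrt ?V * sqrt ?V) * sqrt ((1/4) ^ i)" by (simp only: real_sqrt_mult mult.assoc)
		also have "sqrt ?V * sqrt ?V = ?V" by (rule real_sqrt_mult_self[THEN trans]) simp
		also have "sqrt ((1/4) ^ i) = (1/2 :: real) ^ i"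
			by (rule real_sqrt_unique) (auto simp: power_mult[symmetric] power_divide power2_eq_square power_mult_distrib[symmetric])
		finally show ?thesis .
	qed
	have ae: "AE x in cellm. summable (%i. norm (g i x))"
	proof -
		have "(\<integral>\<^sup>+x. (\<Sum>i. ennreal (norm (g i x))) \<partial>cellm) = (\<Sum>i. \<integral>\<^sup>+x. ennreal (norm (g i x)) \<partial>cellm)"
			by (rule nn_integral_suminf) (use gi in auto)
		also have "... <= (\<Sum>i. ennreal (?V * (1/2) ^ i))"
		proof (rule suminf_le)
			fix i
			have "(\<integral>\<^sup>+x. ennreal (norm (g i x)) \<partial>cellm) = ennreal (LINT x|cellm. norm (g i x))"
				using gi by (intro nn_integral_eq_integral) auto
			also have "... <= ennreal (?V * (1/2) ^ i)" using g1 by (rule ennreal_leI)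
			finally show "(\<integral>\<^sup>+x. ennreal (norm (g i x)) \<partial>cellm) <= ennreal (?V * (1/2) ^ i)" .
		qed auto
		also have "... < \<infinity>"
		proof -
			have "summable (%i. ?V * (1/2 :: real) ^ i)" by (intro summable_mult summable_geometric) simp
			then show ?thesis by (simp add: suminf_ennreal2)
		qed
		finally have "AE x in cellm. (\<Sum>i. ennreal (norm (g i x))) ~= \<infinity>"
			using gi by (intro nn_integral_noteq_infinite) (auto simp: top.not_eq_extremum)
		then show ?thesis
			by eventually_elim (auto intro!: summable_suminf_not_top simp: infinity_ennreal_def)
	qed
	define F where "F x = lim (%i. s i x)" for x
	have Fm: "F \<in> borel_measurable cellm"
		unfolding F_def[abs_def] by (rule borel_measurable_lim_metric) (simp add: s_def)
	have lim: "AE x in cellm. (%i. s i x) ----> F x"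
		using ae
	proof eventually_elim
		case (elim x)
		then have "summable (%i. g i x)" by (rule summable_norm_cancel)
		then have "convergent (%n. \<Sum>i<n. g i x)" by (simp add: summable_iff_convergent)
		moreover have "(\<Sum>i<n. g i x) = s n x - s 0 x" for n
			by (induction n) (auto simp: g_def)
		ultimately have "convergent (%n. s n x - s 0 x)" by simp
		then have "convergent (%n. s n x)" using convergent_diff_const_right_iff[of "%n. s n x" "s 0 x"] by simp
		then show ?case unfolding F_def by (simp add: convergent_LIMSEQ_iff)
	qed
	have "integrable cellm (%x. (norm (F x - tpoly c K x))^2)"
		"(LINT x|cellm. (norm (F x - tpoly c K x))^2) <= ?V * (S - (\<Sum>k\<in>K. (norm (c k))^2))"
		if K: "finite K" for K
	proof -
		have diff: "s i x - tpoly c K x = tpoly c (box3 (r i) - K) x" if "K \<subseteq> box3 (r i)" for i x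
			unfolding s_def using that by (simp add: tpoly_diff finite_box3)
		obtain m where m: "K \<subseteq> box3 m" using finite_subset_box3[OF K] by blast
		have Kr: "K \<subseteq> box3 (r (i + m))" for i
			using m box3_mono[of m "r (i + m)"] ri[of "i + m"] by auto
		have i1: "integrable cellm (%x. (norm (s (i + m) x - tpoly c K x))^2)" for i
				unfolding diff[OF Kr] by (rule tpoly_sq_integral(1)) (simp add: finite_box3)
		have l1: "AE x in cellm. (%i. (norm (s (i + m) x - tpoly c K x))^2) ----> (norm (F x - tpoly c K x))^2"
				using lim
			proof eventually_elim
				case (elim x)
				then have "(%i. s (i + m) x) ----> F x" by (rule LIMSEQ_ignore_initial_segment)
				then show ?case by (intro tendsto_power tendsto_norm tendsto_diff tendsto_const)
			qed
		have e1: "\<forall>\<^sub>F i in sequentially. (LINT x|cellm. (norm (s (i + m) x - tpoly c K x))^2) <= ?V * (S - (\<Sum>k\<in>K. (norm (c k))^2))"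
			proof (rule always_eventually, rule allI)
				fix i
				have "(\<Sum>k\<in>box3 (r (i + m)) - K. (norm (c k))^2) = (\<Sum>k\<in>box3 (r (i + m)). (norm (c k))^2) - (\<Sum>k\<in>K. (norm (c k))^2)"
					by (rule sum_diff[OF finite_box3 Kr])
				then show "(LINT x|cellm. (norm (s (i + m) x - tpoly c K x))^2) <= ?V * (S - (\<Sum>k\<in>K. (norm (c k))^2))"
					unfolding diff[OF Kr] using fin[OF finite_box3, of "r (i + m)"]
					by (subst tpoly_sq_integral(2)) (auto simp: finite_box3 intro!: mult_left_mono)
			qed
		have m1: "(%x. (norm (F x - tpoly c K x))^2) \<in> borel_measurable cellm"
			using Fm by measurable
		show "integrable cellm (%x. (norm (F x - tpoly c K x))^2)"
			by (rule Fatou_real(1)[OF i1 _ m1 _ l1 e1]) auto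
		show "(LINT x|cellm. (norm (F x - tpoly c K x))^2) <= ?V * (S - (\<Sum>k\<in>K. (norm (c k))^2))"
			by (rule Fatou_real(2)[OF i1 _ m1 _ l1 e1]) auto
	qed
	then show ?thesis using Fm c unfolding L2rep_def S_def by blast
qed

lemma L2rep_D:
	assumes "L2rep F c"
	shows "F \<in> borel_measurable cellm" and "sq_summable c"
		and "integrable cellm (%x. (norm (F x))^2)"
		and "(LINT x|cellm. (norm (F x))^2) <= (2 * pi) ^ 3 * (INFSUM k. (norm (c k))^2)"
		and "integrable cellm F"
proof -
	show 1: "F \<in> borel_measurable cellm" "sq_summable c"
		using assms unfolding L2rep_def by auto
	have "finite ({} :: (int ^ 3) set)" by simp
	then have "integrable cellm (%x. (norm (F x - tpoly c {} x))^2) \<and>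
				(LINT x|cellm. (norm (F x - tpoly c {} x))^2)
					<= (2 * pi) ^ 3 * ((INFSUM k. (norm (c k))^2) - (\<Sum>k\<in>{}. (norm (c k))^2))"
		using assms unfolding L2rep_def by blast
	then show 2: "integrable cellm (%x. (norm (F x))^2)"
		and "(LINT x|cellm. (norm (F x))^2) <= (2 * pi) ^ 3 * (INFSUM k. (norm (c k))^2)"
		by (simp_all add: tpoly_def)
	show "integrable cellm F" by (rule norm_integral_le_sqrt(1)[OF 1(1) 2])
qed

lemma L2rep_tendsto:
	assumes "L2rep F c"
	shows "(%n. LINT x|cellm. (norm (F x - tpoly c (box3 n) x))^2) ----> 0"
proof -
	let ?u = "%n. (2 * pi) ^ 3 * ((INFSUM k. (norm (c k))^2) - (\<Sum>k\<in>box3 n. (norm (c k))^2))"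
	have "?u ----> (2 * pi) ^ 3 * ((INFSUM k. (norm (c k))^2) - (INFSUM k. (norm (c k))^2))"
		by (intro tendsto_mult tendsto_const tendsto_diff sum_box3_tendsto L2rep_D(2)[OF assms])
	then have u0: "?u ----> 0" by simp
	have le: "\<forall>\<^sub>F n in sequentially. (LINT x|cellm. (norm (F x - tpoly c (box3 n) x))^2) <= ?u n"
		using assms finite_box3 unfolding L2rep_def by (intro always_eventually) blast
	show ?thesis
		by (rule real_tendsto_sandwich[OF _ le tendsto_const u0])
			 (auto intro!: always_eventually Bochner_Integration.integral_nonneg)
qed

lemma L2rep_product_tendsto:
	assumes F: "L2rep F c" and G: "G \<in> borel_measurable cellm" "integrable cellm (%x. (norm (G x :: complex))^2)"
	shows "integrable cellm (%x. F x * G x)"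
		and "(%n. fc (%x. tpoly c (box3 n) x * G x) k) ----> fc (%x. F x * G x) k"
proof -
	note [measurable] = L2rep_D(1)[OF F] G(1)
	have prod: "integrable cellm (%x. H x * G x)"
		"(LINT x|cellm. norm (H x * G x)) <= sqrt (LINT x|cellm. (norm (H x))^2) * sqrt (LINT x|cellm. (norm (G x))^2)"
		if H: "H \<in> borel_measurable cellm" "integrable cellm (%x. (norm (H x))^2)" for H :: "_ => complex"
	proof -
		note [measurable] = H(1)
		have mm: "(%x. norm (H x)) \<in> borel_measurable cellm" "(%x. norm (G x)) \<in> borel_measurable cellm"
			by measurable
		note cs = integral_Cauchy_Schwarz[OF mm(1) H(2) mm(2) G(2)]
		have "integrable cellm (%x. norm (H x * G x))" using cs(1) by (simp add: norm_mult)
		then show "integrable cellm (%x. H x * G x)" by (subst (asm) integrable_norm_iff) measurable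
		show "(LINT x|cellm. norm (H x * G x)) <= sqrt (LINT x|cellm. (norm (H x))^2) * sqrt (LINT x|cellm. (norm (G x))^2)"
			using cs(2) by (simp add: norm_mult)
	qed
	show FG: "integrable cellm (%x. F x * G x)" by (rule prod(1)[OF L2rep_D(1,3)[OF F]])
	have TG: "integrable cellm (%x. tpoly c (box3 n) x * G x)" for n
		by (rule prod(1)[OF tpoly_measurable tpoly_sq_integral(1)[OF finite_box3]])
	let ?b = "%n. sqrt (LINT x|cellm. (norm (F x - tpoly c (box3 n) x))^2) * sqrt (LINT x|cellm. (norm (G x))^2) / (2 * pi) ^ 3"
	have b: "norm (fc (%x. F x * G x) k - fc (%x. tpoly c (box3 n) x * G x) k) <= ?b n" for n
	proof -
		have D: "integrable cellm (%x. (norm (F x - tpoly c (box3 n) x))^2)"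
			using F finite_box3 unfolding L2rep_def by blast
		have eq: "(%x. F x * G x - tpoly c (box3 n) x * G x) = (%x. (F x - tpoly c (box3 n) x) * G x)"
			by (simp add: algebra_simps)
		have "fc (%x. F x * G x) k - fc (%x. tpoly c (box3 n) x * G x) k = fc (%x. (F x - tpoly c (box3 n) x) * G x) k"
			unfolding eq[symmetric] by (rule fc_diff[OF FG TG, symmetric])
		also have "norm ... <= (LINT x|cellm. norm ((F x - tpoly c (box3 n) x) * G x)) / (2 * pi) ^ 3"
			by (rule norm_fc_le[OF prod(1)[OF _ D]]) measurable
		also have "... <= ?b n"
			by (intro divide_right_mono prod(2)[OF _ D]) (auto intro!: borel_measurable_diff L2rep_D(1)[OF F])
		finally show ?thesis .
	qed
	have "(%n. ?b n) ----> sqrt 0 * sqrt (LINT x|cellm. (norm (G x))^2) / (2 * pi) ^ 3"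
		by (intro tendsto_divide tendsto_mult tendsto_const tendsto_real_sqrt L2rep_tendsto[OF F]) simp
	then have b0: "?b ----> 0" by simp
	have "(%n. fc (%x. F x * G x) k - fc (%x. tpoly c (box3 n) x * G x) k) ----> 0"
		by (rule Lim_null_comparison[OF _ b0]) (use b in auto)
	then have "(%n. fc (%x. F x * G x) k - (fc (%x. F x * G x) k - fc (%x. tpoly c (box3 n) x * G x) k)) ----> fc (%x. F x * G x) k - 0"
		by (intro tendsto_diff tendsto_const)
	then show "(%n. fc (%x. tpoly c (box3 n) x * G x) k) ----> fc (%x. F x * G x) k" by simp
qed

lemma fc_tpoly_mult:
	assumes "finite K" "integrable cellm G"
	shows "fc (%x. tpoly c K x * G x) k = (\<Sum>l\<in>K. c l * fc G (k - l))"
proof -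
	have i: "integrable cellm (%x. c l * (chr l x * G x))" for l
		using integrable_mult_chr[OF assms(2), of l] by (simp add: mult.commute)
	have "(%x. tpoly c K x * G x) = (%x. \<Sum>l\<in>K. c l * (chr l x * G x))"
		by (simp add: tpoly_def sum_distrib_right mult.assoc)
	then show ?thesis using fc_sum[of K "%l x. c l * (chr l x * G x)" k, OF i] by (simp add: fc_cmult fc_shift)
qed

lemma L2rep_fc:
	assumes F: "L2rep F c"
	shows "fc F k = c k"
proof -
	have "(%n. fc (%x. tpoly c (box3 n) x * 1) k) ----> fc (%x. F x * 1) k"
		by (rule L2rep_product_tendsto[OF F]) auto
	then have 1: "(%n. fc (tpoly c (box3 n)) k) ----> fc F k" by simp
	obtain m where "k \<in> box3 m" using ex_box3 by blast
	then have "\<forall>\<^sub>F n in sequentially. fc (tpoly c (box3 n)) k = c k"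
		unfolding eventually_sequentially fc_tpoly[OF finite_box3] using box3_mono by (intro exI[of _ m]) auto
	then have "(%n. fc (tpoly c (box3 n)) k) ----> c k" by (rule tendsto_eventually)
	then show ?thesis using 1 by (rule LIMSEQ_unique[rotated])
qed

lemma conv_summable:
	fixes c d :: "int ^ 3 => 'v::real_normed_vector"
	assumes c: "sq_summable c" and d: "sq_summable d"
	shows "(%l. norm (c l) * norm (d (k - l))) summable_on UNIV"
		and "(INFSUM l. norm (c l) * norm (d (k - l))) <= sqrt (INFSUM k. (norm (c k))^2) * sqrt (INFSUM k. (norm (d k))^2)"
proof -
	have b: "bij_betw (%l. k - l) UNIV UNIV" by (rule bij_betwI[where g = "%l. k - l"]) auto
	have d': "(%l. (norm (d (k - l)))^2) summable_on UNIV"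
		using summable_on_reindex_bij_betw[OF b, of "%l. (norm (d l))^2"] d by simp
	have e: "(INFSUM l. (norm (d (k - l)))^2) = (INFSUM l. (norm (d l))^2)"
		by (rule infsum_reindex_bij_betw[OF b])
	show "(%l. norm (c l) * norm (d (k - l))) summable_on UNIV"
		by (rule infsum_Cauchy_Schwarz(2)[OF c d'])
	show "(INFSUM l. norm (c l) * norm (d (k - l))) <= sqrt (INFSUM k. (norm (c k))^2) * sqrt (INFSUM k. (norm (d k))^2)"
		using infsum_Cauchy_Schwarz(3)[OF c d'] unfolding e by simp
qed

text \<open>The convolution theorem. Only F is approximated by trigonometric polynomials, which act
  on the coefficients of G by shifts; Cauchy-Schwarz controls the error.\<close>

lemma fc_mult:
	assumes F: "L2rep F c" and G: "L2rep G d"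
	shows "integrable cellm (%x. F x * G x)"
		and "(%l. c l * d (k - l)) summable_on UNIV"
		and "fc (%x. F x * G x) k = (INFSUM l. c l * d (k - l))"
proof -
	note GD = L2rep_D[OF G]
	show "integrable cellm (%x. F x * G x)" by (rule L2rep_product_tendsto(1)[OF F GD(1,3)])
	have "(%l. norm (c l * d (k - l))) summable_on UNIV"
		using conv_summable(1)[OF L2rep_D(2)[OF F] GD(2)] by (simp add: norm_mult)
	then show s: "(%l. c l * d (k - l)) summable_on UNIV" by (rule abs_summable_summable)
	have "(%n. fc (%x. tpoly c (box3 n) x * G x) k) ----> fc (%x. F x * G x) k"
		by (rule L2rep_product_tendsto(2)[OF F GD(1,3)])
	moreover have "fc (%x. tpoly c (box3 n) x * G x) k = (\<Sum>l\<in>box3 n. c l * d (k - l))" for n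
		using fc_tpoly_mult[OF finite_box3 GD(5)] by (simp add: L2rep_fc[OF G])
	ultimately show "fc (%x. F x * G x) k = (INFSUM l. c l * d (k - l))"
		using sum_box3_tendsto[OF s] LIMSEQ_unique by simp blast
qed

lemma L2rep_AE_cong:
	assumes F: "L2rep F c" and G: "G \<in> borel_measurable cellm" and ae: "AE x in cellm. F x = G x"
	shows "L2rep G c"
proof -
	note [measurable] = L2rep_D(1)[OF F] G
	have "integrable cellm (%x. (norm (G x - tpoly c K x))^2) = integrable cellm (%x. (norm (F x - tpoly c K x))^2)" for K
		by (rule integrable_cong_AE) (use ae in \<open>auto elim: eventually_mono\<close>)
	moreover have "(LINT x|cellm. (norm (G x - tpoly c K x))^2) = (LINT x|cellm. (norm (F x - tpoly c K x))^2)" for K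
		by (rule integral_cong_AE) (use ae in \<open>auto elim: eventually_mono\<close>)
	ultimately show ?thesis using F G unfolding L2rep_def by simp
qed

section \<open>Square integrable vector fields and their cross product\<close>

definition ccross :: "complex ^ 3 => complex ^ 3 => complex ^ 3" where
	"ccross a b = vector [a $ 2 * b $ 3 - a $ 3 * b $ 2, a $ 3 * b $ 1 - a $ 1 * b $ 3, a $ 1 * b $ 2 - a $ 2 * b $ 1]"

lemma ccross_nth [simp]:
	"ccross a b $ 1 = a $ 2 * b $ 3 - a $ 3 * b $ 2"
	"ccross a b $ 2 = a $ 3 * b $ 1 - a $ 1 * b $ 3"
	"ccross a b $ 3 = a $ 1 * b $ 2 - a $ 2 * b $ 1"
	by (simp_all add: ccross_def vector_3)

lemma cross3_nth [simp]:
	"cross3 a b $ 1 = a $ 2 * b $ 3 - a $ 3 * b $ 2"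
	"cross3 a b $ 2 = a $ 3 * b $ 1 - a $ 1 * b $ 3"
	"cross3 a b $ 3 = a $ 1 * b $ 2 - a $ 2 * b $ 1"
	by (simp_all add: cross3_def vector_3)

lemma norm_ccross_le: "norm (ccross a b) <= 6 * norm a * norm b"
proof -
	have n: "norm (a $ i) <= norm a" "norm (b $ i) <= norm b" for i
		by (rule Finite_Cartesian_Product.norm_nth_le)+
	have d: "norm (a $ i * b $ j - a $ i' * b $ j') <= 2 * (norm a * norm b)" for i j i' j'
	proof -
		have "norm (a $ i * b $ j - a $ i' * b $ j') <= norm (a $ i) * norm (b $ j) + norm (a $ i') * norm (b $ j')"
			by (rule order_trans[OF norm_triangle_ineq4]) (simp add: norm_mult)
		also have "... <= norm a * norm b + norm a * norm b" using n by (intro add_mono mult_mono) auto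
		finally show ?thesis by simp
	qed
	have "norm (ccross a b) <= (\<Sum>i\<in>UNIV. norm (ccross a b $ i))"
		unfolding norm_vec_def by (rule L2_set_le_sum) simp
	also have "... <= 2 * (norm a * norm b) + 2 * (norm a * norm b) + 2 * (norm a * norm b)"
		unfolding sum_3 ccross_nth by (intro add_mono d)
	finally show ?thesis by (simp add: mult.assoc)
qed

lemma norm_cross3_le: "norm (cross3 x y) <= norm x * norm y"
proof (rule power2_le_imp_le)
	show "(norm (cross3 x y))^2 <= (norm x * norm y)^2"
		using norm_cross[of x y] zero_le_power2[of "x \<bullet> y"] unfolding power_mult_distrib by linarith
qed simp

definition l2_field :: "vfield => bool" where
	"l2_field v \<longleftrightarrow> (\<forall>k. v (- k) = cnj_vec (v k)) \<and> sq_summable v"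

definition l2_norm :: "vfield => real" where
	"l2_norm v = sqrt (INFSUM k. (norm (v k))^2)"

lemma l2_norm_nonneg: "0 <= l2_norm v"
	by (simp add: l2_norm_def infsum_nonneg)

lemma l2_norm_sq: "(l2_norm v)^2 = (INFSUM k. (norm (v k))^2)"
	by (simp add: l2_norm_def infsum_nonneg)

lemma norm_vec_sq: "(norm v)^2 = (\<Sum>j\<in>UNIV. (norm (v $ j))^2)" for v :: "('a::real_normed_vector) ^ 3"
	by (simp add: norm_vec_def L2_set_def sum_nonneg)

lemma norm_component_sq_le: "(norm (v $ j))^2 <= (norm v)^2" for v :: "('a::real_normed_vector) ^ 3"
	by (intro power_mono Finite_Cartesian_Product.norm_nth_le) simp

lemma l2_field_component:
	"l2_field v ==> (%k. (norm (v k $ j))^2) summable_on UNIV"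
	unfolding l2_field_def
	by (elim conjE, erule summable_on_comparison_real) (simp add: norm_component_sq_le)

lemma l2_field_diff: "l2_field u ==> l2_field v ==> l2_field (u - v)"
	using wsum_diff(1)[of "%_. 1" u v] by (auto simp: l2_field_def cnj_vec_def vec_eq_iff)

lemma fourier_nth: "fourier F k $ j = fc (%x. of_real (F x $ j)) k"
	by (simp add: fourier_def fc_def chr_def wave_uminus scaleR_conv_of_real)

lemma integrable_vec3:
	fixes F :: "'a => real ^ 3"
	shows "integrable M F \<longleftrightarrow> (\<forall>j. integrable M (%x. F x $ j))"
proof
	assume "integrable M F"
	then show "\<forall>j. integrable M (%x. F x $ j)"
		using integrable_bounded_linear[OF bounded_linear_vec_nth] by blast
next
	assume *: "\<forall>j. integrable M (%x. F x $ j)"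
	have "F = (%x. \<Sum>j\<in>UNIV. F x $ j *\<^sub>R axis j 1)"
		by (auto simp: fun_eq_iff vec_eq_iff axis_def if_distrib[of "%c. _ * c"] cong: if_cong)
	moreover have "integrable M (%x. \<Sum>j\<in>UNIV. F x $ j *\<^sub>R (axis j 1 :: real ^ 3))"
		using * by (intro Bochner_Integration.integrable_sum integrable_scaleR_left) auto
	ultimately show "integrable M F" by simp
qed

lemma L1_torus_components: "F \<in> L1_torus \<longleftrightarrow> (\<forall>j. integrable cellm (%x. F x $ j))"
	by (simp add: L1_torus_def integrable_vec3)

lemma fourier_eq_imp_AE_eq:
	assumes "F \<in> L1_torus" "G \<in> L1_torus" "fourier F = fourier G"
	shows "AE x in cellm. F x = G x"
proof -
	have "AE x in cellm. complex_of_real (F x $ j) = complex_of_real (G x $ j)" for j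
		using assms by (intro fc_eq_imp_AE_eq) (auto simp: L1_torus_components fourier_nth[symmetric] intro!: integrable_of_real)
	then have "AE x in cellm. \<forall>j\<in>UNIV. complex_of_real (F x $ j) = complex_of_real (G x $ j)"
		by (subst AE_ball_countable) auto
	then show ?thesis by eventually_elim (simp add: vec_eq_iff)
qed

text \<open>\<open>fun_of\<close> is a choice among all integrable functions with the given
  coefficients, so its properties must be transferred. The Riesz-Fischer function is real almost
  everywhere because its conjugate has the same coefficients, and uniqueness of coefficients
  identifies it with the chosen function.\<close>

lemma fun_of_l2_field:
	assumes v: "l2_field v"
	shows "is_L1_field v" and "fun_of v \<in> L1_torus" and "fourier (fun_of v) = v"
		and "L2rep (%x. of_real (fun_of v x $ j)) (%k. v k $ j)"
proof -
	have "\<exists>F. L2rep F (%k. v k $ j)" for j by (rule Riesz_Fischer[OF l2_field_component[OF v]])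
	then obtain F where F: "!!j. L2rep (F j) (%k. v k $ j)" by metis
	note FD = L2rep_D[OF F]
	have real: "AE x in cellm. F j x = cnj (F j x)" for j
	proof (rule fc_eq_imp_AE_eq)
		show "integrable cellm (F j)" by (rule FD(5))
		then show "integrable cellm (%x. cnj (F j x))" by (rule integrable_bounded_linear[OF bounded_linear_cnj])
		show "fc (F j) k = fc (%x. cnj (F j x)) k" for k
			using v by (simp add: fc_cnj[OF FD(5)] L2rep_fc[OF F] l2_field_def cnj_vec_def)
	qed
	define R where "R x = (\<chi> j. Re (F j x))" for x
	have Rm: "(%x. complex_of_real (R x $ j)) \<in> borel_measurable cellm" for j
		using FD(1)[of j] by (simp add: R_def)
	have RF: "AE x in cellm. F j x = complex_of_real (R x $ j)" for j
		using real[of j] by eventually_elim (simp add: R_def complex_eq_iff)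
	have R: "L2rep (%x. complex_of_real (R x $ j)) (%k. v k $ j)" for j
		by (rule L2rep_AE_cong[OF F Rm RF])
	have RL1: "R \<in> L1_torus"
		unfolding L1_torus_components using integrable_Re[OF L2rep_D(5)[OF R]] by simp
	have Rv: "fourier R = v"
		by (simp add: fun_eq_iff vec_eq_iff fourier_nth L2rep_fc[OF R])
	show "is_L1_field v" unfolding is_L1_field_def using RL1 Rv by blast
	have ex: "\<exists>F. F \<in> L1_torus \<and> fourier F = v" using RL1 Rv by blast
	then show U: "fun_of v \<in> L1_torus" and Uv: "fourier (fun_of v) = v"
		unfolding fun_of_def by (metis (mono_tags, lifting) someI_ex)+
	have ae: "AE x in cellm. R x = fun_of v x"
		by (rule fourier_eq_imp_AE_eq[OF RL1 U]) (simp add: Rv Uv)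
	show "L2rep (%x. of_real (fun_of v x $ j)) (%k. v k $ j)"
	proof (rule L2rep_AE_cong[OF R])
		have "integrable cellm (%x. fun_of v x $ j)" using U by (simp add: L1_torus_components)
		then show "(%x. complex_of_real (fun_of v x $ j)) \<in> borel_measurable cellm"
			by (rule borel_measurable_integrable[OF integrable_of_real])
		show "AE x in cellm. complex_of_real (R x $ j) = complex_of_real (fun_of v x $ j)"
			using ae by eventually_elim simp
	qed
qed

lemma infsum_vec_nth:
	fixes f :: "'a => complex ^ 3"
	assumes "f summable_on A"
	shows "infsum f A $ j = infsum (%x. f x $ j) A"
	using infsumI[OF has_sum_bounded_linear[OF bounded_linear_vec_nth has_sum_infsum[OF assms]]] by simp

lemma infsum_minus:
	fixes f g :: "'a => 'b::real_normed_vector"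
	assumes f: "f summable_on A" and g: "g summable_on A"
	shows "infsum (%x. f x - g x) A = infsum f A - infsum g A"
proof -
	have "((%x. f x + (- g x)) has_sum (infsum f A + - infsum g A)) A"
		by (intro has_sum_add has_sum_infsum[OF f]
				has_sum_bounded_linear[OF bounded_linear_minus[OF bounded_linear_ident] has_sum_infsum[OF g]])
	then show ?thesis using infsumI by simp blast
qed

lemma ccross_conv_summable:
	fixes u v :: vfield
	assumes u: "sq_summable u" and v: "sq_summable v"
	shows "(%l. norm (ccross (u l) (v (k - l)))) summable_on UNIV" and "(%l. ccross (u l) (v (k - l))) summable_on UNIV"
proof -
	have s: "(%l. 6 * (norm (u l) * norm (v (k - l)))) summable_on UNIV"
		by (rule summable_on_cmult_right[OF conv_summable(1)[OF u v]])
	show "(%l. norm (ccross (u l) (v (k - l)))) summable_on UNIV"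
		by (rule summable_on_comparison_real[OF s]) (use norm_ccross_le in \<open>auto simp: mult.assoc\<close>)
	then show "(%l. ccross (u l) (v (k - l))) summable_on UNIV" by (rule abs_summable_summable)
qed

lemma cross_field_l2:
	assumes u: "l2_field u" and v: "l2_field v"
	shows "cross_fun u v \<in> L1_torus"
		and "cross_field u v k = (INFSUM l. ccross (u l) (v (k - l)))"
proof -
	note U = fun_of_l2_field(4)[OF u] and V = fun_of_l2_field(4)[OF v]
	have prodc: "integrable cellm (%x. complex_of_real (fun_of u x $ i) * complex_of_real (fun_of v x $ j))" for i j
		by (rule fc_mult(1)[OF U V])
	have prod: "integrable cellm (%x. fun_of u x $ i * fun_of v x $ j)" for i j
		using integrable_Re[OF prodc[of i j]] by simp
	show L1: "cross_fun u v \<in> L1_torus"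
		unfolding L1_torus_components forall_3 cross_fun_def cross3_nth
		using prod by (intro conjI Bochner_Integration.integrable_diff) auto
	have fcp: "fc (%x. complex_of_real (fun_of u x $ i * fun_of v x $ j - fun_of u x $ i' * fun_of v x $ j')) k
		 = (INFSUM l. u l $ i * v (k - l) $ j - u l $ i' * v (k - l) $ j')" for i j i' j'
	proof -
		have "fc (%x. complex_of_real (fun_of u x $ i * fun_of v x $ j - fun_of u x $ i' * fun_of v x $ j')) k
			= fc (%x. complex_of_real (fun_of u x $ i) * complex_of_real (fun_of v x $ j)) k
			- fc (%x. complex_of_real (fun_of u x $ i') * complex_of_real (fun_of v x $ j')) k"
			by (subst fc_diff[OF prodc prodc, symmetric]) simp
		also have "... = (INFSUM l. u l $ i * v (k - l) $ j) - (INFSUM l. u l $ i' * v (k - l) $ j')"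
			by (simp only: fc_mult(3)[OF U V])
		also have "... = (INFSUM l. u l $ i * v (k - l) $ j - u l $ i' * v (k - l) $ j')"
			by (rule infsum_minus[symmetric]; rule fc_mult(2)[OF U V])
		finally show ?thesis .
	qed
	have s: "(%l. ccross (u l) (v (k - l))) summable_on UNIV"
		using u v by (intro ccross_conv_summable(2)) (auto simp: l2_field_def)
	have "\<forall>j. cross_field u v k $ j = (INFSUM l. ccross (u l) (v (k - l))) $ j"
		unfolding forall_3 infsum_vec_nth[OF s] cross_field_def fourier_nth cross_fun_def cross3_nth ccross_nth fcp by simp
	then show "cross_field u v k = (INFSUM l. ccross (u l) (v (k - l)))" by (simp add: vec_eq_iff)
qed

lemma fun_of_sq:
	assumes v: "l2_field v"
	shows "fun_of v \<in> borel_measurable cellm" and "integrable cellm (%x. (norm (fun_of v x))^2)"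
		and "sqrt (LINT x|cellm. (norm (fun_of v x))^2) <= sqrt ((2 * pi) ^ 3) * l2_norm v"
proof -
	note VD = L2rep_D[OF fun_of_l2_field(4)[OF v]]
	show "fun_of v \<in> borel_measurable cellm"
		using fun_of_l2_field(2)[OF v] by (auto simp: L1_torus_def)
	have i: "integrable cellm (%x. (norm (fun_of v x $ j))^2)" for j using VD(3)[of j] by simp
	then show "integrable cellm (%x. (norm (fun_of v x))^2)"
		unfolding norm_vec_sq by (intro Bochner_Integration.integrable_sum)
	have "(LINT x|cellm. (norm (fun_of v x))^2) = (\<Sum>j\<in>UNIV. LINT x|cellm. (norm (fun_of v x $ j))^2)"
		unfolding norm_vec_sq by (rule Bochner_Integration.integral_sum) (rule i)
	also have "... <= (\<Sum>j\<in>UNIV. (2 * pi) ^ 3 * (INFSUM k. (norm (v k $ j))^2))"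
		using VD(4) by (intro sum_mono) simp
	also have "... = (2 * pi) ^ 3 * (\<Sum>j\<in>UNIV. (INFSUM k. (norm (v k $ j))^2))" by (simp only: sum_distrib_left)
	also have "(\<Sum>j\<in>UNIV. (INFSUM k. (norm (v k $ j))^2)) = (INFSUM k. (norm (v k))^2)"
		unfolding norm_vec_sq sum_3 using l2_field_component[OF v]
		by (simp only: infsum_add summable_on_add)
	also have "... = (l2_norm v)^2" by (rule l2_norm_sq[symmetric])
	finally have "sqrt (LINT x|cellm. (norm (fun_of v x))^2) <= sqrt ((2 * pi) ^ 3 * (l2_norm v)^2)"
		by (rule real_sqrt_le_mono)
	then show "sqrt (LINT x|cellm. (norm (fun_of v x))^2) <= sqrt ((2 * pi) ^ 3) * l2_norm v"
		by (simp only: real_sqrt_mult real_sqrt_abs abs_of_nonneg[OF l2_norm_nonneg])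
qed

lemma cross3_L1_bound:
	assumes u: "l2_field u" and v: "l2_field v"
	shows "integrable cellm (%x. norm (cross3 (fun_of u x) (fun_of v x)))"
		and "(LINT x|cellm. norm (cross3 (fun_of u x) (fun_of v x))) <= (2 * pi) ^ 3 * l2_norm u * l2_norm v"
proof -
	note U = fun_of_sq[OF u] and V = fun_of_sq[OF v]
	have nm: "(%x. norm (fun_of u x)) \<in> borel_measurable cellm" "(%x. norm (fun_of v x)) \<in> borel_measurable cellm"
		using U(1) V(1) by simp_all
	note cs = integral_Cauchy_Schwarz[OF nm(1) U(2) nm(2) V(2)]
	show i: "integrable cellm (%x. norm (cross3 (fun_of u x) (fun_of v x)))"
		using cross_field_l2(1)[OF u v] by (simp add: L1_torus_def cross_fun_def[abs_def])
	have "(LINT x|cellm. norm (cross3 (fun_of u x) (fun_of v x))) <= (LINT x|cellm. \<bar>norm (fun_of u x) * norm (fun_of v x)\<bar>)"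
		by (rule integral_mono[OF i]) (use cs(1) norm_cross3_le in \<open>auto simp: abs_mult\<close>)
	also have "... <= sqrt (LINT x|cellm. (norm (fun_of u x))^2) * sqrt (LINT x|cellm. (norm (fun_of v x))^2)"
		by (rule cs(2))
	also have "... <= (sqrt ((2 * pi) ^ 3) * l2_norm u) * (sqrt ((2 * pi) ^ 3) * l2_norm v)"
		by (intro mult_mono U(3) V(3)) (auto intro!: mult_nonneg_nonneg l2_norm_nonneg Bochner_Integration.integral_nonneg)
	also have "... = (sqrt ((2 * pi) ^ 3) * sqrt ((2 * pi) ^ 3)) * l2_norm u * l2_norm v"
		by (simp only: mult_ac)
	also have "sqrt ((2 * pi) ^ 3) * sqrt ((2 * pi) ^ 3) = (2 * pi) ^ 3" by (rule real_sqrt_mult_self[THEN trans]) simp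
	finally show "(LINT x|cellm. norm (cross3 (fun_of u x) (fun_of v x))) <= (2 * pi) ^ 3 * l2_norm u * l2_norm v" .
qed

lemma L1_norm_cross_fun:
	assumes "l2_field u" "l2_field v"
	shows "L1_norm (cross_fun u v) <= (2 * pi) ^ 3 * l2_norm u * l2_norm v"
	using cross3_L1_bound(2)[OF assms] by (simp add: L1_norm_def cross_fun_def)

lemma fun_of_diff:
	assumes u: "l2_field u" and v: "l2_field v"
	shows "AE x in cellm. fun_of (u - v) x = fun_of u x - fun_of v x"
proof (rule fourier_eq_imp_AE_eq)
	have U: "integrable cellm (%x. complex_of_real (fun_of u x $ j))" for j
		by (rule L2rep_D(5)[OF fun_of_l2_field(4)[OF u]])
	have V: "integrable cellm (%x. complex_of_real (fun_of v x $ j))" for j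
		by (rule L2rep_D(5)[OF fun_of_l2_field(4)[OF v]])
	show "fun_of (u - v) \<in> L1_torus" by (rule fun_of_l2_field(2)[OF l2_field_diff[OF u v]])
	show "(%x. fun_of u x - fun_of v x) \<in> L1_torus"
		using fun_of_l2_field(2)[OF u] fun_of_l2_field(2)[OF v] by (simp add: L1_torus_def)
	have "fourier (%x. fun_of u x - fun_of v x) = fourier (fun_of u) - fourier (fun_of v)"
		using fc_diff[OF U V] by (simp add: fun_eq_iff vec_eq_iff fourier_nth)
	then show "fourier (fun_of (u - v)) = fourier (%x. fun_of u x - fun_of v x)"
		by (simp add: fun_of_l2_field(3) u v l2_field_diff)
qed

text \<open>Bilinearity in the form u x v - u' x v' = (u - u') x v + u' x (v - v'). It provides the
  continuity by which approximations are pushed through the product.\<close>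

lemma L1_norm_cross_fun_diff:
	assumes u: "l2_field u" "l2_field u'" and v: "l2_field v" "l2_field v'"
	shows "L1_norm (cross_fun u v - cross_fun u' v')
		 <= (2 * pi) ^ 3 * (l2_norm (u - u') * l2_norm v + l2_norm u' * l2_norm (v - v'))"
proof -
	note du = l2_field_diff[OF u] and dv = l2_field_diff[OF v]
	have c1: "cross_fun u v \<in> L1_torus" "cross_fun u' v' \<in> L1_torus"
		by (rule cross_field_l2(1)[OF u(1) v(1)], rule cross_field_l2(1)[OF u(2) v(2)])
	have "L1_norm (cross_fun u v - cross_fun u' v')
		<= (LINT x|cellm. norm (cross3 (fun_of (u - u') x) (fun_of v x)) + norm (cross3 (fun_of u' x) (fun_of (v - v') x)))"
		unfolding L1_norm_def
	proof (rule integral_mono_AE)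
		show "integrable cellm (%x. norm ((cross_fun u v - cross_fun u' v') x))"
			using c1 by (simp add: L1_torus_def)
		show "integrable cellm (%x. norm (cross3 (fun_of (u - u') x) (fun_of v x)) + norm (cross3 (fun_of u' x) (fun_of (v - v') x)))"
			by (intro Bochner_Integration.integrable_add cross3_L1_bound(1) du dv u v)
		show "AE x in cellm. norm ((cross_fun u v - cross_fun u' v') x)
			 <= norm (cross3 (fun_of (u - u') x) (fun_of v x)) + norm (cross3 (fun_of u' x) (fun_of (v - v') x))"
			using fun_of_diff[OF u] fun_of_diff[OF v]
		proof eventually_elim
			case (elim x)
			have "(cross_fun u v - cross_fun u' v') x = cross3 (fun_of (u - u') x) (fun_of v x) + cross3 (fun_of u' x) (fun_of (v - v') x)"
				unfolding elim by (simp add: cross_fun_def vec_eq_iff forall_3 algebra_simps)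
			then show ?case by (simp add: norm_triangle_ineq)
		qed
	qed
	also have "... = (LINT x|cellm. norm (cross3 (fun_of (u - u') x) (fun_of v x))) + (LINT x|cellm. norm (cross3 (fun_of u' x) (fun_of (v - v') x)))"
		by (intro Bochner_Integration.integral_add cross3_L1_bound(1) du dv u v)
	also have "... <= (2 * pi) ^ 3 * l2_norm (u - u') * l2_norm v + (2 * pi) ^ 3 * l2_norm u' * l2_norm (v - v')"
		by (intro add_mono cross3_L1_bound(2) du dv u v)
	finally show ?thesis by (simp only: distrib_left mult.assoc)
qed

subsection \<open>Fourier coefficients of smooth test fields\<close>

lemma prim_eq_integral:
	fixes \<rho> :: "real => 'a::euclidean_space"
	assumes c: "continuous_on {0..T} \<rho>" and t: "0 <= t" "t <= T"
	shows "prim T \<rho> t = integral {0..t} \<rho>"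
proof -
	have c': "continuous_on {0..t} \<rho>" using c t by (auto intro: continuous_on_subset)
	have "prim T \<rho> t = (LINT s|lebesgue_on {0..t}. \<rho> s)"
		unfolding prim_def using t
		by (subst (1 2) integral_restrict_space)
			 (auto intro!: Bochner_Integration.integral_cong simp: indicator_def)
	also have "... = integral {0..t} \<rho>"
		using continuous_imp_integrable_real[OF c'] by (intro lebesgue_integral_eq_integral) auto
	finally show ?thesis .
qed

lemma C_k_on_cong:
	"(!!p. p \<in> S ==> f p = g p) ==> C_k_on n S f ==> C_k_on n S g"
proof (cases n)
	case 0
	assume "!!p. p \<in> S ==> f p = g p" "C_k_on n S f"
	then show ?thesis using 0 by (auto cong: continuous_on_cong)
next
	case (Suc m)
	assume eq: "!!p. p \<in> S ==> f p = g p" and "C_k_on n S f"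
	then obtain f' where f': "!!p. p \<in> S ==> (f has_derivative f' p) (at p within S)" "\<forall>h. C_k_on m S (%p. f' p h)"
		unfolding Suc by auto
	have "(g has_derivative f' p) (at p within S)" if "p \<in> S" for p
		by (rule has_derivative_transform[OF that _ f'(1)[OF that]]) (simp add: eq)
	then show ?thesis unfolding Suc using f'(2) by auto
qed

abbreviation strip :: "real => (real \<times> (real ^ 3)) set" where
	"strip T \<equiv> {0..T} \<times> UNIV"

text \<open>The strip is closed in time, so uniqueness needs small admissible increments in every
  coordinate direction; in time they point away from the nearer end of the interval.\<close>

lemma strip_derivative_unique:
	fixes f :: "real \<times> (real ^ 3) => 'b::real_normed_vector"
	assumes T: "0 < T" and p: "p \<in> strip T"
		and "(f has_derivative f') (at p within strip T)" "(f has_derivative f'') (at p within strip T)"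
	shows "f' = f''"
proof (rule frechet_derivative_unique_within[OF assms(3,4)])
	fix i :: "real \<times> (real ^ 3)" and e :: real
	assume i: "i \<in> Basis" and e: "0 < e"
	obtain t x where px: "p = (t, x)" and t: "0 <= t" "t <= T" using p by (cases p) auto
	show "\<exists>d. 0 < \<bar>d\<bar> \<and> \<bar>d\<bar> < e \<and> p + d *\<^sub>R i \<in> strip T"
	proof (cases "fst i = 0")
		case True
		then show ?thesis using e px t by (intro exI[of _ "e / 2"]) (cases i, auto)
	next
		case False
		then have i1: "fst i = 1" using i by (auto simp: Basis_prod_def)
		define d where "d = min (e / 2) (T / 2)"
		have d: "0 < d" "d < e" "d <= T / 2" using e T by (auto simp: d_def)
		show ?thesis
		proof (cases "t <= T / 2")
			case True
			then show ?thesis using d px t i1 by (intro exI[of _ d]) (cases i, auto)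
		next
			case False
			then show ?thesis using d px t i1 by (intro exI[of _ "- d"]) (cases i, auto)
		qed
	qed
qed

definition periodic_smooth :: "real => (real \<times> (real ^ 3) => real ^ 3) => bool" where
	"periodic_smooth T \<psi> \<longleftrightarrow> smooth_on (strip T) \<psi> \<and>
		 (\<forall>t\<in>{0..T}. \<forall>x j. \<psi> (t, x + (2 * pi) *\<^sub>R axis j 1) = \<psi> (t, x))"

text \<open>\<open>C_k_on\<close> supplies a derivative for each order separately. Uniqueness on the
  strip identifies them, so one derivative is smooth to all orders, and by the same uniqueness it
  inherits the periods.\<close>

lemma periodic_smooth_derivative:
	assumes T: "0 < T" and \<psi>: "periodic_smooth T \<psi>"
	obtains f' where "!!p. p \<in> strip T ==> (\<psi> has_derivative f' p) (at p within strip T)"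
		and "!!h. periodic_smooth T (%p. f' p h)"
proof -
	have C: "C_k_on n (strip T) \<psi>" for n using \<psi> by (simp add: periodic_smooth_def smooth_on_def)
	obtain f' where f': "!!p. p \<in> strip T ==> (\<psi> has_derivative f' p) (at p within strip T)"
		using C[of "Suc 0"] by auto
	have sm: "smooth_on (strip T) (%p. f' p h)" for h
		unfolding smooth_on_def
	proof
		fix n
		obtain g' where g': "!!p. p \<in> strip T ==> (\<psi> has_derivative g' p) (at p within strip T)"
			and Cg: "!!h. C_k_on n (strip T) (%p. g' p h)"
			using C[of "Suc n"] by auto
		have "g' p = f' p" if "p \<in> strip T" for p
			by (rule strip_derivative_unique[OF T that g'[OF that] f'[OF that]])
		then show "C_k_on n (strip T) (%p. f' p h)" by (intro C_k_on_cong[OF _ Cg[of h]]) simp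
	qed
	have per: "f' (t, x + (2 * pi) *\<^sub>R axis j 1) = f' (t, x)" if t: "t \<in> {0..T}" for t x j
	proof -
		let ?c = "(0, (2 * pi) *\<^sub>R axis j 1) :: real \<times> (real ^ 3)"
		let ?p = "(t, x)"
		have p: "?p \<in> strip T" "?p + ?c \<in> strip T" using t by auto
		have im: "(%p. p + ?c) ` strip T \<subseteq> strip T" by auto
		have "((%p. p + ?c) has_derivative (%h. h)) (at ?p within strip T)"
			by (auto intro!: derivative_eq_intros)
		moreover have "(\<psi> has_derivative f' (?p + ?c)) (at (?p + ?c) within (%p. p + ?c) ` strip T)"
			by (rule has_derivative_subset[OF f'[OF p(2)] im])
		ultimately have "((%p. \<psi> (p + ?c)) has_derivative (%h. f' (?p + ?c) h)) (at ?p within strip T)"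
			by (rule has_derivative_in_compose)
		then have "(\<psi> has_derivative f' (?p + ?c)) (at ?p within strip T)"
			by (rule has_derivative_transform[OF p(1), rotated]) (use \<psi> in \<open>auto simp: periodic_smooth_def\<close>)
		then show ?thesis using strip_derivative_unique[OF T p(1) _ f'[OF p(1)]] by simp
	qed
	show ?thesis
		by (rule that[of f', OF f']) (use sm per in \<open>auto simp: periodic_smooth_def\<close>)
qed

lemma periodic_smooth_continuous: "periodic_smooth T \<psi> ==> continuous_on (strip T) \<psi>"
	using C_k_on_continuous unfolding periodic_smooth_def smooth_on_def by blast

lemma periodic_smooth_continuous_x:
	assumes "periodic_smooth T \<psi>" "t \<in> {0..T}"
	shows "continuous_on UNIV (%x. \<psi> (t, x))"
	by (rule continuous_on_compose2[OF periodic_smooth_continuous[OF assms(1)]])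
		 (use assms(2) in \<open>auto intro!: continuous_intros\<close>)

lemma fourier_eq_cell_integral:
	assumes "periodic_smooth T \<psi>" "t \<in> {0..T}"
	shows "fourier (%x. \<psi> (t, x)) k $ l = integral cell (%x. of_real (\<psi> (t, x) $ l) * chr (- k) x) / of_real ((2 * pi) ^ 3)"
proof -
	have "continuous_on cell (%x. complex_of_real (\<psi> (t, x) $ l) * chr (- k) x)"
		by (intro continuous_intros continuous_on_subset[OF periodic_smooth_continuous_x[OF assms]]) auto
	from cell_continuous_integral(2)[OF this] show ?thesis by (simp add: fourier_nth fc_def)
qed

lemma periodic_smooth_fourier_bounded:
	assumes \<psi>: "periodic_smooth T \<psi>"
	shows "\<exists>C\<ge>0. \<forall>t\<in>{0..T}. \<forall>k. norm (fourier (%x. \<psi> (t, x)) k) <= C"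
proof -
	have "compact (\<psi> ` ({0..T} \<times> cell))"
		by (rule compact_continuous_image[OF continuous_on_subset[OF periodic_smooth_continuous[OF \<psi>]]])
			 (auto intro!: compact_Times simp: cell_def)
	then have "bounded (\<psi> ` ({0..T} \<times> cell))" by (rule compact_imp_bounded)
	then obtain B where "\<forall>y\<in>\<psi> ` ({0..T} \<times> cell). norm y <= B" unfolding bounded_iff by blast
	then have B: "norm (\<psi> (t, x)) <= B" if "t \<in> {0..T}" "x \<in> cell" for t x using that by blast
	have "norm (fourier (%x. \<psi> (t, x)) k) <= \<bar>3 * B\<bar>" if t: "t \<in> {0..T}" for t k
	proof -
		have comp: "norm (fourier (%x. \<psi> (t, x)) k $ l) <= B" for l
		proof -
			have c: "continuous_on cell (%x. complex_of_real (\<psi> (t, x) $ l))"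
				by (intro continuous_intros continuous_on_subset[OF periodic_smooth_continuous_x[OF \<psi> t]]) auto
			note i = cell_continuous_integral(1)[OF c]
			have "norm (fourier (%x. \<psi> (t, x)) k $ l) <= (LINT x|cellm. norm (complex_of_real (\<psi> (t, x) $ l))) / (2 * pi) ^ 3"
				unfolding fourier_nth by (rule norm_fc_le[OF i])
			also have "(LINT x|cellm. norm (complex_of_real (\<psi> (t, x) $ l))) <= (LINT x|cellm. B)"
			proof (rule integral_mono)
				fix x assume "x \<in> space cellm"
				then have "norm (\<psi> (t, x)) <= B" using B[OF t] by simp
				moreover have "\<bar>\<psi> (t, x) $ l\<bar> <= norm (\<psi> (t, x))" by (rule component_le_norm_cart)
				ultimately show "norm (complex_of_real (\<psi> (t, x) $ l)) <= B" by simp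
			qed (use integrable_norm[OF i] in auto)
			also have "(LINT x|cellm. B) = (2 * pi) ^ 3 * B" using cell_const_integral[of B] by simp
			finally show ?thesis by (simp add: divide_right_mono)
		qed
		have "norm (fourier (%x. \<psi> (t, x)) k) <= (\<Sum>l\<in>UNIV. norm (fourier (%x. \<psi> (t, x)) k $ l))"
			unfolding norm_vec_def by (rule L2_set_le_sum) simp
		also have "... <= B + B + B" unfolding sum_3 by (intro add_mono comp)
		finally show ?thesis by linarith
	qed
	then show ?thesis by (intro exI[of _ "\<bar>3 * B\<bar>"]) auto
qed

text \<open>The derivative in direction j of \<psi> times a character integrates to zero over the
  cell; the product rule splits this into the two sides.\<close>

lemma fourier_partial_derivative:
	assumes T: "0 < T" and \<psi>: "periodic_smooth T \<psi>"
		and f': "!!p. p \<in> strip T ==> (\<psi> has_derivative f' p) (at p within strip T)"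
		and f'_smooth: "!!h. periodic_smooth T (%p. f' p h)" and t: "t \<in> {0..T}"
	shows "fourier (%x. f' (t, x) (0, axis j 1)) k $ l = \<i> * of_int (k $ j) * fourier (%x. \<psi> (t, x)) k $ l"
proof -
	let ?D = "%x. f' (t, x) (0, axis j 1)"
	let ?g = "%x. complex_of_real (\<psi> (t, x) $ l) * chr (- k) x"
	let ?a = "%x. complex_of_real (?D x $ l) * chr (- k) x"
	let ?g' = "%x. ?a x + - (\<i> * of_int (k $ j)) * ?g x"
	have cg: "continuous_on UNIV ?g"
		by (intro continuous_intros periodic_smooth_continuous_x[OF \<psi> t])
	have ca: "continuous_on UNIV ?a"
		by (intro continuous_intros periodic_smooth_continuous_x[OF f'_smooth t])
	have "integral cell ?g' = 0"
	proof (rule integral_cell_partial_deriv[where g = ?g and j = j])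
		show "continuous_on UNIV ?g'" by (intro continuous_intros cg ca)
		show "?g (x + (2 * pi) *\<^sub>R axis j 1) = ?g x" for x
			using \<psi> t by (simp add: periodic_smooth_def chr_periodic)
		show "((%h. ?g (x + h *\<^sub>R axis j 1)) has_vector_derivative ?g' (x + h *\<^sub>R axis j 1)) (at h)" for x h
		proof -
			have p: "(t, x + h *\<^sub>R axis j 1) \<in> strip T" using t by simp
			have im: "range (%h. (t, x + h *\<^sub>R axis j 1)) \<subseteq> strip T" using t by auto
			have "((%h. (t, x + h *\<^sub>R axis j 1)) has_derivative (%h. (0, h *\<^sub>R axis j 1))) (at h)"
				by (auto intro!: derivative_eq_intros)
			then have "((%h. \<psi> (t, x + h *\<^sub>R axis j 1)) has_derivative (%d. f' (t, x + h *\<^sub>R axis j 1) (0, d *\<^sub>R axis j 1))) (at h)"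
				by (rule has_derivative_in_compose) (rule has_derivative_subset[OF f'[OF p] im])
			moreover have "f' (t, x + h *\<^sub>R axis j 1) (0, d *\<^sub>R axis j 1) = d *\<^sub>R ?D (x + h *\<^sub>R axis j 1)" for d
				using linear_scale[OF has_derivative_linear[OF f'[OF p]], of d "(0, axis j 1)"] by simp
			then have "(%d. f' (t, x + h *\<^sub>R axis j 1) (0, d *\<^sub>R axis j 1)) = (%d. d *\<^sub>R ?D (x + h *\<^sub>R axis j 1))"
				by (rule ext)
			ultimately have "((%h. \<psi> (t, x + h *\<^sub>R axis j 1)) has_vector_derivative ?D (x + h *\<^sub>R axis j 1)) (at h)"
				unfolding has_vector_derivative_def by (simp only:)
			then have d1: "((%h. complex_of_real (\<psi> (t, x + h *\<^sub>R axis j 1) $ l)) has_vector_derivative complex_of_real (?D (x + h *\<^sub>R axis j 1) $ l)) (at h)"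
				by (intro bounded_linear.has_vector_derivative[OF bounded_linear_of_real] bounded_linear.has_vector_derivative[OF bounded_linear_vec_nth])
			have d2: "((%h. chr (- k) (x + h *\<^sub>R axis j 1)) has_vector_derivative - (\<i> * of_int (k $ j)) * chr (- k) (x + h *\<^sub>R axis j 1)) (at h)"
			proof -
				have e: "chr (- k) (x + h *\<^sub>R axis j 1) = chr (- k) x * exp (- (\<i> * of_int (k $ j)) * of_real h)" for h
					by (simp add: chr_def inner_add_right wave_inner_axis cis_conv_exp exp_add[symmetric] algebra_simps)
				show ?thesis unfolding e
					by (rule has_vector_derivative_real_field) (auto intro!: derivative_eq_intros simp: algebra_simps)
			qed
			show ?thesis using has_vector_derivative_mult[OF d1 d2] by (simp add: algebra_simps)
		qed
	qed (rule cg)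
	moreover have "integral cell ?g' = integral cell ?a + - (\<i> * of_int (k $ j)) * integral cell ?g"
	proof -
		have "?a integrable_on cell" "(%x. - (\<i> * of_int (k $ j)) * ?g x) integrable_on cell"
			unfolding cell_def by (intro integrable_continuous continuous_on_subset[OF ca] continuous_intros continuous_on_subset[OF cg]; simp)+
		then show ?thesis by (subst Henstock_Kurzweil_Integration.integral_add) auto
	qed
	ultimately have "integral cell ?a = \<i> * of_int (k $ j) * integral cell ?g" by simp
	then show ?thesis
		using fourier_eq_cell_integral[OF f'_smooth t, of "(0, axis j 1)" k l] fourier_eq_cell_integral[OF \<psi> t, of k l] by simp
qed

lemma periodic_smooth_fourier_decay:
	assumes T: "0 < T" and \<psi>: "periodic_smooth T \<psi>"
	shows "\<exists>C\<ge>0. \<forall>t\<in>{0..T}. \<forall>k. \<bar>of_int (k $ j)\<bar> ^ n * norm (fourier (%x. \<psi> (t, x)) k) <= C"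
	using \<psi>
proof (induction n arbitrary: \<psi>)
	case 0
	then show ?case using periodic_smooth_fourier_bounded by simp
next
	case (Suc n)
	obtain f' where f': "!!p. p \<in> strip T ==> (\<psi> has_derivative f' p) (at p within strip T)"
		and sm: "!!h. periodic_smooth T (%p. f' p h)"
		using periodic_smooth_derivative[OF T Suc.prems] by blast
	obtain C where C: "C \<ge> 0" "!!t k. t \<in> {0..T} ==> \<bar>of_int (k $ j)\<bar> ^ n * norm (fourier (%x. f' (t, x) (0, axis j 1)) k) <= C"
		using Suc.IH[OF sm[of "(0, axis j 1)"]] by blast
	have "\<bar>of_int (k $ j)\<bar> ^ Suc n * norm (fourier (%x. \<psi> (t, x)) k) <= C" if t: "t \<in> {0..T}" for t k
	proof -
		have fp: "fourier (%x. f' (t, x) (0, axis j 1)) k $ l = \<i> * of_int (k $ j) * fourier (%x. \<psi> (t, x)) k $ l" for l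
			by (rule fourier_partial_derivative[OF T Suc.prems _ sm t]) (rule f')
		have "norm (fourier (%x. f' (t, x) (0, axis j 1)) k) = \<bar>of_int (k $ j)\<bar> * norm (fourier (%x. \<psi> (t, x)) k)"
			unfolding norm_vec_def fp by (simp add: norm_mult L2_set_right_distrib)
		then show ?thesis using C(2)[OF t, of k] by (simp add: mult.assoc mult.left_commute)
	qed
	then show ?case using C(1) by blast
qed

text \<open>The order four is chosen for the pairings with fields in H^(-3/2): these cost |k|^3 on
  the squared coefficients, and |k|^3 |k|^(-8) is summable in dimension three.\<close>

lemma periodic_smooth_fourier_decay4:
	assumes T: "0 < T" and \<psi>: "periodic_smooth T \<psi>"
	shows "\<exists>C\<ge>0. \<forall>t\<in>{0..T}. \<forall>k. freq k ^ 4 * norm (fourier (%x. \<psi> (t, x)) k) <= C"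
proof -
	have "\<exists>C. \<forall>j. C j \<ge> 0 \<and> (\<forall>t\<in>{0..T}. \<forall>k. \<bar>of_int (k $ j)\<bar> ^ 4 * norm (fourier (%x. \<psi> (t, x)) k) <= C j)"
		using periodic_smooth_fourier_decay[OF T \<psi>, of _ 4] by (intro choice) auto
	then obtain C where C: "!!j :: 3. C j \<ge> 0"
		"!!j t k. t \<in> {0..T} ==> \<bar>of_int (k $ j)\<bar> ^ 4 * norm (fourier (%x. \<psi> (t, x)) k) <= C j" by blast
	have "freq k ^ 4 * norm (fourier (%x. \<psi> (t, x)) k) <= 3 * (C 1 + C 2 + C 3)" if t: "t \<in> {0..T}" for t k
	proof -
		let ?a = "(of_int (k $ 1))^2 :: real" and ?b = "(of_int (k $ 2))^2 :: real" and ?c = "(of_int (k $ 3))^2 :: real"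
		have "(freq k)^2 = ?a + ?b + ?c" by (simp add: norm_vec_sq sum_3 wave_def)
		moreover have "freq k ^ 4 = ((freq k)^2)^2" by (simp add: power4_eq_xxxx power2_eq_square)
		ultimately have "freq k ^ 4 = (?a + ?b + ?c)^2" by simp
		also have "... <= 3 * (?a^2 + ?b^2 + ?c^2)"
		proof -
			have "(a + b + c)^2 <= 3 * (a^2 + b^2 + c^2)" for a b c :: real
				using zero_le_power2[of "a - b"] zero_le_power2[of "b - c"] zero_le_power2[of "a - c"]
				by (simp add: power2_eq_square algebra_simps)
			then show ?thesis .
		qed
		also have "... = 3 * (\<bar>of_int (k $ 1)\<bar> ^ 4 + \<bar>of_int (k $ 2)\<bar> ^ 4 + \<bar>of_int (k $ 3)\<bar> ^ 4)"
			by (simp add: power4_eq_xxxx power2_eq_square)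
		finally have "freq k ^ 4 * norm (fourier (%x. \<psi> (t, x)) k)
			<= 3 * (\<bar>of_int (k $ 1)\<bar> ^ 4 + \<bar>of_int (k $ 2)\<bar> ^ 4 + \<bar>of_int (k $ 3)\<bar> ^ 4) * norm (fourier (%x. \<psi> (t, x)) k)"
			by (rule mult_right_mono) simp
		then show ?thesis using C(2)[OF t, of k 1] C(2)[OF t, of k 2] C(2)[OF t, of k 3] by (simp add: algebra_simps)
	qed
	then show ?thesis using C(1) by (intro exI[of _ "3 * (C 1 + C 2 + C 3)"]) auto
qed

text \<open>Separates the calculus of smooth functions from the limit equation, which sees a test
  field only through these facts about its coefficients. The one-sided time derivative is the
  Frechet derivative on the strip in direction (1, 0), so smoothness up to the ends of the interval
  applies to it.\<close>

lemma test_field_fourier: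
	fixes \<phi> :: "real \<times> (real ^ 3) => real ^ 3"
	assumes T: "0 < T" and \<phi>: "\<phi> \<in> test_fields T"
	defines "\<Phi> \<equiv> %t. fourier (%x. \<phi> (t, x))"
		and "\<Phi>' \<equiv> %t. fourier (%x. vector_derivative (%s. \<phi> (s, x)) (at t within {0..T}))"
	obtains C where "C \<ge> 0" "!!t k. t \<in> {0..T} ==> freq k ^ 4 * norm (\<Phi> t k) <= C"
		"!!t k. t \<in> {0..T} ==> freq k ^ 4 * norm (\<Phi>' t k) <= C"
		"!!t k. t \<in> {0..T} ==> norm (\<Phi> t k) <= C"
		"!!k. continuous_on {0..T} (%t. \<Phi>' t k)"
		"!!k t. 0 <= t ==> t <= T ==> \<Phi> t k = \<Phi> 0 k + prim T (%s. \<Phi>' s k) t"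
		"!!k. \<Phi> T k = 0"
proof -
	have ps: "periodic_smooth T \<phi>" using \<phi> by (auto simp: test_fields_def periodic_smooth_def)
	obtain f' where f': "!!p. p \<in> strip T ==> (\<phi> has_derivative f' p) (at p within strip T)"
		and sm: "!!h. periodic_smooth T (%p. f' p h)"
		using periodic_smooth_derivative[OF T ps] by blast
	have vd: "((%s. \<phi> (s, x)) has_vector_derivative f' (t, x) (1, 0)) (at t within {0..T})" if t: "t \<in> {0..T}" for t x
	proof -
		have p: "(t, x) \<in> strip T" using t by simp
		have im: "(%s. (s, x)) ` {0..T} \<subseteq> strip T" by auto
		have "((%s. (s, x)) has_derivative (%h. (h, 0))) (at t within {0..T})"
			by (auto intro!: derivative_eq_intros)
		then have "((%s. \<phi> (s, x)) has_derivative (%d. f' (t, x) (d, 0))) (at t within {0..T})"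
			by (rule has_derivative_in_compose) (rule has_derivative_subset[OF f'[OF p] im])
		moreover have "f' (t, x) (d, 0) = d *\<^sub>R f' (t, x) (1, 0)" for d
			using linear_scale[OF has_derivative_linear[OF f'[OF p]], of d "(1, 0)"] by simp
		then have "(%d. f' (t, x) (d, 0)) = (%d. d *\<^sub>R f' (t, x) (1, 0))" by (rule ext)
		ultimately show ?thesis unfolding has_vector_derivative_def by (simp only:)
	qed
	have \<Phi>': "\<Phi>' t = fourier (%x. f' (t, x) (1, 0))" if t: "t \<in> {0..T}" for t
		unfolding \<Phi>'_def using vector_derivative_within_closed_interval[OF T t vd[OF t]] by simp
	obtain C1 where C1: "C1 \<ge> 0" "!!t k. t \<in> {0..T} ==> freq k ^ 4 * norm (\<Phi> t k) <= C1"
		using periodic_smooth_fourier_decay4[OF T ps] unfolding \<Phi>_def by blast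
	obtain C2 where C2: "C2 \<ge> 0" "!!t k. t \<in> {0..T} ==> freq k ^ 4 * norm (\<Phi>' t k) <= C2"
		using periodic_smooth_fourier_decay4[OF T sm[of "(1, 0)"]] \<Phi>' by auto
	obtain C3 where C3: "C3 \<ge> 0" "!!t k. t \<in> {0..T} ==> norm (\<Phi> t k) <= C3"
		using periodic_smooth_fourier_bounded[OF ps] unfolding \<Phi>_def by blast
	have cont2: "continuous_on ({0..T} \<times> cbox 0 (\<chi> j. 2 * pi)) (%(t, x). of_real (\<psi> (t, x) $ l) * chr (- k) x)"
		if "periodic_smooth T \<psi>" for \<psi> k l
		unfolding case_prod_unfold
		by (intro continuous_intros continuous_on_compose2[OF periodic_smooth_continuous[OF that]]
				continuous_on_compose2[OF continuous_chr[of UNIV]]) auto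
	have \<Phi>c: "continuous_on {0..T} (%t. \<Phi>' t k)" for k
	proof -
		have "continuous_on {0..T} (%t. \<Phi>' t k $ l)" for l
		proof -
			have "continuous_on {0..T} (%t. integral cell (%x. of_real (f' (t, x) (1, 0) $ l) * chr (- k) x) / of_real ((2 * pi) ^ 3))"
				unfolding cell_def
				by (intro continuous_intros integral_continuous_on_param cont2[OF sm]) simp
			then show ?thesis by (rule continuous_on_eq) (simp add: \<Phi>' fourier_eq_cell_integral[OF sm])
		qed
		then show ?thesis by (intro continuous_on_vec_lambda[of _ "%l t. \<Phi>' t k $ l", simplified])
	qed
	have FTC: "\<Phi> t k = \<Phi> 0 k + prim T (%s. \<Phi>' s k) t" if t: "0 <= t" "t <= T" for k t
	proof -
		have comp: "((%s. \<Phi> s k $ l) has_vector_derivative \<Phi>' s k $ l) (at s within {0..T})" if s: "s \<in> {0..T}" for s l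
		proof -
			have "((%s. integral cell (%x. of_real (\<phi> (s, x) $ l) * chr (- k) x)) has_vector_derivative
					integral cell (%x. of_real (f' (s, x) (1, 0) $ l) * chr (- k) x)) (at s within {0..T})"
				unfolding cell_def
			proof (rule leibniz_rule_vector_derivative[OF _ _ cont2[OF sm]])
				show "((%s. of_real (\<phi> (s, x) $ l) * chr (- k) x) has_vector_derivative of_real (f' (r, x) (1, 0) $ l) * chr (- k) x)
						(at r within {0..T})" if "r \<in> {0..T}" for r x
					by (intro bounded_linear.has_vector_derivative[OF bounded_linear_mult_left]
							bounded_linear.has_vector_derivative[OF bounded_linear_of_real]
							bounded_linear.has_vector_derivative[OF bounded_linear_vec_nth] vd that)
				show "(%x. of_real (\<phi> (r, x) $ l) * chr (- k) x) integrable_on cbox 0 (\<chi> j. 2 * pi)" if "r \<in> {0..T}" for r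
					by (intro integrable_continuous continuous_intros continuous_on_subset[OF periodic_smooth_continuous_x[OF ps that]]) auto
			qed (use s in auto)
			then have "((%s. integral cell (%x. of_real (\<phi> (s, x) $ l) * chr (- k) x) / of_real ((2 * pi) ^ 3)) has_vector_derivative
					integral cell (%x. of_real (f' (s, x) (1, 0) $ l) * chr (- k) x) / of_real ((2 * pi) ^ 3)) (at s within {0..T})"
				by (rule bounded_linear.has_vector_derivative[OF bounded_linear_divide])
			then have "((%s. \<Phi> s k $ l) has_vector_derivative
					integral cell (%x. of_real (f' (s, x) (1, 0) $ l) * chr (- k) x) / of_real ((2 * pi) ^ 3)) (at s within {0..T})"
				by (rule has_vector_derivative_transform[OF s, rotated]) (simp add: \<Phi>_def fourier_eq_cell_integral[OF ps])
			then show ?thesis by (simp add: \<Phi>'[OF s] fourier_eq_cell_integral[OF sm s])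
		qed
		have ii: "(%s. \<Phi>' s k) integrable_on {0..t}"
			using t by (intro integrable_continuous_interval continuous_on_subset[OF \<Phi>c]) auto
		have "integral {0..t} (%s. \<Phi>' s k) $ l = (\<Phi> t k - \<Phi> 0 k) $ l" for l
		proof -
			have "((%s. \<Phi>' s k $ l) has_integral \<Phi> t k $ l - \<Phi> 0 k $ l) {0..t}"
				using t by (intro fundamental_theorem_of_calculus has_vector_derivative_within_subset[OF comp]) auto
			then show ?thesis
				using integral_linear[OF ii bounded_linear_vec_nth[of l]] by (simp add: comp_def integral_unique)
		qed
		then have "prim T (%s. \<Phi>' s k) t = \<Phi> t k - \<Phi> 0 k"
			unfolding prim_eq_integral[OF \<Phi>c t] vec_eq_iff by blast
		then show ?thesis by simp
	qed
	have end0: "\<Phi> T k = 0" for k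
	proof -
		have "\<phi> (T, x) = 0" for x using \<phi> T unfolding test_fields_def by auto
		then show ?thesis by (simp add: \<Phi>_def vec_eq_iff fourier_nth fc_def)
	qed
	show ?thesis
	proof (rule that[of "max C1 (max C2 C3)"])
		show "freq k ^ 4 * norm (\<Phi> t k) <= max C1 (max C2 C3)" if "t \<in> {0..T}" for t k
			using C1(2)[OF that, of k] by simp
		show "freq k ^ 4 * norm (\<Phi>' t k) <= max C1 (max C2 C3)" if "t \<in> {0..T}" for t k
			using C2(2)[OF that, of k] by simp
		show "norm (\<Phi> t k) <= max C1 (max C2 C3)" if "t \<in> {0..T}" for t k
			using C3(2)[OF that, of k] by simp
		show "0 <= max C1 (max C2 C3)" using C1(1) by simp
	qed (fact \<Phi>c FTC end0)+
qed

subsection \<open>The nonlinearity in Fourier space\<close>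

definition cwave :: "int ^ 3 => complex ^ 3" where
	"cwave k = (\<chi> j. \<i> * of_int (k $ j))"

text \<open>Bilinear over the complex numbers, unlike the inner product of the type; divergence,
  curl and the vector identities are algebraic in this form, and \<open>inner_bdot\<close>
  converts.\<close>

definition bdot :: "complex ^ 3 => complex ^ 3 => complex" where
	"bdot a b = (\<Sum>j\<in>UNIV. a $ j * b $ j)"

lemma bdot_3: "bdot a b = a $ 1 * b $ 1 + a $ 2 * b $ 2 + a $ 3 * b $ 3"
	by (simp add: bdot_def sum_3)

lemma curl_eq: "curl v k = ccross (cwave k) (v k)"
	by (simp add: vec_eq_iff forall_3 curl_def partial_def cwave_def vector_3)

lemma divergence_eq: "divergence v k = bdot (cwave k) (v k)"
	by (simp add: divergence_def partial_def bdot_def cwave_def)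

lemma laplacian_eq: "laplacian v k = - ((freq k)^2 *\<^sub>R v k)"
proof -
	have "(freq k)^2 = (\<Sum>j\<in>UNIV. (of_int (k $ j))^2)" by (simp add: norm_vec_sq wave_def)
	then have n: "complex_of_real ((freq k)^2) = (\<Sum>j\<in>UNIV. (of_int (k $ j))^2)" by simp
	show ?thesis
		unfolding vec_eq_iff
	proof
		fix i
		have "laplacian v k $ i = - (complex_of_real ((freq k)^2) * v k $ i)"
			unfolding n by (simp add: laplacian_def partial_def sum_3 power2_eq_square algebra_simps)
		then show "laplacian v k $ i = (- ((freq k)^2 *\<^sub>R v k)) $ i"
			by (simp only: vector_uminus_component vector_scaleR_component, simp only: scaleR_conv_of_real)
	qed
qed

lemma cwave_diff: "cwave (k - l) = cwave k - cwave l"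
	by (simp add: cwave_def vec_eq_iff algebra_simps)

lemma cwave_uminus: "cwave (- k) = cnj_vec (cwave k)"
	by (simp add: cwave_def cnj_vec_def vec_eq_iff)

lemma cwave_0 [simp]: "cwave 0 = 0"
	by (simp add: cwave_def vec_eq_iff)

lemma norm_cwave: "norm (cwave k) = freq k"
	by (simp add: norm_vec_def cwave_def wave_def norm_mult)

lemma norm_smult_vec: "norm (c *s v) = norm c * norm v" for v :: "complex ^ 3"
	by (simp add: norm_vec_def norm_mult L2_set_right_distrib)

lemma norm_bdot_le: "norm (bdot a b) <= 3 * (norm a * norm b)"
proof -
	have "norm (a $ j * b $ j) <= norm a * norm b" for j
		unfolding norm_mult by (intro mult_mono Finite_Cartesian_Product.norm_nth_le) auto
	then have "norm (bdot a b) <= (\<Sum>j\<in>(UNIV :: 3 set). norm a * norm b)"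
		unfolding bdot_def by (intro sum_norm_le)
	then show ?thesis by simp
qed

lemma norm_cnj_vec [simp]: "norm (cnj_vec v) = norm v"
	by (simp add: cnj_vec_def norm_vec_def)

lemma cnj_vec_cnj_vec [simp]: "cnj_vec (cnj_vec v) = v"
	by (simp add: cnj_vec_def vec_eq_iff)

lemma linear_cnj_vec: "linear cnj_vec"
	by (rule linearI) (simp_all add: cnj_vec_def vec_eq_iff)

lemma bounded_linear_cnj_vec: "bounded_linear cnj_vec"
	using linear_cnj_vec by (simp add: linear_conv_bounded_linear)

lemma inner_complex: "x \<bullet> y = Re (x * cnj y)" for x y :: complex
	by (simp add: inner_complex_def)

lemma inner_bdot: "a \<bullet> b = Re (bdot a (cnj_vec b))" for a b :: "complex ^ 3"
	by (simp add: inner_vec_def bdot_def cnj_vec_def inner_complex_def)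

lemma curl_real: "(!!k. v (- k) = cnj_vec (v k)) ==> curl v (- k) = cnj_vec (curl v k)"
	by (simp add: curl_eq cwave_uminus vec_eq_iff forall_3 cnj_vec_def)

lemma norm_curl_le: "norm (curl v k) <= 6 * (freq k * norm (v k))"
	using norm_ccross_le[of "cwave k" "v k"] by (simp add: curl_eq norm_cwave mult.assoc)

lemma ccross_ccross: "ccross a (ccross b c) = bdot a c *s b - bdot a b *s c"
	by (simp add: vec_eq_iff forall_3 bdot_3 algebra_simps)

text \<open>Kept bilinear in two fields so that differences of quadratic terms can be expanded. The
  derivative sits on the output frequency k alone, so a single mode needs no regularity of u beyond
  L^2.\<close>

definition nlq :: "int ^ 3 => vfield => vfield => vfield" where
	"nlq k u v l = (1/2 * bdot (u l) (v (k - l))) *s cwave k - bdot (u l) (cwave k) *s v (k - l)"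

text \<open>For divergence free \<open>u\<close> this is \<open>u \<times> curl u\<close>, see \<open>nl_eq_cross_field\<close>; the derivative has
	been moved to the output frequency, as in \<open>u \<times> curl u = \<nabla>|u|\<^sup>2/2 - div (u \<otimes> u)\<close>.\<close>

definition nl :: "vfield => vfield" where
	"nl u k = (INFSUM l. nlq k u u l)"

lemma norm_nlq_le: "norm (nlq k u v l) <= 6 * freq k * (norm (u l) * norm (v (k - l)))"
proof -
	let ?p = "norm (u l) * norm (v (k - l)) * freq k"
	have "norm (nlq k u v l) <= norm ((1/2 * bdot (u l) (v (k - l))) *s cwave k) + norm (bdot (u l) (cwave k) *s v (k - l))"
		unfolding nlq_def by (rule norm_triangle_ineq4)
	also have "norm ((1/2 * bdot (u l) (v (k - l))) *s cwave k) <= 3 * ?p"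
	proof -
		have "norm (1/2 * bdot (u l) (v (k - l))) <= 3 * (norm (u l) * norm (v (k - l)))"
		proof -
			have "norm (1/2 * bdot (u l) (v (k - l))) = norm (bdot (u l) (v (k - l))) / 2"
				by (simp add: norm_mult norm_divide)
			moreover have "0 <= norm (u l) * norm (v (k - l))" by simp
			ultimately show ?thesis using norm_bdot_le[of "u l" "v (k - l)"] by linarith
		qed
		then show ?thesis unfolding norm_smult_vec norm_cwave
			using mult_right_mono[OF _ norm_ge_zero[of "wave k"]] by (fastforce simp: mult.assoc)
	qed
	also have "norm (bdot (u l) (cwave k) *s v (k - l)) <= 3 * ?p"
		unfolding norm_smult_vec
		using mult_right_mono[OF norm_bdot_le[of "u l" "cwave k"] norm_ge_zero[of "v (k - l)"]]
		by (simp add: norm_cwave algebra_simps)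
	finally show ?thesis by (simp add: algebra_simps)
qed

lemma nlq_summable:
	assumes u: "sq_summable u" and v: "sq_summable v"
	shows "(%l. norm (nlq k u v l)) summable_on UNIV" and "nlq k u v summable_on UNIV"
		and "norm (INFSUM l. nlq k u v l) <= 6 * freq k * (INFSUM l. norm (u l) * norm (v (k - l)))"
proof -
	note c = conv_summable(1)[OF u v, of k]
	have c': "(%l. 6 * freq k * (norm (u l) * norm (v (k - l)))) summable_on UNIV"
		by (rule summable_on_cmult_right[OF c])
	show s: "(%l. norm (nlq k u v l)) summable_on UNIV"
		by (rule summable_on_comparison_real[OF c']) (simp add: norm_nlq_le)
	then show "nlq k u v summable_on UNIV" by (rule abs_summable_summable)
	have "norm (INFSUM l. nlq k u v l) <= (INFSUM l. norm (nlq k u v l))"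
		by (rule norm_infsum_bound[OF s])
	also have "... <= (INFSUM l. 6 * freq k * (norm (u l) * norm (v (k - l))))"
		by (rule infsum_mono[OF s c' norm_nlq_le])
	also have "... = 6 * freq k * (INFSUM l. norm (u l) * norm (v (k - l)))"
		by (rule infsum_cmult_right')
	finally show "norm (INFSUM l. nlq k u v l) <= 6 * freq k * (INFSUM l. norm (u l) * norm (v (k - l)))" .
qed

lemma norm_nl_conv_le:
	assumes u: "sq_summable u"
	shows "norm (nl u k) <= 6 * freq k * (INFSUM l. norm (u l) * norm (u (k - l)))"
	unfolding nl_def by (rule nlq_summable(3)[OF u u])

lemma norm_nlq_sum_le:
	assumes u: "sq_summable u" and v: "sq_summable v"
	shows "norm (INFSUM l. nlq k u v l) <= 6 * freq k * (l2_norm u * l2_norm v)"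
proof -
	have "6 * freq k * (INFSUM l. norm (u l) * norm (v (k - l))) <= 6 * freq k * (l2_norm u * l2_norm v)"
		using conv_summable(2)[OF u v, of k] by (intro mult_left_mono) (auto simp: l2_norm_def)
	then show ?thesis using nlq_summable(3)[OF u v, of k] by linarith
qed

lemma norm_nl_le:
	assumes u: "sq_summable u"
	shows "norm (nl u k) <= 6 * freq k * (l2_norm u)^2"
	using norm_nlq_sum_le[OF u u] by (simp add: nl_def power2_eq_square)

lemma nl_0: "nl u 0 = 0"
	by (simp add: nl_def nlq_def bdot_def vector_smult_lzero)

lemma norm_nl_diff_le:
	assumes u: "l2_field u" and v: "l2_field v"
	shows "norm (nl u k - nl v k) <= 6 * freq k * (l2_norm (u - v) * (l2_norm u + l2_norm v))"
proof -
	have s: "sq_summable u" "sq_summable v"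
		"sq_summable ((u - v))"
		using u v l2_field_diff[OF u v] by (auto simp: l2_field_def)
	have eq: "nlq k u u l - nlq k v v l = nlq k (u - v) u l + nlq k v (u - v) l" for l
		by (simp add: nlq_def vec_eq_iff bdot_3 algebra_simps)
	have "nl u k - nl v k = (INFSUM l. nlq k u u l - nlq k v v l)"
		unfolding nl_def by (rule infsum_minus[symmetric]; rule nlq_summable(2); fact s)
	also have "... = (INFSUM l. nlq k (u - v) u l) + (INFSUM l. nlq k v (u - v) l)"
		unfolding eq by (rule infsum_add; rule nlq_summable(2); fact s)
	also have "norm ... <= 6 * freq k * (l2_norm (u - v) * l2_norm u) + 6 * freq k * (l2_norm v * l2_norm (u - v))"
		by (rule norm_triangle_le[OF add_mono[OF norm_nlq_sum_le[OF s(3,1)] norm_nlq_sum_le[OF s(2,3)]]])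
	moreover have "6 * w * (d * a) + 6 * w * (b * d) = 6 * w * (d * (a + b))" for w d a b :: real
		by (simp add: algebra_simps)
	ultimately show ?thesis by (simp only:)
qed

text \<open>The vector triple product splits u x curl u into two sums. Exchanging l and k - l
  symmetrizes one of them into half the gradient of |u|^2; in the other, incompressibility replaces
  the derivative frequency k - l by k.\<close>

lemma nl_eq_infsum_cross:
	assumes u: "sq_summable u" and cu: "sq_summable (curl u)"
		and wu: "(%k. (freq k * norm (u k))^2) summable_on UNIV"
		and div: "!!k. divergence u k = 0"
	shows "(INFSUM l. ccross (u l) (curl u (k - l))) = nl u k"
proof -
	define g where "g l = (bdot (u l) (u (k - l)) *s cwave (k - l))" for l
	define h where "h l = bdot (u l) (cwave k) *s u (k - l)" for l
	define e where "e l = bdot (u l) (u (k - l)) *s cwave k" for l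
	have ul: "bdot (u l) (cwave (k - l)) = bdot (u l) (cwave k)" for l
		using div[of l] by (simp add: divergence_eq bdot_3 cwave_diff algebra_simps)
	have tm: "ccross (u l) (curl u (k - l)) = g l - h l" for l
		by (simp add: curl_eq ccross_ccross ul g_def h_def)
	have b: "bij_betw (%l. k - l) UNIV UNIV" by (rule bij_betwI[where g = "%l. k - l"]) auto
	have gs: "g summable_on UNIV"
	proof -
		have "(%l. 3 * (norm (u l) * norm (norm (wave (k - l)) * norm (u (k - l))))) summable_on UNIV"
			using conv_summable(1)[of "%l. norm (u l)" "%l. freq l * norm (u l)" k] u wu
			by (intro summable_on_cmult_right) simp
		moreover have "norm (g l) <= 3 * (norm (u l) * norm (norm (wave (k - l)) * norm (u (k - l))))" for l
			using mult_right_mono[OF norm_bdot_le[of "u l" "u (k - l)"] norm_ge_zero[of "wave (k - l)"]]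
			by (simp add: g_def norm_smult_vec norm_cwave abs_mult algebra_simps)
		ultimately have "(%l. norm (g l)) summable_on UNIV" by (intro summable_on_comparison_real[of _ "%l. norm (g l)"]) auto
		then show ?thesis by (rule abs_summable_summable)
	qed
	have hs: "h summable_on UNIV"
	proof -
		have "(%l. (3 * freq k) * (norm (u l) * norm (u (k - l)))) summable_on UNIV"
			by (rule summable_on_cmult_right[OF conv_summable(1)[OF u u]])
		moreover have "norm (h l) <= (3 * freq k) * (norm (u l) * norm (u (k - l)))" for l
			using mult_right_mono[OF norm_bdot_le[of "u l" "cwave k"] norm_ge_zero[of "u (k - l)"]]
			by (simp add: h_def norm_smult_vec norm_cwave algebra_simps)
		ultimately have "(%l. norm (h l)) summable_on UNIV" by (intro summable_on_comparison_real[of _ "%l. norm (h l)"]) auto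
		then show ?thesis by (rule abs_summable_summable)
	qed
	have g': "(%l. g (k - l)) summable_on UNIV" using summable_on_reindex_bij_betw[OF b, of g] gs by simp
	\<comment> \<open>The two derivative frequencies l and k - l add up to k, which is how the
	  derivative leaves the individual factor.\<close>
	have gsym: "g l + g (k - l) = e l" for l
		by (simp add: g_def e_def vec_eq_iff cwave_diff bdot_3 algebra_simps)
	have "infsum g UNIV + infsum g UNIV = infsum g UNIV + (INFSUM l. g (k - l))"
		using infsum_reindex_bij_betw[OF b, of g] by simp
	also have "... = (INFSUM l. e l)" unfolding infsum_add[OF gs g', symmetric] gsym ..
	finally have g2: "infsum g UNIV + infsum g UNIV = infsum e UNIV" .
	have es: "e summable_on UNIV" using summable_on_add[OF gs g'] unfolding gsym .
	have hf: "infsum g UNIV = (INFSUM l. (1/2) *\<^sub>R e l)"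
	proof -
		have "(INFSUM l. (1/2) *\<^sub>R e l) = (1/2) *\<^sub>R infsum e UNIV" by (rule infsum_scaleR_right)
		also have "... = infsum g UNIV" unfolding g2[symmetric] by (rule scaleR_half_double)
		finally show ?thesis ..
	qed
	have "(INFSUM l. ccross (u l) (curl u (k - l))) = infsum g UNIV - infsum h UNIV"
		unfolding tm by (rule infsum_minus[OF gs hs])
	also have "... = (INFSUM l. (1/2) *\<^sub>R e l - h l)"
		unfolding hf by (rule infsum_minus[OF _ hs, symmetric]) (rule summable_on_scaleR_right, rule es)
	also have "... = nl u k"
	proof -
		have half: "(1/2) *\<^sub>R (c *s a) = (1/2 * c) *s a" for c and a :: "complex ^ 3"
			unfolding vec_eq_iff by (simp only: vector_scaleR_component vector_smult_component) (simp add: scaleR_conv_of_real)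
		show ?thesis unfolding nl_def nlq_def e_def h_def half ..
	qed
	finally show ?thesis .
qed

lemma nl_real:
	assumes "!!k. u (- k) = cnj_vec (u k)"
		and "sq_summable u"
	shows "nl u (- k) = cnj_vec (nl u k)"
proof -
	have b: "bij_betw (%l. - l :: int ^ 3) UNIV UNIV" by (rule bij_betwI[where g = uminus]) auto
	have eq: "nlq (- k) u u (- l) = cnj_vec (nlq k u u l)" for l
	proof -
		have "u (- k - - l) = cnj_vec (u (k - l))" using assms(1)[of "k - l"] by simp
		then show ?thesis
			by (simp add: nlq_def assms(1) cwave_uminus vec_eq_iff cnj_vec_def bdot_3)
	qed
	have "nl u (- k) = (INFSUM l. nlq (- k) u u (- l))"
		unfolding nl_def by (rule infsum_reindex_bij_betw[OF b, symmetric])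
	also have "... = (INFSUM l. cnj_vec (nlq k u u l))" unfolding eq ..
	also have "... = cnj_vec (nl u k)"
		unfolding nl_def
		by (rule infsumI[OF has_sum_bounded_linear[OF bounded_linear_cnj_vec has_sum_infsum[OF nlq_summable(2)[OF assms(2,2)]]]])
	finally show ?thesis .
qed

subsection \<open>Estimates for the nonlinearity\<close>

lemma trilinear_weighted:
	fixes x y z :: "int ^ 3 => real"
	assumes exps: "0 <= a" "a < 3/2" "0 <= b" "b < 3/2" "0 <= c" "c < 3/2" "a + b + c = 3/2"
		and F: "finite F" and zero: "x 0 = 0" "y 0 = 0" "z 0 = 0"
		and X: "!!K. finite K ==> (\<Sum>k\<in>K. freq k powr (2 * a) * (x k)^2) <= A^2"
		and Y: "!!K. finite K ==> (\<Sum>k\<in>K. freq k powr (2 * b) * (y k)^2) <= B^2"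
		and Z: "!!K. finite K ==> (\<Sum>k\<in>K. freq k powr (2 * c) * (z k)^2) <= D^2"
		and nonneg: "0 <= A" "0 <= B" "0 <= D" "!!k. 0 <= x k" "!!k. 0 <= y k" "!!k. 0 <= z k"
	shows "(\<Sum>(l, m)\<in>F. x l * y m * z (l + m)) <= tri_const a b c * A * B * D"
proof -
	let ?F = "{(l, m) \<in> F. l ~= 0 \<and> m ~= 0 \<and> l + m ~= 0}"
	let ?X = "%k. freq k powr a * x k" and ?Y = "%k. freq k powr b * y k" and ?Z = "%k. freq k powr c * z k"
	have "(\<Sum>(l, m)\<in>F. x l * y m * z (l + m)) = (\<Sum>(l, m)\<in>?F. x l * y m * z (l + m))"
		by (rule sum.mono_neutral_right) (use F zero in \<open>auto intro: finite_subset[OF _ F]\<close>)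
	also have "... = (\<Sum>(l, m)\<in>?F. ?X l * ?Y m * ?Z (l + m) * (freq l powr - a * freq m powr - b
						* norm (wave (l + m)) powr - c))"
	proof (rule sum.cong[OF refl])
		fix p assume p: "p \<in> ?F"
		have c1: "freq k powr s * freq k powr - s = 1" if "k ~= 0" for k s
			using that by (simp add: powr_minus)
		obtain l m where lm: "p = (l, m)" by (cases p)
		then have nz: "l ~= 0" "m ~= 0" "l + m ~= 0" using p by auto
		have "?X l * ?Y m * ?Z (l + m) * (freq l powr - a * freq m powr - b * norm (wave (l + m)) powr - c)
			= (x l * y m * z (l + m)) * (freq l powr a * freq l powr - a) * (freq m powr b * freq m powr - b)
				* (norm (wave (l + m)) powr c * norm (wave (l + m)) powr - c)"
			by (simp only: mult_ac)
		then show "(case p of (l, m) => x l * y m * z (l + m)) = (case p of (l, m) =>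
				?X l * ?Y m * ?Z (l + m) * (freq l powr - a * freq m powr - b * norm (wave (l + m)) powr - c))"
			unfolding lm by (simp only: prod.case c1[OF nz(1)] c1[OF nz(2)] c1[OF nz(3)] mult_1_right)
	qed
	also have "... <= tri_const a b c * A * B * D"
	proof (rule trilinear_finite[OF exps])
		show "finite ?F" using F by (auto intro: finite_subset[OF _ F])
	qed (use X Y Z nonneg in \<open>auto simp: power_mult_distrib powr_squared\<close>)
	finally show ?thesis .
qed

text \<open>By duality: with z the weighted convolution itself, the sum S is a trilinear form at
  exponents 0, 1, 1/2 in which z has norm sqrt S, and S <= C A B sqrt S gives the claim. The
  convolution is truncated to a cube to keep the form finite.\<close>

lemma conv_negative_half:
	fixes x y :: "int ^ 3 => real"
	assumes zero: "x 0 = 0" "y 0 = 0"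
		and X: "!!K. finite K ==> (\<Sum>k\<in>K. (x k)^2) <= A^2"
		and Y: "!!K. finite K ==> (\<Sum>k\<in>K. freq k powr 2 * (y k)^2) <= B^2"
		and nonneg: "0 <= A" "0 <= B" "!!k. 0 <= x k" "!!k. 0 <= y k"
		and conv: "!!k. (%l. x l * y (k - l)) summable_on UNIV" and K: "finite K"
	shows "(\<Sum>k\<in>K. freq k powr - 1 * (INFSUM l. x l * y (k - l))^2) <= (tri_const 0 1 (1/2) * A * B)^2"
proof -
	let ?c = "tri_const 0 1 (1/2)"
	have c0: "0 <= ?c" by (rule tri_const_nonneg) auto
	define cv where "cv n k = (\<Sum>l\<in>box3 n. x l * y (k - l))" for n k
	have cv_nn: "0 <= cv n k" for n k unfolding cv_def using nonneg by (intro sum_nonneg) auto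
	have step: "(\<Sum>k\<in>K. freq k powr - 1 * (cv n k)^2) <= (?c * A * B)^2" for n
	proof -
		define S where "S = (\<Sum>k\<in>K. freq k powr - 1 * (cv n k)^2)"
		have S0: "0 <= S" unfolding S_def by (intro sum_nonneg) auto
		define z where "z k = (if k \<in> K then freq k powr - 1 * cv n k else 0)" for k
		let ?g = "%(k, l). (l, k - l) :: (int ^ 3) \<times> (int ^ 3)"
		have inj: "inj_on ?g (K \<times> box3 n)" by (auto simp: inj_on_def)
		have "S = (\<Sum>k\<in>K. \<Sum>l\<in>box3 n. x l * y (k - l) * z k)"
			unfolding S_def z_def cv_def
			by (intro sum.cong refl) (simp add: power2_eq_square sum_distrib_left sum_distrib_right mult_ac)
		also have "... = (\<Sum>p\<in>K \<times> box3 n. (%(l, m). x l * y m * z (l + m)) (?g p))"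
			by (simp add: sum.cartesian_product case_prod_unfold)
		also have "... = (\<Sum>(l, m)\<in>?g ` (K \<times> box3 n). x l * y m * z (l + m))"
			by (simp add: sum.reindex[OF inj])
		also have "... <= ?c * A * B * sqrt S"
		proof (rule trilinear_weighted)
			show "finite (?g ` (K \<times> box3 n))" using K finite_box3 by auto
			show "(\<Sum>k\<in>L. freq k powr (2 * 0) * (x k)^2) <= A^2" if "finite L" for L
			proof -
				have "(\<Sum>k\<in>L. freq k powr (2 * 0) * (x k)^2) <= (\<Sum>k\<in>L. (x k)^2)"
					by (rule sum_mono) auto
				then show ?thesis using X[OF that] by linarith
			qed
			show "(\<Sum>k\<in>L. freq k powr (2 * 1) * (y k)^2) <= B^2" if "finite L" for L
				using Y[OF that] by simp
			show "(\<Sum>k\<in>L. freq k powr (2 * (1/2)) * (z k)^2) <= (sqrt S)^2" if "finite L" for L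
			proof -
				have "(\<Sum>k\<in>L. freq k powr (2 * (1/2)) * (z k)^2) = (\<Sum>k\<in>L \<inter> K. freq k powr - 1 * (cv n k)^2)"
				proof -
					have "freq k powr 1 * (freq k powr - 1 * cv n k)^2 = freq k powr - 1 * (cv n k)^2" for k
						by (cases "k = 0") (simp_all add: power_mult_distrib powr_squared powr_minus power2_eq_square field_simps)
					then show ?thesis
						unfolding sum.inter_restrict[OF that] by (intro sum.cong) (auto simp: z_def)
				qed
				also have "... <= S" unfolding S_def using K by (intro sum_mono2) auto
				finally show ?thesis using S0 by simp
			qed
		qed (use zero nonneg cv_nn S0 in \<open>auto simp: z_def\<close>)
		finally have le: "S <= (?c * A * B) * sqrt S" .
		have "S <= (?c * A * B)^2"
		proof (cases "S = 0")
			case True then show ?thesis by simp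
		next
			case False
			then have p: "0 < sqrt S" using S0 by simp
			have "sqrt S * sqrt S <= (?c * A * B) * sqrt S" using le S0 by simp
			then have "sqrt S <= ?c * A * B" by (rule mult_right_le_imp_le[OF _ p])
			then have "(sqrt S)^2 <= (?c * A * B)^2" using p by (intro power_mono) auto
			then show ?thesis using S0 by simp
		qed
		then show ?thesis unfolding S_def .
	qed
	have "(%n. \<Sum>k\<in>K. freq k powr - 1 * (cv n k)^2) ----> (\<Sum>k\<in>K. freq k powr - 1 * (INFSUM l. x l * y (k - l))^2)"
		unfolding cv_def by (intro tendsto_sum tendsto_mult tendsto_const tendsto_power sum_box3_tendsto conv)
	then show ?thesis by (rule LIMSEQ_le_const2) (use step in auto)
qed

text \<open>36 is the square of the factor 6 in \<open>norm_nl_conv_le\<close>.\<close>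

definition nl_const :: real where
	"nl_const = 36 * (tri_const 0 1 (1/2))^2"

lemma nl_const_nonneg: "0 <= nl_const"
	by (simp add: nl_const_def)

text \<open>The borderline estimate behind \<open>H\<^sup>-\<^sup>3\<^sup>/\<^sup>2\<close> regularity of the nonlinearity.\<close>

lemma nl_sobolev:
	assumes zero: "u 0 = 0" and u: "sq_summable u"
		and u1: "(%k. freq k powr 2 * (norm (u k))^2) summable_on UNIV"
	shows "(%k. freq k powr - 3 * (norm (nl u k))^2) summable_on UNIV"
		and "(INFSUM k. freq k powr - 3 * (norm (nl u k))^2)
			<= nl_const * (l2_norm u)^2 * (INFSUM k. freq k powr 2 * (norm (u k))^2)"
proof -
	let ?B = "INFSUM k. freq k powr 2 * (norm (u k))^2"
	let ?cv = "%k. INFSUM l. norm (u l) * norm (u (k - l))"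
	have B0: "0 <= ?B" by (intro infsum_nonneg) auto
	have fin: "(\<Sum>k\<in>K. freq k powr - 3 * (norm (nl u k))^2) <= nl_const * (l2_norm u)^2 * ?B" if K: "finite K" for K
	proof -
		have "(\<Sum>k\<in>K. freq k powr - 3 * (norm (nl u k))^2) <= (\<Sum>k\<in>K. 36 * (freq k powr - 1 * (?cv k)^2))"
		proof (rule sum_mono)
			fix k
			have "(norm (nl u k))^2 <= (6 * freq k * ?cv k)^2"
				by (intro power_mono norm_nl_conv_le[OF u]) simp
			then have "freq k powr - 3 * (norm (nl u k))^2 <= freq k powr - 3 * (6 * freq k * ?cv k)^2"
				by (intro mult_left_mono) auto
			also have "... = 36 * (freq k powr - 3 * (freq k)^2 * (?cv k)^2)"
				by (simp add: power_mult_distrib algebra_simps)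
			\<comment> \<open>The derivative at the output costs |k|^2, so the weight of order -3 on the
			  nonlinearity is one of order -1 on the convolution.\<close>
			also have "freq k powr - 3 * (freq k)^2 = freq k powr - 1"
				using powr_add[of "freq k" "- 3" 2] by (cases "k = 0") (simp_all add: powr_numeral)
			finally show "freq k powr - 3 * (norm (nl u k))^2 <= 36 * (freq k powr - 1 * (?cv k)^2)" .
		qed
		also have "... = 36 * (\<Sum>k\<in>K. freq k powr - 1 * (?cv k)^2)" by (simp add: sum_distrib_left)
		also have "... <= 36 * (tri_const 0 1 (1/2) * l2_norm u * sqrt ?B)^2"
		proof (intro mult_left_mono conv_negative_half)
			show "(\<Sum>k\<in>L. (norm (u k))^2) <= (l2_norm u)^2" if "finite L" for L
				unfolding l2_norm_sq by (rule sum_le_infsum[OF u _ that]) simp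
			show "(\<Sum>k\<in>L. freq k powr 2 * (norm (u k))^2) <= (sqrt ?B)^2" if "finite L" for L
				using sum_le_infsum[OF u1 _ that] B0 by simp
			show "(%l. norm (u l) * norm (u (k - l))) summable_on UNIV" for k by (rule conv_summable(1)[OF u u])
		qed (use zero K B0 l2_norm_nonneg in auto)
		also have "... = nl_const * (l2_norm u)^2 * ?B"
			using B0 by (simp add: nl_const_def power_mult_distrib)
		finally show ?thesis .
	qed
	show "(%k. freq k powr - 3 * (norm (nl u k))^2) summable_on UNIV"
		and "(INFSUM k. freq k powr - 3 * (norm (nl u k))^2) <= nl_const * (l2_norm u)^2 * ?B"
		by (rule nonneg_summable_bounded[OF _ fin]; simp)+
qed

text \<open>The triple sum is antisymmetric under exchange of the first and third frequency. At
	regularities \<open>1/6, 1/6, 7/6\<close> it converges absolutely, which is where \<open>\<theta> \<ge> 1/6\<close> enters.\<close>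

lemma nl_energy:
	assumes real: "!!k. u (- k) = cnj_vec (u k)" and zero: "u 0 = 0" and div: "!!k. divergence u k = 0"
		and A: "!!K. finite K ==> (\<Sum>k\<in>K. freq k powr (1/3) * (norm (u k))^2) <= A^2"
		and B: "!!K. finite K ==> (\<Sum>k\<in>K. freq k powr (7/3) * (norm (u k))^2) <= B^2"
		and nonneg: "0 <= A" "0 <= B"
	shows "\<bar>\<Sum>k\<in>box3 n. nl u k \<bullet> u k\<bar> <= 36 * (tri_const (1/6) (1/6) (7/6) * A * B * B)"
		and "(%n. \<Sum>k\<in>box3 n. nl u k \<bullet> u k) ----> 0"
proof -
	let ?C = "36 * (tri_const (1/6) (1/6) (7/6) * A * B * B)"
	have s7: "(%k. freq k powr (7/3) * (norm (u k))^2) summable_on UNIV"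
		by (rule nonneg_summable_bounded(1)[OF _ B]) auto
	have s2: "(%k. freq k powr 2 * (norm (u k))^2) summable_on UNIV"
	proof (rule summable_on_comparison_real[OF s7])
		fix k
		have "freq k powr 2 * (norm (u k))^2 <= freq k powr (7/3) * (norm (u k))^2"
			by (intro mult_right_mono norm_wave_powr_mono) auto
		then show "\<bar>freq k powr 2 * (norm (u k))^2\<bar> <= freq k powr (7/3) * (norm (u k))^2"
			by (subst abs_of_nonneg) auto
	qed
	have s0: "sq_summable u"
	proof (rule summable_on_comparison_real[OF s7])
		fix k
		have "freq k powr 0 * (norm (u k))^2 <= freq k powr (7/3) * (norm (u k))^2"
			by (intro mult_right_mono norm_wave_powr_mono) auto
		then show "\<bar>(norm (u k))^2\<bar> <= freq k powr (7/3) * (norm (u k))^2"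
			using zero by (cases "k = 0") auto
	qed
	have wu: "(%k. (freq k * norm (u k))^2) summable_on UNIV"
		using s2 by (simp add: power_mult_distrib powr_numeral)
	have cu: "sq_summable (curl u)"
	proof (rule summable_on_comparison_real)
		show "(%k. 36 * (freq k * norm (u k))^2) summable_on UNIV" by (rule summable_on_cmult_right[OF wu])
		show "\<bar>(norm (curl u k))^2\<bar> <= 36 * (freq k * norm (u k))^2" for k
			using power_mono[OF norm_curl_le[of u k] norm_ge_zero, of 2] by (simp add: power_mult_distrib)
	qed
	define g where "g p = ccross (u (fst p)) (curl u (snd p)) \<bullet> u (fst p + snd p)" for p
	have gle: "\<bar>g p\<bar> <= 36 * (norm (u (fst p)) * (norm (wave (snd p)) * norm (u (snd p))) * norm (u (fst p + snd p)))" for p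
	proof -
		have "\<bar>g p\<bar> <= norm (ccross (u (fst p)) (curl u (snd p))) * norm (u (fst p + snd p))"
			unfolding g_def by (rule Cauchy_Schwarz_ineq2)
		also have "... <= (6 * norm (u (fst p)) * (6 * (norm (wave (snd p)) * norm (u (snd p))))) * norm (u (fst p + snd p))"
			by (intro mult_right_mono order_trans[OF norm_ccross_le] mult_left_mono norm_curl_le) auto
		finally show ?thesis by (simp add: mult_ac)
	qed
	have gfin: "(\<Sum>p\<in>F. \<bar>g p\<bar>) <= ?C" if F: "finite F" for F
	proof -
		have "(\<Sum>p\<in>F. \<bar>g p\<bar>) <= (\<Sum>p\<in>F. 36 * (norm (u (fst p)) * (norm (wave (snd p)) * norm (u (snd p))) * norm (u (fst p + snd p))))"
			by (rule sum_mono[OF gle])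
		also have "... = 36 * (\<Sum>(l, m)\<in>F. norm (u l) * (freq m * norm (u m)) * norm (u (l + m)))"
			by (simp only: sum_distrib_left case_prod_unfold)
		also have "... <= ?C"
		proof (intro mult_left_mono trilinear_weighted[OF _ _ _ _ _ _ _ F])
			show "(\<Sum>k\<in>K. freq k powr (2 * (1/6)) * (norm (u k))^2) <= A^2" if "finite K" for K using A[OF that] by simp
			show "(\<Sum>k\<in>K. freq k powr (2 * (7/6)) * (norm (u k))^2) <= B^2" if "finite K" for K using B[OF that] by simp
			\<comment> \<open>The curl carries one power of the frequency, so the middle factor, of
			  regularity 7/6, enters the trilinear form with exponent 1/6, and 1/6 + 1/6 + 7/6 = 3/2.\<close>
			have "freq k powr (1/3) * (freq k * norm (u k))^2 = freq k powr (7/3) * (norm (u k))^2" for k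
				using powr_add[of "freq k" "1/3" 2] by (cases "k = 0") (simp_all add: power_mult_distrib powr_numeral)
			then show "(\<Sum>k\<in>K. freq k powr (2 * (1/6)) * (freq k * norm (u k))^2) <= B^2" if "finite K" for K
				using B[OF that] by simp
		qed (use zero nonneg in auto)
		finally show ?thesis .
	qed
	have ga: "(%p. \<bar>g p\<bar>) summable_on UNIV" and gi: "(INFSUM p. \<bar>g p\<bar>) <= ?C"
		by (rule nonneg_summable_bounded[OF _ gfin]; simp)+
	\<comment> \<open>A change of variables from both input frequencies to output and first input;
	  absolute summability over pairs then justifies the iterated sums.\<close>
	let ?h = "%(k, l). (l, k - l) :: (int ^ 3) \<times> (int ^ 3)"
	have bh: "bij_betw ?h UNIV UNIV" by (rule bij_betwI[where g = "%(l, m). (l + m, l)"]) auto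
	have Ga: "(%p. \<bar>g (?h p)\<bar>) summable_on UNIV \<times> UNIV"
		using summable_on_reindex_bij_betw[OF bh, of "%p. \<bar>g p\<bar>"] ga by simp
	have Gi: "(\<Sum>\<^sub>\<infinity>p\<in>UNIV \<times> UNIV. \<bar>g (?h p)\<bar>) = (INFSUM p. \<bar>g p\<bar>)"
		using infsum_reindex_bij_betw[OF bh, of "%p. \<bar>g p\<bar>"] by simp
	have Gs: "(%p. g (?h p)) summable_on UNIV \<times> UNIV"
		using Ga summable_on_abs_real by simp
	have Gi0: "(\<Sum>\<^sub>\<infinity>p\<in>UNIV \<times> UNIV. g (?h p)) = (INFSUM p. g p)"
		using infsum_reindex_bij_betw[OF bh, of g] by simp
	have inner: "nl u k \<bullet> u k = (INFSUM l. g (?h (k, l)))" for k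
	proof -
		have "((%l. ccross (u l) (curl u (k - l)) \<bullet> u k) has_sum (nl u k \<bullet> u k)) UNIV"
			unfolding nl_eq_infsum_cross[OF s0 cu wu div, symmetric]
			by (intro has_sum_bounded_linear[OF bounded_linear_inner_left] has_sum_infsum ccross_conv_summable(2) s0 cu)
		then show ?thesis by (simp add: g_def infsumI)
	qed
	have sumk: "(%k. nl u k \<bullet> u k) summable_on UNIV"
	proof -
		have "(%(k, l). g (?h (k, l))) summable_on UNIV \<times> UNIV" using Gs by (simp add: case_prod_unfold)
		then show ?thesis unfolding inner by (rule summable_on_Sigma_banach)
	qed
	have "(INFSUM k. nl u k \<bullet> u k) = (INFSUM p. g p)"
		unfolding inner Gi0[symmetric] by (rule infsum_Sigma_banach[OF Gs])
	also have "... = 0"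
	proof -
		\<comment> \<open>By reality u(l + m) is the conjugate of u(-(l + m)), so \<open>g\<close> is the
		  real part of a triple product of u(l), curl u(m) and u(-(l + m)). The involution exchanges the
		  first and the third vector and so changes the sign.\<close>
		let ?s = "%(l, m). (- (l + m), m) :: (int ^ 3) \<times> (int ^ 3)"
		have bs: "bij_betw ?s UNIV UNIV" by (rule bij_betwI[where g = ?s]) auto
		have anti: "g (?s p) = - g p" for p
		proof -
			obtain l m where p: "p = (l, m)" by (cases p)
			have "u (- (l + m) + m) = cnj_vec (u l)" using real[of l] by simp
			then show ?thesis
				unfolding p g_def real[of "l + m"] prod.case fst_conv snd_conv
				by (simp add: inner_bdot bdot_3 cnj_vec_def algebra_simps)
		qed
		have "(INFSUM p. g p) = (INFSUM p. g (?s p))" by (rule infsum_reindex_bij_betw[OF bs, symmetric])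
		also have "... = - (INFSUM p. g p)" unfolding anti by (rule infsum_uminus)
		finally show ?thesis by simp
	qed
	finally show "(%n. \<Sum>k\<in>box3 n. nl u k \<bullet> u k) ----> 0"
		using sum_box3_tendsto[OF sumk] by simp
	have Gk: "(%l. \<bar>g (?h (k, l))\<bar>) summable_on UNIV" for k
		using summable_on_SigmaD1[of "%k l. \<bar>g (?h (k, l))\<bar>" UNIV "%_. UNIV" k] Ga by (simp add: case_prod_unfold)
	have "\<bar>\<Sum>k\<in>box3 n. nl u k \<bullet> u k\<bar> <= (\<Sum>k\<in>box3 n. INFSUM l. \<bar>g (?h (k, l))\<bar>)"
		unfolding inner
		by (rule order_trans[OF sum_abs], rule sum_mono) (use norm_infsum_bound[of "%l. g (?h (_, l))" UNIV] Gk in auto)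
	also have "... <= (INFSUM k. INFSUM l. \<bar>g (?h (k, l))\<bar>)"
	proof (rule sum_le_infsum[OF _ _ finite_box3])
		have "(%(k, l). \<bar>g (?h (k, l))\<bar>) summable_on UNIV \<times> UNIV" using Ga by (simp add: case_prod_unfold)
		then show "(%k. INFSUM l. \<bar>g (?h (k, l))\<bar>) summable_on UNIV" by (rule summable_on_Sigma_banach)
	qed (auto intro!: infsum_nonneg)
	also have "... = (INFSUM p. \<bar>g p\<bar>)"
		unfolding Gi[symmetric] by (rule infsum_Sigma_banach[OF Ga])
	finally show "\<bar>\<Sum>k\<in>box3 n. nl u k \<bullet> u k\<bar> <= ?C" using gi by linarith
qed

subsection \<open>Sobolev spaces as weighted sequence spaces\<close>

text \<open>At k = 0 the base is 0 and \<open>powr\<close> returns 0 for every exponent, so the zero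
  mode carries no weight even for s <= 0 and sums may run over the whole lattice.\<close>

definition wgt :: "real => int ^ 3 => real" where
	"wgt s k = freq k powr (2 * s)"

definition hwt :: "real => int ^ 3 => real" where
	"hwt s k = (1 + (freq k)^2) powr s"

lemma wgt_nonneg [simp]: "0 <= wgt s k" by (simp add: wgt_def)
lemma wgt_uminus [simp]: "wgt s (- k) = wgt s k" by (simp add: wgt_def wave_uminus)
lemma wgt_eq_0_iff [simp]: "wgt s k = 0 \<longleftrightarrow> k = 0" by (simp add: wgt_def)
lemma wgt_pos: "k ~= 0 ==> 0 < wgt s k" by (simp add: wgt_def)
lemma wgt_mono: "s <= t ==> wgt s k <= wgt t k" unfolding wgt_def by (rule norm_wave_powr_mono) simp
lemma wgt_add: "wgt (s + t) k = wgt s k * wgt t k" by (simp add: wgt_def powr_add[symmetric] distrib_left)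
lemma wgt_1: "wgt 1 k = (freq k)^2" by (simp add: wgt_def powr_numeral)
lemma wgt_ge_1: "0 <= s ==> k ~= 0 ==> 1 <= wgt s k"
	unfolding wgt_def using ge_one_powr_ge_zero[OF norm_wave_ge_1] by simp

lemma hwt_pos: "0 < hwt s k"
proof -
	have "0 < 1 + (freq k)^2" by (simp add: add_pos_nonneg)
	then show ?thesis by (simp add: hwt_def)
qed

lemma hwt_nonneg [simp]: "0 <= hwt s k" using hwt_pos[of s k] by linarith
lemma hwt_neq_0 [simp]: "hwt s k ~= 0" using hwt_pos[of s k] by linarith
lemma hwt_uminus [simp]: "hwt s (- k) = hwt s k" by (simp add: hwt_def wave_uminus)

lemma Hv_eq_wspace: "Hv s = wspace (wgt s) cnj_vec"
proof -
	have "(%k. freq k powr (2 * s) * (norm (c k))^2) summable_on (UNIV - {0})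
		 \<longleftrightarrow> wsummable (wgt s) c" for c :: vfield
		by (rule summable_on_cong_neutral) (auto simp: wgt_def)
	then show ?thesis by (auto simp: Hv_def wspace_def mean_free_def)
qed

lemma Hv_norm_eq_wnorm: "Hv_norm s = wnorm (wgt s)"
proof
	fix c :: vfield
	have "(\<Sum>\<^sub>\<infinity>k\<in>UNIV - {0}. freq k powr (2 * s) * (norm (c k))^2) = (wsum (wgt s) c)"
		by (rule infsum_cong_neutral) (auto simp: wgt_def)
	then show "Hv_norm s c = wnorm (wgt s) c" by (simp add: Hv_norm_def wnorm_def)
qed

lemma Hs_eq_wspace: "Hs s = wspace (hwt s) cnj"
	unfolding Hs_def wspace_def hwt_def[symmetric] by simp

lemma Hs_norm_eq_wnorm: "Hs_norm s = wnorm (hwt s)"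
	by (simp add: fun_eq_iff Hs_norm_def wnorm_def hwt_def)

lemma Hv_iff: "c \<in> Hv s \<longleftrightarrow> c 0 = 0 \<and> (\<forall>k. c (- k) = cnj_vec (c k)) \<and> wsummable (wgt s) c"
	by (auto simp: Hv_eq_wspace wspace_def)

lemma Hs_iff: "c \<in> Hs s \<longleftrightarrow> (\<forall>k. c (- k) = cnj (c k)) \<and> wsummable (hwt s) c"
	unfolding Hs_eq_wspace wspace_def by simp

lemma Hv_sigma_subset: "Hv_sigma s \<subseteq> Hv s"
	by (auto simp: Hv_sigma_def)

lemma bochner_L2_wspace_D:
	fixes u :: "real => int ^ 3 => 'v::euclidean_space"
	assumes W: "!!k. 0 <= W k" and X: "X \<subseteq> wspace W J" and u: "u \<in> bochner_Lp 2 T X (wnorm W)"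
	shows "(%t. u t k) \<in> borel_measurable (leb T)"
		and "AE t in leb T. u t \<in> X"
		and "integrable (leb T) (%t. wsum W (u t))"
proof -
	have m: "bochner_measurable T X (wnorm W) u" and i: "integrable (leb T) (%t. (wnorm W (u t))^2)"
		using u by (auto simp: bochner_Lp_def)
	show "(%t. u t k) \<in> borel_measurable (leb T)" by (rule bochner_measurable_component[OF W X m])
	show "AE t in leb T. u t \<in> X"
		using m unfolding bochner_measurable_def by (auto elim!: eventually_mono)
	show "integrable (leb T) (%t. wsum W (u t))"
		using i by (simp add: wnorm_sq W)
qed

lemmas bochner_L2_Hv_D = bochner_L2_wspace_D[where W = "wgt s" and J = cnj_vec for s, OF wgt_nonneg, folded Hv_eq_wspace Hv_norm_eq_wnorm]
lemmas bochner_L2_Hs_D = bochner_L2_wspace_D[where W = "hwt s" and J = cnj for s, OF hwt_nonneg, folded Hs_eq_wspace Hs_norm_eq_wnorm]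

lemma bochner_L2_Hv_I:
	assumes "!!k. (%t. u t k) \<in> borel_measurable (leb T)"
		and "AE t in leb T. u t \<in> Hv s"
		and "integrable (leb T) (%t. wsum (wgt s) (u t))"
	shows "u \<in> bochner_Lp 2 T (Hv s) (Hv_norm s)"
	using assms bochner_measurable_wspace[of "wgt s" cnj_vec u T]
	by (simp add: bochner_Lp_def Hv_eq_wspace Hv_norm_eq_wnorm wnorm_sq linear_cnj_vec)

lemma bochner_L2_Hs_I:
	assumes "!!k. (%t. u t k) \<in> borel_measurable (leb T)"
		and "AE t in leb T. u t \<in> Hs s"
		and "integrable (leb T) (%t. wsum (hwt s) (u t))"
	shows "u \<in> bochner_Lp 2 T (Hs s) (Hs_norm s)"
proof -
	have "linear cnj" by (rule linearI) (simp_all add: scaleR_conv_of_real)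
	then show ?thesis
		using assms bochner_measurable_wspace[of "hwt s" cnj u T]
		by (simp add: bochner_Lp_def Hs_eq_wspace Hs_norm_eq_wnorm wnorm_sq)
qed

text \<open>Transfers integrability in time between weights by comparing summands. The two fields
  may take values in different spaces, so it also serves derivatives and the pressure.\<close>

lemma weighted_domination:
	fixes y :: "real => int ^ 3 => 'a::euclidean_space" and z :: "real => int ^ 3 => 'b::euclidean_space"
	assumes V: "!!k. 0 <= V k" and m: "!!k. (%t. y t k) \<in> borel_measurable (leb T)"
		and le: "!!t k. V k * (norm (y t k))^2 <= c * (H k * (norm (z t k))^2)"
		and s: "AE t in leb T. wsummable H (z t)"
		and i: "integrable (leb T) (%t. wsum H (z t))"
	shows "AE t in leb T. wsummable V (y t)"
		and "integrable (leb T) (%t. wsum V (y t))"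
proof -
	let ?M = "leb T"
	show vs: "AE t in ?M. wsummable V (y t)"
		using s
	proof eventually_elim
		case (elim t)
		show ?case by (rule summable_on_comparison_real[OF summable_on_cmult_right[OF elim, of c]]) (use le[of _ t] V in auto)
	qed
	have mm: "(%t. wsum V (y t)) \<in> borel_measurable ?M"
		by (rule borel_measurable_infsum_AE[OF _ _ vs]) (use m in \<open>auto intro!: borel_measurable_times\<close>)
	show "integrable ?M (%t. wsum V (y t))"
	proof (rule Bochner_Integration.integrable_bound[OF integrable_mult_right[OF i, of c] mm])
		show "AE t in ?M. norm (wsum V (y t)) <= norm (c * (wsum H (z t)))"
			using s vs
		proof eventually_elim
			case (elim t)
			have "0 <= (wsum V (y t))" using V by (intro infsum_nonneg) auto
			moreover have "(wsum V (y t)) <= (INFSUM k. c * (H k * (norm (z t k))^2))"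
				by (rule infsum_mono[OF elim(2) summable_on_cmult_right[OF elim(1)] le])
			ultimately show ?case by (simp add: infsum_cmult_right')
		qed
	qed
qed

lemma integrable_of_square:
	fixes g :: "real => 'b::euclidean_space"
	assumes m: "g \<in> borel_measurable (leb T)" and i: "integrable (leb T) (%t. (norm (g t))^2)"
	shows "integrable (leb T) g"
proof -
	interpret finite_measure "leb T" by (rule lebesgue_on_interval_sigma_finite)
	have "integrable (leb T) (%t. 1 + (norm (g t))^2)" using i by simp
	then show ?thesis
	proof (rule Bochner_Integration.integrable_bound[OF _ m])
		show "AE t in leb T. norm (g t) <= norm (1 + (norm (g t))^2)"
		proof (rule AE_I2)
			fix t
			have "2 * norm (g t) * 1 <= (norm (g t))^2 + 1^2" by (rule sum_squares_bound)
			then have "norm (g t) <= 1 + (norm (g t))^2" using norm_ge_zero[of "g t"] unfolding power_one by linarith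
			then show "norm (g t) <= norm (1 + (norm (g t))^2)" by simp
		qed
	qed
qed

lemma integrable_mode:
	fixes u :: "real => int ^ 3 => 'v::euclidean_space"
	assumes W: "!!k. 0 <= W k" "0 < W k"
		and meas: "!!k. (%t. u t k) \<in> borel_measurable (leb T)"
		and sum: "AE t in leb T. wsummable W (u t)"
		and int: "integrable (leb T) (%t. wsum W (u t))"
	shows "integrable (leb T) (%t. (norm (u t k))^2)" and "integrable (leb T) (%t. u t k)"
proof -
	have m: "(%t. (norm (u t k))^2) \<in> borel_measurable (leb T)" using meas[of k] by measurable
	have "integrable (leb T) (%t. inverse (W k) * (wsum W (u t)))" using int by simp
	then show 1: "integrable (leb T) (%t. (norm (u t k))^2)"
	proof (rule Bochner_Integration.integrable_bound[OF _ m])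
		show "AE t in leb T. norm ((norm (u t k))^2) <= norm (inverse (W k) * (wsum W (u t)))"
			using sum
		proof eventually_elim
			case (elim t)
			have "W k * (norm (u t k))^2 <= (wsum W (u t))"
				using le_infsum[OF elim] W(1) by auto
			then have "inverse (W k) * (W k * (norm (u t k))^2) <= inverse (W k) * (wsum W (u t))"
				using W(2) by (intro mult_left_mono) auto
			also have "inverse (W k) * (W k * (norm (u t k))^2) = (norm (u t k))^2" using W(2) by simp
			finally show ?case by (simp del: mult_le_cancel_left)
		qed
	qed
	show "integrable (leb T) (%t. u t k)" by (rule integrable_of_square[OF meas 1])
qed

text \<open>Measurability is asked of one side and inherited by the other. It is used where an
  integrand is a pairing whose measurability is known only through its reduced form.\<close>

lemma LINT_cong_AE_lebesgue_on:
	fixes g h :: "real => 'b::euclidean_space"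
	assumes "h \<in> borel_measurable (leb T)" "AE t in leb T. g t = h t"
	shows "(LINT t|leb T. g t) = (LINT t|leb T. h t)"
proof -
	have ae: "AE t in leb T. h t = g t" using assms(2) by eventually_elim simp
	have "g \<in> borel_measurable (leb T)"
		by (rule borel_measurable_lebesgue_on_AE[OF assms(1) _ ae]) simp
	then show ?thesis by (rule integral_cong_AE[OF _ assms])
qed

subsection \<open>Symbols of the filter and of the deconvolution operator\<close>

definition asymb :: "real => real => int ^ 3 => real" where
	"asymb \<alpha> \<theta> k = 1 + \<alpha> powr (2 * \<theta>) * freq k powr (2 * \<theta>)"

definition dsymb :: "real => real => nat => int ^ 3 => real" where
	"dsymb \<alpha> \<theta> N k = (\<Sum>i=0..N. (1 - inverse (asymb \<alpha> \<theta> k)) ^ i)"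

lemma asymb_ge_1: "1 <= asymb \<alpha> \<theta> k" by (simp add: asymb_def)
lemma asymb_pos: "0 < asymb \<alpha> \<theta> k" using asymb_ge_1[of \<alpha> \<theta> k] by linarith
lemma asymb_uminus [simp]: "asymb \<alpha> \<theta> (- k) = asymb \<alpha> \<theta> k" by (simp add: asymb_def wave_uminus)
lemma dsymb_uminus [simp]: "dsymb \<alpha> \<theta> N (- k) = dsymb \<alpha> \<theta> N k" by (simp add: dsymb_def)

lemma inverse_asymb_le_1: "inverse (asymb \<alpha> \<theta> k) <= 1"
	using asymb_ge_1 by (simp add: inverse_le_1_iff)

lemma filtered_eq: "filtered \<alpha> \<theta> v k = inverse (asymb \<alpha> \<theta> k) *\<^sub>R v k"
	by (simp add: filtered_def asymb_def)

lemma A_op_eq: "A_op \<alpha> \<theta> v k = asymb \<alpha> \<theta> k *\<^sub>R v k"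
	by (simp add: A_op_def asymb_def)

lemma D_op_eq: "D_op \<alpha> \<theta> N v k = dsymb \<alpha> \<theta> N k *\<^sub>R v k"
proof -
	have "((%u. u - filtered \<alpha> \<theta> u) ^^ i) v k = (1 - inverse (asymb \<alpha> \<theta> k)) ^ i *\<^sub>R v k" for i
		by (induction i) (simp_all add: filtered_eq scaleR_left_diff_distrib left_diff_distrib)
	then show ?thesis by (simp add: D_op_def dsymb_def scaleR_sum_left)
qed

text \<open>Partial sums of the geometric series with ratio 1 - 1/a and sum a. The bounds have
  different tasks: 1 lets u control w, a is uniform in N, and N + 1 is uniform in k.\<close>

lemma dsymb_bounds: "1 <= dsymb \<alpha> \<theta> N k" "dsymb \<alpha> \<theta> N k <= asymb \<alpha> \<theta> k" "dsymb \<alpha> \<theta> N k <= real N + 1"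
	and dsymb_tendsto: "(%N. dsymb \<alpha> \<theta> N k) ----> asymb \<alpha> \<theta> k"
proof -
	let ?a = "asymb \<alpha> \<theta> k"
	define x where "x = 1 - inverse ?a"
	have x: "0 <= x" "x < 1" using inverse_asymb_le_1[of \<alpha> \<theta> k] asymb_pos[of \<alpha> \<theta> k] by (auto simp: x_def)
	have d: "dsymb \<alpha> \<theta> N k = (\<Sum>i<Suc N. x ^ i)" for N
		unfolding dsymb_def x_def by (rule sum.cong) auto
	have "(\<Sum>i<1. x ^ i) <= (\<Sum>i<Suc N. x ^ i)" using x by (intro sum_mono2) auto
	then show "1 <= dsymb \<alpha> \<theta> N k" unfolding d by simp
	have "(\<Sum>i<Suc N. x ^ i) <= (\<Sum>i<Suc N. 1)" using x by (intro sum_mono power_le_one) auto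
	then show "dsymb \<alpha> \<theta> N k <= real N + 1" unfolding d by simp
	have s: "(%i. x ^ i) sums ?a"
	proof -
		have "1 / (1 - x) = ?a" by (simp add: x_def divide_inverse)
		then show ?thesis using geometric_sums[of x] x by simp
	qed
	have "(\<Sum>i<Suc N. x ^ i) <= ?a"
		using sum_le_suminf[OF sums_summable[OF s], of "{..<Suc N}"] x sums_unique[OF s] by simp
	then show "dsymb \<alpha> \<theta> N k <= ?a" unfolding d .
	show "(%N. dsymb \<alpha> \<theta> N k) ----> ?a"
		unfolding d using s unfolding sums_def by (rule LIMSEQ_Suc)
qed

lemma dsymb_pos: "0 < dsymb \<alpha> \<theta> N k" using dsymb_bounds(1)[of \<alpha> \<theta> N k] by linarith

text \<open>The source of uniformity in N: u carries the factor d, while the energy of the equation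
  has the density a d.\<close>

lemma dsymb_sq_le: "(dsymb \<alpha> \<theta> N k)^2 <= asymb \<alpha> \<theta> k * dsymb \<alpha> \<theta> N k"
	unfolding power2_eq_square using dsymb_bounds(2) dsymb_pos less_imp_le by (intro mult_right_mono) blast+

lemma wgt_le_asymb:
	assumes "0 < \<alpha>"
	shows "wgt \<theta> k <= \<alpha> powr (- 2 * \<theta>) * asymb \<alpha> \<theta> k"
proof -
	have "\<alpha> powr (- 2 * \<theta>) * asymb \<alpha> \<theta> k = \<alpha> powr (- 2 * \<theta>) + wgt \<theta> k"
		using assms by (simp add: asymb_def wgt_def distrib_left powr_minus mult.assoc[symmetric])
	then show ?thesis by simp
qed

lemma divergence_scaleR: "divergence (%k. c k *\<^sub>R v k) k = c k *\<^sub>R divergence v k"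
	by (simp add: divergence_eq bdot_def scaleR_sum_right)

lemma cnj_vec_scaleR: "cnj_vec (c *\<^sub>R v) = c *\<^sub>R cnj_vec v"
	by (simp add: linear_scale[OF linear_cnj_vec])

lemma Hv_1_l2:
	assumes v: "v \<in> Hv 1"
	shows "l2_field v" and "l2_field (curl v)" and "l2_norm v <= Hv_norm 1 v" and "l2_norm (curl v) <= 6 * Hv_norm 1 v"
proof -
	have z: "v 0 = 0" and r: "!!k. v (- k) = cnj_vec (v k)" and s: "wsummable (wgt 1) v"
		using v by (auto simp: Hv_iff)
	have le0: "(norm (v k))^2 <= wgt 1 k * (norm (v k))^2" for k
		using mult_right_mono[OF wgt_ge_1[of 1 k], of "(norm (v k))^2"] z by (cases "k = 0") auto
	have lec: "(norm (curl v k))^2 <= 36 * (wgt 1 k * (norm (v k))^2)" for k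
		using power_mono[OF norm_curl_le[of v k] norm_ge_zero, of 2] by (simp add: power_mult_distrib wgt_1)
	have s0: "sq_summable v"
		by (rule summable_on_comparison_real[OF s]) (use le0 in auto)
	have s36: "(%k. 36 * (wgt 1 k * (norm (v k))^2)) summable_on UNIV" by (rule summable_on_cmult_right[OF s])
	have sc: "sq_summable (curl v)"
		by (rule summable_on_comparison_real[OF s36]) (use lec in auto)
	show "l2_field v" "l2_field (curl v)" using r s0 sc curl_real[of v, OF r] by (auto simp: l2_field_def)
	have N: "(Hv_norm 1 v)^2 = (wsum (wgt 1) v)" "0 <= Hv_norm 1 v"
		by (simp_all add: Hv_norm_eq_wnorm wnorm_sq wnorm_nonneg)
	have "(l2_norm v)^2 <= (Hv_norm 1 v)^2" unfolding N l2_norm_sq by (rule infsum_mono[OF s0 s le0])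
	then show "l2_norm v <= Hv_norm 1 v" using N(2) by (rule power2_le_imp_le)
	have "(l2_norm (curl v))^2 <= (6 * Hv_norm 1 v)^2"
		unfolding power_mult_distrib N l2_norm_sq using infsum_mono[OF sc s36 lec] by (simp add: infsum_cmult_right')
	then show "l2_norm (curl v) <= 6 * Hv_norm 1 v" by (rule power2_le_imp_le) (use N(2) in simp)
qed

lemma nl_eq_cross_field:
	assumes u: "u \<in> Hv 1" and div: "!!k. divergence u k = 0"
	shows "cross_field u (curl u) = nl u"
proof -
	note l = Hv_1_l2(1,2)[OF u]
	have s: "sq_summable u" "sq_summable (curl u)"
		"(%k. (freq k * norm (u k))^2) summable_on UNIV"
		using l u by (auto simp: l2_field_def Hv_iff wgt_1 power_mult_distrib)
	show ?thesis by (rule ext) (simp add: cross_field_l2(2)[OF l] nl_eq_infsum_cross[OF s div])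
qed

subsection \<open>Testing against single modes\<close>

text \<open>Two opposite modes with conjugate coefficients, the smallest real field that sees
  coefficient k. As z ranges over all vectors, pairings with it determine the coefficient.\<close>

definition mode_field :: "int ^ 3 => complex ^ 3 => vfield" where
	"mode_field k z l = (if l = k then z else 0) + (if l = - k then cnj_vec z else 0)"

lemma neq_uminus: "k ~= 0 ==> k ~= - k" for k :: "int ^ 3"
	by (auto simp: vec_eq_iff)

lemma cnj_vec_0 [simp]: "cnj_vec 0 = 0"
	by (simp add: cnj_vec_def vec_eq_iff)

lemma inner_cnj_vec: "cnj_vec a \<bullet> cnj_vec b = a \<bullet> b"
	by (simp add: inner_vec_def cnj_vec_def inner_complex_def)

lemma pairing_mode_field:
	assumes k: "k ~= 0" and v: "v (- k) = cnj_vec (v k)"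
	shows "pairing v (%l. c *\<^sub>R mode_field k z l) = 2 * (2 * pi) ^ 3 * (c * (v k \<bullet> z))"
proof -
	have "(INFSUM l. v l \<bullet> (c *\<^sub>R mode_field k z l)) = (\<Sum>\<^sub>\<infinity>l\<in>{k, - k}. v l \<bullet> (c *\<^sub>R mode_field k z l))"
		by (rule infsum_cong_neutral) (auto simp: mode_field_def)
	also have "... = v k \<bullet> (c *\<^sub>R z) + v (- k) \<bullet> (c *\<^sub>R cnj_vec z)"
		using neq_uminus[OF k] by (auto simp: mode_field_def)
	also have "... = 2 * (c * (v k \<bullet> z))" by (simp add: v inner_cnj_vec)
	finally show ?thesis by (simp add: pairing_def)
qed

lemma mode_field_real: "mode_field k z (- l) = cnj_vec (mode_field k z l)"
	by (auto simp: mode_field_def linear_add[OF linear_cnj_vec] minus_equation_iff add.commute)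

lemma partial_mode_field:
	"partial j (%l. c *\<^sub>R mode_field k z l) = (%l. c *\<^sub>R mode_field k ((\<i> * of_int (k $ j)) *s z) l)"
proof
	fix l
	show "partial j (%l. c *\<^sub>R mode_field k z l) l = c *\<^sub>R mode_field k ((\<i> * of_int (k $ j)) *s z) l"
	proof -
		have "l = - k ==> l $ j = - (k $ j)" by simp
		then show ?thesis
			unfolding vec_eq_iff partial_def mode_field_def cnj_vec_def
			by (auto simp: algebra_simps)
	qed
qed

lemma grad_pairing_mode_field:
	assumes k: "k ~= 0" and v: "v (- k) = cnj_vec (v k)"
	shows "grad_pairing v (%l. c *\<^sub>R mode_field k z l) = 2 * (2 * pi) ^ 3 * (c * ((freq k)^2 * (v k \<bullet> z)))"
proof -
	have pr: "partial j v (- k) = cnj_vec (partial j v k)" for j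
		using v by (simp add: partial_def cnj_vec_def vec_eq_iff)
	have pk: "partial j v k \<bullet> ((\<i> * of_int (k $ j)) *s z) = (of_int (k $ j))^2 * (v k \<bullet> z)" for j
	proof -
		have "(\<i> * of_int m * a) \<bullet> (\<i> * of_int m * b) = (of_int m)^2 * (a \<bullet> b)" for m and a b :: complex
			by (simp add: inner_complex_def power2_eq_square algebra_simps)
		then show ?thesis by (simp add: inner_vec_def partial_def sum_distrib_left)
	qed
	have "(freq k)^2 = (\<Sum>j\<in>UNIV. (of_int (k $ j))^2)" by (simp add: norm_vec_sq wave_def)
	then have e: "(freq k)^2 * (v k \<bullet> z) = (\<Sum>j\<in>UNIV. (of_int (k $ j))^2 * (v k \<bullet> z))"
		by (simp only: sum_distrib_right)
	have "pairing (partial j v) (partial j (%l. c *\<^sub>R mode_field k z l))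
			= 2 * (2 * pi) ^ 3 * (c * ((of_int (k $ j))^2 * (v k \<bullet> z)))" for j
		by (simp only: partial_mode_field pairing_mode_field[OF k pr] pk)
	then show ?thesis
		unfolding grad_pairing_def e by (simp only: sum_distrib_left)
qed

subsection \<open>More on primitives\<close>

lemma prim_diff:
	assumes "integrable (leb T) f" and "integrable (leb T) g"
	shows "prim T (%t. f t - g t) \<tau> = prim T f \<tau> - prim T g \<tau>"
	unfolding prim_def scaleR_right_diff_distrib
	by (rule Bochner_Integration.integral_diff) (use assms in \<open>auto intro!: integrable_indicator_lebesgue_on\<close>)

lemma prim_scaleR: "prim T (%t. c *\<^sub>R f t) \<tau> = c *\<^sub>R prim T f \<tau>"
	unfolding prim_def by (simp only: scaleR_left_commute[of _ c] integral_scaleR_right)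

lemma prim_sum:
	assumes "!!i. i \<in> I ==> integrable (leb T) (f i)"
	shows "prim T (%t. \<Sum>i\<in>I. f i t) \<tau> = (\<Sum>i\<in>I. prim T (f i) \<tau>)"
	unfolding prim_def scaleR_sum_right
	by (rule Bochner_Integration.integral_sum) (use assms in \<open>auto intro!: integrable_indicator_lebesgue_on\<close>)

lemma prim_bounded_linear:
	assumes "bounded_linear L" and "integrable (leb T) f"
	shows "prim T (%t. L (f t)) \<tau> = L (prim T f \<tau>)"
proof -
	interpret L: bounded_linear L by fact
	show ?thesis unfolding prim_def
		using integral_bounded_linear[OF assms(1) integrable_indicator_lebesgue_on[OF assms(2), of "{..\<tau>}"]]
		by (simp add: L.scaleR)
qed

lemma prim_cong_AE:
	assumes f: "f \<in> borel_measurable (leb T)" and ae: "AE t in leb T. g t = f t"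
	shows "prim T g \<tau> = prim T f \<tau>"
	unfolding prim_def
	by (rule LINT_cong_AE_lebesgue_on)
		 (use f ae in \<open>auto intro!: borel_measurable_scaleR indicator_measurable_lebesgue_on elim: eventually_mono\<close>)

lemma prim_mono_AE:
	fixes f g :: "real => real"
	assumes "integrable (leb T) f" "integrable (leb T) g"
		and ae: "AE t in leb T. f t <= g t"
	shows "prim T f \<tau> <= prim T g \<tau>"
	unfolding prim_def
proof (rule integral_mono_AE)
	show "AE t in leb T. indicator {..\<tau>} t *\<^sub>R f t <= indicator {..\<tau>} t *\<^sub>R g t"
		using ae by eventually_elim (auto split: split_indicator)
qed (intro integrable_indicator_lebesgue_on assms; simp)+

lemma prim_le_integral:
	fixes f :: "real => real"
	assumes "integrable (leb T) f" and "!!t. 0 <= f t"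
	shows "prim T f \<tau> <= (LINT t|leb T. f t)"
	unfolding prim_def
	by (rule integral_mono[OF integrable_indicator_lebesgue_on[OF assms(1)] assms(1)])
		 (use assms(2) in \<open>auto split: split_indicator\<close>)

lemma prim_tendsto:
	fixes f :: "nat => real => 'a::euclidean_space"
	assumes f: "!!n. f n \<in> borel_measurable (leb T)" and g: "g \<in> borel_measurable (leb T)"
		and lim: "AE t in leb T. (%n. f n t) ----> g t"
		and le: "!!n. AE t in leb T. norm (f n t) <= h t" and h: "integrable (leb T) h"
	shows "(%n. prim T (f n) \<tau>) ----> prim T g \<tau>"
	unfolding prim_def
proof (rule integral_dominated_convergence[where w = h])
	show "AE t in leb T. (%n. indicator {..\<tau>} t *\<^sub>R f n t) ----> indicator {..\<tau>} t *\<^sub>R g t"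
		using lim by eventually_elim (rule tendsto_scaleR[OF tendsto_const])
	show "AE t in leb T. norm (indicator {..\<tau>} t *\<^sub>R f n t) <= h t" for n
		using le[of n] by eventually_elim (auto split: split_indicator intro: order_trans[OF norm_ge_zero])
qed (use f g h in \<open>auto intro!: borel_measurable_scaleR indicator_measurable_lebesgue_on\<close>)

lemma prim_by_parts_inner:
	fixes f g F G :: "real => 'a::euclidean_space"
	assumes f: "integrable (leb T) f" and g: "integrable (leb T) g"
		and F: "!!t. 0 <= t ==> t <= T ==> F t = F 0 + prim T f t"
		and G: "!!t. 0 <= t ==> t <= T ==> G t = G 0 + prim T g t"
		and \<tau>: "0 <= \<tau>" "\<tau> <= T"
	shows "integrable (leb T) (%t. f t \<bullet> G t)" and "integrable (leb T) (%t. F t \<bullet> g t)"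
		and "F \<tau> \<bullet> G \<tau> = F 0 \<bullet> G 0 + prim T (%t. f t \<bullet> G t) \<tau> + prim T (%t. F t \<bullet> g t) \<tau>"
proof -
	have fb: "integrable (leb T) (%t. f t \<bullet> b)" "integrable (leb T) (%t. g t \<bullet> b)" for b
		using f g by auto
	have Fb: "F t \<bullet> b = F 0 \<bullet> b + prim T (%t. f t \<bullet> b) t" "G t \<bullet> b = G 0 \<bullet> b + prim T (%t. g t \<bullet> b) t"
		if "0 <= t" "t <= T" for t b
		using F[OF that] G[OF that] by (simp_all add: prim_inner[OF f] prim_inner[OF g] inner_add_left[symmetric])
	note bp = prim_by_parts[OF fb Fb \<tau>]
	have fG: "f t \<bullet> G t = (\<Sum>b\<in>Basis. (f t \<bullet> b) * (G t \<bullet> b))" and Fg: "F t \<bullet> g t = (\<Sum>b\<in>Basis. (F t \<bullet> b) * (g t \<bullet> b))" for t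
		by (rule euclidean_inner)+
	show "integrable (leb T) (%t. f t \<bullet> G t)" unfolding fG by (rule Bochner_Integration.integrable_sum) (rule bp(1))
	show "integrable (leb T) (%t. F t \<bullet> g t)" unfolding Fg by (rule Bochner_Integration.integrable_sum) (rule bp(2))
	have "F \<tau> \<bullet> G \<tau> = (\<Sum>b\<in>Basis. (F \<tau> \<bullet> b) * (G \<tau> \<bullet> b))" by (rule euclidean_inner)
	also have "... = (\<Sum>b\<in>Basis. (F 0 \<bullet> b) * (G 0 \<bullet> b)) + (\<Sum>b\<in>Basis. prim T (%t. (f t \<bullet> b) * (G t \<bullet> b)) \<tau>)
			+ (\<Sum>b\<in>Basis. prim T (%t. (F t \<bullet> b) * (g t \<bullet> b)) \<tau>)"
		by (simp only: bp(3) sum.distrib)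
	also have "... = F 0 \<bullet> G 0 + prim T (%t. f t \<bullet> G t) \<tau> + prim T (%t. F t \<bullet> g t) \<tau>"
		unfolding fG Fg by (simp only: euclidean_inner[of "F 0" "G 0"] prim_sum[OF bp(1)] prim_sum[OF bp(2)])
	finally show "F \<tau> \<bullet> G \<tau> = F 0 \<bullet> G 0 + prim T (%t. f t \<bullet> G t) \<tau> + prim T (%t. F t \<bullet> g t) \<tau>" .
qed

lemma integrable_bounded_interval:
	fixes g :: "real => 'b::euclidean_space"
	assumes "g \<in> borel_measurable (leb T)" and "AE t in leb T. norm (g t) <= B"
	shows "integrable (leb T) g"
	by (rule finite_measure.integrable_const_bound[OF lebesgue_on_interval_sigma_finite assms(2,1)])

lemma nlq_measurable:
	assumes "!!k. (%t. u t k) \<in> borel_measurable M"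
	shows "(%t. nlq k (u t) (u t) l) \<in> borel_measurable M"
proof -
	have c: "continuous_on UNIV (%p. (1/2 * bdot (fst p) (snd p)) *s cwave k - bdot (fst p) (cwave k) *s snd p)"
		unfolding bdot_3 vector_scalar_mult_def by (intro continuous_intros)
	show ?thesis unfolding nlq_def
		by (rule borel_measurable_continuous_Pair[OF assms assms c])
qed

subsection \<open>The approximate solutions\<close>

locale setting =
	fixes T \<nu> \<alpha> \<theta> :: real and f :: "real => vfield" and v0 :: vfield
	assumes T: "T > 0" and \<nu>: "\<nu> > 0" and \<alpha>: "\<alpha> > 0" and \<theta>: "1/6 <= \<theta>" "\<theta> < 1"
		and f: "f \<in> bochner_Lp 2 T (Hv_sigma (- 1)) (Hv_norm (- 1))"
		and v0: "v0 \<in> Hv_sigma 0"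
begin

abbreviation M :: "real measure" where "M \<equiv> leb T"
abbreviation a :: "int ^ 3 => real" where "a \<equiv> asymb \<alpha> \<theta>"
abbreviation d :: "nat => int ^ 3 => real" where "d \<equiv> dsymb \<alpha> \<theta>"

definition forcing :: "real => real" where
	"forcing t = (wsum (wgt (- 1)) (f t))"

text \<open>Initial energy of the unfiltered field plus energy injected by the force, with 1/\<nu>
  from Young's inequality. The same number bounds all approximations.\<close>

definition E0 :: real where
	"E0 = (INFSUM k. (norm (v0 k))^2) + (1 / \<nu>) * (LINT t|M. forcing t)"

text \<open>The pressure that the divergence constraint forces upon a velocity \<open>w\<close> with \<open>u = D w\<close>.\<close>

definition press :: "vfield => sfield" where
	"press u k = - bdot (cwave k) (nl u k) / of_real (a k * (freq k)^2)"

text \<open>The time derivative of coefficient k with the pressure already eliminated, hence a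
  function of velocity and force alone.\<close>

definition rhs :: "vfield => vfield => vfield => vfield" where
	"rhs u w g k = inverse (a k) *\<^sub>R nl u k - (\<nu> * (freq k)^2) *\<^sub>R w k - grad (press u) k + inverse (a k) *\<^sub>R g k"

lemma f_measurable: "(%t. f t k) \<in> borel_measurable M"
	and f_AE: "AE t in M. f t \<in> Hv_sigma (- 1)"
	and forcing_integrable: "integrable M forcing"
	using bochner_L2_Hv_D[OF Hv_sigma_subset f] by (auto simp: forcing_def[abs_def])

lemma forcing_nonneg: "0 <= forcing t"
	unfolding forcing_def by (intro infsum_nonneg) simp

lemma f_summable: "AE t in M. wsummable (wgt (- 1)) (f t)"
	using f_AE by eventually_elim (auto simp: Hv_sigma_def Hv_iff)

lemma f_integrable: "k ~= 0 ==> integrable M (%t. f t k)"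
	by (rule integrable_mode(2)[OF _ _ f_measurable f_summable forcing_integrable[unfolded forcing_def[abs_def]]])
		 (auto simp: wgt_pos)

lemma v0_props: "v0 0 = 0" "v0 (- k) = cnj_vec (v0 k)" "divergence v0 k = 0" "sq_summable v0"
proof -
	have h: "v0 0 = 0" "!!k. v0 (- k) = cnj_vec (v0 k)" "!!k. divergence v0 k = 0" "wsummable (wgt 0) v0"
		using v0 by (auto simp: Hv_sigma_def Hv_iff)
	have e: "wgt 0 k * (norm (v0 k))^2 = (norm (v0 k))^2" for k using h(1) by (cases "k = 0") (auto simp: wgt_def)
	show "v0 0 = 0" "v0 (- k) = cnj_vec (v0 k)" "divergence v0 k = 0" "sq_summable v0"
		using h(1-3) h(4)[unfolded e] by auto
qed

lemma E0_nonneg: "0 <= E0"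
	unfolding E0_def using \<nu> forcing_nonneg
	by (intro add_nonneg_nonneg mult_nonneg_nonneg infsum_nonneg Bochner_Integration.integral_nonneg) auto

lemma bdot_cwave_self: "bdot (cwave k) (cwave k) = - of_real ((freq k)^2)"
proof -
	have "(freq k)^2 = (of_int (k $ 1))^2 + (of_int (k $ 2))^2 + (of_int (k $ 3))^2"
		by (simp add: norm_vec_sq wave_def sum_3)
	then show ?thesis by (simp add: bdot_3 cwave_def power2_eq_square algebra_simps)
qed

lemma grad_eq: "grad p k = p k *s cwave k"
	by (simp add: vec_eq_iff grad_def cwave_def mult_ac)

lemma norm_press_le: "norm (press u k) <= 3 * norm (nl u k) / (a k * freq k)"
proof (cases "k = 0")
	case False
	then have w: "0 < freq k" by simp
	have "norm (press u k) = norm (bdot (cwave k) (nl u k)) / (a k * (freq k)^2)"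
		using asymb_pos[of \<alpha> \<theta> k] by (simp add: press_def norm_divide norm_mult norm_power)
	also have "... <= (3 * (freq k * norm (nl u k))) / (a k * (freq k)^2)"
		using norm_bdot_le[of "cwave k" "nl u k"] asymb_pos[of \<alpha> \<theta> k] w
		by (intro divide_right_mono) (auto simp: norm_cwave)
	also have "... = 3 * norm (nl u k) / (a k * freq k)"
		using w by (simp add: power2_eq_square)
	finally show ?thesis .
qed (simp add: press_def bdot_def)

lemma norm_grad_press_le: "norm (grad (press u) k) <= 3 * norm (nl u k)"
proof (cases "k = 0")
	case False
	then have w: "0 < freq k" by simp
	have "norm (grad (press u) k) = norm (press u k) * freq k"
		by (simp add: grad_eq norm_smult_vec norm_cwave)
	also have "... <= (3 * norm (nl u k) / (a k * freq k)) * freq k"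
		by (rule mult_right_mono[OF norm_press_le]) simp
	also have "... = 3 * norm (nl u k) / a k" using w by simp
	also have "... <= 3 * norm (nl u k)"
		using asymb_ge_1[of \<alpha> \<theta> k] by (simp add: divide_le_eq mult_le_cancel_left1 mult_left_le)
	finally show ?thesis .
qed (simp add: grad_eq)

lemma grad_press_inner:
	assumes "bdot (cwave k) (w k) = 0" shows "grad p k \<bullet> w k = 0"
proof -
	have "bdot (cwave k) (cnj_vec (w k)) = - cnj (bdot (cwave k) (w k))"
		by (simp add: bdot_3 cwave_def cnj_vec_def)
	then have "bdot (cwave k) (cnj_vec (w k)) = 0" using assms by simp
	moreover have "bdot (p k *s cwave k) (cnj_vec (w k)) = p k * bdot (cwave k) (cnj_vec (w k))"
		by (simp add: bdot_3 algebra_simps)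
	ultimately show ?thesis by (simp add: grad_eq inner_bdot)
qed

lemma norm_rhs_le:
	"norm (rhs u w g k) <= 4 * norm (nl u k) + \<nu> * (freq k)^2 * norm (w k) + norm (g k)"
proof -
	have i: "norm (inverse (a k) *\<^sub>R x) <= norm x" for x :: "complex ^ 3"
		using inverse_asymb_le_1[of \<alpha> \<theta> k] asymb_pos[of \<alpha> \<theta> k] by (simp add: mult_left_le_one_le)
	have "norm (rhs u w g k) <= norm (inverse (a k) *\<^sub>R nl u k) + norm ((\<nu> * (freq k)^2) *\<^sub>R w k) + norm (grad (press u) k) + norm (inverse (a k) *\<^sub>R g k)"
		unfolding rhs_def by (meson add_mono norm_triangle_le norm_triangle_le_diff order_refl)
	then show ?thesis
		using i[of "nl u k"] i[of "g k"] norm_grad_press_le[of u k] \<nu> by (simp add: abs_mult)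
qed

end

locale approx = setting +
	fixes N :: nat and w :: "real => vfield" and q :: "real => sfield"
	assumes sol: "regular_weak_solution T \<nu> \<alpha> \<theta> f v0 N w q"
begin

definition u :: "real => vfield" where
	"u t k = d N k *\<^sub>R w t k"

lemma D_op_w: "D_op \<alpha> \<theta> N (w t) = u t"
	by (simp add: fun_eq_iff D_op_eq u_def)

lemma w_mem: "t \<in> {0..T} ==> w t \<in> Hv_sigma \<theta>"
	using sol by (auto simp: regular_weak_solution_def time_continuous_def)

lemma w_props:
	assumes "t \<in> {0..T}"
	shows "w t 0 = 0" "w t (- k) = cnj_vec (w t k)" "divergence (w t) k = 0" "bdot (cwave k) (w t k) = 0"
		"wsummable (wgt \<theta>) (w t)"
	using w_mem[OF assms] by (auto simp: Hv_sigma_def Hv_iff divergence_eq)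

lemma w_L2: "w \<in> bochner_Lp 2 T (Hv_sigma (1 + \<theta>)) (Hv_norm (1 + \<theta>))"
	using sol by (simp add: regular_weak_solution_def)

lemma w_measurable: "(%t. w t k) \<in> borel_measurable M"
	and w_AE: "AE t in M. w t \<in> Hv_sigma (1 + \<theta>)"
	and w_integrable: "integrable M (%t. wsum (wgt (1 + \<theta>)) (w t))"
	using bochner_L2_Hv_D[OF Hv_sigma_subset w_L2] by auto

lemma w_summable: "AE t in M. wsummable (wgt (1 + \<theta>)) (w t)"
	using w_AE by eventually_elim (auto simp: Hv_sigma_def Hv_iff)

lemma w_diff_tendsto:
	assumes t: "t \<in> {0..T}"
	shows "((%s. INFSUM k. wgt \<theta> k * (norm (w s k - w t k))^2) \<longlongrightarrow> 0) (at t within {0..T})"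
proof -
	have "((%s. Hv_norm \<theta> (w s - w t)) \<longlongrightarrow> 0) (at t within {0..T})"
		using sol t by (auto simp: regular_weak_solution_def time_continuous_def)
	then have "((%s. (Hv_norm \<theta> (w s - w t))^2) \<longlongrightarrow> 0^2) (at t within {0..T})" by (rule tendsto_power)
	then show ?thesis by (simp add: Hv_norm_eq_wnorm wnorm_sq)
qed

lemma w_continuous: "continuous_on {0..T} (%t. w t k)"
	unfolding continuous_on_def
proof
	fix t assume t: "t \<in> {0..T}"
	show "((%t. w t k) \<longlongrightarrow> w t k) (at t within {0..T})"
	proof (cases "k = 0")
		case True
		have "\<forall>\<^sub>F s in at t within {0..T}. w s k = w t k"
			using w_props(1) t True by (auto simp: eventually_at_filter)
		then show ?thesis by (rule tendsto_eventually)
	next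
		case False
		let ?S = "%s. INFSUM k. wgt \<theta> k * (norm (w s k - w t k))^2"
		have lim: "((%s. sqrt (?S s / wgt \<theta> k)) \<longlongrightarrow> sqrt (0 / wgt \<theta> k)) (at t within {0..T})"
			using False by (intro tendsto_real_sqrt tendsto_divide w_diff_tendsto t tendsto_const) simp
		have "((%s. w s k - w t k) \<longlongrightarrow> 0) (at t within {0..T})"
		proof (rule Lim_null_comparison)
			show "\<forall>\<^sub>F s in at t within {0..T}. norm (w s k - w t k) <= sqrt (?S s / wgt \<theta> k)"
				unfolding eventually_at_filter
			proof (rule always_eventually, intro allI impI)
				fix s assume s: "s \<in> {0..T}"
				have "wgt \<theta> k * (norm (w s k - w t k))^2 <= ?S s"
					using w_props(5)[OF s] w_props(5)[OF t] by (intro le_infsum[of "%k. wgt \<theta> k * (norm (w s k - w t k))^2"] wsum_diff) auto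
				then have "(norm (w s k - w t k))^2 <= ?S s / wgt \<theta> k" using wgt_pos[OF False, of \<theta>] by (simp add: field_simps)
				then show "norm (w s k - w t k) <= sqrt (?S s / wgt \<theta> k)" by (rule real_le_rsqrt)
			qed
			show "((%s. sqrt (?S s / wgt \<theta> k)) \<longlongrightarrow> 0) (at t within {0..T})" using lim by simp
		qed
		then show ?thesis by (simp add: LIM_zero_iff)
	qed
qed

text \<open>Continuity into H^\<theta> and compactness of the time interval. Being a supremum in
  time, it supplies the one factor of the trilinear form that is not integrated in time.\<close>

lemma w_bounded: "\<exists>B\<ge>0. \<forall>t\<in>{0..T}. (wsum (wgt \<theta>) (w t)) <= B"
proof -
	let ?S = "%t. wsum (wgt \<theta>) (w t)"
	have S0: "0 <= ?S t" for t by (intro infsum_nonneg) simp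
	have "\<exists>\<delta>>0. \<forall>s\<in>{0..T}. dist s t < \<delta> \<longrightarrow> ?S s <= 2 + 2 * ?S t" if t: "t \<in> {0..T}" for t
	proof -
		have "\<forall>\<^sub>F s in at t within {0..T}. (INFSUM k. wgt \<theta> k * (norm (w s k - w t k))^2) < 1"
			by (rule order_tendstoD(2)[OF w_diff_tendsto[OF t]]) simp
		then obtain \<delta> where \<delta>: "\<delta> > 0" "!!s. s \<in> {0..T} ==> s ~= t ==> dist s t < \<delta> ==> (INFSUM k. wgt \<theta> k * (norm (w s k - w t k))^2) < 1"
			unfolding eventually_at by auto
		have "?S s <= 2 + 2 * ?S t" if s: "s \<in> {0..T}" "dist s t < \<delta>" for s
		proof (cases "s = t")
			case True then show ?thesis using S0[of t] by simp
		next
			case False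
			have d: "(%k. wgt \<theta> k * (norm (w s k - w t k))^2) summable_on UNIV"
				using w_props(5)[OF s(1)] w_props(5)[OF t] by (intro wsum_diff) auto
			have m: "(%k. wgt \<theta> k * (norm (- w t k))^2) summable_on UNIV" using w_props(5)[OF t] by simp
			have "?S s <= 2 * (INFSUM k. wgt \<theta> k * (norm (w s k - w t k))^2) + 2 * ?S t"
				using wsum_diff(2)[of "wgt \<theta>" "%k. w s k - w t k" "%k. - w t k", OF wgt_nonneg d m] by simp
			then show ?thesis using \<delta>(2)[OF s(1) False s(2)] by linarith
		qed
		then show ?thesis using \<delta>(1) by blast
	qed
	then have "\<forall>t\<in>{0..T}. \<exists>\<delta>. \<delta> > 0 \<and> (\<forall>s\<in>{0..T}. dist s t < \<delta> \<longrightarrow> ?S s <= 2 + 2 * ?S t)" by blast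
	from bchoice[OF this] obtain \<delta> where \<delta>: "!!t. t \<in> {0..T} ==> \<delta> t > 0"
		"!!t s. t \<in> {0..T} ==> s \<in> {0..T} ==> dist s t < \<delta> t ==> ?S s <= 2 + 2 * ?S t"
		by blast
	have cov: "{0..T} \<subseteq> (\<Union>t\<in>{0..T}. ball t (\<delta> t))" using \<delta>(1) by force
	obtain C where C: "C \<subseteq> {0..T}" "finite C" "{0..T} \<subseteq> (\<Union>t\<in>C. ball t (\<delta> t))"
		by (rule compactE_image[OF compact_Icc _ cov]) auto
	have "?S s <= (\<Sum>t\<in>C. 2 + 2 * ?S t)" if s: "s \<in> {0..T}" for s
	proof -
		obtain t where t: "t \<in> C" "s \<in> ball t (\<delta> t)" using C(3) s by blast
		then have "?S s <= 2 + 2 * ?S t" using \<delta>(2)[of t s] C(1) s by (auto simp: dist_commute)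
		also have "... <= (\<Sum>t\<in>C. 2 + 2 * ?S t)"
			using S0 C(2) t(1) by (intro member_le_sum[of t C "%t. 2 + 2 * ?S t"]) (auto intro: add_nonneg_nonneg)
		finally show ?thesis .
	qed
	moreover have "0 <= (\<Sum>t\<in>C. 2 + 2 * ?S t)" using S0 by (intro sum_nonneg) (auto intro: add_nonneg_nonneg)
	ultimately show ?thesis by blast
qed

lemma u_props:
	assumes "t \<in> {0..T}"
	shows "u t 0 = 0" "u t (- k) = cnj_vec (u t k)" "divergence (u t) k = 0" "bdot (cwave k) (u t k) = 0"
		"l2_field (u t)"
proof -
	show z: "u t 0 = 0" and r: "u t (- k) = cnj_vec (u t k)" for k using w_props[OF assms] by (simp_all add: u_def cnj_vec_scaleR)
	show "divergence (u t) k = 0" for k using divergence_scaleR[of "d N" "w t" k] w_props(3)[OF assms] by (simp add: u_def[abs_def])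
	then show "bdot (cwave k) (u t k) = 0" by (simp add: divergence_eq)
	have "sq_summable (u t)"
	proof (rule summable_on_comparison_real)
		show "(%k. (real N + 1)^2 * (wgt \<theta> k * (norm (w t k))^2)) summable_on UNIV"
			by (rule summable_on_cmult_right[OF w_props(5)[OF assms]])
		fix k
		have "(norm (u t k))^2 = (d N k)^2 * (norm (w t k))^2" by (simp add: u_def power_mult_distrib)
		also have "... <= (real N + 1)^2 * (wgt \<theta> k * (norm (w t k))^2)"
			using w_props(1)[OF assms] dsymb_bounds(3)[of \<alpha> \<theta> N k] dsymb_pos[of \<alpha> \<theta> N k] wgt_ge_1[of \<theta> k] \<theta>
				mult_right_mono[OF wgt_ge_1[of \<theta> k], of "(norm (w t k))^2"]
			by (cases "k = 0") (auto intro!: mult_mono power_mono)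
		finally show "\<bar>(norm (u t k))^2\<bar> <= (real N + 1)^2 * (wgt \<theta> k * (norm (w t k))^2)" by simp
	qed
	then show "l2_field (u t)" using r by (simp add: l2_field_def)
qed

lemma u_measurable: "(%t. u t k) \<in> borel_measurable M"
	unfolding u_def using w_measurable by (intro borel_measurable_scaleR) auto

text \<open>The constant depends on N, so the use is qualitative: it gives meaning to the nonlinear
  terms of one approximation and makes their work on it summable.\<close>

lemma u_weighted:
	assumes t: "wsummable (wgt s) (w t)" and K: "finite K" and rs: "r <= s"
	shows "(\<Sum>k\<in>K. wgt r k * (norm (u t k))^2) <= (real N + 1)^2 * (wsum (wgt s) (w t))"
proof -
	have "(\<Sum>k\<in>K. wgt r k * (norm (u t k))^2) <= (\<Sum>k\<in>K. (real N + 1)^2 * (wgt s k * (norm (w t k))^2))"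
	proof (rule sum_mono)
		fix k
		have "wgt r k * (norm (u t k))^2 = (d N k)^2 * (wgt r k * (norm (w t k))^2)" by (simp add: u_def power_mult_distrib)
		also have "... <= (real N + 1)^2 * (wgt s k * (norm (w t k))^2)"
			using dsymb_bounds(3)[of \<alpha> \<theta> N k] dsymb_pos[of \<alpha> \<theta> N k] wgt_mono[OF rs, of k]
			by (intro mult_mono power_mono mult_right_mono) auto
		finally show "wgt r k * (norm (u t k))^2 <= (real N + 1)^2 * (wgt s k * (norm (w t k))^2)" .
	qed
	also have "... <= (real N + 1)^2 * (wsum (wgt s) (w t))"
		unfolding sum_distrib_left[symmetric] by (intro mult_left_mono sum_le_infsum[OF t _ K]) auto
	finally show ?thesis .
qed

lemma nl_measurable: "(%t. nl (u t) k) \<in> borel_measurable M"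
	unfolding nl_def
proof (rule borel_measurable_infsum_AE)
	show "(%t. nlq k (u t) (u t) l) \<in> borel_measurable M" for l by (rule nlq_measurable[OF u_measurable])
	show "AE t in M. (%l. nlq k (u t) (u t) l) summable_on UNIV"
		using u_props(5) by (intro AE_I2 nlq_summable(2)) (auto simp: l2_field_def)
qed simp

lemma nl_bounded: "\<exists>B. \<forall>t\<in>{0..T}. norm (nl (u t) k) <= B"
proof -
	obtain B where B: "!!t. t \<in> {0..T} ==> (wsum (wgt \<theta>) (w t)) <= B" using w_bounded by blast
	have "norm (nl (u t) k) <= 6 * freq k * ((real N + 1)^2 * B)" if t: "t \<in> {0..T}" for t
	proof -
		have s: "sq_summable (u t)" using u_props(5)[OF t] by (simp add: l2_field_def)
		have "(l2_norm (u t))^2 <= (real N + 1)^2 * B"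
			unfolding l2_norm_sq
		proof (rule infsum_le_finite_sums[OF s])
			fix K :: "(int ^ 3) set" assume K: "finite K"
			have "(\<Sum>k\<in>K. (norm (u t k))^2) = (\<Sum>k\<in>K. wgt 0 k * (norm (u t k))^2)"
				using u_props(1)[OF t] by (intro sum.cong refl) (auto simp: wgt_def)
			also have "... <= (real N + 1)^2 * (wsum (wgt \<theta>) (w t))"
				by (rule u_weighted[OF w_props(5)[OF t] K]) (use \<theta> in simp)
			also have "... <= (real N + 1)^2 * B" using B[OF t] by (intro mult_left_mono) auto
			finally show "(\<Sum>k\<in>K. (norm (u t k))^2) <= (real N + 1)^2 * B" .
		qed
		then have "6 * freq k * (l2_norm (u t))^2 <= 6 * freq k * ((real N + 1)^2 * B)" by (intro mult_left_mono) auto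
		then show ?thesis using norm_nl_le[OF s, of k] by linarith
	qed
	then show ?thesis by blast
qed

lemma nl_integrable: "integrable M (%t. nl (u t) k)"
proof -
	obtain B where "!!t. t \<in> {0..T} ==> norm (nl (u t) k) <= B" using nl_bounded by blast
	then show ?thesis by (intro integrable_bounded_interval[OF nl_measurable] AE_I2) auto
qed

lemma w_integrable_mode: "integrable M (%t. w t k)"
	by (rule continuous_imp_integrable_real[OF w_continuous])

lemma cross_field_AE: "AE t in M. cross_field (D_op \<alpha> \<theta> N (w t)) (curl (D_op \<alpha> \<theta> N (w t))) = nl (u t)"
	using w_summable AE_space
proof eventually_elim
	case (elim t)
	then have t: "t \<in> {0..T}" by simp
	have "wsummable (wgt 1) (u t)"
		using u_weighted[OF elim(1), of _ 1] \<theta> by (intro nonneg_summable_bounded(1)) auto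
	then have "u t \<in> Hv 1" using u_props(1,2)[OF t] by (simp add: Hv_iff)
	then show ?case unfolding D_op_w by (rule nl_eq_cross_field[OF _ u_props(3)[OF t]])
qed

lemma q_props:
	"(%t. q t k) \<in> borel_measurable M" "AE t in M. q t \<in> Hs (4 * \<theta> - 1/2)" "AE t in M. q t 0 = 0"
	"integrable M (%t. wsum (hwt (4 * \<theta> - 1/2)) (q t))"
	"integrable M (%t. q t k)"
proof -
	have q: "q \<in> bochner_Lp 2 T (Hs (4 * \<theta> - 1/2)) (Hs_norm (4 * \<theta> - 1/2))"
		using sol by (simp add: regular_weak_solution_def)
	show 1: "(%t. q t k) \<in> borel_measurable M" "AE t in M. q t \<in> Hs (4 * \<theta> - 1/2)"
		"integrable M (%t. wsum (hwt (4 * \<theta> - 1/2)) (q t))" for k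
		using bochner_L2_Hs_D[OF subset_refl q] by auto
	show "AE t in M. q t 0 = 0" using sol by (auto simp: regular_weak_solution_def mean_free_def)
	have "AE t in M. wsummable (hwt (4 * \<theta> - 1/2)) (q t)"
		using 1(2) by eventually_elim (simp add: Hs_iff)
	then show "integrable M (%t. q t k)"
		by (intro integrable_mode(2)[OF _ _ 1(1) _ 1(3)]) (auto simp: hwt_pos less_imp_le)
qed

lemma grad_q_integrable: "integrable M (%t. grad (q t) k)"
proof -
	have "bounded_linear (%c. c *s cwave k)"
		unfolding linear_conv_bounded_linear[symmetric]
		by (rule linearI) (auto simp: vec_eq_iff algebra_simps)
	then show ?thesis unfolding grad_eq by (rule integrable_bounded_linear[OF _ q_props(5)])
qed

text \<open>Test fields need only be square integrable in time, so an indicator in time times a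
  single mode is admissible and turns the weak formulation into an integral equation. It holds at
  every \<tau> because the modes of w are continuous.\<close>

lemma mode_equation_q:
	assumes k: "k ~= 0" and \<tau>: "0 <= \<tau>" "\<tau> <= T"
	shows "w \<tau> k = w 0 k + prim T (%t. inverse (a k) *\<^sub>R nl (u t) k - (\<nu> * (freq k)^2) *\<^sub>R w t k
						- grad (q t) k + inverse (a k) *\<^sub>R f t k) \<tau>"
proof -
	obtain w' where w'L2: "w' \<in> bochner_Lp 2 T (Hv (4 * \<theta> - 3/2)) (Hv_norm (4 * \<theta> - 3/2))"
		and w'd: "has_weak_time_deriv T w w'"
		and eq: "!!\<phi>. \<phi> \<in> bochner_Lp 2 T (Hv 1) (Hv_norm 1) ==>
					 (LINT t|M. pairing (w' t) (\<phi> t)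
							- pairing (filtered \<alpha> \<theta> (cross_field (D_op \<alpha> \<theta> N (w t)) (curl (D_op \<alpha> \<theta> N (w t))))) (\<phi> t)
							+ \<nu> * grad_pairing (w t) (\<phi> t)
							+ pairing (grad (q t)) (\<phi> t))
					 = (LINT t|M. pairing (filtered \<alpha> \<theta> (f t)) (\<phi> t))"
		using sol unfolding regular_weak_solution_def by blast
	note w'D = bochner_L2_Hv_D[OF subset_refl w'L2]
	have w's: "AE t in M. wsummable (wgt (4 * \<theta> - 3/2)) (w' t)"
		using w'D(2) by eventually_elim (simp add: Hv_iff)
	have w'i: "integrable M (%t. w' t k)"
		using k by (intro integrable_mode(2)[OF _ _ w'D(1) w's w'D(3)]) (auto simp: wgt_pos)
	have w_prim: "w \<tau> k = w 0 k + prim T (%t. w' t k) \<tau>"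
	proof (rule weak_deriv_prim[OF T w_continuous w'i _ \<tau>])
		fix \<eta> assume "test_time T \<eta>"
		then show "(LINT t|M. deriv \<eta> t *\<^sub>R w t k) = - (LINT t|M. \<eta> t *\<^sub>R w' t k)"
			using w'd unfolding has_weak_time_deriv_def test_time_def by blast
	qed
	\<comment> \<open>\<open>X\<close> collects the left side of the weak equation at mode k and
	  \<open>Y\<close> the force. Testing up to time \<tau> shows that their primitives agree at
	  \<tau>.\<close>
	define X where "X t = w' t k - inverse (a k) *\<^sub>R nl (u t) k + (\<nu> * (freq k)^2) *\<^sub>R w t k + grad (q t) k" for t
	define Y where "Y t = inverse (a k) *\<^sub>R f t k" for t
	have Xi: "integrable M X" unfolding X_def using w'i nl_integrable w_integrable_mode grad_q_integrable by auto
	have Yi: "integrable M Y" unfolding Y_def using f_integrable[OF k] by auto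
	have "prim T X \<tau> \<bullet> z = prim T Y \<tau> \<bullet> z" for z
	proof -
		let ?\<phi> = "%t l. indicator {..\<tau>} t *\<^sub>R mode_field k z l"
		let ?c = "INFSUM l. wgt 1 l * (norm (mode_field k z l))^2"
		have \<phi>n: "(INFSUM l. wgt 1 l * (norm (?\<phi> t l))^2) = indicator {..\<tau>} t * ?c" for t :: real
			by (auto split: split_indicator)
		have \<phi>: "?\<phi> \<in> bochner_Lp 2 T (Hv 1) (Hv_norm 1)"
		proof (rule bochner_L2_Hv_I)
			show "(%t. ?\<phi> t l) \<in> borel_measurable M" for l
				by (intro borel_measurable_scaleR indicator_measurable_lebesgue_on) auto
			show "AE t in M. ?\<phi> t \<in> Hv 1"
			proof (rule AE_I2, unfold Hv_iff, intro conjI allI)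
				fix t l
				show "?\<phi> t 0 = 0" using k by (simp add: mode_field_def)
				show "?\<phi> t (- l) = cnj_vec (?\<phi> t l)" by (simp add: mode_field_real cnj_vec_scaleR)
				show "(%l. wgt 1 l * (norm (?\<phi> t l))^2) summable_on UNIV"
					by (rule finite_nonzero_values_imp_summable_on, rule finite_subset[of _ "{k, - k}"]) (auto simp: mode_field_def split: if_splits)
			qed
			show "integrable M (%t. INFSUM l. wgt 1 l * (norm (?\<phi> t l))^2)"
				unfolding \<phi>n
				by (rule integrable_bounded_interval[where B = "\<bar>?c\<bar>"])
					 (auto intro!: borel_measurable_times indicator_measurable_lebesgue_on split: split_indicator)
		qed
		have L: "AE t in M. pairing (w' t) (?\<phi> t)
							- pairing (filtered \<alpha> \<theta> (cross_field (D_op \<alpha> \<theta> N (w t)) (curl (D_op \<alpha> \<theta> N (w t))))) (?\<phi> t)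
							+ \<nu> * grad_pairing (w t) (?\<phi> t) + pairing (grad (q t)) (?\<phi> t)
						= 2 * (2 * pi) ^ 3 * (indicator {..\<tau>} t *\<^sub>R (X t \<bullet> z))"
			using cross_field_AE w'D(2) q_props(2) AE_space
		proof eventually_elim
			case (elim t)
			then have t: "t \<in> {0..T}" by simp
			have r1: "w' t (- k) = cnj_vec (w' t k)" using elim(2) by (simp add: Hv_iff)
			have r2: "filtered \<alpha> \<theta> (nl (u t)) (- k) = cnj_vec (filtered \<alpha> \<theta> (nl (u t)) k)"
				using u_props[OF t] by (simp add: filtered_eq cnj_vec_scaleR nl_real l2_field_def)
			have "q t (- k) = cnj (q t k)" using elim(3) by (simp add: Hs_iff)
			then have r3: "grad (q t) (- k) = cnj_vec (grad (q t) k)" by (simp add: grad_def cnj_vec_def vec_eq_iff)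
			show ?case
				unfolding elim(1) pairing_mode_field[OF k r1] pairing_mode_field[OF k r2] pairing_mode_field[OF k r3]
					grad_pairing_mode_field[where v = "w t", OF k w_props(2)[OF t]]
				by (simp add: X_def filtered_eq inner_add_left inner_diff_left algebra_simps)
		qed
		have R: "AE t in M. pairing (filtered \<alpha> \<theta> (f t)) (?\<phi> t) = 2 * (2 * pi) ^ 3 * (indicator {..\<tau>} t *\<^sub>R (Y t \<bullet> z))"
			using f_AE
		proof eventually_elim
			case (elim t)
			then have "filtered \<alpha> \<theta> (f t) (- k) = cnj_vec (filtered \<alpha> \<theta> (f t) k)"
				by (simp add: Hv_sigma_def Hv_iff filtered_eq cnj_vec_scaleR)
			then show ?case by (simp add: pairing_mode_field[OF k] Y_def filtered_eq)
		qed
		have m: "(%t. 2 * (2 * pi) ^ 3 * (indicator {..\<tau>} t *\<^sub>R (Z t \<bullet> z))) \<in> borel_measurable M" if "integrable M Z" for Z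
			using that by (intro borel_measurable_times borel_measurable_scaleR indicator_measurable_lebesgue_on borel_measurable_inner) auto
		have "(LINT t|M. 2 * (2 * pi) ^ 3 * (indicator {..\<tau>} t *\<^sub>R (X t \<bullet> z))) = (LINT t|M. 2 * (2 * pi) ^ 3 * (indicator {..\<tau>} t *\<^sub>R (Y t \<bullet> z)))"
			using eq[OF \<phi>] unfolding LINT_cong_AE_lebesgue_on[OF m[OF Xi] L] LINT_cong_AE_lebesgue_on[OF m[OF Yi] R] .
		then have "prim T (%t. X t \<bullet> z) \<tau> = prim T (%t. Y t \<bullet> z) \<tau>" unfolding prim_def by simp
		then show ?thesis by (simp add: prim_inner[OF Xi] prim_inner[OF Yi])
	qed
	then have "(prim T X \<tau> - prim T Y \<tau>) \<bullet> (prim T X \<tau> - prim T Y \<tau>) = 0" by (simp only: inner_diff_left diff_self)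
	then have XY: "prim T X \<tau> = prim T Y \<tau>" by simp
	let ?r = "%t. inverse (a k) *\<^sub>R nl (u t) k - (\<nu> * (freq k)^2) *\<^sub>R w t k - grad (q t) k + inverse (a k) *\<^sub>R f t k"
	have "?r = (%t. w' t k - (X t - Y t))" by (auto simp: X_def Y_def)
	then have "prim T ?r \<tau> = prim T (%t. w' t k) \<tau> - (prim T X \<tau> - prim T Y \<tau>)"
		by (simp add: prim_diff w'i Xi Yi)
	then show ?thesis using w_prim XY by simp
qed

text \<open>The divergence of the integral equation has no velocity on the left, so that of the
  integrand has zero primitive and vanishes almost everywhere; this is an equation for the
  coefficient of q. Countability of the lattice provides a common null set.\<close>

lemma pressure_AE: "AE t in M. q t = press (u t)"
proof -
	have "AE t in M. q t k = press (u t) k" for k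
	proof (cases "k = 0")
		case True
		show ?thesis using q_props(3) by eventually_elim (simp add: True press_def bdot_def)
	next
		case k: False
		let ?r = "%t. inverse (a k) *\<^sub>R nl (u t) k - (\<nu> * (freq k)^2) *\<^sub>R w t k - grad (q t) k + inverse (a k) *\<^sub>R f t k"
		have ri: "integrable M ?r"
			using nl_integrable w_integrable_mode grad_q_integrable f_integrable[OF k] by auto
		have bl: "bounded_linear (bdot (cwave k))"
			unfolding linear_conv_bounded_linear[symmetric]
			by (rule linearI) (auto simp: bdot_3 algebra_simps)
		interpret L: bounded_linear "bdot (cwave k)" by (rule bl)
		have "AE t in M. bdot (cwave k) (?r t) = 0"
		proof (rule AE_zero_if_prim_zero)
			show "integrable M (%t. bdot (cwave k) (?r t))" by (rule integrable_bounded_linear[OF bl ri])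
			fix \<tau> assume \<tau>: "0 <= \<tau>" "\<tau> <= T"
			have "prim T (%t. bdot (cwave k) (?r t)) \<tau> = bdot (cwave k) (prim T ?r \<tau>)" by (rule prim_bounded_linear[OF bl ri])
			also have "prim T ?r \<tau> = w \<tau> k - w 0 k" using mode_equation_q[OF k \<tau>] by simp
			also have "bdot (cwave k) (w \<tau> k - w 0 k) = 0" using w_props(4)[of \<tau> k] w_props(4)[of 0 k] \<tau> T by (simp add: L.diff)
			finally show "prim T (%t. bdot (cwave k) (?r t)) \<tau> = 0" .
		qed
		then show ?thesis using f_AE AE_space
		proof eventually_elim
			case (elim t)
			then have t: "t \<in> {0..T}" and fk: "bdot (cwave k) (f t k) = 0" by (auto simp: Hv_sigma_def divergence_eq)
			have "bdot (cwave k) (grad (q t) k) = - (of_real ((freq k)^2) * q t k)"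
			proof -
				have "bdot (cwave k) (c *s cwave k) = c * bdot (cwave k) (cwave k)" for c by (simp add: bdot_3 algebra_simps)
				then show ?thesis by (simp add: grad_eq bdot_cwave_self)
			qed
			then have "inverse (a k) *\<^sub>R bdot (cwave k) (nl (u t) k) + of_real ((freq k)^2) * q t k = 0"
				using elim(1) fk w_props(4)[OF t, of k] by (simp add: L.add L.diff L.scaleR)
			then have "of_real (a k) * (of_real (inverse (a k)) * bdot (cwave k) (nl (u t) k) + of_real ((freq k)^2) * q t k) = 0"
				by (simp only: scaleR_conv_of_real mult_zero_right)
			moreover have "of_real (a k) * of_real (inverse (a k)) = (1 :: complex)"
				using asymb_pos[of \<alpha> \<theta> k] unfolding of_real_mult[symmetric] by simp
			ultimately have "bdot (cwave k) (nl (u t) k) + of_real (a k) * of_real ((freq k)^2) * q t k = 0"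
				by (simp only: distrib_left mult.assoc[symmetric] mult_1_left)
			then have "of_real (a k * (freq k)^2) * q t k = - bdot (cwave k) (nl (u t) k)"
				by (simp only: of_real_mult add_eq_0_iff)
			moreover have "complex_of_real (a k * (freq k)^2) ~= 0" using k asymb_pos[of \<alpha> \<theta> k] by simp
			ultimately show ?case unfolding press_def by (simp only: eq_divide_eq mult.commute[of "q t k"]) simp
		qed
	qed
	then have "AE t in M. \<forall>k. q t k = press (u t) k" unfolding AE_all_countable ..
	then show ?thesis by eventually_elim (simp add: fun_eq_iff)
qed

lemma rhs_integrable: "k ~= 0 ==> integrable M (%t. rhs (u t) (w t) (f t) k)"
	and mode_equation: "k ~= 0 ==> 0 <= \<tau> ==> \<tau> <= T ==> w \<tau> k = w 0 k + prim T (%t. rhs (u t) (w t) (f t) k) \<tau>"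
proof -
	assume k: "k ~= 0"
	let ?r = "%t. inverse (a k) *\<^sub>R nl (u t) k - (\<nu> * (freq k)^2) *\<^sub>R w t k - grad (q t) k + inverse (a k) *\<^sub>R f t k"
	have ri: "integrable M ?r"
		using nl_integrable w_integrable_mode grad_q_integrable f_integrable[OF k] by auto
	have ae: "AE t in M. ?r t = rhs (u t) (w t) (f t) k"
		using pressure_AE by eventually_elim (simp add: rhs_def)
	have m: "(%t. rhs (u t) (w t) (f t) k) \<in> borel_measurable M"
		by (rule borel_measurable_lebesgue_on_AE[OF _ _ ae]) (use ri in auto)
	show "integrable M (%t. rhs (u t) (w t) (f t) k)" by (rule integrable_cong_AE_imp[OF ri m ae])
	assume \<tau>: "0 <= \<tau>" "\<tau> <= T"
	show "w \<tau> k = w 0 k + prim T (%t. rhs (u t) (w t) (f t) k) \<tau>"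
		using mode_equation_q[OF k \<tau>] unfolding prim_cong_AE[OF m ae] .
qed

lemma w_initial: "w 0 k = inverse (a k) *\<^sub>R v0 k"
	using sol by (simp add: regular_weak_solution_def filtered_eq)

end

subsection \<open>The energy estimate\<close>

context approx begin

text \<open>The density of the inner product of A w with D w. It arises from testing with A D w: A
  removes the filter from the nonlinearity and the force, D turns w into u.\<close>

definition en :: "real => int ^ 3 => real" where
	"en t k = a k * d N k * (norm (w t k))^2"

lemma en_nonneg [simp]: "0 <= en t k"
	using asymb_pos[of \<alpha> \<theta> k] dsymb_pos[of \<alpha> \<theta> N k] by (simp add: en_def)

lemma norm_u_sq_le_en: "(norm (u t k))^2 <= en t k"
	using mult_right_mono[OF dsymb_sq_le[of \<alpha> \<theta> N k], of "(norm (w t k))^2"]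
	by (simp add: en_def u_def power_mult_distrib)

lemma norm_w_sq_le_u: "(norm (w t k))^2 <= (norm (u t k))^2"
	using dsymb_bounds(1)[of \<alpha> \<theta> N k] mult_right_mono[of 1 "(d N k)^2" "(norm (w t k))^2"]
	by (simp add: u_def power_mult_distrib one_le_power)

lemma u_continuous: "continuous_on {0..T} (%t. u t k)"
	unfolding u_def by (intro continuous_on_scaleR continuous_on_const w_continuous)

lemma en_integrable: "integrable M (%t. en t k)"
	unfolding en_def by (rule continuous_imp_integrable_real) (intro continuous_intros w_continuous)

lemma f_sq_integrable: "k ~= 0 ==> integrable M (%t. (norm (f t k))^2)"
	by (rule integrable_mode(1)[OF _ _ f_measurable f_summable forcing_integrable[unfolded forcing_def[abs_def]]])
		 (auto simp: wgt_pos)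

lemma nl_u_integrable: "integrable M (%t. nl (u t) k \<bullet> u t k)"
proof -
	obtain B where B: "!!t. t \<in> {0..T} ==> norm (nl (u t) k) <= B" using nl_bounded by blast
	have "bounded ((%t. u t k) ` {0..T})"
		by (intro compact_imp_bounded compact_continuous_image u_continuous compact_Icc)
	then obtain B' where B': "!!t. t \<in> {0..T} ==> norm (u t k) <= B'" unfolding bounded_iff by blast
	show ?thesis
	proof (rule integrable_bounded_interval)
		show "(%t. nl (u t) k \<bullet> u t k) \<in> borel_measurable M"
			by (intro borel_measurable_inner nl_measurable u_measurable)
		show "AE t in M. norm (nl (u t) k \<bullet> u t k) <= B * B'"
		proof (rule AE_I2)
			fix t assume "t \<in> space M"
			then have t: "t \<in> {0..T}" by simp
			have "norm (nl (u t) k \<bullet> u t k) <= norm (nl (u t) k) * norm (u t k)" by (simp add: Cauchy_Schwarz_ineq2)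
			also have "... <= B * B'" using B[OF t] B'[OF t] by (intro mult_mono) (auto intro: order_trans[OF norm_ge_zero])
			finally show "norm (nl (u t) k \<bullet> u t k) <= B * B'" .
		qed
	qed
qed

text \<open>The pressure gradient is orthogonal to divergence free fields, and Young's inequality
  spends half of the dissipation on the force, which uses that \<open>en\<close> dominates
  |u|^2.\<close>

lemma rhs_inner_le:
	assumes t: "t \<in> {0..T}" and k: "k ~= 0"
	shows "2 * (a k * d N k * (rhs (u t) (w t) (f t) k \<bullet> w t k))
		<= 2 * (nl (u t) k \<bullet> u t k) - \<nu> * (wgt 1 k * en t k) + (1 / \<nu>) * (wgt (- 1) k * (norm (f t k))^2)"
proof -
	have a: "a k ~= 0" using asymb_pos[of \<alpha> \<theta> k] by simp
	have g: "grad (press (u t)) k \<bullet> w t k = 0" by (rule grad_press_inner[OF w_props(4)[OF t]])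
	have "a k * d N k * (rhs (u t) (w t) (f t) k \<bullet> w t k)
			= (a k * inverse (a k)) * (d N k * (nl (u t) k \<bullet> w t k)) - \<nu> * ((freq k)^2 * (a k * d N k * (w t k \<bullet> w t k)))
				+ (a k * inverse (a k)) * (d N k * (f t k \<bullet> w t k))"
		unfolding rhs_def by (simp add: inner_add_left inner_diff_left g algebra_simps)
	also have "... = nl (u t) k \<bullet> u t k - \<nu> * (wgt 1 k * en t k) + f t k \<bullet> u t k"
		using a by (simp add: u_def en_def wgt_1 power2_norm_eq_inner)
	finally have e: "a k * d N k * (rhs (u t) (w t) (f t) k \<bullet> w t k)
		= nl (u t) k \<bullet> u t k - \<nu> * (wgt 1 k * en t k) + f t k \<bullet> u t k" .
	have w: "freq k > 0" using k by simp
	let ?x = "norm (f t k) / freq k" and ?y = "freq k * norm (u t k)"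
	have "2 * (f t k \<bullet> u t k) <= 2 * (?x * ?y)" using w norm_cauchy_schwarz[of "f t k" "u t k"] by simp
	also have "... <= (1 / \<nu>) * ?x^2 + \<nu> * ?y^2"
	proof -
		have "0 <= (1 / \<nu>) * (?x - \<nu> * ?y)^2" using \<nu> by (intro mult_nonneg_nonneg) auto
		also have "... = (1 / \<nu>) * ?x^2 + \<nu> * ?y^2 - 2 * (?x * ?y)" using \<nu> by (simp add: power2_diff field_simps power2_eq_square)
		finally show ?thesis by linarith
	qed
	also have "?x^2 = wgt (- 1) k * (norm (f t k))^2"
		using w by (simp add: wgt_def power_divide powr_minus powr_numeral divide_inverse mult.commute power_mult_distrib power_inverse)
	also have "?y^2 = wgt 1 k * (norm (u t k))^2" by (simp add: power_mult_distrib wgt_1)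
	finally have "2 * (f t k \<bullet> u t k) <= (1 / \<nu>) * (wgt (- 1) k * (norm (f t k))^2) + \<nu> * (wgt 1 k * (norm (u t k))^2)" .
	moreover have "\<nu> * (wgt 1 k * (norm (u t k))^2) <= \<nu> * (wgt 1 k * en t k)"
		using \<nu> norm_u_sq_le_en[of t k] by (intro mult_left_mono) auto
	ultimately show ?thesis using e by linarith
qed

lemma energy_mode:
	assumes k: "k ~= 0" and \<tau>: "0 <= \<tau>" "\<tau> <= T"
	shows "en \<tau> k + \<nu> * prim T (%t. wgt 1 k * en t k) \<tau>
		<= (norm (v0 k))^2 + 2 * prim T (%t. nl (u t) k \<bullet> u t k) \<tau> + (1 / \<nu>) * prim T (%t. wgt (- 1) k * (norm (f t k))^2) \<tau>"
proof -
	let ?r = "%t. rhs (u t) (w t) (f t) k"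
	have me: "!!t. 0 <= t ==> t <= T ==> w t k = w 0 k + prim T ?r t" by (rule mode_equation[OF k])
	note bp = prim_by_parts_inner[OF rhs_integrable[OF k] rhs_integrable[OF k] me me \<tau>]
	have "(norm (w \<tau> k))^2 = (norm (w 0 k))^2 + 2 * prim T (%t. ?r t \<bullet> w t k) \<tau>"
		using bp(3) by (simp add: power2_norm_eq_inner inner_commute)
	note i1 = integrable_mult_right[OF nl_u_integrable, of 2 k]
		and i2 = integrable_mult_right[OF integrable_mult_right[OF en_integrable], of \<nu> "wgt 1 k" k]
		and i4 = integrable_mult_right[OF integrable_mult_right[OF f_sq_integrable[OF k]], of "1 / \<nu>" "wgt (- 1) k"]
	from \<open>(norm (w \<tau> k))^2 = _\<close> have "en \<tau> k = en 0 k + (2 * a k * d N k) * prim T (%t. ?r t \<bullet> w t k) \<tau>"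
		by (simp add: en_def algebra_simps)
	moreover have "(2 * a k * d N k) * prim T (%t. ?r t \<bullet> w t k) \<tau> = prim T (%t. (2 * a k * d N k) * (?r t \<bullet> w t k)) \<tau>"
		by (rule prim_cmult[symmetric])
	moreover have "prim T (%t. (2 * a k * d N k) * (?r t \<bullet> w t k)) \<tau> <= prim T (%t. 2 * (nl (u t) k \<bullet> u t k) - \<nu> * (wgt 1 k * en t k) + (1 / \<nu>) * (wgt (- 1) k * (norm (f t k))^2)) \<tau>"
	proof (rule prim_mono_AE)
		show "AE t in M. (2 * a k * d N k) * (?r t \<bullet> w t k)
			<= 2 * (nl (u t) k \<bullet> u t k) - \<nu> * (wgt 1 k * en t k) + (1 / \<nu>) * (wgt (- 1) k * (norm (f t k))^2)"
			using rhs_inner_le[OF _ k] by (intro AE_I2) (simp add: mult.assoc)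
		show "integrable M (%t. (2 * a k * d N k) * (?r t \<bullet> w t k))" by (rule integrable_mult_right[OF bp(1)])
		show "integrable M (%t. 2 * (nl (u t) k \<bullet> u t k) - \<nu> * (wgt 1 k * en t k) + (1 / \<nu>) * (wgt (- 1) k * (norm (f t k))^2))"
			by (rule Bochner_Integration.integrable_add[OF Bochner_Integration.integrable_diff[OF i1 i2] i4])
	qed
	moreover have "prim T (%t. 2 * (nl (u t) k \<bullet> u t k) - \<nu> * (wgt 1 k * en t k) + (1 / \<nu>) * (wgt (- 1) k * (norm (f t k))^2)) \<tau>
			= 2 * prim T (%t. nl (u t) k \<bullet> u t k) \<tau> - \<nu> * prim T (%t. wgt 1 k * en t k) \<tau>
			+ (1 / \<nu>) * prim T (%t. wgt (- 1) k * (norm (f t k))^2) \<tau>"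
	proof -
		have c: "prim T (%t. 2 * (nl (u t) k \<bullet> u t k)) \<tau> = 2 * prim T (%t. nl (u t) k \<bullet> u t k) \<tau>"
			"prim T (%t. \<nu> * (wgt 1 k * en t k)) \<tau> = \<nu> * prim T (%t. wgt 1 k * en t k) \<tau>"
			"prim T (%t. (1 / \<nu>) * (wgt (- 1) k * (norm (f t k))^2)) \<tau> = (1 / \<nu>) * prim T (%t. wgt (- 1) k * (norm (f t k))^2) \<tau>"
			by (rule prim_cmult)+
		show ?thesis
			by (rule trans[OF prim_add[OF Bochner_Integration.integrable_diff[OF i1 i2] i4]], rule arg_cong2[where f = plus],
					rule trans[OF prim_diff[OF i1 i2]], rule arg_cong2[where f = minus]) (rule c)+
	qed
	\<comment> \<open>The initial value is filtered, w(0) = v0 / a, so the density is d / a times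
	  |v0|^2, and d <= a.\<close>
	moreover have "en 0 k <= (norm (v0 k))^2"
	proof -
		have "en 0 k = d N k / a k * (norm (v0 k))^2"
			using asymb_pos[of \<alpha> \<theta> k] by (simp add: en_def w_initial power_mult_distrib power2_eq_square field_simps)
		also have "... <= 1 * (norm (v0 k))^2"
			using asymb_pos[of \<alpha> \<theta> k] dsymb_bounds(2)[of \<alpha> \<theta> N k] by (intro mult_right_mono) auto
		finally show ?thesis by simp
	qed
	ultimately show ?thesis by linarith
qed

text \<open>Dominated convergence in time. Of the three velocity factors one is bounded in time
  through H^\<theta> and two are square integrable through H^(1+\<theta>), so the majorant is
  integrable for the given N.\<close>

lemma nl_work_tendsto: "(%n. prim T (%t. \<Sum>k\<in>box3 n. nl (u t) k \<bullet> u t k) \<tau>) ----> 0"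
proof -
	obtain B where B: "0 <= B" "!!t. t \<in> {0..T} ==> (wsum (wgt \<theta>) (w t)) <= B" using w_bounded by blast
	let ?D = "%t. wsum (wgt (1 + \<theta>)) (w t)"
	let ?n = "real N + 1"
	have D0: "0 <= ?D t" for t by (intro infsum_nonneg) simp
	have key: "AE t in M. (\<forall>n. norm (\<Sum>k\<in>box3 n. nl (u t) k \<bullet> u t k) <= 36 * (tri_const (1/6) (1/6) (7/6) * (?n * sqrt B)) * ?n^2 * ?D t)
			\<and> (%n. \<Sum>k\<in>box3 n. nl (u t) k \<bullet> u t k) ----> 0"
		using w_summable AE_space
	proof eventually_elim
		case (elim t)
		then have t: "t \<in> {0..T}" by simp
		have A: "(\<Sum>k\<in>K. freq k powr (1/3) * (norm (u t k))^2) <= (?n * sqrt B)^2" if K: "finite K" for K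
		proof -
			have "(\<Sum>k\<in>K. wgt (1/6) k * (norm (u t k))^2) <= ?n^2 * (wsum (wgt \<theta>) (w t))"
				by (rule u_weighted[OF w_props(5)[OF t] K \<theta>(1)])
			also have "... <= ?n^2 * B" by (intro mult_left_mono B(2) t) simp
			finally show ?thesis using B(1) by (simp add: wgt_def power_mult_distrib)
		qed
		have Bd: "(\<Sum>k\<in>K. freq k powr (7/3) * (norm (u t k))^2) <= (?n * sqrt (?D t))^2" if K: "finite K" for K
		proof -
			have "(\<Sum>k\<in>K. wgt (7/6) k * (norm (u t k))^2) <= ?n^2 * ?D t"
				by (rule u_weighted[OF elim(1) K]) (use \<theta>(1) in simp)
			then show ?thesis using D0[of t] by (simp add: wgt_def power_mult_distrib)
		qed
		have nn: "0 <= ?n * sqrt B" "0 <= ?n * sqrt (?D t)" using B(1) D0[of t] by auto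
		note ne = nl_energy[OF u_props(2)[OF t] u_props(1)[OF t] u_props(3)[OF t] A Bd nn]
		have "36 * (tri_const (1/6) (1/6) (7/6) * (?n * sqrt B) * (?n * sqrt (?D t)) * (?n * sqrt (?D t)))
				= 36 * (tri_const (1/6) (1/6) (7/6) * (?n * sqrt B)) * ?n^2 * (sqrt (?D t) * sqrt (?D t))"
			by (simp only: power2_eq_square mult_ac)
		also have "sqrt (?D t) * sqrt (?D t) = ?D t" using D0[of t] by simp
		finally have e: "36 * (tri_const (1/6) (1/6) (7/6) * (?n * sqrt B) * (?n * sqrt (?D t)) * (?n * sqrt (?D t)))
				= 36 * (tri_const (1/6) (1/6) (7/6) * (?n * sqrt B)) * ?n^2 * ?D t" .
		show ?case using ne(1)[unfolded e] ne(2) unfolding real_norm_def by blast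
	qed
	have "(%n. prim T (%t. \<Sum>k\<in>box3 n. nl (u t) k \<bullet> u t k) \<tau>) ----> prim T (%t. 0 :: real) \<tau>"
	proof (rule prim_tendsto)
		show "(%t. \<Sum>k\<in>box3 n. nl (u t) k \<bullet> u t k) \<in> borel_measurable M" for n
			by (intro borel_measurable_sum borel_measurable_inner nl_measurable u_measurable)
		show "AE t in M. (%n. \<Sum>k\<in>box3 n. nl (u t) k \<bullet> u t k) ----> 0" using key by eventually_elim simp
		show "AE t in M. norm (\<Sum>k\<in>box3 n. nl (u t) k \<bullet> u t k) <= 36 * (tri_const (1/6) (1/6) (7/6) * (?n * sqrt B)) * ?n^2 * ?D t" for n
			using key by eventually_elim simp
		show "integrable M (%t. 36 * (tri_const (1/6) (1/6) (7/6) * (?n * sqrt B)) * ?n^2 * ?D t)"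
			by (intro integrable_mult_right w_integrable)
	qed simp
	then show ?thesis by (simp add: prim_def)
qed

text \<open>The left side lives on a fixed cube, whereas the nonlinear work disappears only in the
  limit of large cubes. The inequality is therefore taken on a larger cube, whose additional terms
  on the left are nonnegative, and that cube is sent to infinity.\<close>

lemma energy_box:
	assumes \<tau>: "0 <= \<tau>" "\<tau> <= T"
	shows "(\<Sum>k\<in>box3 m. en \<tau> k) + \<nu> * prim T (%t. \<Sum>k\<in>box3 m. wgt 1 k * en t k) \<tau> <= E0"
proof -
	define L where "L k = en \<tau> k + \<nu> * prim T (%t. wgt 1 k * en t k) \<tau>" for k
	have en0: "en t 0 = 0" if "t \<in> {0..T}" for t using w_props(1)[OF that] by (simp add: en_def)
	have L: "(\<Sum>k\<in>K. en \<tau> k) + \<nu> * prim T (%t. \<Sum>k\<in>K. wgt 1 k * en t k) \<tau> = (\<Sum>k\<in>K. L k)" for K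
	proof -
		have "prim T (%t. \<Sum>k\<in>K. wgt 1 k * en t k) \<tau> = (\<Sum>k\<in>K. prim T (%t. wgt 1 k * en t k) \<tau>)"
			by (rule prim_sum) (intro integrable_mult_right en_integrable)
		then show ?thesis by (simp add: L_def sum.distrib sum_distrib_left)
	qed
	have L0: "0 <= L k" for k
		unfolding L_def prim_def using \<nu> by (intro add_nonneg_nonneg mult_nonneg_nonneg Bochner_Integration.integral_nonneg) auto
	have "(\<Sum>k\<in>box3 m. L k) <= E0 + 2 * prim T (%t. \<Sum>k\<in>box3 n. nl (u t) k \<bullet> u t k) \<tau>" if mn: "m <= n" for n
	proof -
		let ?J = "box3 n - {0}"
		let ?V = "%k. (norm (v0 k))^2" and ?X = "%k. prim T (%t. nl (u t) k \<bullet> u t k) \<tau>"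
			and ?F = "%k. prim T (%t. wgt (- 1) k * (norm (f t k))^2) \<tau>"
		have "L 0 = 0" using en0[of \<tau>] \<tau> by (simp add: L_def prim_def wgt_def)
		have "(\<Sum>k\<in>box3 m. L k) <= (\<Sum>k\<in>box3 n. L k)"
			by (rule sum_mono2) (use L0 mn box3_mono finite_box3 in auto)
		also have "... = (\<Sum>k\<in>?J. L k)" by (rule sum.mono_neutral_right) (use finite_box3 \<open>L 0 = 0\<close> in auto)
		also have "... <= (\<Sum>k\<in>?J. ?V k + 2 * ?X k + (1 / \<nu>) * ?F k)"
			unfolding L_def by (intro sum_mono energy_mode \<tau>) auto
		also have "... = (\<Sum>k\<in>?J. ?V k) + 2 * (\<Sum>k\<in>?J. ?X k) + (1 / \<nu>) * (\<Sum>k\<in>?J. ?F k)"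
			by (simp add: sum.distrib sum_distrib_left)
		finally have "(\<Sum>k\<in>box3 m. L k) <= (\<Sum>k\<in>?J. ?V k) + 2 * (\<Sum>k\<in>?J. ?X k) + (1 / \<nu>) * (\<Sum>k\<in>?J. ?F k)" .
		moreover have "(\<Sum>k\<in>?J. ?V k) <= (INFSUM k. ?V k)" by (rule sum_le_infsum[OF v0_props(4)]) (auto simp: finite_box3)
		moreover have "(\<Sum>k\<in>?J. ?X k) = (\<Sum>k\<in>box3 n. ?X k)"
			by (rule sum.mono_neutral_left) (auto simp: finite_box3 nl_0 prim_def)
		moreover have "(\<Sum>k\<in>box3 n. ?X k) = prim T (%t. \<Sum>k\<in>box3 n. nl (u t) k \<bullet> u t k) \<tau>" by (rule prim_sum[symmetric]) (rule nl_u_integrable)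
		moreover have "(1 / \<nu>) * (\<Sum>k\<in>?J. ?F k) <= (1 / \<nu>) * (LINT t|M. forcing t)"
		proof (rule mult_left_mono)
			have i: "integrable M (%t. wgt (- 1) k * (norm (f t k))^2)" if "k \<in> ?J" for k
				using f_sq_integrable that by (intro integrable_mult_right) auto
			have "(\<Sum>k\<in>?J. ?F k) = prim T (%t. \<Sum>k\<in>?J. wgt (- 1) k * (norm (f t k))^2) \<tau>" by (rule prim_sum[symmetric]) (rule i)
			also have "... <= prim T forcing \<tau>"
			proof (rule prim_mono_AE)
				show "AE t in M. (\<Sum>k\<in>?J. wgt (- 1) k * (norm (f t k))^2) <= forcing t"
					using f_summable unfolding forcing_def by eventually_elim (rule sum_le_infsum, auto simp: finite_box3)
			qed (rule Bochner_Integration.integrable_sum, rule i, assumption, rule forcing_integrable)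
			also have "... <= (LINT t|M. forcing t)" by (rule prim_le_integral[OF forcing_integrable forcing_nonneg])
			finally show "(\<Sum>k\<in>?J. ?F k) <= (LINT t|M. forcing t)" .
		qed (use \<nu> in simp)
		ultimately show ?thesis unfolding E0_def by linarith
	qed
	moreover have "(%n. E0 + 2 * prim T (%t. \<Sum>k\<in>box3 n. nl (u t) k \<bullet> u t k) \<tau>) ----> E0 + 2 * 0"
		by (rule tendsto_add[OF tendsto_const tendsto_mult[OF tendsto_const nl_work_tendsto]])
	ultimately have "(\<Sum>k\<in>box3 m. L k) <= E0 + 2 * 0" by (intro LIMSEQ_le_const) auto
	then show ?thesis unfolding L by simp
qed

lemma energy: 
	assumes t: "t \<in> {0..T}" and K: "finite K"
	shows "(\<Sum>k\<in>K. en t k) <= E0"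
proof (rule finite_sum_le_box3[OF _ _ K])
	show "(\<Sum>k\<in>box3 n. en t k) <= E0" for n
	proof -
		have "0 <= \<nu> * prim T (%t. \<Sum>k\<in>box3 n. wgt 1 k * en t k) t"
			unfolding prim_def using \<nu> by (intro mult_nonneg_nonneg Bochner_Integration.integral_nonneg) (auto intro!: sum_nonneg mult_nonneg_nonneg)
		then show ?thesis using energy_box[of t n] t by simp
	qed
qed simp

lemma energy_dissipation: "(LINT t|M. (\<Sum>k\<in>box3 n. wgt 1 k * en t k)) <= E0 / \<nu>"
proof -
	have "0 <= (\<Sum>k\<in>box3 n. en T k)" by (intro sum_nonneg) simp
	then have "\<nu> * (LINT t|M. (\<Sum>k\<in>box3 n. wgt 1 k * en t k)) <= E0" using energy_box[of T n] T by (simp add: prim_T)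
	then show ?thesis using \<nu> by (simp add: field_simps)
qed

lemma energy_u:
	assumes t: "t \<in> {0..T}"
	shows "finite K ==> (\<Sum>k\<in>K. (norm (u t k))^2) <= E0" and "(l2_norm (u t))^2 <= E0"
		and "(norm (w t k))^2 <= E0"
proof -
	show 1: "(\<Sum>k\<in>K. (norm (u t k))^2) <= E0" if "finite K" for K
		using energy[OF t that] sum_mono[of K "%k. (norm (u t k))^2" "en t", OF norm_u_sq_le_en] by linarith
	show "(l2_norm (u t))^2 <= E0"
		unfolding l2_norm_sq using u_props(5)[OF t] 1 by (intro infsum_le_finite_sums) (auto simp: l2_field_def)
	show "(norm (w t k))^2 <= E0" using 1[of "{k}"] by (intro order_trans[OF norm_w_sq_le_u]) simp
qed

lemma norm_rhs_bound:
	assumes t: "t \<in> {0..T}"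
	shows "norm (rhs (u t) (w t) (f t) k) <= 24 * freq k * E0 + \<nu> * (freq k)^2 * sqrt E0 + norm (f t k)"
proof -
	have s: "sq_summable (u t)" using u_props(5)[OF t] by (simp add: l2_field_def)
	have "4 * norm (nl (u t) k) <= 4 * (6 * freq k * E0)"
		using norm_nl_le[OF s, of k] mult_left_mono[OF energy_u(2)[OF t], of "6 * freq k"] by simp
	moreover have "norm (w t k) <= sqrt E0" using energy_u(3)[OF t] by (rule real_le_rsqrt)
	then have "\<nu> * (freq k)^2 * norm (w t k) <= \<nu> * (freq k)^2 * sqrt E0"
		using \<nu> by (intro mult_left_mono) auto
	ultimately show ?thesis using norm_rhs_le[of "u t" "w t" "f t" k] by linarith
qed

text \<open>The modulus is the increment of one continuous function that does not involve N. The
  force enters it through a primitive, as it is only integrable in time.\<close>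

lemma equicontinuous:
	assumes k: "k ~= 0" and st: "0 <= \<sigma>" "\<sigma> <= \<tau>" "\<tau> <= T"
	defines "g \<equiv> %t. 24 * freq k * E0 + \<nu> * (freq k)^2 * sqrt E0 + norm (f t k)"
	shows "norm (w \<tau> k - w \<sigma> k) <= prim T g \<tau> - prim T g \<sigma>"
proof -
	have gi: "integrable M g" unfolding g_def using f_integrable[OF k]
		by (intro Bochner_Integration.integrable_add integrable_norm integrable_bounded_interval[where g = "%_. _"]) auto
	have ind: "indicator {..\<tau>} t - indicator {..\<sigma>} t = (indicator {\<sigma><..\<tau>} t :: real)" for t using st(2) by (auto split: split_indicator)
	have ii: "integrable M (%t. indicator A t *\<^sub>R h t)" if "integrable M h" "A \<in> sets borel" for h :: "real => real" and A
		using that by (intro integrable_indicator_lebesgue_on)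
	have "norm (w \<tau> k - w \<sigma> k) = norm (prim T (%t. rhs (u t) (w t) (f t) k) \<tau> - prim T (%t. rhs (u t) (w t) (f t) k) \<sigma>)"
		using mode_equation[OF k, of \<tau>] mode_equation[OF k, of \<sigma>] st by simp
	also have "... <= (LINT t|M. indicator {\<sigma><..\<tau>} t * norm (rhs (u t) (w t) (f t) k))"
		by (rule prim_diff_norm_le[OF rhs_integrable[OF k] st(2)])
	also have "... <= (LINT t|M. indicator {..\<tau>} t *\<^sub>R g t - indicator {..\<sigma>} t *\<^sub>R g t)"
	proof (rule integral_mono)
		show "indicator {\<sigma><..\<tau>} t * norm (rhs (u t) (w t) (f t) k) <= indicator {..\<tau>} t *\<^sub>R g t - indicator {..\<sigma>} t *\<^sub>R g t"
			if "t \<in> space M" for t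
		proof -
			have "indicator {\<sigma><..\<tau>} t * norm (rhs (u t) (w t) (f t) k) <= indicator {\<sigma><..\<tau>} t * g t"
				unfolding g_def using that by (intro mult_left_mono norm_rhs_bound) auto
			then show ?thesis unfolding scaleR_diff_left[symmetric] ind by simp
		qed
		show "integrable M (%t. indicator {\<sigma><..\<tau>} t * norm (rhs (u t) (w t) (f t) k))"
			using ii[OF integrable_norm[OF rhs_integrable[OF k]], of "{\<sigma><..\<tau>}"] by simp
		show "integrable M (%t. indicator {..\<tau>} t *\<^sub>R g t - indicator {..\<sigma>} t *\<^sub>R g t)"
			by (intro Bochner_Integration.integrable_diff ii gi) auto
	qed
	also have "... = prim T g \<tau> - prim T g \<sigma>"
		unfolding prim_def by (rule Bochner_Integration.integral_diff) (intro ii gi; simp)+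
	finally show ?thesis .
qed

end

subsection \<open>Compactness and passage to the limit, mode by mode\<close>

text \<open>A diagonal subsequence over rational times and all modes; the common modulus of
  continuity of each mode extends the convergence to every time, not merely almost every
  time.\<close>

lemma ascoli_modes:
	fixes x :: "nat => real => 'i::countable => 'a::euclidean_space"
	assumes T: "0 < T"
		and bound: "!!n t k. t \<in> {0..T} ==> norm (x n t k) <= B k"
		and equi: "!!n k \<sigma> \<tau>. 0 <= \<sigma> ==> \<sigma> <= \<tau> ==> \<tau> <= T ==> norm (x n \<tau> k - x n \<sigma> k) <= G k \<tau> - G k \<sigma>"
		and cont: "!!k. continuous_on {0..T} (G k)"
	obtains r X where "strict_mono (r :: nat => nat)" "!!t k. t \<in> {0..T} ==> (%j. x (r j) t k) ----> X t k"
proof -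
	let ?S = "(\<rat> \<inter> {0..T}) \<times> (UNIV :: 'i set)"
	\<comment> \<open>Rescaling brings all modes into the unit ball, as the subsequence theorem asks
	  for a single bound; the summand 1 avoids division by zero.\<close>
	let ?f = "%n p. x n (fst p) (snd p) /\<^sub>R (\<bar>B (snd p)\<bar> + 1)"
	have S: "countable ?S" by (auto intro!: countable_rat countable_Int1)
	have fb: "norm (?f n p) <= 1" if "p \<in> ?S" for n p
	proof -
		have "norm (x n (fst p) (snd p)) <= \<bar>B (snd p)\<bar> + 1" using bound[of "fst p" n "snd p"] that by (cases p) auto
		then show ?thesis by (simp add: field_simps)
	qed
	from function_convergent_subsequence[where f = ?f, OF S fb] obtain r
		where r: "strict_mono r" "!!p. p \<in> ?S ==> \<exists>l. (%n. ?f (r n) p) ----> l" by blast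
	have rat: "Cauchy (%n. x (r n) s k)" if s: "s \<in> \<rat>" "s \<in> {0..T}" for s k
	proof -
		obtain l where l: "(%n. x (r n) s k /\<^sub>R (\<bar>B k\<bar> + 1)) ----> l" using r(2)[of "(s, k)"] s by auto
		then have "(%n. (\<bar>B k\<bar> + 1) *\<^sub>R (x (r n) s k /\<^sub>R (\<bar>B k\<bar> + 1))) ----> (\<bar>B k\<bar> + 1) *\<^sub>R l" by (rule tendsto_scaleR[OF tendsto_const])
		moreover have "\<bar>B k\<bar> + 1 ~= 0" by linarith
		ultimately show ?thesis by (auto intro: LIMSEQ_imp_Cauchy)
	qed
	have osc: "norm (x n t k - x n s k) <= \<bar>G k t - G k s\<bar>" if "t \<in> {0..T}" "s \<in> {0..T}" for n t s k
		using equi[of s t n k] equi[of t s n k] that by (cases "s <= t") (auto simp: norm_minus_commute)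
	have "Cauchy (%n. x (r n) t k)" if t: "t \<in> {0..T}" for t k
	proof (rule metric_CauchyI)
		fix e :: real assume "0 < e"
		then obtain \<delta> where \<delta>: "\<delta> > 0" "!!s. s \<in> {0..T} ==> dist s t < \<delta> ==> dist (G k s) (G k t) < e / 3"
			using cont[of k] t unfolding continuous_on_iff by (metis divide_pos_pos zero_less_numeral)
		have "max 0 (t - \<delta>) < min T (t + \<delta>)" using \<delta>(1) t T by auto
		then obtain s where s: "s \<in> \<rat>" "max 0 (t - \<delta>) < s" "s < min T (t + \<delta>)" using Rats_dense_in_real by blast
		then have sT: "s \<in> {0..T}" "dist s t < \<delta>" by (auto simp: dist_real_def)
		obtain M where M: "!!m n. m \<ge> M ==> n \<ge> M ==> dist (x (r m) s k) (x (r n) s k) < e / 3"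
			using rat[OF s(1) sT(1), of k] \<open>0 < e\<close> unfolding Cauchy_def by (metis divide_pos_pos zero_less_numeral)
		have "dist (x (r m) t k) (x (r n) t k) < e" if mn: "m \<ge> M" "n \<ge> M" for m n
		proof -
			have "norm (x (r i) t k - x (r i) s k) < e / 3" for i
				using osc[OF t sT(1), of "r i" k] \<delta>(2)[OF sT] by (simp add: dist_real_def abs_minus_commute)
			then have "dist (x (r m) t k) (x (r m) s k) < e / 3" "dist (x (r n) s k) (x (r n) t k) < e / 3"
				by (simp_all add: dist_norm norm_minus_commute)
			then show ?thesis using M[OF mn] dist_triangle[of "x (r m) t k" "x (r n) t k" "x (r m) s k"]
					dist_triangle[of "x (r m) s k" "x (r n) t k" "x (r n) s k"] by linarith
		qed
		then show "\<exists>M. \<forall>m\<ge>M. \<forall>n\<ge>M. dist (x (r m) t k) (x (r n) t k) < e" by blast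
	qed
	then have "(%n. x (r n) t k) ----> lim (%n. x (r n) t k)" if "t \<in> {0..T}" for t k
		using that Cauchy_convergent_iff convergent_LIMSEQ_iff by blast
	then show ?thesis by (rule that[OF r(1), of "%t k. lim (%n. x (r n) t k)"])
qed

lemma mode_L2_tendsto:
	fixes x :: "nat => real => 'a::euclidean_space"
	assumes meas: "!!j. x j \<in> borel_measurable (leb T)" "X \<in> borel_measurable (leb T)"
		and bound: "!!j t. t \<in> {0..T} ==> norm (x j t) <= B"
		and lim: "!!t. t \<in> {0..T} ==> (%j. x j t) ----> X t"
	shows "(%j. LINT t|leb T. (norm (x j t))^2) ----> (LINT t|leb T. (norm (X t))^2)"
proof (rule integral_dominated_convergence[where w = "%_. B^2"])
	show "integrable (leb T) (%_. B^2)" by (rule integrable_bounded_interval) auto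
	show "AE t in leb T. (%j. (norm (x j t))^2) ----> (norm (X t))^2"
		using lim by (intro AE_I2 tendsto_power tendsto_norm) auto
	show "AE t in leb T. norm ((norm (x j t))^2) <= B^2" for j
		using bound by (intro AE_I2) (auto intro!: power_mono)
qed (use meas in measurable)

lemma limit_box_integral_le:
	fixes x :: "nat => real => int ^ 3 => 'a::euclidean_space"
	assumes meas: "!!j k. (%t. x j t k) \<in> borel_measurable (leb T)" "!!k. (%t. X t k) \<in> borel_measurable (leb T)"
		and bound: "!!j t k. t \<in> {0..T} ==> norm (x j t k) <= B k" 
		and lim: "!!t k. t \<in> {0..T} ==> (%j. x j t k) ----> X t k"
		and C: "!!j. (LINT t|leb T. (\<Sum>k\<in>K. W k * (norm (x j t k))^2)) <= C"
	shows "(LINT t|leb T. (\<Sum>k\<in>K. W k * (norm (X t k))^2)) <= C"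
proof -
	have Xb: "norm (X t k) <= B k" if "t \<in> {0..T}" for t k
		by (rule Lim_norm_ubound[OF trivial_limit_sequentially lim[OF that]]) (rule always_eventually, rule allI, rule bound[OF that])
	have i: "integrable (leb T) (%t. (norm (y t))^2)"
		if "y \<in> borel_measurable (leb T)" "!!t. t \<in> {0..T} ==> norm (y t) <= b" for y :: "real => 'a" and b
		by (rule integrable_bounded_interval[where B = "b^2"]) (use that in \<open>auto intro!: AE_I2 power_mono\<close>)
	have e: "(LINT t|leb T. (\<Sum>k\<in>K. W k * (norm (y t k))^2)) = (\<Sum>k\<in>K. W k * (LINT t|leb T. (norm (y t k))^2))"
		if "!!k. (%t. y t k) \<in> borel_measurable (leb T)" "!!t k. t \<in> {0..T} ==> norm (y t k) <= B k" for y :: "real => int ^ 3 => 'a"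
	proof -
		have "(LINT t|leb T. (\<Sum>k\<in>K. W k * (norm (y t k))^2)) = (\<Sum>k\<in>K. LINT t|leb T. W k * (norm (y t k))^2)"
			by (rule Bochner_Integration.integral_sum) (rule integrable_mult_right, rule i, rule that(1), rule that(2))
		then show ?thesis by simp
	qed
	have "(%j. \<Sum>k\<in>K. W k * (LINT t|leb T. (norm (x j t k))^2)) ----> (\<Sum>k\<in>K. W k * (LINT t|leb T. (norm (X t k))^2))"
		by (intro tendsto_sum tendsto_mult tendsto_const mode_L2_tendsto[OF meas bound lim])
	moreover have "(LINT t|leb T. (\<Sum>k\<in>K. W k * (norm (X t k))^2)) = (\<Sum>k\<in>K. W k * (LINT t|leb T. (norm (X t k))^2))"
		by (rule e) (rule meas(2), rule Xb)
	moreover have "(LINT t|leb T. (\<Sum>k\<in>K. W k * (norm (x j t k))^2)) = (\<Sum>k\<in>K. W k * (LINT t|leb T. (norm (x j t k))^2))" for j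
		by (rule e) (rule meas(1), rule bound)
	ultimately show ?thesis using C by (auto intro!: LIMSEQ_le_const2)
qed

text \<open>Low modes converge by dominated convergence in time; on high modes W is a small multiple
  of the stronger weight W', whose integrals are bounded. This takes the place of an Aubin-Lions
  compactness theorem.\<close>

lemma strong_convergence_modes:
	fixes x :: "nat => real => int ^ 3 => 'a::euclidean_space"
	assumes W: "!!k. 0 <= W k" "!!k. 0 <= W' k"
		and tail: "!!\<epsilon>. 0 < \<epsilon> ==> \<exists>n. \<forall>k. k \<notin> box3 n \<longrightarrow> W k <= \<epsilon> * W' k"
		and meas: "!!j k. (%t. x j t k) \<in> borel_measurable (leb T)"
		and bound: "!!j t k. t \<in> {0..T} ==> norm (x j t k) <= B k"
		and lim: "!!t k. t \<in> {0..T} ==> (%j. x j t k) ----> 0"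
		and C: "!!j n. (LINT t|leb T. (\<Sum>k\<in>box3 n. W' k * (norm (x j t k))^2)) <= C"
	shows "(%j. LINT t|leb T. (wsum W (x j t))) ----> 0"
proof (rule LIMSEQ_I)
	let ?M = "leb T"
	have i: "integrable ?M (%t. (norm (x j t k))^2)" for j k
		by (rule integrable_bounded_interval[where B = "(B k)^2"]) (use meas bound in \<open>auto intro!: AE_I2 power_mono\<close>)
	have iW: "integrable ?M (%t. V k * (norm (x j t k))^2)" for V j and k :: "int ^ 3" by (intro integrable_mult_right i)
	have C0: "0 <= C" using C[of 0 0] W by (simp add: box3_0) (meson Bochner_Integration.integral_nonneg order_trans zero_le_mult_iff zero_le_power2)
	fix \<epsilon> :: real assume \<epsilon>: "0 < \<epsilon>"
	\<comment> \<open>C + 1 rather than C in the denominator, since C may be zero.\<close>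
	define \<eta> where "\<eta> = \<epsilon> / (2 * (C + 1))"
	have \<eta>: "0 < \<eta>" "\<eta> * C < \<epsilon> / 2" using \<epsilon> C0 by (auto simp: \<eta>_def field_simps)
	obtain n where n: "!!k. k \<notin> box3 n ==> W k <= \<eta> * W' k" using tail[OF \<eta>(1)] by blast
	let ?L = "%j. \<Sum>k\<in>box3 n. W k * (LINT t|?M. (norm (x j t k))^2)"
	have le: "(LINT t|?M. (wsum W (x j t))) <= ?L j + \<eta> * C" for j
	proof (rule integrable_infsum_nonneg(3)[OF iW])
		fix m
		have "(\<Sum>k\<in>box3 m. W k * (norm (x j t k))^2) <= (\<Sum>k\<in>box3 n. W k * (norm (x j t k))^2) + \<eta> * (\<Sum>k\<in>box3 m. W' k * (norm (x j t k))^2)" for t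
		proof -
			have "(\<Sum>k\<in>box3 m. W k * (norm (x j t k))^2) = (\<Sum>k\<in>box3 m \<inter> box3 n. W k * (norm (x j t k))^2) + (\<Sum>k\<in>box3 m - box3 n. W k * (norm (x j t k))^2)"
				by (rule sum.Int_Diff) (rule finite_box3)
			also have "... <= (\<Sum>k\<in>box3 n. W k * (norm (x j t k))^2) + (\<Sum>k\<in>box3 m - box3 n. (\<eta> * W' k) * (norm (x j t k))^2)"
				using n W finite_box3 by (intro add_mono sum_mono2 sum_mono mult_right_mono) auto
			also have "(\<Sum>k\<in>box3 m - box3 n. (\<eta> * W' k) * (norm (x j t k))^2) <= (\<Sum>k\<in>box3 m. (\<eta> * W' k) * (norm (x j t k))^2)"
				using \<eta> W finite_box3 by (intro sum_mono2) auto
			finally show ?thesis by (simp add: sum_distrib_left mult.assoc)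
		qed
		then have "(LINT t|?M. (\<Sum>k\<in>box3 m. W k * (norm (x j t k))^2))
				<= (LINT t|?M. (\<Sum>k\<in>box3 n. W k * (norm (x j t k))^2) + \<eta> * (\<Sum>k\<in>box3 m. W' k * (norm (x j t k))^2))"
			using iW by (intro integral_mono Bochner_Integration.integrable_add integrable_mult_right Bochner_Integration.integrable_sum) auto
		also have "... = (LINT t|?M. (\<Sum>k\<in>box3 n. W k * (norm (x j t k))^2)) + \<eta> * (LINT t|?M. (\<Sum>k\<in>box3 m. W' k * (norm (x j t k))^2))"
			using iW by (subst Bochner_Integration.integral_add) auto
		also have "(LINT t|?M. (\<Sum>k\<in>box3 n. W k * (norm (x j t k))^2)) = ?L j"
			using iW by (subst Bochner_Integration.integral_sum) auto
		finally show "(LINT t|?M. (\<Sum>k\<in>box3 m. W k * (norm (x j t k))^2)) <= ?L j + \<eta> * C"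
			using mult_left_mono[OF C[of j m] less_imp_le[OF \<eta>(1)]] by linarith
	qed (use W in auto)
	have "?L ----> (\<Sum>k\<in>box3 n. W k * (LINT t|?M. (norm (0 :: 'a))^2))"
		by (intro tendsto_sum tendsto_mult tendsto_const mode_L2_tendsto[OF meas _ bound lim]) auto
	then have "?L ----> 0" by simp
	then obtain j0 where j0: "!!j. j \<ge> j0 ==> \<bar>?L j\<bar> < \<epsilon> / 2"
		using LIMSEQ_D[of ?L 0 "\<epsilon> / 2"] \<epsilon> by auto
	show "\<exists>j0. \<forall>j\<ge>j0. norm ((LINT t|?M. (wsum W (x j t))) - 0) < \<epsilon>"
	proof (intro exI allI impI)
		fix j assume "j \<ge> j0"
		moreover have "0 <= (LINT t|?M. (wsum W (x j t)))"
			using W by (intro Bochner_Integration.integral_nonneg infsum_nonneg) auto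
		ultimately show "norm ((LINT t|?M. (wsum W (x j t))) - 0) < \<epsilon>"
			using le[of j] j0[of j] \<eta>(2) by (simp add: abs_less_iff)
	qed
qed

lemma integral_sum_box3_tendsto:
	fixes p :: "real => int ^ 3 => real"
	assumes i: "!!k. integrable (leb T) (%t. p t k)"
		and s: "AE t in leb T. (%k. \<bar>p t k\<bar>) summable_on UNIV"
		and h: "integrable (leb T) h" "AE t in leb T. (INFSUM k. \<bar>p t k\<bar>) <= h t"
	shows "integrable (leb T) (%t. INFSUM k. p t k)"
		and "(%n. \<Sum>k\<in>box3 n. LINT t|leb T. p t k) ----> (LINT t|leb T. (INFSUM k. p t k))"
proof -
	let ?M = "leb T"
	have s': "AE t in ?M. (%k. p t k) summable_on UNIV" using s by eventually_elim (rule summable_on_abs_real)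
	have m: "(%t. INFSUM k. p t k) \<in> borel_measurable ?M"
		by (rule borel_measurable_infsum_AE[OF _ _ s']) (use i in auto)
	have b: "AE t in ?M. norm (\<Sum>k\<in>box3 n. p t k) <= h t" for n
		using s h(2)
	proof eventually_elim
		case (elim t)
		have "norm (\<Sum>k\<in>box3 n. p t k) <= (\<Sum>k\<in>box3 n. \<bar>p t k\<bar>)" by (simp add: sum_abs)
		also have "... <= (INFSUM k. \<bar>p t k\<bar>)" by (rule sum_le_infsum[OF elim(1)]) (auto simp: finite_box3)
		finally show ?case using elim(2) by linarith
	qed
	have l: "AE t in ?M. (%n. \<Sum>k\<in>box3 n. p t k) ----> (INFSUM k. p t k)"
		using s' by eventually_elim (rule sum_box3_tendsto)
	have mb: "(%t. \<Sum>k\<in>box3 n. p t k) \<in> borel_measurable ?M" for n using i by (intro borel_measurable_sum) auto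
	show "integrable ?M (%t. INFSUM k. p t k)" by (rule integrable_dominated_convergence[OF m mb h(1) l b])
	have "(%n. LINT t|?M. (\<Sum>k\<in>box3 n. p t k)) ----> (LINT t|?M. (INFSUM k. p t k))"
		by (rule integral_dominated_convergence[OF m mb h(1) l b])
	moreover have "(LINT t|?M. (\<Sum>k\<in>box3 n. p t k)) = (\<Sum>k\<in>box3 n. LINT t|?M. p t k)" for n
		by (rule Bochner_Integration.integral_sum[OF i])
	ultimately show "(%n. \<Sum>k\<in>box3 n. LINT t|?M. p t k) ----> (LINT t|?M. (INFSUM k. p t k))" by simp
qed

text \<open>Cauchy-Schwarz with the dual weight \<open>inverse (H k)\<close>. H may vanish at k = 0,
  where the dual weight is then 0 as well; the norms say nothing about that mode, and it drops out
  because z has none.\<close>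

lemma integral_pairing:
	fixes z \<psi> :: "real => int ^ 3 => 'a::euclidean_space"
	assumes H: "!!k. 0 <= H k" "!!k. k ~= 0 ==> 0 < H k"
		and meas: "!!k. (%t. z t k) \<in> borel_measurable (leb T)" "!!k. (%t. \<psi> t k) \<in> borel_measurable (leb T)"
		and z0: "AE t in leb T. z t 0 = 0"
		and z: "AE t in leb T. wsummable H (z t)"
			"integrable (leb T) (%t. wsum H (z t))"
		and \<psi>: "AE t in leb T. (%k. inverse (H k) * (norm (\<psi> t k))^2) summable_on UNIV"
			"integrable (leb T) (%t. INFSUM k. inverse (H k) * (norm (\<psi> t k))^2)"
	shows "AE t in leb T. (%k. z t k \<bullet> \<psi> t k) summable_on UNIV"
		and "!!k. integrable (leb T) (%t. z t k \<bullet> \<psi> t k)"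
		and "integrable (leb T) (%t. INFSUM k. z t k \<bullet> \<psi> t k)"
		and "(%n. \<Sum>k\<in>box3 n. LINT t|leb T. z t k \<bullet> \<psi> t k) ----> (LINT t|leb T. (INFSUM k. z t k \<bullet> \<psi> t k))"
		and "\<bar>LINT t|leb T. (INFSUM k. z t k \<bullet> \<psi> t k)\<bar>
			<= sqrt (LINT t|leb T. (wsum H (z t))) * sqrt (LINT t|leb T. (INFSUM k. inverse (H k) * (norm (\<psi> t k))^2))"
proof -
	let ?M = "leb T"
	define A where "A t = (wsum H (z t))" for t
	define D where "D t = (INFSUM k. inverse (H k) * (norm (\<psi> t k))^2)" for t
	have A0: "0 <= A t" and D0: "0 <= D t" for t unfolding A_def D_def using H(1) by (auto intro!: infsum_nonneg)
	have key: "AE t in ?M. (%k. \<bar>z t k \<bullet> \<psi> t k\<bar>) summable_on UNIV \<and> (INFSUM k. \<bar>z t k \<bullet> \<psi> t k\<bar>) <= sqrt (A t) * sqrt (D t)"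
		using z0 z(1) \<psi>(1)
	proof eventually_elim
		case (elim t)
		let ?x = "%k. sqrt (H k) * norm (z t k)" and ?y = "%k. sqrt (inverse (H k)) * norm (\<psi> t k)"
		have sq: "(?x k)^2 = H k * (norm (z t k))^2" "(?y k)^2 = inverse (H k) * (norm (\<psi> t k))^2" for k
			using H(1) by (simp_all add: power_mult_distrib)
		have le: "\<bar>z t k \<bullet> \<psi> t k\<bar> <= \<bar>?x k * ?y k\<bar>" for k
		proof (cases "k = 0")
			case False
			then have "sqrt (H k) * sqrt (inverse (H k)) = 1" using H(2)[of k] by (simp add: real_sqrt_mult[symmetric] del: real_sqrt_inverse)
			moreover have "?x k * ?y k = (sqrt (H k) * sqrt (inverse (H k))) * (norm (z t k) * norm (\<psi> t k))" by (simp only: mult_ac)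
			ultimately have "?x k * ?y k = norm (z t k) * norm (\<psi> t k)" by (simp only: mult_1_left)
			then show ?thesis using Cauchy_Schwarz_ineq2[of "z t k" "\<psi> t k"] by (simp only: abs_mult abs_norm_cancel)
		qed (simp add: elim(1))
		note cs = infsum_Cauchy_Schwarz[of ?x ?y, unfolded sq, OF elim(2,3)]
		have s: "(%k. \<bar>z t k \<bullet> \<psi> t k\<bar>) summable_on UNIV"
			by (rule summable_on_comparison_real[OF cs(1)]) (use le in simp)
		have "(INFSUM k. \<bar>z t k \<bullet> \<psi> t k\<bar>) <= (INFSUM k. \<bar>?x k * ?y k\<bar>)" by (rule infsum_mono[OF s cs(1) le])
		then show ?case using s cs(3) unfolding A_def D_def by linarith
	qed
	have Am: "A \<in> borel_measurable ?M" and Dm: "D \<in> borel_measurable ?M" and Ai: "integrable ?M A" and Di: "integrable ?M D"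
		using z(2) \<psi>(2) unfolding A_def[abs_def] D_def[abs_def] by auto
	have sqA: "(%t. sqrt (A t)) \<in> borel_measurable ?M" "integrable ?M (%t. (sqrt (A t))^2)" using Am Ai A0 by auto
	have sqD: "(%t. sqrt (D t)) \<in> borel_measurable ?M" "integrable ?M (%t. (sqrt (D t))^2)" using Dm Di D0 by auto
	note CS = integral_Cauchy_Schwarz[OF sqA sqD]
	have ks: "AE t in ?M. (%k. \<bar>z t k \<bullet> \<psi> t k\<bar>) summable_on UNIV" using key by eventually_elim simp
	have kb: "AE t in ?M. (INFSUM k. \<bar>z t k \<bullet> \<psi> t k\<bar>) <= sqrt (A t) * sqrt (D t)" using key by eventually_elim simp
	show "AE t in ?M. (%k. z t k \<bullet> \<psi> t k) summable_on UNIV" using ks by eventually_elim (rule summable_on_abs_real)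
	show i: "integrable ?M (%t. z t k \<bullet> \<psi> t k)" for k
	proof (rule Bochner_Integration.integrable_bound[OF CS(1)])
		show "(%t. z t k \<bullet> \<psi> t k) \<in> borel_measurable ?M" by (intro borel_measurable_inner meas)
		show "AE t in ?M. norm (z t k \<bullet> \<psi> t k) <= norm (sqrt (A t) * sqrt (D t))"
			using ks kb
		proof eventually_elim
			case (elim t)
			have "\<bar>z t k \<bullet> \<psi> t k\<bar> <= (INFSUM k. \<bar>z t k \<bullet> \<psi> t k\<bar>)" by (rule le_infsum[OF elim(1)]) simp
			then show ?case using elim(2) unfolding real_norm_def by linarith
		qed
	qed
	note lim = integral_sum_box3_tendsto[OF i ks CS(1) kb]
	show "integrable ?M (%t. INFSUM k. z t k \<bullet> \<psi> t k)" by (rule lim(1))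
	show "(%n. \<Sum>k\<in>box3 n. LINT t|?M. z t k \<bullet> \<psi> t k) ----> (LINT t|?M. (INFSUM k. z t k \<bullet> \<psi> t k))" by (rule lim(2))
	have "\<bar>LINT t|?M. (INFSUM k. z t k \<bullet> \<psi> t k)\<bar> <= (LINT t|?M. \<bar>INFSUM k. z t k \<bullet> \<psi> t k\<bar>)" by (rule integral_abs_bound)
	also have "... <= (LINT t|?M. \<bar>sqrt (A t) * sqrt (D t)\<bar>)"
	proof (rule integral_mono_AE)
		show "integrable ?M (%t. \<bar>INFSUM k. z t k \<bullet> \<psi> t k\<bar>)" "integrable ?M (%t. \<bar>sqrt (A t) * sqrt (D t)\<bar>)"
			by (intro integrable_abs lim(1) CS(1))+
		show "AE t in ?M. \<bar>INFSUM k. z t k \<bullet> \<psi> t k\<bar> <= \<bar>sqrt (A t) * sqrt (D t)\<bar>"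
			using ks kb
		proof eventually_elim
			case (elim t)
			have "\<bar>INFSUM k. z t k \<bullet> \<psi> t k\<bar> <= (INFSUM k. \<bar>z t k \<bullet> \<psi> t k\<bar>)"
				using norm_infsum_bound[of "%k. z t k \<bullet> \<psi> t k" UNIV] elim(1) by simp
			then show ?case using elim(2) by linarith
		qed
	qed
	also have "... <= sqrt (LINT t|?M. A t) * sqrt (LINT t|?M. D t)" using CS(2) A0 D0 by simp
	finally show "\<bar>LINT t|?M. (INFSUM k. z t k \<bullet> \<psi> t k)\<bar>
			<= sqrt (LINT t|?M. (wsum H (z t))) * sqrt (LINT t|?M. (INFSUM k. inverse (H k) * (norm (\<psi> t k))^2))"
		by (simp add: A_def D_def)
qed

text \<open>Truncating \<open>\<psi>\<close> to a box reduces weak convergence to the convergence of finitely many modes.\<close>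

lemma weak_convergence_modes:
	fixes z :: "nat => real => int ^ 3 => 'a::euclidean_space" and \<psi> :: "real => int ^ 3 => 'a"
	assumes H: "!!k. 0 <= H k" "!!k. k ~= 0 ==> 0 < H k"
		and meas: "!!j k. (%t. z j t k) \<in> borel_measurable (leb T)" "!!k. (%t. \<psi> t k) \<in> borel_measurable (leb T)"
		and z0: "!!j. AE t in leb T. z j t 0 = 0"
		and z: "!!j. AE t in leb T. wsummable H (z j t)"
			"!!j. integrable (leb T) (%t. wsum H (z j t))"
		and C: "!!j. (LINT t|leb T. (wsum H (z j t))) <= C"
		and \<psi>: "AE t in leb T. (%k. inverse (H k) * (norm (\<psi> t k))^2) summable_on UNIV"
			"integrable (leb T) (%t. INFSUM k. inverse (H k) * (norm (\<psi> t k))^2)"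
		and modes: "!!k. (%j. LINT t|leb T. z j t k \<bullet> \<psi> t k) ----> 0"
	shows "(%j. LINT t|leb T. (INFSUM k. z j t k \<bullet> \<psi> t k)) ----> 0"
proof (rule LIMSEQ_I)
	let ?M = "leb T"
	let ?I = "%\<psi> j. LINT t|?M. (INFSUM k. z j t k \<bullet> \<psi> t k)" and ?J = "%\<psi> k j. LINT t|?M. z j t k \<bullet> \<psi> t k"
	define g where "g t k = inverse (H k) * (norm (\<psi> t k))^2" for t k
	have g0: "0 <= g t k" for t k using H(1) by (simp add: g_def)
	have gm: "(%t. g t k) \<in> borel_measurable ?M" for k unfolding g_def using meas(2)[of k] by measurable
	have gs: "AE t in ?M. (%k. \<bar>g t k\<bar>) summable_on UNIV" and gi: "integrable ?M (%t. INFSUM k. g t k)"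
		using \<psi> g0 by (simp_all add: g_def H(1))
	have gki: "integrable ?M (%t. g t k)" for k
	proof (rule Bochner_Integration.integrable_bound[OF gi gm])
		show "AE t in ?M. norm (g t k) <= norm (INFSUM k. g t k)" using gs
		proof eventually_elim
			case (elim t)
			then have "g t k <= (INFSUM k. g t k)" using g0 by (intro le_infsum) auto
			then show ?case using g0[of t k] by simp
		qed
	qed
	have gh: "AE t in ?M. (INFSUM k. \<bar>g t k\<bar>) <= (INFSUM k. g t k)" using g0 by simp
	define \<psi>' where "\<psi>' n t k = (if k \<in> box3 n then 0 else \<psi> t k)" for n t k
	define g' where "g' n t k = (if k \<in> box3 n then 0 else g t k)" for n t k
	have g': "inverse (H k) * (norm (\<psi>' n t k))^2 = g' n t k" for n t k by (simp add: \<psi>'_def g'_def g_def)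
	have gs': "AE t in ?M. (%k. \<bar>g' n t k\<bar>) summable_on UNIV" for n
		using gs by eventually_elim (rule summable_on_comparison_real, assumption, auto simp: g'_def)
	have gb': "AE t in ?M. (INFSUM k. \<bar>g' n t k\<bar>) <= (INFSUM k. g t k)" for n
		using gs gs'[of n]
	proof eventually_elim
		case (elim t)
		then have "(INFSUM k. \<bar>g' n t k\<bar>) <= (INFSUM k. \<bar>g t k\<bar>)" by (intro infsum_mono) (auto simp: g'_def)
		then show ?case using g0 by simp
	qed
	have g'i: "integrable ?M (%t. g' n t k)" for n k unfolding g'_def by (cases "k \<in> box3 n") (simp_all add: gki)
	note G = integral_sum_box3_tendsto[OF gki gs gi gh] and G' = integral_sum_box3_tendsto[OF g'i gs' gi gb']
	have \<psi>'m: "(%t. \<psi>' n t k) \<in> borel_measurable ?M" for n k unfolding \<psi>'_def using meas(2) by (cases "k \<in> box3 n") auto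
	have \<psi>'s: "AE t in ?M. (%k. inverse (H k) * (norm (\<psi>' n t k))^2) summable_on UNIV" for n
		unfolding g' using gs'[of n] by eventually_elim (rule summable_on_abs_real)
	have \<psi>'i: "integrable ?M (%t. INFSUM k. inverse (H k) * (norm (\<psi>' n t k))^2)" for n unfolding g' by (rule G'(1))
	note P = integral_pairing[OF H meas z0 z \<psi>] and P' = integral_pairing[OF H meas(1) \<psi>'m z0 z \<psi>'s \<psi>'i]
	\<comment> \<open>Formulated for limits of box sums, so that splitting off a cube of modes applies
	  alike to integrated pairings and to integrated dual norms.\<close>
	have cut: "b = (\<Sum>k\<in>box3 n. y k) + b'"
		if y: "(%m. \<Sum>k\<in>box3 m. y k) ----> b" and y': "(%m. \<Sum>k\<in>box3 m. if k \<in> box3 n then 0 else y k) ----> b'" for y :: "int ^ 3 => real" and b b' n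
	proof (rule LIMSEQ_unique[OF y])
		have "(%m. (\<Sum>k\<in>box3 n. y k) + (\<Sum>k\<in>box3 m. if k \<in> box3 n then 0 else y k)) ----> (\<Sum>k\<in>box3 n. y k) + b'"
			by (intro tendsto_add tendsto_const y')
		moreover have "\<forall>\<^sub>F m in sequentially. (\<Sum>k\<in>box3 n. y k) + (\<Sum>k\<in>box3 m. if k \<in> box3 n then 0 else y k) = (\<Sum>k\<in>box3 m. y k)"
			using eventually_ge_at_top[of n]
		proof eventually_elim
			case (elim m)
			have "(\<Sum>k\<in>box3 m. y k) = (\<Sum>k\<in>box3 m - box3 n. y k) + (\<Sum>k\<in>box3 n. y k)"
				by (rule sum.subset_diff[OF box3_mono[OF elim] finite_box3])
			also have "(\<Sum>k\<in>box3 m - box3 n. y k) = (\<Sum>k\<in>box3 m. if k \<in> box3 n then 0 else y k)"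
				by (rule sum.mono_neutral_cong_left) (auto simp: finite_box3)
			finally show ?case by simp
		qed
		ultimately show "(%m. \<Sum>k\<in>box3 m. y k) ----> (\<Sum>k\<in>box3 n. y k) + b'" by (rule Lim_transform_eventually)
	qed
	have split: "?I \<psi> j = (\<Sum>k\<in>box3 n. ?J \<psi> k j) + ?I (\<psi>' n) j" for n j
	proof (rule cut[OF P(4)])
		have "?J (\<psi>' n) k j = (if k \<in> box3 n then 0 else ?J \<psi> k j)" for k by (simp add: \<psi>'_def)
		then show "(%m. \<Sum>k\<in>box3 m. if k \<in> box3 n then 0 else ?J \<psi> k j) ----> ?I (\<psi>' n) j" using P'(4)[of j n] by simp
	qed
	have C0: "0 <= C" by (rule order_trans[OF _ C[of 0]]) (use H in \<open>auto intro!: Bochner_Integration.integral_nonneg infsum_nonneg\<close>)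
	let ?\<beta> = "%n. LINT t|?M. (INFSUM k. inverse (H k) * (norm (\<psi>' n t k))^2)"
	have \<beta>: "?\<beta> ----> 0"
	proof -
		have "(LINT t|?M. (INFSUM k. g t k)) = (\<Sum>k\<in>box3 n. LINT t|?M. g t k) + ?\<beta> n" for n
		proof (rule cut[OF G(2)])
			have "(LINT t|?M. g' n t k) = (if k \<in> box3 n then 0 else (LINT t|?M. g t k))" for k by (simp add: g'_def)
			then show "(%m. \<Sum>k\<in>box3 m. if k \<in> box3 n then 0 else (LINT t|?M. g t k)) ----> ?\<beta> n"
				unfolding g' using G'(2)[of n] by simp
		qed
		then have "?\<beta> = (%n. (LINT t|?M. (INFSUM k. g t k)) - (\<Sum>k\<in>box3 n. LINT t|?M. g t k))" by (simp add: fun_eq_iff algebra_simps)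
		moreover have "(%n. (LINT t|?M. (INFSUM k. g t k)) - (\<Sum>k\<in>box3 n. LINT t|?M. g t k)) ----> (LINT t|?M. (INFSUM k. g t k)) - (LINT t|?M. (INFSUM k. g t k))"
			by (intro tendsto_diff tendsto_const G(2))
		ultimately show ?thesis by simp
	qed
	have "(%n. sqrt C * sqrt (?\<beta> n)) ----> sqrt C * sqrt 0" by (intro tendsto_mult tendsto_const tendsto_real_sqrt \<beta>)
	then have lim: "(%n. sqrt C * sqrt (?\<beta> n)) ----> 0" by simp
	fix \<epsilon> :: real assume \<epsilon>: "0 < \<epsilon>"
	obtain n where n: "sqrt C * sqrt (?\<beta> n) < \<epsilon> / 2"
		using order_tendstoD(2)[OF lim, of "\<epsilon> / 2"] \<epsilon> by (auto simp: eventually_sequentially)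
	have "(%j. \<Sum>k\<in>box3 n. ?J \<psi> k j) ----> (\<Sum>k\<in>box3 n. 0)" by (intro tendsto_sum modes)
	then have "(%j. \<Sum>k\<in>box3 n. ?J \<psi> k j) ----> 0" by simp
	then obtain j0 where j0: "!!j. j \<ge> j0 ==> \<bar>\<Sum>k\<in>box3 n. ?J \<psi> k j\<bar> < \<epsilon> / 2"
		using LIMSEQ_D[of "%j. \<Sum>k\<in>box3 n. ?J \<psi> k j" 0 "\<epsilon> / 2"] \<epsilon> by auto
	show "\<exists>j0. \<forall>j\<ge>j0. norm (?I \<psi> j - 0) < \<epsilon>"
	proof (intro exI allI impI)
		fix j assume j: "j \<ge> j0"
		have "\<bar>?I (\<psi>' n) j\<bar> <= sqrt (LINT t|?M. (wsum H (z j t))) * sqrt (?\<beta> n)" by (rule P'(5))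
		also have "... <= sqrt C * sqrt (?\<beta> n)"
			using C[of j] H by (intro mult_right_mono real_sqrt_le_mono real_sqrt_ge_zero Bochner_Integration.integral_nonneg infsum_nonneg) auto
		finally have "\<bar>?I (\<psi>' n) j\<bar> < \<epsilon> / 2" using n by linarith
		then show "norm (?I \<psi> j - 0) < \<epsilon>" using split[of j n] j0[OF j] by (simp only: real_norm_def diff_0_right)
	qed
qed

lemma wgt_tail:
	assumes "s < s'" and "0 < \<epsilon>"
	shows "\<exists>n. \<forall>k. k \<notin> box3 n \<longrightarrow> wgt s k <= \<epsilon> * wgt s' k"
proof -
	have "(%n. real (Suc n) powr (2 * (s - s'))) ----> 0"
		using assms(1) by (intro tendsto_neg_powr filterlim_compose[OF filterlim_real_sequentially filterlim_Suc]) auto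
	then obtain n where n: "real (Suc n) powr (2 * (s - s')) < \<epsilon>"
		using order_tendstoD(2)[of _ 0 sequentially \<epsilon>] assms(2) by (auto simp: eventually_sequentially)
	have "wgt s k <= \<epsilon> * wgt s' k" if k: "k \<notin> box3 n" for k
	proof -
		have "freq k powr (2 * (s - s')) <= real (Suc n) powr (2 * (s - s'))"
			using norm_wave_ge[OF k] assms(1) by (intro powr_mono2') auto
		then have "wgt (s - s') k <= \<epsilon>" using n by (simp add: wgt_def)
		then have "wgt (s - s') k * wgt s' k <= \<epsilon> * wgt s' k" by (rule mult_right_mono) simp
		then show ?thesis using wgt_add[of "s - s'" s' k] by simp
	qed
	then show ?thesis by blast
qed

lemma integral_inner_bound:
	fixes g h :: "real => 'a::euclidean_space"
	assumes g: "g \<in> borel_measurable (leb T)" "integrable (leb T) (%t. (norm (g t))^2)"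
		and h: "h \<in> borel_measurable (leb T)" "integrable (leb T) (%t. (norm (h t))^2)"
	shows "\<bar>LINT t|leb T. g t \<bullet> h t\<bar> <= sqrt (LINT t|leb T. (norm (g t))^2) * sqrt (LINT t|leb T. (norm (h t))^2)"
proof -
	let ?M = "leb T"
	note CS = integral_Cauchy_Schwarz[OF measurable_compose[OF g(1) borel_measurable_norm] g(2) measurable_compose[OF h(1) borel_measurable_norm] h(2)]
	have le: "\<bar>g t \<bullet> h t\<bar> <= norm (g t) * norm (h t)" for t by (rule Cauchy_Schwarz_ineq2)
	have i: "integrable ?M (%t. g t \<bullet> h t)"
	proof (rule Bochner_Integration.integrable_bound[OF CS(1)])
		show "(%t. g t \<bullet> h t) \<in> borel_measurable ?M" by (intro borel_measurable_inner g h)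
		show "AE t in ?M. norm (g t \<bullet> h t) <= norm (norm (g t) * norm (h t))" using le by (intro AE_I2) simp
	qed
	have "\<bar>LINT t|?M. g t \<bullet> h t\<bar> <= (LINT t|?M. \<bar>g t \<bullet> h t\<bar>)" by (rule integral_abs_bound)
	also have "... <= (LINT t|?M. \<bar>norm (g t) * norm (h t)\<bar>)"
		using le by (intro integral_mono integrable_abs i CS(1)) simp
	also note CS(2)
	finally show ?thesis .
qed

lemma prim_L2_tendsto:
	fixes g :: "nat => real => 'a::euclidean_space"
	assumes g: "!!j. integrable (leb T) (g j)" and h: "integrable (leb T) h"
		and i: "!!j. integrable (leb T) (%t. (norm (g j t - h t))^2)"
		and lim: "(%j. LINT t|leb T. (norm (g j t - h t))^2) ----> 0"
	shows "(%j. prim T (g j) \<tau>) ----> prim T h \<tau>"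
proof -
	let ?M = "leb T"
	have d: "integrable ?M (%t. g j t - h t)" for j using g h by auto
	have one: "integrable ?M (%t. 1 :: real)" by (rule integrable_bounded_interval[where B = 1]) auto
	let ?c = "sqrt (LINT t|?M. 1^2)"
	have le: "norm (prim T (g j) \<tau> - prim T h \<tau>) <= ?c * sqrt (LINT t|?M. (norm (g j t - h t))^2)" for j
	proof -
		have "norm (prim T (g j) \<tau> - prim T h \<tau>) = norm (LINT t|?M. indicator {..\<tau>} t *\<^sub>R (g j t - h t))"
			unfolding prim_diff[OF g h, symmetric] by (simp add: prim_def)
		also have "... <= (LINT t|?M. norm (indicator {..\<tau>} t *\<^sub>R (g j t - h t)))" by (rule integral_norm_bound)
		also have "... <= (LINT t|?M. \<bar>1 * norm (g j t - h t)\<bar>)"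
		proof (rule integral_mono)
			show "integrable ?M (%t. norm (indicator {..\<tau>} t *\<^sub>R (g j t - h t)))"
				by (rule integrable_norm) (rule integrable_indicator_lebesgue_on[OF d]; simp)
			show "integrable ?M (%t. \<bar>1 * norm (g j t - h t)\<bar>)" using integrable_norm[OF d[of j]] by simp
		qed (auto split: split_indicator)
		also have "... <= ?c * sqrt (LINT t|?M. (norm (g j t - h t))^2)"
			using one by (intro integral_Cauchy_Schwarz(2) i borel_measurable_norm) (use d in auto)
		finally show ?thesis .
	qed
	have "(%j. ?c * sqrt (LINT t|?M. (norm (g j t - h t))^2)) ----> ?c * sqrt 0"
		by (intro tendsto_mult tendsto_const tendsto_real_sqrt lim)
	then have "(%j. ?c * sqrt (LINT t|?M. (norm (g j t - h t))^2)) ----> 0" by simp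
	then have "(%j. prim T (g j) \<tau> - prim T h \<tau>) ----> 0"
		by (rule Lim_null_comparison[OF always_eventually[OF allI[OF le]]])
	then show ?thesis by (simp add: LIM_zero_iff)
qed

lemma bounded_linear_bdot: "bounded_linear (bdot c)"
	unfolding linear_conv_bounded_linear[symmetric]
	by (rule linearI) (auto simp: bdot_3 algebra_simps)

section \<open>The pressure in the borderline Sobolev space\<close>

context setting begin

text \<open>The filtered Leray projection: two factors i, one in \<open>bdot (cwave k) z\<close> and
  one in the final \<open>cwave k\<close>, turn the plus sign into a minus. As a bounded linear map
  of the nonlinearity it commutes with limits and primitives.\<close>

definition leray :: "int ^ 3 => complex ^ 3 => complex ^ 3" where
	"leray k z = inverse (a k) *\<^sub>R z + (bdot (cwave k) z / of_real (a k * (freq k)^2)) *s cwave k"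

lemma rhs_eq_leray: "rhs v x g k = leray k (nl v k) - (\<nu> * (freq k)^2) *\<^sub>R x k + inverse (a k) *\<^sub>R g k"
	by (simp add: rhs_def leray_def grad_eq press_def vec_eq_iff)

lemma bounded_linear_leray: "bounded_linear (leray k)"
proof -
	interpret L: bounded_linear "bdot (cwave k)" by (rule bounded_linear_bdot)
	have "bounded_linear (%c. (c / of_real (a k * (freq k)^2)) *s cwave k)"
		unfolding linear_conv_bounded_linear[symmetric]
		by (rule linearI) (auto simp: vec_eq_iff divide_inverse algebra_simps)
	from bounded_linear_compose[OF this bounded_linear_bdot]
	show ?thesis unfolding leray_def by (intro bounded_linear_add bounded_linear_scaleR_right)
qed

lemma press_real:
	assumes "l2_field v"
	shows "press v (- k) = cnj (press v k)"
proof -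
	have "nl v (- k) = cnj_vec (nl v k)" using assms by (intro nl_real) (auto simp: l2_field_def)
	then show ?thesis by (simp add: press_def bdot_3 cwave_def cnj_vec_def wave_uminus)
qed

text \<open>36 is 4 times 9: 4 from comparing the inhomogeneous weight with the homogeneous one, 9
  from the factor 3 in \<open>norm_press_le\<close>.\<close>

definition press_const :: real where
	"press_const = 36 * \<alpha> powr (- 4 * \<theta>)"

text \<open>The filter gains 2\<theta> derivatives and solving for the pressure one more: with s =
  -1/2 + 2\<theta> the exponents satisfy 2s - 4\<theta> - 2 = -3.\<close>

lemma press_weight: "hwt (- 1/2 + 2 * \<theta>) k * (norm (press v k))^2 <= press_const * (freq k powr - 3 * (norm (nl v k))^2)"
proof (cases "k = 0")
	case False
	let ?K = "freq k" and ?s = "- 1/2 + 2 * \<theta>"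
	have K: "1 <= ?K" by (rule norm_wave_ge_1[OF False])
	\<comment> \<open>For s >= 0 this is 1 + |k|^2 <= 2 |k|^2 together with s <= 2; for negative s the
	  inhomogeneous weight is the smaller one.\<close>
	have h: "hwt ?s k <= 4 * ?K powr (2 * ?s)"
	proof (cases "0 <= ?s")
		case True
		have "hwt ?s k <= (2 * ?K^2) powr ?s" unfolding hwt_def using K True by (intro powr_mono2) auto
		also have "... = 2 powr ?s * (?K^2) powr ?s" by (rule powr_mult)
		also have "(?K^2) powr ?s = ?K powr (2 * ?s)" using powr_powr[of ?K 2 ?s] K by (simp add: powr_numeral)
		also have "2 powr ?s * ?K powr (2 * ?s) <= 2 powr 2 * ?K powr (2 * ?s)"
			using \<theta> by (intro mult_right_mono powr_mono) auto
		finally show ?thesis by simp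
	next
		case False
		have "hwt ?s k <= (?K^2) powr ?s" unfolding hwt_def using K False by (intro powr_mono2') auto
		also have "(?K^2) powr ?s = ?K powr (2 * ?s)" using powr_powr[of ?K 2 ?s] K by (simp add: powr_numeral)
		finally show ?thesis using powr_ge_zero[of ?K "2 * ?s"] by linarith
	qed
	have ak: "\<alpha> powr (2 * \<theta>) * ?K powr (2 * \<theta>) <= a k" by (simp add: asymb_def)
	have pos: "0 < \<alpha> powr (2 * \<theta>) * ?K powr (2 * \<theta>)" using \<alpha> False by (intro mult_pos_pos) auto
	have "norm (press v k) <= 3 * norm (nl v k) / (a k * ?K)" by (rule norm_press_le)
	also have "... <= 3 * norm (nl v k) / ((\<alpha> powr (2 * \<theta>) * ?K powr (2 * \<theta>)) * ?K)"
		using ak pos K by (intro divide_left_mono mult_right_mono mult_pos_pos) (auto simp: asymb_pos)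
	finally have "(norm (press v k))^2 <= (3 * norm (nl v k) / ((\<alpha> powr (2 * \<theta>) * ?K powr (2 * \<theta>)) * ?K))^2"
		by (intro power_mono) auto
	also have "... = 9 * (norm (nl v k))^2 * (\<alpha> powr (- 4 * \<theta>) * ?K powr (- 4 * \<theta> - 2))"
	proof -
		have "(\<alpha> powr (2 * \<theta>) * ?K powr (2 * \<theta>) * ?K)^2 = \<alpha> powr (4 * \<theta>) * ?K powr (4 * \<theta> + 2)"
			using \<alpha> K by (simp add: power2_eq_square powr_add powr_add[symmetric] powr_numeral mult_ac)
		moreover have "inverse (\<alpha> powr (4 * \<theta>) * ?K powr (4 * \<theta> + 2)) = \<alpha> powr (- 4 * \<theta>) * ?K powr (- 4 * \<theta> - 2)"
		proof -
			have "- 4 * \<theta> = - (4 * \<theta>)" "- 4 * \<theta> - 2 = - (4 * \<theta> + 2)" by simp_all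
			then show ?thesis by (simp only: powr_minus inverse_mult_distrib)
		qed
		moreover have "(3 * n / c)^2 = 9 * n^2 * inverse (c^2)" for n c :: real
			by (simp add: power_divide power_mult_distrib divide_inverse power_inverse)
		ultimately show ?thesis by (simp only:)
	qed
	finally have p: "(norm (press v k))^2 <= 9 * (norm (nl v k))^2 * (\<alpha> powr (- 4 * \<theta>) * ?K powr (- 4 * \<theta> - 2))" .
	have "hwt ?s k * (norm (press v k))^2 <= (4 * ?K powr (2 * ?s)) * (9 * (norm (nl v k))^2 * (\<alpha> powr (- 4 * \<theta>) * ?K powr (- 4 * \<theta> - 2)))"
		by (rule mult_mono[OF h p]) auto
	also have "... = press_const * ((?K powr (2 * ?s) * ?K powr (- 4 * \<theta> - 2)) * (norm (nl v k))^2)" by (simp add: press_const_def)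
	also have "?K powr (2 * ?s) * ?K powr (- 4 * \<theta> - 2) = ?K powr - 3" by (simp add: powr_add[symmetric])
	finally show ?thesis .
qed (simp add: press_def bdot_def)

text \<open>Stated for any field with the energy bounds, so that the approximations and their limit
  obtain the same constants.\<close>

lemma press_bounds:
	fixes v :: "real => vfield"
	assumes v': "\<forall>t\<in>{0..T}. l2_field (v t) \<and> v t 0 = 0 \<and> (l2_norm (v t))^2 <= E0"
		and meas: "!!k. (%t. v t k) \<in> borel_measurable M"
		and s: "AE t in M. wsummable (wgt 1) (v t)"
		and i: "integrable M (%t. wsum (wgt 1) (v t))" "(LINT t|M. (wsum (wgt 1) (v t))) <= E0 / \<nu>"
	shows "(%t. nl (v t) k) \<in> borel_measurable M" and "(%t. press (v t) k) \<in> borel_measurable M"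
		and "t \<in> {0..T} ==> norm (nl (v t) k) <= 6 * freq k * E0"
		and "integrable M (%t. nl (v t) k)"
		and "AE t in M. wsummable (wgt (- 3/2)) (nl (v t))"
		and "integrable M (%t. wsum (wgt (- 3/2)) (nl (v t)))"
		and "AE t in M. wsummable (hwt (- 1/2 + 2 * \<theta>)) (press (v t))"
		and "integrable M (%t. wsum (hwt (- 1/2 + 2 * \<theta>)) (press (v t)))"
		and "(LINT t|M. (wsum (hwt (- 1/2 + 2 * \<theta>)) (press (v t)))) <= press_const * (nl_const * E0 * (E0 / \<nu>))"
proof -
	let ?B = "%t. wsum (wgt 1) (v t)"
	have v: "l2_field (v t)" "v t 0 = 0" "(l2_norm (v t))^2 <= E0" if "t \<in> {0..T}" for t using v' that by auto
	have l2: "sq_summable (v t)" if "t \<in> {0..T}" for t using v(1)[OF that] by (simp add: l2_field_def)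
	show nm: "(%t. nl (v t) k) \<in> borel_measurable M" for k
		unfolding nl_def
	proof (rule borel_measurable_infsum_AE)
		show "(%t. nlq k (v t) (v t) l) \<in> borel_measurable M" for l by (rule nlq_measurable[OF meas])
		show "AE t in M. (%l. nlq k (v t) (v t) l) summable_on UNIV"
			using l2 by (intro AE_I2 nlq_summable(2)) auto
	qed simp
	have "(%t. bdot (cwave k) (nl (v t) k)) \<in> borel_measurable M" for k
		using nm[of k] borel_measurable_continuous_onI[OF linear_continuous_on[OF bounded_linear_bdot]] by (rule measurable_compose)
	then show pm: "(%t. press (v t) k) \<in> borel_measurable M" for k
		unfolding press_def by (intro borel_measurable_divide borel_measurable_uminus) auto
	show nb: "norm (nl (v t) k) <= 6 * freq k * E0" if "t \<in> {0..T}" for t k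
		using norm_nl_le[OF l2[OF that], of k] mult_left_mono[OF v(3)[OF that], of "6 * freq k"] by simp
	show "integrable M (%t. nl (v t) k)" by (rule integrable_bounded_interval[OF nm], rule AE_I2, rule nb, simp)
	have key: "AE t in M. wsummable (wgt (- 3/2)) (nl (v t))
			\<and> (wsum (wgt (- 3/2)) (nl (v t))) <= nl_const * E0 * ?B t"
		using s AE_space
	proof eventually_elim
		case (elim t)
		then have t: "t \<in> {0..T}" by simp
		have s2: "(%k. freq k powr 2 * (norm (v t k))^2) summable_on UNIV" using elim(1) by (simp add: wgt_def)
		have B: "(INFSUM k. freq k powr 2 * (norm (v t k))^2) = ?B t" by (simp add: wgt_def)
		have w: "freq k powr - 3 = wgt (- 3/2) k" for k by (simp add: wgt_def)
		note ns = nl_sobolev[OF v(2)[OF t] l2[OF t] s2, unfolded B w]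
		have "nl_const * (l2_norm (v t))^2 * ?B t <= nl_const * E0 * ?B t"
			using v(3)[OF t] by (intro mult_right_mono mult_left_mono nl_const_nonneg infsum_nonneg) auto
		then show ?case using ns by linarith
	qed
	show ns: "AE t in M. wsummable (wgt (- 3/2)) (nl (v t))" using key by eventually_elim simp
	have nm2: "(%t. wsum (wgt (- 3/2)) (nl (v t))) \<in> borel_measurable M"
		by (rule borel_measurable_infsum_AE[OF _ _ ns]) (use nm in \<open>auto intro!: borel_measurable_times\<close>)
	have iB: "integrable M (%t. nl_const * E0 * ?B t)" by (intro integrable_mult_right i)
	show ni: "integrable M (%t. wsum (wgt (- 3/2)) (nl (v t)))"
	proof (rule Bochner_Integration.integrable_bound[OF iB nm2])
		show "AE t in M. norm (wsum (wgt (- 3/2)) (nl (v t))) <= norm (nl_const * E0 * ?B t)"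
			using key
		proof eventually_elim
			case (elim t)
			have "0 <= (wsum (wgt (- 3/2)) (nl (v t)))" by (intro infsum_nonneg) simp
			then show ?case using elim by simp
		qed
	qed
	have pw: "hwt (- 1/2 + 2 * \<theta>) k * (norm (press (v t) k))^2 <= press_const * (wgt (- 3/2) k * (norm (nl (v t) k))^2)" for t k
		using press_weight[of k "v t"] by (simp add: wgt_def)
	have c0: "0 <= press_const" by (simp add: press_const_def)
	note pd = weighted_domination[OF hwt_nonneg pm pw ns ni]
	show ps: "AE t in M. wsummable (hwt (- 1/2 + 2 * \<theta>)) (press (v t))" by (rule pd(1))
	show pi: "integrable M (%t. wsum (hwt (- 1/2 + 2 * \<theta>)) (press (v t)))" by (rule pd(2))
	have pb: "AE t in M. (wsum (hwt (- 1/2 + 2 * \<theta>)) (press (v t))) <= press_const * (nl_const * E0 * ?B t)"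
		using key ps
	proof eventually_elim
		case (elim t)
		have "(wsum (hwt (- 1/2 + 2 * \<theta>)) (press (v t))) <= (INFSUM k. press_const * (wgt (- 3/2) k * (norm (nl (v t) k))^2))"
			by (rule infsum_mono[OF elim(2) summable_on_cmult_right]) (use elim(1) pw in auto)
		also have "... = press_const * (wsum (wgt (- 3/2)) (nl (v t)))" by (rule infsum_cmult_right')
		also have "... <= press_const * (nl_const * E0 * ?B t)" using elim(1) c0 by (intro mult_left_mono) auto
		finally show ?case .
	qed
	have ipB: "integrable M (%t. press_const * (nl_const * E0 * ?B t))" by (intro integrable_mult_right iB)
	have "(LINT t|M. (wsum (hwt (- 1/2 + 2 * \<theta>)) (press (v t)))) <= (LINT t|M. press_const * (nl_const * E0 * ?B t))"
		by (rule integral_mono_AE[OF pi ipB pb])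
	also have "... = press_const * (nl_const * E0 * (LINT t|M. ?B t))" by simp
	also have "... <= press_const * (nl_const * E0 * (E0 / \<nu>))"
		using c0 nl_const_nonneg E0_nonneg i(2) by (intro mult_left_mono) auto
	finally show "(LINT t|M. (wsum (hwt (- 1/2 + 2 * \<theta>)) (press (v t)))) <= press_const * (nl_const * E0 * (E0 / \<nu>))" .
qed

end

section \<open>The limit along a subsequence whose modes converge\<close>

locale limit = setting +
	fixes r :: "nat => nat" and w :: "nat => real => vfield" and q :: "nat => real => sfield" and W :: "real => vfield"
	assumes sol: "!!N. N > 0 ==> regular_weak_solution T \<nu> \<alpha> \<theta> f v0 N (w N) (q N)"
		and r: "strict_mono r" "!!j. r j > 0"
		and lim: "!!t k. t \<in> {0..T} ==> (%j. w (r j) t k) ----> W t k"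
begin

abbreviation x :: "nat => real => vfield" where "x j \<equiv> w (r j)"
abbreviation u :: "nat => real => vfield" where "u j \<equiv> approx.u \<alpha> \<theta> (r j) (w (r j))"

text \<open>The limit of the deconvolved fields, since the symbols of D_N tend to that of A; it is
  the field that enters the limiting product.\<close>

definition U :: "real => vfield" where
	"U t k = a k *\<^sub>R W t k"

lemma ap: "approx T \<nu> \<alpha> \<theta> f v0 (r j) (w (r j)) (q (r j))"
	by (rule approx.intro[OF setting_axioms]) (rule approx_axioms.intro[OF sol[OF r(2)]])

lemma u_eq: "u j t k = d (r j) k *\<^sub>R x j t k"
	by (rule approx.u_def[OF ap])

lemma u_lim: "t \<in> {0..T} ==> (%j. u j t k) ----> U t k"
	unfolding u_eq U_def by (intro tendsto_scaleR filterlim_compose[OF dsymb_tendsto filterlim_subseq[OF r(1)]] lim)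

lemma norm_x_le: "t \<in> {0..T} ==> norm (x j t k) <= sqrt E0"
	by (rule real_le_rsqrt) (rule approx.energy_u(3)[OF ap])

lemma norm_u_le: "t \<in> {0..T} ==> norm (u j t k) <= sqrt E0"
	by (rule real_le_rsqrt) (use approx.energy_u(1)[OF ap, of t "{k}"] in simp)

lemma norm_W_le: "t \<in> {0..T} ==> norm (W t k) <= sqrt E0"
	by (rule Lim_norm_ubound[OF trivial_limit_sequentially lim]) (auto intro!: always_eventually norm_x_le)

lemma norm_U_le: "t \<in> {0..T} ==> norm (U t k) <= sqrt E0"
	by (rule Lim_norm_ubound[OF trivial_limit_sequentially u_lim]) (auto intro!: always_eventually norm_u_le)

lemma x_measurable: "(%t. x j t k) \<in> borel_measurable M"
	by (rule approx.w_measurable[OF ap])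

lemma u_measurable: "(%t. u j t k) \<in> borel_measurable M"
	by (rule approx.u_measurable[OF ap])

lemma W_measurable: "(%t. W t k) \<in> borel_measurable M"
	by (rule borel_measurable_lebesgue_on_AE_LIMSEQ[where f = "%j t. x j t k"]) (auto intro!: AE_I2 lim x_measurable)

lemma U_measurable: "(%t. U t k) \<in> borel_measurable M"
	unfolding U_def using W_measurable by (intro borel_measurable_scaleR) auto

lemma W_props:
	assumes t: "t \<in> {0..T}"
	shows "W t 0 = 0" "W t (- k) = cnj_vec (W t k)" "bdot (cwave k) (W t k) = 0" "divergence (W t) k = 0"
proof -
	note wp = approx.w_props[OF ap t]
	show "W t 0 = 0" using lim[OF t, of 0] by (simp add: wp(1) LIMSEQ_const_iff)
	have "(%j. x j t (- k)) ----> cnj_vec (W t k)"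
		unfolding wp(2) by (rule bounded_linear.tendsto[OF bounded_linear_cnj_vec lim[OF t]])
	then show "W t (- k) = cnj_vec (W t k)" by (rule LIMSEQ_unique[OF lim[OF t]])
	have "(%j. bdot (cwave k) (x j t k)) ----> bdot (cwave k) (W t k)"
		by (rule bounded_linear.tendsto[OF bounded_linear_bdot lim[OF t]])
	then show "bdot (cwave k) (W t k) = 0" by (simp add: wp(4) LIMSEQ_const_iff)
	then show "divergence (W t) k = 0" by (simp add: divergence_eq)
qed

lemma U_sums: 
	assumes t: "t \<in> {0..T}" and K: "finite K"
	shows "(\<Sum>k\<in>K. (norm (U t k))^2) <= E0"
proof (rule LIMSEQ_le_const2)
	show "(%j. \<Sum>k\<in>K. (norm (u j t k))^2) ----> (\<Sum>k\<in>K. (norm (U t k))^2)"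
		by (intro tendsto_sum tendsto_power tendsto_norm u_lim t)
	show "\<exists>n. \<forall>j\<ge>n. (\<Sum>k\<in>K. (norm (u j t k))^2) <= E0" using approx.energy_u(1)[OF ap t K] by blast
qed

lemma U_props:
	assumes t: "t \<in> {0..T}"
	shows "U t 0 = 0" "U t (- k) = cnj_vec (U t k)" "divergence (U t) k = 0" "l2_field (U t)" "(l2_norm (U t))^2 <= E0"
proof -
	show "U t 0 = 0" "U t (- k) = cnj_vec (U t k)" for k using W_props(1,2)[OF t] by (simp_all add: U_def cnj_vec_scaleR)
	moreover have s: "sq_summable (U t)" by (rule nonneg_summable_bounded(1)[OF _ U_sums[OF t]]) simp
	ultimately show "l2_field (U t)" by (simp add: l2_field_def)
	show "(l2_norm (U t))^2 <= E0" unfolding l2_norm_sq by (rule infsum_le_finite_sums[OF s U_sums[OF t]])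
	show "divergence (U t) k = 0" using divergence_scaleR[of a "W t" k] W_props(4)[OF t] by (simp add: U_def[abs_def])
qed

lemma u_props:
	assumes t: "t \<in> {0..T}"
	shows "u j t 0 = 0" "l2_field (u j t)" "(l2_norm (u j t))^2 <= E0"
	using approx.u_props(1,5)[OF ap t] approx.energy_u(2)[OF ap t] by auto

lemma sq_integrable:
	assumes "y \<in> borel_measurable M" "!!t. t \<in> {0..T} ==> norm (y t) <= B"
	shows "integrable M (%t. (norm (y t :: 'a::euclidean_space))^2)"
proof (rule integrable_bounded_interval)
	show "(%t. (norm (y t))^2) \<in> borel_measurable M" using assms(1) by measurable
	show "AE t in M. norm ((norm (y t))^2) <= B^2" using assms(2) by (intro AE_I2) (auto intro!: power_mono)
qed

lemma modes_sq: "integrable M (%t. (norm (x j t k))^2)" "integrable M (%t. (norm (u j t k))^2)"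
	"integrable M (%t. (norm (W t k))^2)" "integrable M (%t. (norm (U t k))^2)"
	by (rule sq_integrable[OF x_measurable norm_x_le] sq_integrable[OF u_measurable norm_u_le]
		sq_integrable[OF W_measurable norm_W_le] sq_integrable[OF U_measurable norm_U_le], assumption)+

lemmas x_sq = modes_sq(1) and u_sq = modes_sq(2) and W_sq = modes_sq(3) and U_sq = modes_sq(4)

definition C1 :: real where "C1 = \<alpha> powr (- 2 * \<theta>) * (E0 / \<nu>)"

lemma u_dissipation: "(LINT t|M. (\<Sum>k\<in>box3 n. wgt 1 k * (norm (u j t k))^2)) <= E0 / \<nu>"
proof -
	have "(LINT t|M. (\<Sum>k\<in>box3 n. wgt 1 k * (norm (u j t k))^2)) <= (LINT t|M. (\<Sum>k\<in>box3 n. wgt 1 k * approx.en \<alpha> \<theta> (r j) (x j) t k))"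
		by (intro integral_mono Bochner_Integration.integrable_sum integrable_mult_right u_sq approx.en_integrable[OF ap]
				sum_mono mult_left_mono approx.norm_u_sq_le_en[OF ap]) auto
	then show ?thesis using approx.energy_dissipation[OF ap, of j n] by linarith
qed

text \<open>The density a d |w|^2 is at least a |w|^2 because d >= 1, and a dominates
  \<open>wgt \<theta>\<close> up to a power of \<alpha>; this is the gain of \<theta> derivatives of
  w over u.\<close>

lemma x_dissipation: "(LINT t|M. (\<Sum>k\<in>box3 n. wgt (1 + \<theta>) k * (norm (x j t k))^2)) <= C1"
proof -
	let ?e = "approx.en \<alpha> \<theta> (r j) (x j)"
	have le: "wgt (1 + \<theta>) k * (norm (x j t k))^2 <= \<alpha> powr (- 2 * \<theta>) * (wgt 1 k * ?e t k)" for t k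
	proof -
		have "wgt (1 + \<theta>) k * (norm (x j t k))^2 = wgt 1 k * (wgt \<theta> k * (norm (x j t k))^2)" by (simp add: wgt_add)
		also have "... <= wgt 1 k * ((\<alpha> powr (- 2 * \<theta>) * a k) * (d (r j) k * (norm (x j t k))^2))"
			using wgt_le_asymb[OF \<alpha>, of \<theta> k] mult_right_mono[OF dsymb_bounds(1)[of \<alpha> \<theta> "r j" k], of "(norm (x j t k))^2"] asymb_pos[of \<alpha> \<theta> k]
			by (intro mult_left_mono mult_mono) auto
		also have "... = \<alpha> powr (- 2 * \<theta>) * (wgt 1 k * ?e t k)" by (simp add: approx.en_def[OF ap])
		finally show ?thesis .
	qed
	have "(LINT t|M. (\<Sum>k\<in>box3 n. wgt (1 + \<theta>) k * (norm (x j t k))^2)) <= (LINT t|M. (\<Sum>k\<in>box3 n. \<alpha> powr (- 2 * \<theta>) * (wgt 1 k * ?e t k)))"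
		by (intro integral_mono Bochner_Integration.integrable_sum integrable_mult_right x_sq approx.en_integrable[OF ap] sum_mono le)
	also have "... = \<alpha> powr (- 2 * \<theta>) * (LINT t|M. (\<Sum>k\<in>box3 n. wgt 1 k * ?e t k))"
		by (simp add: sum_distrib_left[symmetric])
	also have "... <= C1" unfolding C1_def by (intro mult_left_mono approx.energy_dissipation[OF ap]) simp
	finally show ?thesis .
qed

lemma U_dissipation: "(LINT t|M. (\<Sum>k\<in>box3 n. wgt 1 k * (norm (U t k))^2)) <= E0 / \<nu>"
	by (rule limit_box_integral_le[where x = u and X = U and B = "%_. sqrt E0"])
		(rule u_measurable U_measurable norm_u_le u_lim u_dissipation | assumption)+

lemma W_dissipation: "(LINT t|M. (\<Sum>k\<in>box3 n. wgt (1 + \<theta>) k * (norm (W t k))^2)) <= C1"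
	by (rule limit_box_integral_le[where x = x and X = W and B = "%_. sqrt E0"])
		(rule x_measurable W_measurable norm_x_le lim x_dissipation | assumption)+

text \<open>Turns the bounds on cubes into almost everywhere summability and integrability in time,
  for the approximations and for both limit fields.\<close>

lemmas u_bochner = integrable_infsum_nonneg[OF integrable_mult_right[OF u_sq] _ _ u_dissipation, simplified]
	and x_bochner = integrable_infsum_nonneg[OF integrable_mult_right[OF x_sq] _ _ x_dissipation, simplified]
	and U_bochner = integrable_infsum_nonneg[OF integrable_mult_right[OF U_sq] _ _ U_dissipation, simplified]
	and W_bochner = integrable_infsum_nonneg[OF integrable_mult_right[OF W_sq] _ _ W_dissipation, simplified]

subsection \<open>Strong convergence\<close>

lemma in_bochner_Hv:
	assumes s: "s <= 1 + \<theta>" and m: "!!k. (%t. y t k) \<in> borel_measurable M"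
		and y: "!!t k. t \<in> {0..T} ==> y t 0 = 0 \<and> y t (- k) = cnj_vec (y t k)"
		and b: "AE t in M. wsummable (wgt (1 + \<theta>)) (y t)"
			"integrable M (%t. wsum (wgt (1 + \<theta>)) (y t))"
	shows "y \<in> bochner_Lp 2 T (Hv s) (Hv_norm s)"
proof -
	have le: "wgt s k * (norm (y t k))^2 <= 1 * (wgt (1 + \<theta>) k * (norm (y t k))^2)" for t k
		using wgt_mono[OF s] by (simp add: mult_right_mono)
	note im = weighted_domination[OF wgt_nonneg m le b]
	show ?thesis
	proof (rule bochner_L2_Hv_I[OF m _ im(2)])
		show "AE t in M. y t \<in> Hv s" using im(1) AE_space by eventually_elim (use y in \<open>auto simp: Hv_iff\<close>)
	qed
qed

lemma x_in_bochner: "s <= 1 + \<theta> ==> x j \<in> bochner_Lp 2 T (Hv s) (Hv_norm s)"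
	by (rule in_bochner_Hv[OF _ x_measurable _ x_bochner(1,2)]) (use approx.w_props(1,2)[OF ap] in auto)

lemma W_in_bochner: "s <= 1 + \<theta> ==> W \<in> bochner_Lp 2 T (Hv s) (Hv_norm s)"
	by (rule in_bochner_Hv[OF _ W_measurable _ W_bochner(1,2)]) (use W_props(1,2) in auto)

lemma diff_dissipation:
	fixes y :: "real => vfield"
	assumes y: "!!k. integrable M (%t. (norm (y t k))^2)" "!!k. (%t. y t k) \<in> borel_measurable M"
		and Y: "!!k. integrable M (%t. (norm (Y t k))^2)" "!!k. (%t. Y t k) \<in> borel_measurable M"
		and b: "(LINT t|M. (\<Sum>k\<in>box3 n. wgt s k * (norm (y t k))^2)) <= C" "(LINT t|M. (\<Sum>k\<in>box3 n. wgt s k * (norm (Y t k))^2)) <= C"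
	shows "(LINT t|M. (\<Sum>k\<in>box3 n. wgt s k * (norm (y t k - Y t k))^2)) <= 4 * C"
proof -
	have i: "integrable M (%t. \<Sum>k\<in>box3 n. wgt s k * (norm (y t k))^2)" "integrable M (%t. \<Sum>k\<in>box3 n. wgt s k * (norm (Y t k))^2)"
		by (intro Bochner_Integration.integrable_sum integrable_mult_right y Y)+
	have le: "(\<Sum>k\<in>box3 n. wgt s k * (norm (y t k - Y t k))^2)
			<= 2 * (\<Sum>k\<in>box3 n. wgt s k * (norm (y t k))^2) + 2 * (\<Sum>k\<in>box3 n. wgt s k * (norm (Y t k))^2)" for t
	proof -
		have "(\<Sum>k\<in>box3 n. wgt s k * (norm (y t k - Y t k))^2)
				<= (\<Sum>k\<in>box3 n. wgt s k * (2 * (norm (y t k))^2 + 2 * (norm (Y t k))^2))"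
			by (intro sum_mono mult_left_mono norm_diff_sq_le) auto
		then show ?thesis by (simp add: sum_distrib_left distrib_left sum.distrib mult_ac)
	qed
	have i2: "integrable M (%t. 2 * (\<Sum>k\<in>box3 n. wgt s k * (norm (y t k))^2))" "integrable M (%t. 2 * (\<Sum>k\<in>box3 n. wgt s k * (norm (Y t k))^2))"
		by (intro integrable_mult_right i)+
	have m: "(%t. \<Sum>k\<in>box3 n. wgt s k * (norm (y t k - Y t k))^2) \<in> borel_measurable M"
		by (intro borel_measurable_sum borel_measurable_times borel_measurable_const
				borel_measurable_power[OF measurable_compose[OF borel_measurable_diff[OF y(2) Y(2)] borel_measurable_norm]])
	have id: "integrable M (%t. \<Sum>k\<in>box3 n. wgt s k * (norm (y t k - Y t k))^2)"
	proof (rule Bochner_Integration.integrable_bound[OF Bochner_Integration.integrable_add[OF i2] m], rule AE_I2)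
		fix t
		have "0 <= (\<Sum>k\<in>box3 n. wgt s k * (norm (y t k - Y t k))^2)" by (intro sum_nonneg) auto
		then show "norm (\<Sum>k\<in>box3 n. wgt s k * (norm (y t k - Y t k))^2)
			<= norm (2 * (\<Sum>k\<in>box3 n. wgt s k * (norm (y t k))^2) + 2 * (\<Sum>k\<in>box3 n. wgt s k * (norm (Y t k))^2))"
			using le[of t] by simp
	qed
	have "(LINT t|M. (\<Sum>k\<in>box3 n. wgt s k * (norm (y t k - Y t k))^2))
			<= (LINT t|M. 2 * (\<Sum>k\<in>box3 n. wgt s k * (norm (y t k))^2) + 2 * (\<Sum>k\<in>box3 n. wgt s k * (norm (Y t k))^2))"
		by (rule integral_mono[OF id Bochner_Integration.integrable_add[OF i2] le])
	also have "... = 2 * (LINT t|M. (\<Sum>k\<in>box3 n. wgt s k * (norm (y t k))^2)) + 2 * (LINT t|M. (\<Sum>k\<in>box3 n. wgt s k * (norm (Y t k))^2))"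
		unfolding Bochner_Integration.integral_add[OF i2] by simp
	finally show ?thesis using b by linarith
qed

lemma strong:
	assumes "s < 1 + \<theta>"
	shows "(%j. LINT t|M. (INFSUM k. wgt s k * (norm (x j t k - W t k))^2)) ----> 0"
proof (rule strong_convergence_modes[OF wgt_nonneg wgt_nonneg wgt_tail[OF assms]])
	show "(%t. x j t k - W t k) \<in> borel_measurable M" for j k using x_measurable W_measurable by (rule borel_measurable_diff)
	show "norm (x j t k - W t k) <= 2 * sqrt E0" if "t \<in> {0..T}" for j t k
		using norm_triangle_ineq4[of "x j t k" "W t k"] norm_x_le[OF that, of j k] norm_W_le[OF that, of k] by linarith
	show "(%j. x j t k - W t k) ----> 0" if "t \<in> {0..T}" for t k using lim[OF that] by (rule LIM_zero)
	show "(LINT t|M. (\<Sum>k\<in>box3 n. wgt (1 + \<theta>) k * (norm (x j t k - W t k))^2)) <= 4 * C1" for j n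
		by (rule diff_dissipation[OF x_sq x_measurable W_sq W_measurable x_dissipation W_dissipation])
qed

text \<open>The symbols of D_N converge to that of A only mode by mode, not uniformly in k, so this
  is not deduced from the convergence of w but from the modes of u and their uniform bound in
  L^2(H^1).\<close>

lemma strong_u: "(%j. LINT t|M. (INFSUM k. wgt 0 k * (norm (u j t k - U t k))^2)) ----> 0"
proof (rule strong_convergence_modes[OF wgt_nonneg wgt_nonneg wgt_tail[of 0 1]])
	show "(%t. u j t k - U t k) \<in> borel_measurable M" for j k using u_measurable U_measurable by (rule borel_measurable_diff)
	show "norm (u j t k - U t k) <= 2 * sqrt E0" if "t \<in> {0..T}" for j t k
		using norm_triangle_ineq4[of "u j t k" "U t k"] norm_u_le[OF that, of j k] norm_U_le[OF that, of k] by linarith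
	show "(%j. u j t k - U t k) ----> 0" if "t \<in> {0..T}" for t k using u_lim[OF that] by (rule LIM_zero)
	show "(LINT t|M. (\<Sum>k\<in>box3 n. wgt 1 k * (norm (u j t k - U t k))^2)) <= 4 * (E0 / \<nu>)" for j n
		by (rule diff_dissipation[OF u_sq u_measurable U_sq U_measurable u_dissipation U_dissipation])
qed auto

lemma L2_strong: 
	assumes "s < 1 + \<theta>"
	shows "L2_strong_conv T (Hv s) (Hv_norm s) x W"
proof -
	have "(%j. sqrt (LINT t|M. (INFSUM k. wgt s k * (norm (x j t k - W t k))^2))) ----> sqrt 0"
		by (rule tendsto_real_sqrt[OF strong[OF assms]])
	moreover have "(Hv_norm s (x j t - W t))^2 = (INFSUM k. wgt s k * (norm (x j t k - W t k))^2)" for j t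
		by (simp add: Hv_norm_eq_wnorm wnorm_sq)
	ultimately show ?thesis unfolding L2_strong_conv_def using x_in_bochner W_in_bochner assms by auto
qed

text \<open>Inherited from the bound of U in L^2 at every time: \<open>wgt \<theta>\<close> is at
  most a constant times a, and a <= a^2.\<close>

lemma W_Linf: "W \<in> bochner_Linf T (Hv \<theta>) (Hv_norm \<theta>)"
proof -
	have "AE t in M. Hv_norm \<theta> (W t) <= sqrt (\<alpha> powr (- 2 * \<theta>) * E0)"
	proof (rule AE_I2)
		fix t assume "t \<in> space M"
		then have t: "t \<in> {0..T}" by simp
		have le: "wgt \<theta> k * (norm (W t k))^2 <= \<alpha> powr (- 2 * \<theta>) * (norm (U t k))^2" for k
		proof -
			have "wgt \<theta> k * (norm (W t k))^2 <= (\<alpha> powr (- 2 * \<theta>) * a k) * (norm (W t k))^2" by (intro mult_right_mono wgt_le_asymb \<alpha>) simp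
			also have "... <= (\<alpha> powr (- 2 * \<theta>) * (a k)^2) * (norm (W t k))^2"
				using asymb_ge_1[of \<alpha> \<theta> k] self_le_power[of "a k" 2] by (intro mult_right_mono mult_left_mono) auto
			finally show ?thesis by (simp add: U_def power_mult_distrib mult.assoc)
		qed
		have fin: "(\<Sum>k\<in>K. wgt \<theta> k * (norm (W t k))^2) <= \<alpha> powr (- 2 * \<theta>) * E0" if K: "finite K" for K
		proof -
			have "(\<Sum>k\<in>K. wgt \<theta> k * (norm (W t k))^2) <= (\<Sum>k\<in>K. \<alpha> powr (- 2 * \<theta>) * (norm (U t k))^2)" by (rule sum_mono[OF le])
			also have "... <= \<alpha> powr (- 2 * \<theta>) * E0" unfolding sum_distrib_left[symmetric] by (intro mult_left_mono U_sums t K) simp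
			finally show ?thesis .
		qed
		have "(wsum (wgt \<theta>) (W t)) <= \<alpha> powr (- 2 * \<theta>) * E0" by (rule nonneg_summable_bounded(2)[OF _ fin]) auto
		then show "Hv_norm \<theta> (W t) <= sqrt (\<alpha> powr (- 2 * \<theta>) * E0)" by (simp add: Hv_norm_eq_wnorm wnorm_def)
	qed
	then show ?thesis using W_in_bochner[of \<theta>] by (auto simp: bochner_Linf_def bochner_Lp_def)
qed

subsection \<open>Convergence of the nonlinearity and of the pressure\<close>

lemma u_energy: "\<forall>t\<in>{0..T}. l2_field (u j t) \<and> u j t 0 = 0 \<and> (l2_norm (u j t))^2 <= E0"
	and U_energy: "\<forall>t\<in>{0..T}. l2_field (U t) \<and> U t 0 = 0 \<and> (l2_norm (U t))^2 <= E0"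
	using u_props U_props by auto

lemmas u_press = press_bounds[OF u_energy u_measurable u_bochner]
	and U_press = press_bounds[OF U_energy U_measurable U_bochner]

lemma nl_diff_sq: "integrable M (%t. (norm (nl (u j t) k - nl (U t) k))^2)"
proof (rule sq_integrable)
	show "(%t. nl (u j t) k - nl (U t) k) \<in> borel_measurable M" by (rule borel_measurable_diff[OF u_press(1) U_press(1)])
	show "norm (nl (u j t) k - nl (U t) k) <= 12 * freq k * E0" if t: "t \<in> {0..T}" for t
		using norm_triangle_ineq4[of "nl (u j t) k" "nl (U t) k"] u_press(3)[OF t, of j k] U_press(3)[OF t, of k] by linarith
qed

text \<open>At a fixed output mode the derivative is a mere factor |k|, so the nonlinearity is a
  bounded quadratic map on L^2 and convergence of u in L^2(L^2) suffices. The constant 12 is 6 times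
  the two factors bounded by sqrt E0.\<close>

lemma nl_conv: "(%j. LINT t|M. (norm (nl (u j t) k - nl (U t) k))^2) ----> 0"
proof -
	let ?D = "%j t. INFSUM k. wgt 0 k * (norm (u j t k - U t k))^2"
	let ?c = "(12 * freq k * sqrt E0)^2"
	have Di: "integrable M (?D j)" and ae: "AE t in M. (%k. wgt 0 k * (norm (u j t k - U t k))^2) summable_on UNIV" for j
	proof -
		have b: "norm (u j t k - U t k) <= 2 * sqrt E0" if "t \<in> {0..T}" for t k
			using norm_triangle_ineq4[of "u j t k" "U t k"] norm_u_le[OF that, of j k] norm_U_le[OF that, of k] by linarith
		have i: "integrable M (%t. wgt 0 k * (norm (u j t k - U t k))^2)" "integrable M (%t. wgt 1 k * (norm (u j t k - U t k))^2)" for k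
			by (intro integrable_mult_right sq_integrable[OF borel_measurable_diff[OF u_measurable U_measurable] b]; simp)+
		have bd: "(LINT t|M. (\<Sum>k\<in>box3 n. wgt 0 k * (norm (u j t k - U t k))^2)) <= 4 * (E0 / \<nu>)" for n
		proof -
			have "(LINT t|M. (\<Sum>k\<in>box3 n. wgt 0 k * (norm (u j t k - U t k))^2)) <= (LINT t|M. (\<Sum>k\<in>box3 n. wgt 1 k * (norm (u j t k - U t k))^2))"
				by (intro integral_mono Bochner_Integration.integrable_sum i sum_mono mult_right_mono wgt_mono) auto
			also have "... <= 4 * (E0 / \<nu>)"
				by (rule diff_dissipation[OF u_sq u_measurable U_sq U_measurable u_dissipation U_dissipation])
			finally show ?thesis .
		qed
		note * = integrable_infsum_nonneg[OF i(1) _ _ bd, simplified]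
		show "integrable M (?D j)" "AE t in M. (%k. wgt 0 k * (norm (u j t k - U t k))^2) summable_on UNIV" by (fact *)+
	qed
	have le: "(norm (nl (u j t) k - nl (U t) k))^2 <= ?c * ?D j t" if t: "t \<in> {0..T}" for j t
	proof -
		have e: "wgt 0 k * (norm (u j t k - U t k))^2 = (norm ((u j t - U t) k))^2" for k
			using u_props(1)[OF t, of j] U_props(1)[OF t] by (cases "k = 0") (auto simp: wgt_def)
		have D: "?D j t = (l2_norm (u j t - U t))^2" unfolding l2_norm_sq e ..
		have "l2_norm (u j t) <= sqrt E0" "l2_norm (U t) <= sqrt E0"
			by (rule real_le_rsqrt, rule u_props(3)[OF t], rule real_le_rsqrt, rule U_props(5)[OF t])
		then have "norm (nl (u j t) k - nl (U t) k) <= 6 * freq k * (l2_norm (u j t - U t) * (sqrt E0 + sqrt E0))"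
			using norm_nl_diff_le[OF u_props(2)[OF t] U_props(4)[OF t], of j k]
			by (elim order_trans) (intro mult_left_mono add_mono, auto simp: l2_norm_nonneg)
		also have "... = (12 * freq k * sqrt E0) * l2_norm (u j t - U t)" by simp
		finally have "(norm (nl (u j t) k - nl (U t) k))^2 <= ((12 * freq k * sqrt E0) * l2_norm (u j t - U t))^2"
			by (rule power_mono) simp
		then show ?thesis unfolding D power_mult_distrib[of _ "l2_norm (u j t - U t)"] .
	qed
	have "(LINT t|M. (norm (nl (u j t) k - nl (U t) k))^2) <= ?c * (LINT t|M. ?D j t)" for j
	proof -
		have "(LINT t|M. (norm (nl (u j t) k - nl (U t) k))^2) <= (LINT t|M. ?c * ?D j t)"
			by (rule integral_mono[OF nl_diff_sq integrable_mult_right[OF Di] le]) simp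
		then show ?thesis by simp
	qed
	then have 1: "\<forall>\<^sub>F j in sequentially. (LINT t|M. (norm (nl (u j t) k - nl (U t) k))^2) <= ?c * (LINT t|M. ?D j t)" by simp
	have 2: "(%j. ?c * (LINT t|M. ?D j t)) ----> 0"
		using tendsto_mult[OF tendsto_const strong_u, of ?c] by (simp only: mult_zero_right)
	have 3: "\<forall>\<^sub>F j in sequentially. 0 <= (LINT t|M. (norm (nl (u j t) k - nl (U t) k))^2)"
		by (intro always_eventually allI Bochner_Integration.integral_nonneg) simp
	show ?thesis by (rule tendsto_sandwich[OF 3 1 tendsto_const 2])
qed

text \<open>The integral equation of a mode passes to the limit term by term, the nonlinearity by
  \<open>nl_conv\<close> through the bounded map \<open>leray k\<close>. The time derivative of the
  limit needs no separate convergence argument.\<close>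

lemma limit_mode_equation:
	assumes k: "k ~= 0" and \<tau>: "0 <= \<tau>" "\<tau> <= T"
	shows "W \<tau> k = inverse (a k) *\<^sub>R v0 k + prim T (%t. rhs (U t) (W t) (f t) k) \<tau>"
		and "integrable M (%t. rhs (U t) (W t) (f t) k)"
proof -
	let ?n = "\<nu> * (freq k)^2"
	have Wi: "integrable M (%t. W t k)" and xi: "integrable M (%t. x j t k)" for j
		by (rule integrable_of_square[OF W_measurable W_sq] integrable_of_square[OF x_measurable x_sq])+
	have i: "integrable M (%t. leray k (nl (v t) k))" "integrable M (%t. ?n *\<^sub>R y t k)" "integrable M (%t. inverse (a k) *\<^sub>R f t k)"
		"integrable M (%t. rhs (v t) (y t) (f t) k)"
		"prim T (%t. rhs (v t) (y t) (f t) k) \<tau> = leray k (prim T (%t. nl (v t) k) \<tau>) - ?n *\<^sub>R prim T (%t. y t k) \<tau>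
				+ inverse (a k) *\<^sub>R prim T (%t. f t k) \<tau>"
		if n: "integrable M (%t. nl (v t) k)" and y: "integrable M (%t. y t k)" for v y
	proof -
		show 1: "integrable M (%t. leray k (nl (v t) k))" by (rule integrable_bounded_linear[OF bounded_linear_leray n])
		show 2: "integrable M (%t. ?n *\<^sub>R y t k)" using y by auto
		show 3: "integrable M (%t. inverse (a k) *\<^sub>R f t k)" using f_integrable[OF k] by auto
		note 4 = Bochner_Integration.integrable_diff[OF 1 2]
		show "integrable M (%t. rhs (v t) (y t) (f t) k)" unfolding rhs_eq_leray by (rule Bochner_Integration.integrable_add[OF 4 3])
		show "prim T (%t. rhs (v t) (y t) (f t) k) \<tau> = leray k (prim T (%t. nl (v t) k) \<tau>) - ?n *\<^sub>R prim T (%t. y t k) \<tau>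
				+ inverse (a k) *\<^sub>R prim T (%t. f t k) \<tau>"
			unfolding rhs_eq_leray prim_add[OF 4 3] prim_diff[OF 1 2] prim_scaleR prim_bounded_linear[OF bounded_linear_leray n] ..
	qed
	show "integrable M (%t. rhs (U t) (W t) (f t) k)" by (rule i(4)[where v = U and y = W, OF U_press(4) Wi])
	have dx: "norm (x j t k - W t k) <= 2 * sqrt E0" if "t \<in> {0..T}" for j t
		using norm_triangle_ineq4[of "x j t k" "W t k"] norm_x_le[OF that, of j k] norm_W_le[OF that, of k] by linarith
	have xW: "(%j. prim T (%t. x j t k) \<tau>) ----> prim T (%t. W t k) \<tau>"
	proof (rule prim_L2_tendsto[OF xi Wi])
		have dm: "(%t. x j t k - W t k) \<in> borel_measurable M" for j by (rule borel_measurable_diff[OF x_measurable W_measurable])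
		show "integrable M (%t. (norm (x j t k - W t k))^2)" for j by (rule sq_integrable[OF dm dx])
		have z: "(%j. x j t k - W t k) ----> 0" if "t \<in> {0..T}" for t using lim[OF that] by (rule LIM_zero)
		show "(%j. LINT t|M. (norm (x j t k - W t k))^2) ----> 0"
			using mode_L2_tendsto[OF dm _ dx z] by simp
	qed
	have "(%j. x j 0 k + prim T (%t. rhs (u j t) (x j t) (f t) k) \<tau>) ----> inverse (a k) *\<^sub>R v0 k + prim T (%t. rhs (U t) (W t) (f t) k) \<tau>"
		unfolding approx.w_initial[OF ap] i(5)[where v = "u j" and y = "x j" for j, OF u_press(4) xi] i(5)[where v = U and y = W, OF U_press(4) Wi]
		by (intro tendsto_add tendsto_diff tendsto_scaleR tendsto_const xW bounded_linear.tendsto[OF bounded_linear_leray]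
				prim_L2_tendsto[OF u_press(4) U_press(4) nl_diff_sq nl_conv])
	then have "(%j. x j \<tau> k) ----> inverse (a k) *\<^sub>R v0 k + prim T (%t. rhs (U t) (W t) (f t) k) \<tau>"
		using approx.mode_equation[OF ap k \<tau>] by simp
	then show "W \<tau> k = inverse (a k) *\<^sub>R v0 k + prim T (%t. rhs (U t) (W t) (f t) k) \<tau>"
		using LIMSEQ_unique[OF lim] \<tau> by auto
qed

end

section \<open>The quadratic term as an integrable function of time with values in L^1\<close>

lemma curl_diff: "curl (u - v) = curl u - curl v"
	by (simp add: fun_eq_iff curl_def partial_def vec_eq_iff forall_3 algebra_simps)

lemma Hv_diff: "u \<in> Hv s ==> v \<in> Hv s ==> u - v \<in> Hv s"
	using wsum_diff(1)[of "wgt s" u v] linear_diff[OF linear_cnj_vec] by (simp add: Hv_iff)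

lemma L1_norm_diff_le:
	assumes "F \<in> L1_torus" "G \<in> L1_torus"
	shows "\<bar>L1_norm F - L1_norm G\<bar> <= L1_norm (F - G)"
proof -
	have i: "integrable (lebesgue_on cell) F" "integrable (lebesgue_on cell) G" using assms by (auto simp: L1_torus_def)
	have "\<bar>L1_norm F - L1_norm G\<bar> = \<bar>LINT x|lebesgue_on cell. norm (F x) - norm (G x)\<bar>"
		unfolding L1_norm_def by (simp add: Bochner_Integration.integral_diff[OF integrable_norm[OF i(1)] integrable_norm[OF i(2)]])
	also have "... <= (LINT x|lebesgue_on cell. \<bar>norm (F x) - norm (G x)\<bar>)" by (rule integral_abs_bound)
	also have "... <= L1_norm (F - G)" unfolding L1_norm_def fun_diff_def
		by (intro integral_mono integrable_abs Bochner_Integration.integrable_diff integrable_norm i norm_triangle_ineq3)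
	finally show ?thesis .
qed

text \<open>The map v -> v x curl v is continuous from H^1 to L^1 and sends functions with finitely
  many values to such functions, so it carries an approximating sequence of u to one of the product.
  The squared H^1 norm is an integrable majorant.\<close>

lemma cross_fun_bochner:
	assumes meas: "!!k. (%t. u t k) \<in> borel_measurable (leb T)"
		and ae: "AE t in leb T. u t \<in> Hv 1"
		and int: "integrable (leb T) (%t. wsum (wgt 1) (u t))"
	shows "(%t. cross_fun (u t) (curl (u t))) \<in> bochner_Lp 1 T L1_torus L1_norm"
proof -
	let ?M = "leb T"
	define F where "F v = cross_fun v (curl v)" for v
	have "bochner_measurable T (Hv 1) (Hv_norm 1) u"
		using bochner_measurable_wspace[of "wgt 1" cnj_vec u T] meas ae
		by (simp add: Hv_eq_wspace Hv_norm_eq_wnorm linear_cnj_vec)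
	then obtain g where g0: "\<forall>n. finite (g n ` {0..T}) \<and> g n ` {0..T} \<subseteq> Hv 1 \<and> (\<forall>y. {t \<in> {0..T}. g n t = y} \<in> sets lebesgue)"
		and gl: "AE t in ?M. u t \<in> Hv 1 \<and> (%n. Hv_norm 1 (g n t - u t)) ----> 0"
		unfolding bochner_measurable_def by blast
	have g: "finite (g n ` {0..T})" "t \<in> {0..T} ==> g n t \<in> Hv 1" "{t \<in> {0..T}. g n t = y} \<in> sets lebesgue" for n t y
		using g0 by (simp_all add: image_subset_iff)
	have F1: "F v \<in> L1_torus" if "v \<in> Hv 1" for v
		unfolding F_def by (rule cross_field_l2(1)[OF Hv_1_l2(1,2)[OF that]])
	have conv: "AE t in ?M. (%n. L1_norm (F (g n t) - F (u t))) ----> 0"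
		using gl AE_space
	proof eventually_elim
		case (elim t)
		then have t: "t \<in> {0..T}" and u: "u t \<in> Hv 1" and l: "(%n. Hv_norm 1 (g n t - u t)) ----> 0" by auto
		let ?d = "%n. Hv_norm 1 (g n t - u t)" and ?H = "Hv_norm 1 (u t)"
		have nn: "0 <= Hv_norm 1 v" for v by (simp add: Hv_norm_eq_wnorm wnorm_nonneg)
		have le: "L1_norm (F (g n t) - F (u t)) <= (2 * pi) ^ 3 * (?d n * (6 * sqrt (2 * (?d n)^2 + 2 * ?H^2)) + ?H * (6 * ?d n))" for n
		proof -
			note gn = g(2)[OF t, of n]
			note df = Hv_diff[OF gn u]
			\<comment> \<open>Strong measurability gives no bound on the approximations, so their norm is
			  recovered from that of the error and of u.\<close>
			have "(Hv_norm 1 (g n t))^2 <= 2 * (?d n)^2 + 2 * ?H^2"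
				using wsum_diff(2)[of "wgt 1" "g n t - u t" "%k. - u t k"] df u
				by (simp add: Hv_norm_eq_wnorm wnorm_sq Hv_iff)
			then have G: "Hv_norm 1 (g n t) <= sqrt (2 * (?d n)^2 + 2 * ?H^2)" by (rule real_le_rsqrt)
			have "L1_norm (F (g n t) - F (u t)) <= (2 * pi) ^ 3 * (l2_norm (g n t - u t) * l2_norm (curl (g n t)) + l2_norm (u t) * l2_norm (curl (g n t) - curl (u t)))"
				unfolding F_def by (rule L1_norm_cross_fun_diff[OF Hv_1_l2(1)[OF gn] Hv_1_l2(1)[OF u] Hv_1_l2(2)[OF gn] Hv_1_l2(2)[OF u]])
			also have "... <= (2 * pi) ^ 3 * (?d n * (6 * sqrt (2 * (?d n)^2 + 2 * ?H^2)) + ?H * (6 * ?d n))"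
				unfolding curl_diff[symmetric]
				by (intro mult_left_mono add_mono mult_mono Hv_1_l2(3)[OF df] Hv_1_l2(3)[OF u] Hv_1_l2(4)[OF df]
						order_trans[OF Hv_1_l2(4)[OF gn]] G) (auto simp: nn l2_norm_nonneg)
			finally show ?thesis .
		qed
		have "(%n. (2 * pi) ^ 3 * (?d n * (6 * sqrt (2 * (?d n)^2 + 2 * ?H^2)) + ?H * (6 * ?d n)))
				----> (2 * pi) ^ 3 * (0 * (6 * sqrt (2 * 0^2 + 2 * ?H^2)) + ?H * (6 * 0))"
			by (intro tendsto_intros l)
		then have "(%n. (2 * pi) ^ 3 * (?d n * (6 * sqrt (2 * (?d n)^2 + 2 * ?H^2)) + ?H * (6 * ?d n))) ----> 0" by simp
		then show ?case
			by (rule tendsto_sandwich[OF always_eventually always_eventually tendsto_const, rotated 2])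
				 (use le in \<open>auto simp: L1_norm_def\<close>)
	qed
	have bm: "bochner_measurable T L1_torus L1_norm (%t. F (u t))"
		unfolding bochner_measurable_def
	proof (intro exI conjI allI)
		fix n
		show "finite ((%t. F (g n t)) ` {0..T})" using finite_imageI[OF g(1)[of n], of F] by (simp add: image_image)
		show "(%t. F (g n t)) ` {0..T} \<subseteq> L1_torus" using F1 g(2) by auto
		fix y
		have "{t \<in> {0..T}. F (g n t) = y} = (\<Union>v\<in>{v \<in> g n ` {0..T}. F v = y}. {t \<in> {0..T}. g n t = v})" by auto
		also have "... \<in> sets lebesgue" using g(1,3) by (intro sets.finite_UN) auto
		finally show "{t \<in> {0..T}. F (g n t) = y} \<in> sets lebesgue" .
	next
		show "AE t in ?M. F (u t) \<in> L1_torus \<and> (%n. L1_norm (F (g n t) - F (u t))) ----> 0"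
			using conv ae by eventually_elim (auto intro: F1)
	qed
	have Fm: "(%t. L1_norm (F (u t))) \<in> borel_measurable ?M"
	proof (rule borel_measurable_lebesgue_on_AE_LIMSEQ)
		fix n
		have "simple_function ?M (g n)"
			unfolding simple_function_def
		proof (intro conjI ballI)
			show "finite (g n ` space ?M)" using g(1) by simp
			fix y
			have "g n -` {y} \<inter> space ?M = {t \<in> {0..T}. g n t = y}" by auto
			then show "g n -` {y} \<inter> space ?M \<in> sets ?M" using g(3)[of n y] by (auto simp: sets_restrict_space_iff)
		qed
		from simple_function_compose[OF this, of "%v. L1_norm (F v)"]
		show "(%t. L1_norm (F (g n t))) \<in> borel_measurable ?M" by (intro borel_measurable_simple_function) (simp add: comp_def)
	next
		show "AE t in ?M. (%n. L1_norm (F (g n t))) ----> L1_norm (F (u t))"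
			using conv ae AE_space
		proof eventually_elim
			case (elim t)
			then have t: "t \<in> {0..T}" by simp
			have "(%n. L1_norm (F (g n t)) - L1_norm (F (u t))) ----> 0"
				by (rule Lim_null_comparison[OF _ elim(1)])
					 (use L1_norm_diff_le[OF F1[OF g(2)[OF t]] F1[OF elim(2)]] in \<open>auto intro!: always_eventually\<close>)
			then show ?case by (simp add: LIM_zero_iff)
		qed
	qed simp
	have "integrable ?M (%t. L1_norm (F (u t)))"
	proof (rule Bochner_Integration.integrable_bound[OF integrable_mult_right[OF int, of "(2 * pi) ^ 3 * 6"] Fm])
		show "AE t in ?M. norm (L1_norm (F (u t))) <= norm ((2 * pi) ^ 3 * 6 * (wsum (wgt 1) (u t)))"
			using ae
		proof eventually_elim
			case (elim t)
			have nn: "0 <= Hv_norm 1 (u t)" by (simp add: Hv_norm_eq_wnorm wnorm_nonneg)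
			have "L1_norm (F (u t)) <= (2 * pi) ^ 3 * l2_norm (u t) * l2_norm (curl (u t))"
				unfolding F_def by (rule L1_norm_cross_fun[OF Hv_1_l2(1,2)[OF elim]])
			also have "... <= (2 * pi) ^ 3 * Hv_norm 1 (u t) * (6 * Hv_norm 1 (u t))"
				by (intro mult_mono Hv_1_l2(3,4)[OF elim]) (auto simp: nn l2_norm_nonneg)
			also have "... = (2 * pi) ^ 3 * 6 * (Hv_norm 1 (u t))^2" by (simp add: power2_eq_square)
			also have "(Hv_norm 1 (u t))^2 = (wsum (wgt 1) (u t))" by (simp add: Hv_norm_eq_wnorm wnorm_sq)
			finally show ?case by (simp add: L1_norm_def)
		qed
	qed
	then show ?thesis using bm by (simp add: bochner_Lp_def F_def)
qed

text \<open>The norm dual to H^(-3/2), a space in which all terms of the limit equation live; the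
  decay of order four leaves the summable |k|^(-5).\<close>

lemma test_weight:
	fixes \<Psi> :: "real => int ^ 3 => 'a::euclidean_space"
	assumes m: "!!k. (%t. \<Psi> t k) \<in> borel_measurable (leb T)"
		and b: "!!t k. t \<in> {0..T} ==> freq k ^ 4 * norm (\<Psi> t k) <= C"
		and T: "0 < T"
	shows "AE t in leb T. (%k. inverse (wgt (- 3/2) k) * (norm (\<Psi> t k))^2) summable_on UNIV"
		and "integrable (leb T) (%t. INFSUM k. inverse (wgt (- 3/2) k) * (norm (\<Psi> t k))^2)"
proof -
	let ?M = "leb T" and ?h = "%k. freq k powr - 5"
	have s: "?h summable_on UNIV" by (rule lattice_summable) simp
	have le: "inverse (wgt (- 3/2) k) * (norm (\<Psi> t k))^2 <= C^2 * ?h k" if t: "t \<in> {0..T}" for t k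
	proof (cases "k = 0")
		case False
		let ?K = "freq k"
		have K: "0 < ?K" using False by simp
		have "(?K ^ 4 * norm (\<Psi> t k))^2 <= C^2" by (rule power_mono[OF b[OF t]]) simp
		then have "(?K ^ 4 * norm (\<Psi> t k))^2 * ?h k <= C^2 * ?h k" by (rule mult_right_mono) simp
		moreover have "?K ^ 8 * ?h k = inverse (wgt (- 3/2) k)"
		proof -
			have "?K ^ 8 = ?K powr 8" using K by simp
			then have "?K ^ 8 * ?h k = ?K powr (8 + - 5)" by (simp only: powr_add)
			also have "... = ?K powr 3" by simp
			also have "... = inverse (?K powr - 3)" by (simp add: powr_minus)
			finally show ?thesis by (simp add: wgt_def)
		qed
		moreover have "(?K ^ 4 * norm (\<Psi> t k))^2 * ?h k = (?K ^ 8 * ?h k) * (norm (\<Psi> t k))^2"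
			by (simp add: power_mult_distrib power_mult[symmetric])
		ultimately show ?thesis by simp
	qed (simp add: wgt_def)
	have g: "(%t. inverse (wgt (- 3/2) k) * (norm (\<Psi> t k))^2) \<in> borel_measurable ?M" for k using m[of k] by measurable
	have gi: "integrable ?M (%t. inverse (wgt (- 3/2) k) * (norm (\<Psi> t k))^2)" for k
		by (rule integrable_bounded_interval[OF g[of k], of "C^2 * ?h k"]) (use le in \<open>auto intro!: AE_I2\<close>)
	show "AE t in ?M. (%k. inverse (wgt (- 3/2) k) * (norm (\<Psi> t k))^2) summable_on UNIV"
	proof (rule AE_I2)
		fix t assume "t \<in> space ?M"
		then have t: "t \<in> {0..T}" by simp
		show "(%k. inverse (wgt (- 3/2) k) * (norm (\<Psi> t k))^2) summable_on UNIV"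
			by (rule summable_on_comparison_real[OF summable_on_cmult_right[OF s, of "C^2"]]) (use le[OF t] in simp)
	qed
	have bd: "(LINT t|?M. (\<Sum>k\<in>box3 n. inverse (wgt (- 3/2) k) * (norm (\<Psi> t k))^2)) <= (LINT t|?M. C^2 * (INFSUM k. ?h k))" for n
	proof (rule integral_mono)
		show "integrable ?M (%t. \<Sum>k\<in>box3 n. inverse (wgt (- 3/2) k) * (norm (\<Psi> t k))^2)" by (rule Bochner_Integration.integrable_sum[OF gi])
		show "integrable ?M (%t. C^2 * (INFSUM k. ?h k))"
			by (rule integrable_bounded_interval[where B = "norm (C^2 * (INFSUM k. ?h k))"]) auto
		fix t assume "t \<in> space ?M"
		then have t: "t \<in> {0..T}" by simp
		have "(\<Sum>k\<in>box3 n. inverse (wgt (- 3/2) k) * (norm (\<Psi> t k))^2) <= (\<Sum>k\<in>box3 n. C^2 * ?h k)" by (rule sum_mono[OF le[OF t]])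
		also have "... <= C^2 * (INFSUM k. ?h k)" unfolding sum_distrib_left[symmetric]
			by (intro mult_left_mono sum_le_infsum[OF s]) (auto simp: finite_box3)
		finally show "(\<Sum>k\<in>box3 n. inverse (wgt (- 3/2) k) * (norm (\<Psi> t k))^2) <= C^2 * (INFSUM k. ?h k)" .
	qed
	show "integrable ?M (%t. INFSUM k. inverse (wgt (- 3/2) k) * (norm (\<Psi> t k))^2)"
		by (rule integrable_infsum_nonneg(2)[OF gi _ _ bd]) auto
qed

context limit begin

subsection \<open>Weak convergence of the pressure\<close>

abbreviation s0 :: real where "s0 \<equiv> - 1/2 + 2 * \<theta>"

lemma press_in_bochner:
	assumes "!!t. t \<in> {0..T} ==> l2_field (v t)" and "!!k. (%t. press (v t) k) \<in> borel_measurable M"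
		and "AE t in M. wsummable (hwt s0) (press (v t))"
		and "integrable M (%t. wsum (hwt s0) (press (v t)))"
	shows "(%t. press (v t)) \<in> bochner_Lp 2 T (Hs s0) (Hs_norm s0)"
proof (rule bochner_L2_Hs_I[OF assms(2) _ assms(4)])
	show "AE t in M. press (v t) \<in> Hs s0"
		using assms(3) AE_space
	proof eventually_elim
		case (elim t)
		then show ?case using press_real[OF assms(1), of t] by (simp add: Hs_iff)
	qed
qed

lemma P_in_bochner: "(%t. press (U t)) \<in> bochner_Lp 2 T (Hs s0) (Hs_norm s0)"
	by (rule press_in_bochner[OF U_props(4) U_press(2,7,8)])

text \<open>The pressures agree with \<open>press\<close> only at almost every time, while elements
  of the Bochner spaces are functions rather than classes.\<close>

lemma bochner_L2_Hs_cong: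
	assumes p: "p \<in> bochner_Lp 2 T (Hs s) (Hs_norm s)" and ae: "AE t in M. p' t = p t"
	shows "p' \<in> bochner_Lp 2 T (Hs s) (Hs_norm s)"
proof -
	note D = bochner_L2_Hs_D[OF subset_refl p]
	have ae': "AE t in M. p t = p' t" using ae by eventually_elim simp
	have m: "(%t. p' t k) \<in> borel_measurable M" for k
		by (rule borel_measurable_lebesgue_on_AE[OF D(1)[of k]]) (use ae' in \<open>auto elim: eventually_mono\<close>)
	have e: "AE t in M. (wsum (hwt s) (p t)) = (wsum (hwt s) (p' t))"
		using ae by eventually_elim simp
	have m2: "(%t. wsum (hwt s) (p' t)) \<in> borel_measurable M"
		by (rule borel_measurable_lebesgue_on_AE[OF _ _ e]) (use D(3) in auto)
	show ?thesis
	proof (rule bochner_L2_Hs_I[OF m])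
		show "AE t in M. p' t \<in> Hs s" using D(2) ae by eventually_elim simp
		show "integrable M (%t. wsum (hwt s) (p' t))" by (rule integrable_cong_AE_imp[OF D(3) m2 e])
	qed
qed

lemma q_in_bochner: "q (r j) \<in> bochner_Lp 2 T (Hs s0) (Hs_norm s0)"
	by (rule bochner_L2_Hs_cong[OF press_in_bochner[OF u_props(2) u_press(2,7,8)] approx.pressure_AE[OF ap]])

lemma press_zero: "press v 0 = 0"
	by (simp add: press_def bdot_def)

text \<open>A pressure mode is a bounded linear image of the same mode of the nonlinearity, so
  \<open>nl_conv\<close> carries over.\<close>

lemma press_mode_conv:
	assumes \<psi>: "(%t. \<psi> t) \<in> borel_measurable M" "integrable M (%t. (norm (\<psi> t))^2)"
	shows "(%j. LINT t|M. (press (u j t) k - press (U t) k) \<bullet> \<psi> t) ----> 0"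
proof -
	let ?L = "%z. - bdot (cwave k) z / of_real (a k * (freq k)^2)"
	have bl: "bounded_linear ?L"
		using bounded_linear_compose[OF bounded_linear_divide bounded_linear_minus[OF bounded_linear_bdot]] .
	interpret L: bounded_linear ?L by (rule bl)
	obtain K where K: "!!z. norm (?L z) <= norm z * K" "0 < K" using L.pos_bounded by blast
	have e: "press (u j t) k - press (U t) k = ?L (nl (u j t) k - nl (U t) k)" for j t
		unfolding L.diff press_def ..
	have le: "(norm (press (u j t) k - press (U t) k))^2 <= K^2 * (norm (nl (u j t) k - nl (U t) k))^2" for j t
		using power_mono[OF K(1)[of "nl (u j t) k - nl (U t) k"] norm_ge_zero, of 2] unfolding e power_mult_distrib by (simp add: mult.commute)
	have m: "(%t. press (u j t) k - press (U t) k) \<in> borel_measurable M" for j by (rule borel_measurable_diff[OF u_press(2) U_press(2)])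
	have i: "integrable M (%t. (norm (press (u j t) k - press (U t) k))^2)" for j
		by (rule Bochner_Integration.integrable_bound[OF integrable_mult_right[OF nl_diff_sq, of "K^2" j k]])
			 (use m[of j] le[of j] in \<open>auto intro!: AE_I2\<close>)
	have b: "\<bar>LINT t|M. (press (u j t) k - press (U t) k) \<bullet> \<psi> t\<bar> <= sqrt (K^2 * (LINT t|M. (norm (nl (u j t) k - nl (U t) k))^2)) * sqrt (LINT t|M. (norm (\<psi> t))^2)" for j
	proof -
		have "(LINT t|M. (norm (press (u j t) k - press (U t) k))^2) <= (LINT t|M. K^2 * (norm (nl (u j t) k - nl (U t) k))^2)"
			by (intro integral_mono i integrable_mult_right nl_diff_sq le)
		also have "... = K^2 * (LINT t|M. (norm (nl (u j t) k - nl (U t) k))^2)" by simp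
		finally show ?thesis
			using integral_inner_bound[OF m i \<psi>, of j]
			by (elim order_trans) (intro mult_right_mono real_sqrt_le_mono, auto intro!: Bochner_Integration.integral_nonneg)
	qed
	have "(%j. sqrt (K^2 * (LINT t|M. (norm (nl (u j t) k - nl (U t) k))^2)) * sqrt (LINT t|M. (norm (\<psi> t))^2))
			----> sqrt (K^2 * 0) * sqrt (LINT t|M. (norm (\<psi> t))^2)"
		by (intro tendsto_mult tendsto_const tendsto_real_sqrt nl_conv)
	then have l: "(%j. sqrt (K^2 * (LINT t|M. (norm (nl (u j t) k - nl (U t) k))^2)) * sqrt (LINT t|M. (norm (\<psi> t))^2)) ----> 0" by simp
	show ?thesis by (rule Lim_null_comparison[OF always_eventually l]) (use b in simp)
qed

lemma weak: "L2_weak_conv T s0 (%j. q (r j)) (%t. press (U t))"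
	unfolding L2_weak_conv_def
proof (intro conjI allI ballI q_in_bochner P_in_bochner)
	fix \<psi> assume "\<psi> \<in> bochner_Lp 2 T (Hs (- s0)) (Hs_norm (- s0))"
	note D = bochner_L2_Hs_D[OF subset_refl this]
	let ?H = "hwt s0" and ?C = "press_const * (nl_const * E0 * (E0 / \<nu>))"
	let ?z = "%j t k. press (u j t) k - press (U t) k"
	have inv: "inverse (?H k) = hwt (- s0) k" for k by (simp only: hwt_def powr_minus)
	have Ds: "AE t in M. (%k. inverse (?H k) * (norm (\<psi> t k))^2) summable_on UNIV"
		unfolding inv using D(2) by eventually_elim (simp only: Hs_iff)
	have Di: "integrable M (%t. INFSUM k. inverse (?H k) * (norm (\<psi> t k))^2)" unfolding inv by (rule D(3))
	have \<psi>2: "integrable M (%t. (norm (\<psi> t k))^2)" for k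
		by (rule integrable_mode(1)[OF _ _ D(1) Ds Di]) (use hwt_pos[of s0] in \<open>auto simp: less_imp_le\<close>)
	have z0: "AE t in M. press (v t) 0 = 0" for v by (simp add: press_zero)
	have z0': "AE t in M. ?z j t 0 = 0" for j by (simp add: press_zero)
	have zm: "(%t. ?z j t k) \<in> borel_measurable M" for j k by (rule borel_measurable_diff[OF u_press(2) U_press(2)])
	have zs: "AE t in M. wsummable ?H (?z j t) \<and>
			(wsum ?H (?z j t)) <= 2 * (wsum ?H (press (u j t))) + 2 * (wsum ?H (press (U t)))" for j
		using u_press(7)[of j] U_press(7)
	proof eventually_elim
		case (elim t)
		then show ?case using wsum_diff[of ?H "press (u j t)" "press (U t)"] by simp
	qed
	have zs': "AE t in M. wsummable ?H (?z j t)" for j using zs[of j] by eventually_elim simp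
	have zm2: "(%t. wsum ?H (?z j t)) \<in> borel_measurable M" for j
		by (rule borel_measurable_infsum_AE[OF _ _ zs']) (use zm in \<open>auto intro!: borel_measurable_times borel_measurable_power measurable_compose[OF zm borel_measurable_norm]\<close>)
	have i2: "integrable M (%t. 2 * (wsum ?H (press (u j t))))" "integrable M (%t. 2 * (wsum ?H (press (U t))))" for j
		by (intro integrable_mult_right u_press(8) U_press(8))+
	have zi: "integrable M (%t. wsum ?H (?z j t))" for j
	proof (rule Bochner_Integration.integrable_bound[OF Bochner_Integration.integrable_add[OF i2] zm2])
		show "AE t in M. norm (wsum ?H (?z j t))
			<= norm (2 * (wsum ?H (press (u j t))) + 2 * (wsum ?H (press (U t))))"
			using zs[of j]
		proof eventually_elim
			case (elim t)
			have "0 <= (wsum ?H (?z j t))" by (intro infsum_nonneg) simp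
			then show ?case using elim by simp
		qed
	qed
	have zC: "(LINT t|M. (wsum ?H (?z j t))) <= 4 * ?C" for j
	proof -
		have "(LINT t|M. (wsum ?H (?z j t)))
				<= (LINT t|M. 2 * (wsum ?H (press (u j t))) + 2 * (wsum ?H (press (U t))))"
			by (rule integral_mono_AE[OF zi Bochner_Integration.integrable_add[OF i2]]) (use zs[of j] in \<open>auto elim: eventually_mono\<close>)
		also have "... = 2 * (LINT t|M. (wsum ?H (press (u j t)))) + 2 * (LINT t|M. (wsum ?H (press (U t))))"
			unfolding Bochner_Integration.integral_add[OF i2] by simp
		finally have "(LINT t|M. (wsum ?H (?z j t))) <= 2 * (LINT t|M. (wsum ?H (press (u j t)))) + 2 * (LINT t|M. (wsum ?H (press (U t))))" .
		moreover have "(LINT t|M. (wsum ?H (press (u j t)))) <= ?C" by (rule u_press(9))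
		moreover have "(LINT t|M. (wsum ?H (press (U t)))) <= ?C" by (rule U_press(9))
		moreover have "A <= 2 * B + 2 * D ==> B <= c ==> D <= c ==> A <= 4 * c" for A B D c :: real by linarith
		ultimately show ?thesis by blast
	qed
	note P1 = integral_pairing[OF hwt_nonneg hwt_pos u_press(2) D(1) z0 u_press(7,8) Ds Di]
		and P2 = integral_pairing[OF hwt_nonneg hwt_pos U_press(2) D(1) z0 U_press(7,8) Ds Di]
		and P3 = integral_pairing[OF hwt_nonneg hwt_pos zm D(1) z0' zs' zi Ds Di]
	have lim0: "(%j. LINT t|M. (INFSUM k. ?z j t k \<bullet> \<psi> t k)) ----> 0"
		by (rule weak_convergence_modes[OF hwt_nonneg hwt_pos zm D(1) z0' zs' zi zC Ds Di press_mode_conv[OF D(1) \<psi>2]])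
	\<comment> \<open>Linearity of the integrated pairing is read off from box sums, where it concerns
	  finitely many integrals.\<close>
	have diff: "(LINT t|M. (INFSUM k. press (u j t) k \<bullet> \<psi> t k)) - (LINT t|M. (INFSUM k. press (U t) k \<bullet> \<psi> t k)) = (LINT t|M. (INFSUM k. ?z j t k \<bullet> \<psi> t k))" for j
	proof (rule LIMSEQ_unique[OF tendsto_diff[OF P1(4) P2(4)]])
		have "(\<Sum>k\<in>box3 n. LINT t|M. ?z j t k \<bullet> \<psi> t k)
				= (\<Sum>k\<in>box3 n. LINT t|M. press (u j t) k \<bullet> \<psi> t k) - (\<Sum>k\<in>box3 n. LINT t|M. press (U t) k \<bullet> \<psi> t k)" for n
			unfolding inner_diff_left Bochner_Integration.integral_diff[OF P1(2) P2(2)] sum_subtractf ..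
		then show "(%n. (\<Sum>k\<in>box3 n. LINT t|M. press (u j t) k \<bullet> \<psi> t k) - (\<Sum>k\<in>box3 n. LINT t|M. press (U t) k \<bullet> \<psi> t k))
			----> (LINT t|M. (INFSUM k. ?z j t k \<bullet> \<psi> t k))" using P3(4)[of j] by simp
	qed
	have qe: "(LINT t|M. pairing (q (r j) t) (\<psi> t)) = (2 * pi) ^ 3 * (LINT t|M. (INFSUM k. press (u j t) k \<bullet> \<psi> t k))" for j
	proof -
		have "(LINT t|M. pairing (q (r j) t) (\<psi> t)) = (LINT t|M. (2 * pi) ^ 3 * (INFSUM k. press (u j t) k \<bullet> \<psi> t k))"
		proof (rule LINT_cong_AE_lebesgue_on)
			show "(%t. (2 * pi) ^ 3 * (INFSUM k. press (u j t) k \<bullet> \<psi> t k)) \<in> borel_measurable M"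
				using P1(3)[of j] by (intro borel_measurable_times) auto
			show "AE t in M. pairing (q (r j) t) (\<psi> t) = (2 * pi) ^ 3 * (INFSUM k. press (u j t) k \<bullet> \<psi> t k)"
				using approx.pressure_AE[OF ap, of j] by eventually_elim (simp add: pairing_def)
		qed
		then show ?thesis by simp
	qed
	have "(%j. (LINT t|M. (INFSUM k. press (u j t) k \<bullet> \<psi> t k))) ----> (LINT t|M. (INFSUM k. press (U t) k \<bullet> \<psi> t k))"
		using lim0 unfolding diff[symmetric] by (simp add: LIM_zero_iff)
	then have "(%j. (2 * pi) ^ 3 * (LINT t|M. (INFSUM k. press (u j t) k \<bullet> \<psi> t k))) ----> (2 * pi) ^ 3 * (LINT t|M. (INFSUM k. press (U t) k \<bullet> \<psi> t k))"
		by (rule tendsto_mult[OF tendsto_const])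
	then show "(%j. LINT t|M. pairing (q (r j) t) (\<psi> t)) ----> (LINT t|M. pairing (press (U t)) (\<psi> t))"
		unfolding qe by (simp add: pairing_def)
qed

end

context limit begin

subsection \<open>The limit equation\<close>

lemma U_Hv1: "AE t in M. U t \<in> Hv 1"
	using U_bochner(1) AE_space by eventually_elim (use U_props(1,2) in \<open>auto simp: Hv_iff\<close>)

lemma A_op_W: "A_op \<alpha> \<theta> (W t) = U t"
	by (simp add: fun_eq_iff A_op_eq U_def)

lemma cross_field_U: "AE t in M. cross_field (U t) (curl (U t)) = nl (U t)"
	using U_Hv1 AE_space by eventually_elim (rule nl_eq_cross_field, use U_props(3) in auto)

lemma f_0: "AE t in M. f t 0 = 0"
	using f_AE by eventually_elim (auto simp: Hv_sigma_def Hv_iff)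

text \<open>Each mode equation is multiplied by the mode of the test field and integrated by parts
  in time, where the final value vanishes. The sum over a cube is zero, and each of its terms
  converges separately as the cube grows.\<close>

lemma test_equation:
	fixes \<Phi> \<Phi>' :: "real => vfield"
	assumes C: "C \<ge> 0" "!!t k. t \<in> {0..T} ==> freq k ^ 4 * norm (\<Phi> t k) <= C"
			"!!t k. t \<in> {0..T} ==> freq k ^ 4 * norm (\<Phi>' t k) <= C"
		and cont: "!!k. continuous_on {0..T} (%t. \<Phi>' t k)"
		and prim: "!!k t. 0 <= t ==> t <= T ==> \<Phi> t k = \<Phi> 0 k + prim T (%s. \<Phi>' s k) t"
		and fin: "!!k. \<Phi> T k = 0"
	shows "- (LINT t|M. pairing (W t) (\<Phi>' t)) - pairing (filtered \<alpha> \<theta> v0) (\<Phi> 0)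
			- (LINT t|M. pairing (cross_field (A_op \<alpha> \<theta> (W t)) (curl (A_op \<alpha> \<theta> (W t)))) (filtered \<alpha> \<theta> (\<Phi> t)))
			- \<nu> * (LINT t|M. pairing (W t) (laplacian (\<Phi> t)))
			- (LINT t|M. pairing (press (U t)) (divergence (\<Phi> t)))
			= (LINT t|M. pairing (f t) (filtered \<alpha> \<theta> (\<Phi> t)))"
proof -
	define \<Psi> where "\<Psi> t = filtered \<alpha> \<theta> (\<Phi> t)" for t
	define X where "X t k = (freq k)^2 *\<^sub>R W t k" for t k
	define G where "G t = grad (press (U t))" for t
	\<comment> \<open>One weight for all time integrals: W, its Laplacian, the nonlinearity, the
	  pressure gradient and the force all lie in L^2(H^(-3/2)).\<close>
	let ?H = "wgt (- 3/2)"
	have H: "!!k. k ~= 0 ==> 0 < ?H k" by (rule wgt_pos)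
	have \<Phi>'i: "integrable M (%t. \<Phi>' t k)" for k by (rule continuous_imp_integrable_real[OF cont])
	have \<Phi>'m: "(%t. \<Phi>' t k) \<in> borel_measurable M" for k by (rule borel_measurable_integrable[OF \<Phi>'i])
	have "continuous_on {0..T} (%t. \<Phi> 0 k + prim T (%s. \<Phi>' s k) t)" for k
		by (intro continuous_on_add continuous_on_const continuous_on_subset[OF continuous_prim[OF \<Phi>'i]]) simp
	then have "continuous_on {0..T} (%t. \<Phi> t k)" for k
		by (rule continuous_on_eq) (rule prim[symmetric]; simp)
	then have \<Phi>m: "(%t. \<Phi> t k) \<in> borel_measurable M" for k
		by (intro borel_measurable_integrable continuous_imp_integrable_real)
	have \<Psi>m: "(%t. \<Psi> t k) \<in> borel_measurable M" for k
		unfolding \<Psi>_def filtered_eq by (intro borel_measurable_scaleR borel_measurable_const \<Phi>m)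
	have \<Psi>C: "freq k ^ 4 * norm (\<Psi> t k) <= C" if "t \<in> {0..T}" for t k
	proof -
		have "norm (\<Psi> t k) = inverse (a k) * norm (\<Phi> t k)" using asymb_pos[of \<alpha> \<theta> k] by (simp add: \<Psi>_def filtered_eq)
		also have "... <= 1 * norm (\<Phi> t k)" by (rule mult_right_mono[OF inverse_asymb_le_1]) simp
		finally have "freq k ^ 4 * norm (\<Psi> t k) <= freq k ^ 4 * norm (\<Phi> t k)" by (intro mult_left_mono) auto
		then show ?thesis using C(2)[OF that, of k] by linarith
	qed
	note tw = test_weight[OF \<Phi>m C(2) T] and tw' = test_weight[OF \<Phi>'m C(3) T] and tw\<Psi> = test_weight[OF \<Psi>m \<Psi>C T]
	have Xm: "(%t. X t k) \<in> borel_measurable M" for k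
		unfolding X_def by (intro borel_measurable_scaleR borel_measurable_const W_measurable)
	have Gm: "(%t. G t k) \<in> borel_measurable M" for k
	proof -
		have "bounded_linear (%c. c *s cwave k)"
			unfolding linear_conv_bounded_linear[symmetric]
			by (rule linearI) (auto simp: vec_eq_iff algebra_simps)
		from measurable_compose[OF U_press(2)[of k] borel_measurable_continuous_onI[OF linear_continuous_on[OF this]]]
		show ?thesis by (simp add: G_def grad_eq)
	qed
	have Wle: "?H k * (norm (W t k))^2 <= 1 * (wgt (1 + \<theta>) k * (norm (W t k))^2)" for t k
		using \<theta> by (simp add: mult_right_mono wgt_mono)
	have Xle: "?H k * (norm (X t k))^2 <= 1 * (wgt (1 + \<theta>) k * (norm (W t k))^2)" for t k
	proof -
		have "?H k * (norm (X t k))^2 = (wgt (- 3/2) k * (wgt 1 k * wgt 1 k)) * (norm (W t k))^2"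
			by (simp add: X_def power_mult_distrib wgt_1 power2_eq_square)
		\<comment> \<open>The Laplacian costs two derivatives: -3/2 + 2 = 1/2, which is below 1 +
		  \<theta>.\<close>
		also have "wgt (- 3/2) k * (wgt 1 k * wgt 1 k) = wgt (1/2) k" by (simp add: wgt_add[symmetric])
		also have "wgt (1/2) k * (norm (W t k))^2 <= wgt (1 + \<theta>) k * (norm (W t k))^2"
			using \<theta> by (intro mult_right_mono wgt_mono) auto
		finally show ?thesis by simp
	qed
	have Gle: "?H k * (norm (G t k))^2 <= 9 * (?H k * (norm (nl (U t) k))^2)" for t k
		using mult_left_mono[OF power_mono[OF norm_grad_press_le[of "U t" k] norm_ge_zero, of 2] wgt_nonneg[of "- 3/2" k]]
		by (simp add: G_def power_mult_distrib)
	have fle: "?H k * (norm (f t k))^2 <= 1 * (wgt (- 1) k * (norm (f t k))^2)" for t k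
		by (simp add: mult_right_mono wgt_mono)
	note Wd = weighted_domination[OF wgt_nonneg W_measurable Wle W_bochner(1,2)]
		and Xd = weighted_domination[OF wgt_nonneg Xm Xle W_bochner(1,2)]
		and Gd = weighted_domination[OF wgt_nonneg Gm Gle U_press(5,6)]
		and fd = weighted_domination[OF wgt_nonneg f_measurable fle f_summable forcing_integrable[unfolded forcing_def[abs_def]]]
	have z: "AE t in M. W t 0 = 0" "AE t in M. X t 0 = 0" "AE t in M. nl (U t) 0 = 0" "AE t in M. G t 0 = 0"
		using W_props(1) by (auto simp: X_def nl_0 G_def grad_eq press_zero intro!: AE_I2)
	note P1 = integral_pairing[OF wgt_nonneg H W_measurable \<Phi>'m z(1) Wd tw']
		and P2 = integral_pairing[OF wgt_nonneg H U_press(1) \<Psi>m z(3) U_press(5,6) tw\<Psi>]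
		and P3 = integral_pairing[OF wgt_nonneg H Xm \<Phi>m z(2) Xd tw]
		and P4 = integral_pairing[OF wgt_nonneg H Gm \<Phi>m z(4) Gd tw]
		and P5 = integral_pairing[OF wgt_nonneg H f_measurable \<Psi>m f_0 fd tw\<Psi>]
	let ?i1 = "%k. LINT t|M. W t k \<bullet> \<Phi>' t k" and ?i2 = "%k. LINT t|M. nl (U t) k \<bullet> \<Psi> t k"
		and ?i3 = "%k. LINT t|M. X t k \<bullet> \<Phi> t k" and ?i4 = "%k. LINT t|M. G t k \<bullet> \<Phi> t k" and ?i5 = "%k. LINT t|M. f t k \<bullet> \<Psi> t k"
	let ?i0 = "%k. filtered \<alpha> \<theta> v0 k \<bullet> \<Phi> 0 k"
	let ?I1 = "LINT t|M. (INFSUM k. W t k \<bullet> \<Phi>' t k)" and ?I2 = "LINT t|M. (INFSUM k. nl (U t) k \<bullet> \<Psi> t k)"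
		and ?I3 = "LINT t|M. (INFSUM k. X t k \<bullet> \<Phi> t k)" and ?I4 = "LINT t|M. (INFSUM k. G t k \<bullet> \<Phi> t k)"
		and ?I5 = "LINT t|M. (INFSUM k. f t k \<bullet> \<Psi> t k)"
	\<comment> \<open>The initial term is not integrated in time, so it is summed by hand: a product is
	  at most the sum of the squares, here |v0|^2 and a multiple of |k|^(-5).\<close>
	have i0s: "?i0 summable_on UNIV"
	proof (rule summable_on_comparison_real)
		show "(%k. (norm (v0 k))^2 + C^2 * freq k powr - 5) summable_on UNIV"
			by (intro summable_on_add summable_on_cmult_right v0_props(4) lattice_summable) simp
		fix k
		show "\<bar>?i0 k\<bar> <= (norm (v0 k))^2 + C^2 * freq k powr - 5"
		proof (cases "k = 0")
			case False
			let ?K = "freq k"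
			have K: "1 <= ?K" by (rule norm_wave_ge_1[OF False])
			have "0 < ?K ^ 4" using False by simp
			then have "norm (\<Phi> 0 k) <= C * ?K powr - 4"
				using C(2)[of 0 k] T K by (simp add: powr_minus powr_numeral divide_inverse[symmetric] pos_le_divide_eq mult.commute)
			then have "(norm (\<Phi> 0 k))^2 <= (C * ?K powr - 4)^2" by (rule power_mono) simp
			also have "... = C^2 * ?K powr - 8" by (simp add: power_mult_distrib power2_eq_square powr_add[symmetric])
			also have "... <= C^2 * ?K powr - 5" using K by (intro mult_left_mono powr_mono) auto
			finally have p: "(norm (\<Phi> 0 k))^2 <= C^2 * ?K powr - 5" .
			have "\<bar>?i0 k\<bar> <= norm (filtered \<alpha> \<theta> v0 k) * norm (\<Phi> 0 k)" by (rule Cauchy_Schwarz_ineq2)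
			also have "... <= norm (v0 k) * norm (\<Phi> 0 k)"
				using inverse_asymb_le_1[of \<alpha> \<theta> k] asymb_pos[of \<alpha> \<theta> k]
				by (intro mult_right_mono) (auto simp: filtered_eq mult_left_le_one_le)
			also have "... <= (norm (v0 k))^2 + (norm (\<Phi> 0 k))^2"
				using sum_squares_bound[of "norm (v0 k)" "norm (\<Phi> 0 k)"] mult_nonneg_nonneg[OF norm_ge_zero[of "v0 k"] norm_ge_zero[of "\<Phi> 0 k"]] by linarith
			finally show ?thesis using p by linarith
		qed (simp add: filtered_eq v0_props(1))
	qed
	have mode: "?i0 k + ?i1 k + ?i2 k - \<nu> * ?i3 k - ?i4 k + ?i5 k = 0" for k
	proof (cases "k = 0")
		case True
		have "?i1 0 = 0" "?i2 0 = 0" "?i3 0 = 0" "?i4 0 = 0" "?i5 0 = 0"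
			by (rule integral_eq_zero_AE, use z f_0 in \<open>auto elim: eventually_mono\<close>)+
		then show ?thesis by (simp add: True filtered_eq v0_props(1))
	next
		case False
		have W0: "W 0 k = inverse (a k) *\<^sub>R v0 k" using limit_mode_equation(1)[OF False, of 0] T by (simp add: prim_le_0)
		have Wp: "W t k = W 0 k + prim T (%t. rhs (U t) (W t) (f t) k) t" if "0 <= t" "t <= T" for t
			unfolding W0 by (rule limit_mode_equation(1)[OF False that])
		have ip: "integrable M (%t. rhs (U t) (W t) (f t) k)" by (rule limit_mode_equation(2)[OF False _ order_refl]) (use T in simp)
		have pp: "!!t. 0 <= t ==> t <= T ==> \<Phi> t k = \<Phi> 0 k + prim T (%s. \<Phi>' s k) t" by (rule prim)
		have "W T k \<bullet> \<Phi> T k = W 0 k \<bullet> \<Phi> 0 k + prim T (%t. rhs (U t) (W t) (f t) k \<bullet> \<Phi> t k) T + prim T (%t. W t k \<bullet> \<Phi>' t k) T"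
			by (rule prim_by_parts_inner(3)[OF ip \<Phi>'i Wp pp]) (use T in auto)
		then have e: "?i0 k + (LINT t|M. rhs (U t) (W t) (f t) k \<bullet> \<Phi> t k) + ?i1 k = 0"
			by (simp add: fin prim_T W0 filtered_eq)
		have r: "rhs (U t) (W t) (f t) k \<bullet> \<Phi> t k = (nl (U t) k \<bullet> \<Psi> t k - \<nu> * (X t k \<bullet> \<Phi> t k) - G t k \<bullet> \<Phi> t k) + f t k \<bullet> \<Psi> t k" for t
			by (simp add: rhs_def \<Psi>_def X_def G_def filtered_eq inner_add_left inner_diff_left)
		have i3: "integrable M (%t. \<nu> * (X t k \<bullet> \<Phi> t k))" by (rule integrable_mult_right[OF P3(2)])
		have j1: "integrable M (%t. nl (U t) k \<bullet> \<Psi> t k - \<nu> * (X t k \<bullet> \<Phi> t k))"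
			by (rule Bochner_Integration.integrable_diff[OF P2(2) i3])
		have j2: "integrable M (%t. nl (U t) k \<bullet> \<Psi> t k - \<nu> * (X t k \<bullet> \<Phi> t k) - G t k \<bullet> \<Phi> t k)"
			by (rule Bochner_Integration.integrable_diff[OF j1 P4(2)])
		have "(LINT t|M. rhs (U t) (W t) (f t) k \<bullet> \<Phi> t k) = (LINT t|M. nl (U t) k \<bullet> \<Psi> t k - \<nu> * (X t k \<bullet> \<Phi> t k) - G t k \<bullet> \<Phi> t k) + ?i5 k"
			unfolding r by (rule Bochner_Integration.integral_add[OF j2 P5(2)])
		moreover have "(LINT t|M. nl (U t) k \<bullet> \<Psi> t k - \<nu> * (X t k \<bullet> \<Phi> t k) - G t k \<bullet> \<Phi> t k) = (LINT t|M. nl (U t) k \<bullet> \<Psi> t k - \<nu> * (X t k \<bullet> \<Phi> t k)) - ?i4 k"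
			by (rule Bochner_Integration.integral_diff[OF j1 P4(2)])
		moreover have "(LINT t|M. nl (U t) k \<bullet> \<Psi> t k - \<nu> * (X t k \<bullet> \<Phi> t k)) = ?i2 k - (LINT t|M. \<nu> * (X t k \<bullet> \<Phi> t k))"
			by (rule Bochner_Integration.integral_diff[OF P2(2) i3])
		moreover have "(LINT t|M. \<nu> * (X t k \<bullet> \<Phi> t k)) = \<nu> * ?i3 k" by (rule integral_mult_right_zero)
		ultimately have "(LINT t|M. rhs (U t) (W t) (f t) k \<bullet> \<Phi> t k) = ?i2 k - \<nu> * ?i3 k - ?i4 k + ?i5 k" by linarith
		then show ?thesis using e by linarith
	qed
	let ?S = "%i n. \<Sum>k\<in>box3 n. i k"
	have "(%n. ?S ?i0 n + ?S ?i1 n + ?S ?i2 n - \<nu> * ?S ?i3 n - ?S ?i4 n + ?S ?i5 n)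
			----> (INFSUM k. ?i0 k) + ?I1 + ?I2 - \<nu> * ?I3 - ?I4 + ?I5"
		by (intro tendsto_add tendsto_diff tendsto_mult tendsto_const sum_box3_tendsto[OF i0s] P1(4) P2(4) P3(4) P4(4) P5(4))
	moreover have "?S ?i0 n + ?S ?i1 n + ?S ?i2 n - \<nu> * ?S ?i3 n - ?S ?i4 n + ?S ?i5 n = 0" for n
	proof -
		have "?S (%k. ?i0 k + ?i1 k + ?i2 k - \<nu> * ?i3 k - ?i4 k + ?i5 k) n = 0" unfolding mode by simp
		then show ?thesis by (simp only: sum.distrib sum_subtractf sum_distrib_left)
	qed
	ultimately have eq: "(INFSUM k. ?i0 k) + ?I1 + ?I2 - \<nu> * ?I3 - ?I4 + ?I5 = 0"
		by (simp add: LIMSEQ_const_iff)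
	let ?c = "(2 * pi) ^ 3 :: real"
	have e1: "(LINT t|M. pairing (W t) (\<Phi>' t)) = ?c * ?I1" and e0: "pairing (filtered \<alpha> \<theta> v0) (\<Phi> 0) = ?c * (INFSUM k. ?i0 k)"
		and e5: "(LINT t|M. pairing (f t) (filtered \<alpha> \<theta> (\<Phi> t))) = ?c * ?I5"
		by (simp_all add: pairing_def \<Psi>_def)
	have e2: "(LINT t|M. pairing (cross_field (A_op \<alpha> \<theta> (W t)) (curl (A_op \<alpha> \<theta> (W t)))) (filtered \<alpha> \<theta> (\<Phi> t))) = ?c * ?I2"
	proof -
		have "(LINT t|M. pairing (cross_field (A_op \<alpha> \<theta> (W t)) (curl (A_op \<alpha> \<theta> (W t)))) (filtered \<alpha> \<theta> (\<Phi> t))) = (LINT t|M. ?c * (INFSUM k. nl (U t) k \<bullet> \<Psi> t k))"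
		proof (rule LINT_cong_AE_lebesgue_on)
			show "(%t. ?c * (INFSUM k. nl (U t) k \<bullet> \<Psi> t k)) \<in> borel_measurable M" using P2(3) by (intro borel_measurable_times) auto
			show "AE t in M. pairing (cross_field (A_op \<alpha> \<theta> (W t)) (curl (A_op \<alpha> \<theta> (W t)))) (filtered \<alpha> \<theta> (\<Phi> t)) = ?c * (INFSUM k. nl (U t) k \<bullet> \<Psi> t k)"
				using cross_field_U by eventually_elim (simp add: A_op_W pairing_def \<Psi>_def)
		qed
		then show ?thesis by simp
	qed
	have "W t k \<bullet> laplacian (\<Phi> t) k = - (X t k \<bullet> \<Phi> t k)" for t k by (simp add: laplacian_eq X_def)
	then have e3: "(LINT t|M. pairing (W t) (laplacian (\<Phi> t))) = - (?c * ?I3)" by (simp add: pairing_def infsum_uminus)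
	\<comment> \<open>Integration by parts for one mode: the minus sign comes from conjugating i k when
	  the gradient is moved to the test field.\<close>
	have "press (U t) k \<bullet> divergence (\<Phi> t) k = - (G t k \<bullet> \<Phi> t k)" for t k
	proof -
		have "bdot (p *s cwave k) (cnj_vec z) = - (p * cnj (bdot (cwave k) z))" for p z
			by (simp add: bdot_3 cwave_def cnj_vec_def algebra_simps)
		then have "G t k \<bullet> \<Phi> t k = - Re (press (U t) k * cnj (bdot (cwave k) (\<Phi> t k)))"
			by (simp add: G_def grad_eq inner_bdot)
		then show ?thesis by (simp add: divergence_eq inner_complex_def)
	qed
	then have e4: "(LINT t|M. pairing (press (U t)) (divergence (\<Phi> t))) = - (?c * ?I4)" by (simp add: pairing_def infsum_uminus)
	have alg: "- (c * a1) - c * a0 - c * a2 - n * (- (c * a3)) - (- (c * a4)) - c * a5 = - (c * (a0 + a1 + a2 - n * a3 - a4 + a5))"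
		for c n a0 a1 a2 a3 a4 a5 :: real by (simp add: algebra_simps)
	have "- (?c * ?I1) - ?c * (INFSUM k. ?i0 k) - ?c * ?I2 - \<nu> * (- (?c * ?I3)) - (- (?c * ?I4)) - ?c * ?I5
		= - (?c * ((INFSUM k. ?i0 k) + ?I1 + ?I2 - \<nu> * ?I3 - ?I4 + ?I5))" by (rule alg)
	also have "... = 0" unfolding eq by simp
	finally show ?thesis unfolding e0 e1 e2 e3 e4 e5 by linarith
qed

lemma limit_solution: "distributional_solution T \<nu> \<alpha> \<theta> f v0 W (%t. press (U t))"
	unfolding distributional_solution_def
proof (intro conjI ballI)
	show "AE t in M. is_L1_field (A_op \<alpha> \<theta> (W t)) \<and> is_L1_field (curl (A_op \<alpha> \<theta> (W t)))"
		using U_Hv1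
	proof eventually_elim
		case (elim t)
		show ?case unfolding A_op_W using fun_of_l2_field[OF Hv_1_l2(1)[OF elim]] fun_of_l2_field[OF Hv_1_l2(2)[OF elim]]
			by (auto simp: is_L1_field_def)
	qed
	show "(%t. cross_fun (A_op \<alpha> \<theta> (W t)) (curl (A_op \<alpha> \<theta> (W t)))) \<in> bochner_Lp 1 T L1_torus L1_norm"
		unfolding A_op_W by (rule cross_fun_bochner[OF U_measurable U_Hv1 U_bochner(2)])
	show "AE t in M. \<forall>k. divergence (W t) k = 0" using W_props(4) by (intro AE_I2) auto
	show "AE t in M. mean_free (W t) \<and> mean_free (press (U t))"
		using W_props(1) by (intro AE_I2) (auto simp: mean_free_def press_zero)
	fix \<phi> assume \<phi>: "\<phi> \<in> test_fields T"
	show "let \<phi>F = (%t. fourier (%x. \<phi> (t, x)));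
						 \<phi>F' = (%t. fourier (%x. vector_derivative (%s. \<phi> (s, x)) (at t within {0..T})))
				 in - (LINT t|leb T. pairing (W t) (\<phi>F' t))
						- pairing (filtered \<alpha> \<theta> v0) (\<phi>F 0)
						- (LINT t|leb T.
								 pairing (cross_field (A_op \<alpha> \<theta> (W t)) (curl (A_op \<alpha> \<theta> (W t))))
												 (filtered \<alpha> \<theta> (\<phi>F t)))
						- \<nu> * (LINT t|leb T. pairing (W t) (laplacian (\<phi>F t)))
						- (LINT t|leb T. pairing (press (U t)) (divergence (\<phi>F t)))
						= (LINT t|leb T. pairing (f t) (filtered \<alpha> \<theta> (\<phi>F t)))"
		unfolding Let_def
		by (rule test_field_fourier[OF T \<phi>], rule test_equation) assumption+
qed

end

section \<open>Extraction of the subsequence and conclusion\<close>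

lemma (in setting) convergent_subsequence:
	assumes sol: "!!N. N > 0 ==> regular_weak_solution T \<nu> \<alpha> \<theta> f v0 N (w N) (q N)"
	obtains r W where "limit T \<nu> \<alpha> \<theta> f v0 r w q W"
proof -
	\<comment> \<open>The sequence starts at order 1, since solutions are given for N > 0 only; the
	  shift by \<open>Suc\<close> is undone in the final choice of indices.\<close>
	have ap: "approx T \<nu> \<alpha> \<theta> f v0 (Suc n) (w (Suc n)) (q (Suc n))" for n
		by (rule approx.intro[OF setting_axioms]) (rule approx_axioms.intro[OF sol], simp)
	\<comment> \<open>At k = 0 the force is replaced by 0, because its integrability in time was
	  derived for nonzero modes; the zero modes of the velocities are constant in time.\<close>
	define g where "g k t = 24 * freq k * E0 + \<nu> * (freq k)^2 * sqrt E0 + (if k = 0 then 0 else norm (f t k))" for k t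
	define G where "G k = prim T (g k)" for k
	have gi: "integrable M (g k)" for k
		unfolding g_def using f_integrable[of k]
		by (intro Bochner_Integration.integrable_add integrable_bounded_interval[where g = "%_. _"]) (cases "k = 0"; auto)+
	have g0: "0 <= g k t" for k t using E0_nonneg \<nu> by (auto simp: g_def)
	have bound: "norm (w (Suc n) t k) <= sqrt E0" if "t \<in> {0..T}" for n t k
		by (rule real_le_rsqrt) (rule approx.energy_u(3)[OF ap that])
	have cont: "continuous_on {0..T} (G k)" for k
		unfolding G_def by (rule continuous_on_subset[OF continuous_prim[OF gi]]) simp
	have equi: "norm (w (Suc n) \<tau> k - w (Suc n) \<sigma> k) <= G k \<tau> - G k \<sigma>"
		if st: "0 <= \<sigma>" "\<sigma> <= \<tau>" "\<tau> <= T" for n k \<sigma> \<tau>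
	proof (cases "k = 0")
		case True
		have "G k \<sigma> <= G k \<tau>"
			unfolding G_def prim_def
			by (rule integral_mono[OF integrable_indicator_lebesgue_on[OF gi] integrable_indicator_lebesgue_on[OF gi]])
					 (use g0 st(2) in \<open>auto split: split_indicator\<close>)
		then show ?thesis using approx.w_props(1)[OF ap, of \<tau>] approx.w_props(1)[OF ap, of \<sigma>] st True by simp
	next
		case False
		then have "g k = (%t. 24 * freq k * E0 + \<nu> * (freq k)^2 * sqrt E0 + norm (f t k))"
			by (simp add: g_def fun_eq_iff)
		then show ?thesis using approx.equicontinuous[OF ap False st] unfolding G_def by (simp only:)
	qed
	have "\<exists>r' W. strict_mono r' \<and> (\<forall>t\<in>{0..T}. \<forall>k. (%j. w (Suc (r' j)) t k) ----> W t k)"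
	proof (rule ascoli_modes[where x = "%n. w (Suc n)" and B = "%_. sqrt E0" and G = G, OF T bound equi cont])
		fix r :: "nat => nat" and X
		assume "strict_mono r" and "!!t k. t \<in> {0..T} ==> (%j. w (Suc (r j)) t k) ----> X t k"
		then show ?thesis by (intro exI[of _ r] exI[of _ X] conjI ballI allI)
	qed
	then obtain r' W where r': "strict_mono r'" "!!t k. t \<in> {0..T} ==> (%j. w (Suc (r' j)) t k) ----> W t k"
		by blast
	have "limit T \<nu> \<alpha> \<theta> f v0 (%j. Suc (r' j)) w q W"
		by (rule limit.intro[OF setting_axioms], rule limit_axioms.intro)
			 (use sol r' in \<open>auto simp: strict_mono_def\<close>)
	then show ?thesis by (rule that)
qed

theorem theorem4p1:
  fixes T \<nu> \<alpha> \<theta> :: real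
    and f :: "real \<Rightarrow> vfield" and v0 :: vfield
    and w :: "nat \<Rightarrow> real \<Rightarrow> vfield" and q :: "nat \<Rightarrow> real \<Rightarrow> sfield"
  assumes "T > 0" and "\<nu> > 0" and "\<alpha> > 0" and "1/6 \<le> \<theta>" and "\<theta> < 1"
    and "f \<in> bochner_Lp 2 T (Hv_sigma (- 1)) (Hv_norm (- 1))"
    and "v0 \<in> Hv_sigma 0"
    and "\<And>N. N > 0 \<Longrightarrow> regular_weak_solution T \<nu> \<alpha> \<theta> f v0 N (w N) (q N)"
  shows "\<exists>(r :: nat \<Rightarrow> nat) w_lim q_lim.
           strict_mono r \<and> (\<forall>j. r j > 0) \<and>
           w_lim \<in> bochner_Linf T (Hv \<theta>) (Hv_norm \<theta>) \<and>
           w_lim \<in> bochner_Lp 2 T (Hv (1 + \<theta>)) (Hv_norm (1 + \<theta>)) \<and>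
           q_lim \<in> bochner_Lp 2 T (Hs (- 1/2 + 2 * \<theta>)) (Hs_norm (- 1/2 + 2 * \<theta>)) \<and>
           (\<forall>s < 1 + \<theta>. L2_strong_conv T (Hv s) (Hv_norm s) (\<lambda>j. w (r j)) w_lim) \<and>
           L2_weak_conv T (- 1/2 + 2 * \<theta>) (\<lambda>j. q (r j)) q_lim \<and>
           distributional_solution T \<nu> \<alpha> \<theta> f v0 w_lim q_lim"
proof -
	interpret setting T \<nu> \<alpha> \<theta> f v0 by (rule setting.intro[OF assms(1-7)])
	obtain r W where "limit T \<nu> \<alpha> \<theta> f v0 r w q W" using convergent_subsequence[OF assms(8)] by blast
	then interpret limit T \<nu> \<alpha> \<theta> f v0 r w q W .
	show ?thesis
		using r W_Linf W_in_bochner[OF order_refl] P_in_bochner L2_strong weak limit_solution by blast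
qed

end
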